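(* Let $T$ be a standard graded Noetherian ring, let $I,J$ be homogeneous ideals of $T$, and let $L$ be a graded $T$-module. Let $\mathbf{b}=b_1,\ldots,b_s$ be homogeneous elements of $T$ with $I=(b_1,\ldots,b_s)$. Then for every $i\geq 0$ there is a graded isomorphism $$H^i_{I,J}(L)\cong H^i\big({}^*\mathbf{C}^{\bullet}_{\mathbf{b},J}\otimes_T L\big).$$
   Context: Rings graded here are commutative; $T=\bigoplus_{n\ge0}T_n$ standard graded means generated over $T_0$ by $T_1$. $\Gamma_{I,J}(L)=\{y\in L\mid I^ny\subseteq Jy\text{ for some }n\ge1\}$ is the $(I,J)$-torsion functor; it is left exact and $H^i_{I,J}(-)$ is its $i$-th right derived functor (local cohomology with respect to the pair $(I,J)$). For a graded module $L$, $\Gamma_{I,J}(L)$ is graded by $\Gamma_{I,J}(L)_u=\{y\in L_u\mid I^ny\subseteq Jy\text{ for some }n\ge 1\}$ for $u\in\mathbb{Z}$, and $H^i_{I,J}(L)$ is graded by identifying it with ${}^*H^i_{I,J}(L)$, the $i$-th right derived functor of $\Gamma_{I,J}$ on the category of graded $T$-modules (it is known that ${}^*H^i_{I,J}(L)\cong H^i_{I,J}(L)$ as underlying $T$-modules). For a homogeneous $b\in T$, ${}^*S_{b,J}=\{b^n+j\mid n\ge0,\ j\text{ a homogeneous element of }J\text{ with }\deg j=\deg b^n\}$, which is a multiplicatively closed set of homogeneous elements, and ${}^*L_{b,J}:=({}^*S_{b,J})^{-1}L$, a graded $T$-module. For $\mathbf{b}=b_1,\ldots,b_s$ homogeneous,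 ${}^*\mathbf{C}^\bullet_{\mathbf{b},J}=\bigotimes_{i=1}^s{}^*\mathbf{C}^\bullet_{b_i,J}$ where ${}^*\mathbf{C}^\bullet_{b_i,J}=\big(0\to T\to{}^*T_{b_i,J}\to0\big)$ with $T$ in cohomological degree $0$ and the natural localization map, i.e. the complex $0\to T\to\prod_i{}^*T_{b_i,J}\to\prod_{i<j}{}^*({}^*T_{b_i,J})_{b_j,J}\to\cdots\to{}^*(\cdots({}^*T_{b_1,J})\cdots)_{b_s,J}\to0$. *)

theory Defs
  imports "HOL-Algebra.Module" "HOL-Algebra.Ideal_Product" "HOL-Algebra.Generated_Groups"
    "HOL-Algebra.Generated_Rings" "HOL-Algebra.Ring_Divisibility"
begin

section \<open>Graded rings and graded modules\<close>

record 'a gring = "'a ring" +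
  rcomp :: "nat \<Rightarrow> 'a set"

record ('a, 'b) gmodule = "('a, 'b) module" +
  mcomp :: "int \<Rightarrow> 'b set"

definition direct_sum_decomposition :: "('b, 'z) ring_scheme \<Rightarrow> ('i \<Rightarrow> 'b set) \<Rightarrow> bool" where
  "direct_sum_decomposition M G \<longleftrightarrow>
     (\<forall>u. additive_subgroup (G u) M) \<and>
     (\<forall>x\<in>carrier M. \<exists>!f. (\<forall>u. f u \<in> G u) \<and> finite {u. f u \<noteq> \<zero>\<^bsub>M\<^esub>} \<and>
        x = (\<Oplus>\<^bsub>M\<^esub>u\<in>{u. f u \<noteq> \<zero>\<^bsub>M\<^esub>}. f u))"

locale graded_ring = cring T for T :: "'a gring" (structure) +
  assumes rcomp_decomposition: "direct_sum_decomposition T (rcomp T)"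
    and one_rcomp: "\<one> \<in> rcomp T 0"
    and mult_rcomp: "\<lbrakk>x \<in> rcomp T m; y \<in> rcomp T n\<rbrakk> \<Longrightarrow> x \<otimes> y \<in> rcomp T (m + n)"

locale standard_graded_ring = graded_ring +
  assumes generated_in_degree_one: "generate_ring T (rcomp T 0 \<union> rcomp T 1) = carrier T"

definition homogeneous_elements :: "'a gring \<Rightarrow> 'a set" where
  "homogeneous_elements T = (\<Union>n. rcomp T n)"

definition homogeneous_ideal :: "'a gring \<Rightarrow> 'a set \<Rightarrow> bool" where
  "homogeneous_ideal T I \<longleftrightarrow> ideal I T \<and> I = Idl\<^bsub>T\<^esub> (I \<inter> homogeneous_elements T)"

locale graded_module = graded_ring T + module T M
  for T :: "'a gring" and M :: "('a, 'b) gmodule" (structure) +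
  assumes mcomp_decomposition: "direct_sum_decomposition M (mcomp M)"
    and smult_mcomp: "\<lbrakk>t \<in> rcomp T n; x \<in> mcomp M u\<rbrakk> \<Longrightarrow> t \<odot> x \<in> mcomp M (int n + u)"

definition graded_hom ::
    "'a gring \<Rightarrow> ('a, 'b) gmodule \<Rightarrow> ('a, 'c) gmodule \<Rightarrow> ('b \<Rightarrow> 'c) set" where
  "graded_hom T M N = {f. f \<in> carrier M \<rightarrow> carrier N \<and>
     (\<forall>x\<in>carrier M. \<forall>y\<in>carrier M. f (x \<oplus>\<^bsub>M\<^esub> y) = f x \<oplus>\<^bsub>N\<^esub> f y) \<and>
     (\<forall>t\<in>carrier T. \<forall>x\<in>carrier M. f (t \<odot>\<^bsub>M\<^esub> x) = t \<odot>\<^bsub>N\<^esub> f x) \<and>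
     (\<forall>u. f ` mcomp M u \<subseteq> mcomp N u)}"

definition graded_isomorphic ::
    "'a gring \<Rightarrow> ('a, 'b) gmodule \<Rightarrow> ('a, 'c) gmodule \<Rightarrow> bool" where
  "graded_isomorphic T M N \<longleftrightarrow>
     (\<exists>f\<in>graded_hom T M N. bij_betw f (carrier M) (carrier N) \<and>
        (\<forall>u. f ` mcomp M u = mcomp N u))"

definition graded_submodule :: "('a, 'b) gmodule \<Rightarrow> 'b set \<Rightarrow> ('a, 'b) gmodule" where
  "graded_submodule M N = M\<lparr>carrier := N, mcomp := (\<lambda>u. N \<inter> mcomp M u)\<rparr>"

definition quotient_module ::
    "'a gring \<Rightarrow> ('a, 'b, 'z) module_scheme \<Rightarrow> 'b set \<Rightarrow> ('a, 'b set) module" where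
  "quotient_module T M N =
     \<lparr>carrier = a_rcosets\<^bsub>M\<^esub> N, monoid.mult = undefined, one = undefined,
      zero = N, add = set_add M,
      smult = (\<lambda>t X. \<Union>x\<in>X. N +>\<^bsub>M\<^esub> (t \<odot>\<^bsub>M\<^esub> x))\<rparr>"

definition with_grading :: "('a, 'b) module \<Rightarrow> (int \<Rightarrow> 'b set) \<Rightarrow> ('a, 'b) gmodule" where
  "with_grading M G =
     \<lparr>carrier = carrier M, monoid.mult = monoid.mult M, one = one M, zero = zero M, add = add M,
      smult = smult M, mcomp = G\<rparr>"

definition graded_quotient ::
    "'a gring \<Rightarrow> ('a, 'b) gmodule \<Rightarrow> 'b set \<Rightarrow> ('a, 'b set) gmodule" where
  "graded_quotient T M N =
     with_grading (quotient_module T M N) (\<lambda>u. (\<lambda>x. N +>\<^bsub>M\<^esub> x) ` mcomp M u)"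


section \<open>Cohomology and graded injective resolutions\<close>

definition cocycles :: "(nat \<Rightarrow> ('a, 'b) gmodule) \<Rightarrow> (nat \<Rightarrow> 'b \<Rightarrow> 'b) \<Rightarrow> nat \<Rightarrow> 'b set" where
  "cocycles X d i = {x \<in> carrier (X i). d i x = \<zero>\<^bsub>X (Suc i)\<^esub>}"

definition coboundaries :: "(nat \<Rightarrow> ('a, 'b) gmodule) \<Rightarrow> (nat \<Rightarrow> 'b \<Rightarrow> 'b) \<Rightarrow> nat \<Rightarrow> 'b set" where
  "coboundaries X d i =
     (case i of 0 \<Rightarrow> {\<zero>\<^bsub>X 0\<^esub>} | Suc k \<Rightarrow> d k ` carrier (X k))"

definition cohomology ::
    "'a gring \<Rightarrow> (nat \<Rightarrow> ('a, 'b) gmodule) \<Rightarrow> (nat \<Rightarrow> 'b \<Rightarrow> 'b) \<Rightarrow> nat \<Rightarrow> ('a, 'b set) gmodule" where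
  "cohomology T X d i =
     graded_quotient T (graded_submodule (X i) (cocycles X d i)) (coboundaries X d i)"

text \<open>
  Injective objects of the category of graded \<open>T\<close>-modules and homomorphisms of degree 0.
  A definition cannot quantify over types, so the test objects are the graded modules with
  elements in \<open>'a + 'e\<close>.  This universe contains an isomorphic copy of \<open>E\<close> itself and of
  every shift of \<open>T\<close> and of its homogeneous ideals; by the graded Baer criterion the
  extension property for these test objects is the one for all graded modules.
\<close>
definition graded_injective :: "'a gring \<Rightarrow> ('a, 'e) gmodule \<Rightarrow> bool" where
  "graded_injective T E \<longleftrightarrow> graded_module T E \<and>
     (\<forall>(M :: ('a, 'a + 'e) gmodule) (N :: ('a, 'a + 'e) gmodule) f g.
        graded_module T M \<and> graded_module T N \<and>
        f \<in> graded_hom T M N \<and> inj_on f (carrier M) \<and> g \<in> graded_hom T M E \<longrightarrow>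
        (\<exists>h\<in>graded_hom T N E. \<forall>x\<in>carrier M. h (f x) = g x))"

definition graded_injective_resolution ::
    "'a gring \<Rightarrow> ('a, 'l) gmodule \<Rightarrow> ('l \<Rightarrow> 'e) \<Rightarrow>
     (nat \<Rightarrow> ('a, 'e) gmodule) \<Rightarrow> (nat \<Rightarrow> 'e \<Rightarrow> 'e) \<Rightarrow> bool" where
  "graded_injective_resolution T L \<epsilon> E d \<longleftrightarrow>
     (\<forall>q. graded_injective T (E q)) \<and>
     (\<forall>q. d q \<in> graded_hom T (E q) (E (Suc q))) \<and>
     \<epsilon> \<in> graded_hom T L (E 0) \<and> inj_on \<epsilon> (carrier L) \<and>
     \<epsilon> ` carrier L = cocycles E d 0 \<and>
     (\<forall>q. d q ` carrier (E q) = cocycles E d (Suc q))"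


section \<open>Local cohomology with respect to a pair of ideals\<close>

definition torsion_part ::
    "'a gring \<Rightarrow> 'a set \<Rightarrow> 'a set \<Rightarrow> ('a, 'b) gmodule \<Rightarrow> 'b set" where
  "torsion_part T I J L = {y \<in> carrier L. \<exists>n::nat. n \<ge> 1 \<and>
     (\<lambda>a. a \<odot>\<^bsub>L\<^esub> y) ` (I [^]\<^bsub>ideals_set T\<^esub> n) \<subseteq> (\<lambda>j. j \<odot>\<^bsub>L\<^esub> y) ` J}"

definition \<Gamma> ::
    "'a gring \<Rightarrow> 'a set \<Rightarrow> 'a set \<Rightarrow> ('a, 'b) gmodule \<Rightarrow> ('a, 'b) gmodule" where
  "\<Gamma> T I J L = graded_submodule L (torsion_part T I J L)"

text \<open>
  The right derived functors of \<open>\<Gamma>\<close>, computed from a graded injective resolution \<open>(E, d)\<close>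
  of the module; \<open>\<Gamma>\<close> acts on homomorphisms by restriction.
\<close>
definition local_cohomology ::
    "'a gring \<Rightarrow> 'a set \<Rightarrow> 'a set \<Rightarrow> (nat \<Rightarrow> ('a, 'e) gmodule) \<Rightarrow> (nat \<Rightarrow> 'e \<Rightarrow> 'e) \<Rightarrow>
     nat \<Rightarrow> ('a, 'e set) gmodule" where
  "local_cohomology T I J E d i = cohomology T (\<lambda>q. \<Gamma> T I J (E q)) d i"


section \<open>Localization\<close>

text \<open>
  Iterated localizations of \<open>T\<close>, for an arbitrary number of steps, have to live in one type:
  \<open>Elem t\<close> is an element \<open>t\<close> of \<open>T\<close>, and \<open>Frac m s\<close> is the formal fraction \<open>m / s\<close>.
\<close>
datatype 'a frac_expr =
    Elem (elem_of: 'a)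
  | Frac (numerator: "'a frac_expr") (denominator: 'a)

text \<open>
  The element \<open>m / s\<close> of \<open>S\<inverse>M\<close> is represented by a chosen member of the equivalence class
  of \<open>(m, s)\<close>, not by the class itself, since classes would not be of type \<open>frac_expr\<close>.
\<close>
definition fraction ::
    "'a gring \<Rightarrow> 'a set \<Rightarrow> ('a, 'a frac_expr) gmodule \<Rightarrow> 'a frac_expr \<Rightarrow> 'a \<Rightarrow> 'a frac_expr" where
  "fraction T S M m s = (SOME x. \<exists>m'\<in>carrier M. \<exists>s'\<in>S. x = Frac m' s' \<and>
     (\<exists>w\<in>S. w \<odot>\<^bsub>M\<^esub> (s' \<odot>\<^bsub>M\<^esub> m) = w \<odot>\<^bsub>M\<^esub> (s \<odot>\<^bsub>M\<^esub> m')))"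

text \<open>The grading is the usual one if \<open>S\<close> consists of homogeneous elements.\<close>
definition localization ::
    "'a gring \<Rightarrow> 'a set \<Rightarrow> ('a, 'a frac_expr) gmodule \<Rightarrow> ('a, 'a frac_expr) gmodule" where
  "localization T S M =
     \<lparr>carrier = {fraction T S M m s | m s. m \<in> carrier M \<and> s \<in> S},
      monoid.mult = undefined, one = undefined,
      zero = fraction T S M \<zero>\<^bsub>M\<^esub> \<one>\<^bsub>T\<^esub>,
      add = (\<lambda>x y. fraction T S M
        (denominator y \<odot>\<^bsub>M\<^esub> numerator x \<oplus>\<^bsub>M\<^esub> denominator x \<odot>\<^bsub>M\<^esub> numerator y)
        (denominator x \<otimes>\<^bsub>T\<^esub> denominator y)),
      smult = (\<lambda>t x. fraction T S M (t \<odot>\<^bsub>M\<^esub> numerator x) (denominator x)),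
      mcomp = (\<lambda>u. {fraction T S M m s | m s v n.
        m \<in> mcomp M v \<and> s \<in> S \<inter> rcomp T n \<and> u = v - int n})\<rparr>"

text \<open>
  The set \<open>{}\<^sup>*S\<^bsub>b,J\<^esub>\<close>.  If \<open>b\<^sup>n = 0\<close>, then \<open>b\<^sup>n\<close> is homogeneous of every degree; the set then
  contains 0 in any case.
\<close>
definition star_S :: "'a gring \<Rightarrow> 'a set \<Rightarrow> 'a \<Rightarrow> 'a set" where
  "star_S T J b = {b [^]\<^bsub>T\<^esub> n \<oplus>\<^bsub>T\<^esub> j | (n::nat) j.
     j \<in> J \<and> (\<exists>k. b [^]\<^bsub>T\<^esub> n \<in> rcomp T k \<and> j \<in> rcomp T k)}"

abbreviation star_localization ::
    "'a gring \<Rightarrow> 'a set \<Rightarrow> 'a \<Rightarrow> ('a, 'a frac_expr) gmodule \<Rightarrow> ('a, 'a frac_expr) gmodule" where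
  "star_localization T J b M \<equiv> localization T (star_S T J b) M"

definition ring_as_gmodule :: "'a gring \<Rightarrow> ('a, 'a frac_expr) gmodule" where
  "ring_as_gmodule T =
     \<lparr>carrier = Elem ` carrier T, monoid.mult = undefined, one = undefined,
      zero = Elem \<zero>\<^bsub>T\<^esub>,
      add = (\<lambda>x y. Elem (elem_of x \<oplus>\<^bsub>T\<^esub> elem_of y)),
      smult = (\<lambda>t x. Elem (t \<otimes>\<^bsub>T\<^esub> elem_of x)),
      mcomp = (\<lambda>u. if 0 \<le> u then Elem ` rcomp T (nat u) else {Elem \<zero>\<^bsub>T\<^esub>})\<rparr>"


section \<open>The \<open>\<^sup>*C\<close>-complex\<close>

text \<open>
  The list of indices is decreasing: its head is the outermost, i.e. last, localization.
\<close>
primrec iterated_localization ::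
    "'a gring \<Rightarrow> 'a set \<Rightarrow> 'a list \<Rightarrow> nat list \<Rightarrow> ('a, 'a frac_expr) gmodule" where
  "iterated_localization T J bs [] = ring_as_gmodule T"
| "iterated_localization T J bs (i # is) =
     star_localization T J (bs ! i) (iterated_localization T J bs is)"

text \<open>
  For \<open>k\<close> in \<open>is\<close>, the natural map to the iterated localization along \<open>is\<close> from the one in
  which the step \<open>k\<close> is left out: the localization map at step \<open>k\<close>, to which the outer
  localization functors are applied.
\<close>
primrec natural_map ::
    "'a gring \<Rightarrow> 'a set \<Rightarrow> 'a list \<Rightarrow> nat \<Rightarrow> nat list \<Rightarrow> 'a frac_expr \<Rightarrow> 'a frac_expr" where
  "natural_map T J bs k [] = id"
| "natural_map T J bs k (i # is) =
     (if i = k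
      then (\<lambda>x. fraction T (star_S T J (bs ! i)) (iterated_localization T J bs is) x \<one>\<^bsub>T\<^esub>)
      else (\<lambda>x. fraction T (star_S T J (bs ! i)) (iterated_localization T J bs is)
                  (natural_map T J bs k is (numerator x)) (denominator x)))"

definition descending :: "nat set \<Rightarrow> nat list" where
  "descending A = rev (sorted_list_of_set A)"

text \<open>The product of a finite family of graded modules.\<close>
definition graded_product :: "'i set \<Rightarrow> ('i \<Rightarrow> ('a, 'b) gmodule) \<Rightarrow> ('a, 'i \<Rightarrow> 'b) gmodule" where
  "graded_product K M =
     \<lparr>carrier = (\<Pi>\<^sub>E k\<in>K. carrier (M k)), monoid.mult = undefined, one = undefined,
      zero = (\<lambda>k\<in>K. \<zero>\<^bsub>M k\<^esub>),
      add = (\<lambda>x y. \<lambda>k\<in>K. x k \<oplus>\<^bsub>M k\<^esub> y k),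
      smult = (\<lambda>t x. \<lambda>k\<in>K. t \<odot>\<^bsub>M k\<^esub> x k),
      mcomp = (\<lambda>u. \<Pi>\<^sub>E k\<in>K. mcomp (M k) u)\<rparr>"

text \<open>Indices run over \<open>{0..<s}\<close> instead of \<open>{1..s}\<close>; \<open>i\<^sub>1 < \<dots> < i\<^sub>p\<close> is encoded as a set.\<close>
definition cech_indices :: "'a list \<Rightarrow> nat \<Rightarrow> nat set set" where
  "cech_indices bs p = {A. A \<subseteq> {..<length bs} \<and> card A = p}"

definition cech_module ::
    "'a gring \<Rightarrow> 'a set \<Rightarrow> 'a list \<Rightarrow> nat \<Rightarrow> ('a, nat set \<Rightarrow> 'a frac_expr) gmodule" where
  "cech_module T J bs p =
     graded_product (cech_indices bs p) (\<lambda>A. iterated_localization T J bs (descending A))"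

definition cech_differential ::
    "'a gring \<Rightarrow> 'a set \<Rightarrow> 'a list \<Rightarrow> nat \<Rightarrow>
     (nat set \<Rightarrow> 'a frac_expr) \<Rightarrow> (nat set \<Rightarrow> 'a frac_expr)" where
  "cech_differential T J bs p x = (\<lambda>B\<in>cech_indices bs (Suc p).
     let N = iterated_localization T J bs (descending B)
     in \<Oplus>\<^bsub>N\<^esub>k\<in>B. ((\<ominus>\<^bsub>T\<^esub> \<one>\<^bsub>T\<^esub>) [^]\<^bsub>T\<^esub> card {i\<in>B. i < k}) \<odot>\<^bsub>N\<^esub>
                    natural_map T J bs k (descending B) (x (B - {k})))"


section \<open>Tensor products\<close>

definition free_module :: "'a gring \<Rightarrow> 'x set \<Rightarrow> ('a, 'x \<Rightarrow> 'a) module" where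
  "free_module T X =
     \<lparr>carrier = {\<phi>. (\<forall>x. \<phi> x \<in> carrier T) \<and> finite {x. \<phi> x \<noteq> \<zero>\<^bsub>T\<^esub>} \<and>
                     {x. \<phi> x \<noteq> \<zero>\<^bsub>T\<^esub>} \<subseteq> X},
      monoid.mult = undefined, one = undefined,
      zero = (\<lambda>x. \<zero>\<^bsub>T\<^esub>), add = (\<lambda>\<phi> \<psi> x. \<phi> x \<oplus>\<^bsub>T\<^esub> \<psi> x), smult = (\<lambda>t \<phi> x. t \<otimes>\<^bsub>T\<^esub> \<phi> x)\<rparr>"

definition basis_vector :: "'a gring \<Rightarrow> 'x \<Rightarrow> 'x \<Rightarrow> 'a" where
  "basis_vector T x = (\<lambda>y. if y = x then \<one>\<^bsub>T\<^esub> else \<zero>\<^bsub>T\<^esub>)"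

definition tensor_relations ::
    "'a gring \<Rightarrow> ('a, 'b) gmodule \<Rightarrow> ('a, 'c) gmodule \<Rightarrow> ('b \<times> 'c \<Rightarrow> 'a) set" where
  "tensor_relations T M N =
     (let F = free_module T (carrier M \<times> carrier N); e = (\<lambda>x y. basis_vector T (x, y)) in
      \<Inter>{R. submodule R T F \<and>
         (\<forall>x\<in>carrier M. \<forall>x'\<in>carrier M. \<forall>y\<in>carrier N.
            e (x \<oplus>\<^bsub>M\<^esub> x') y \<ominus>\<^bsub>F\<^esub> (e x y \<oplus>\<^bsub>F\<^esub> e x' y) \<in> R) \<and>
         (\<forall>x\<in>carrier M. \<forall>y\<in>carrier N. \<forall>y'\<in>carrier N.
            e x (y \<oplus>\<^bsub>N\<^esub> y') \<ominus>\<^bsub>F\<^esub> (e x y \<oplus>\<^bsub>F\<^esub> e x y') \<in> R) \<and>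
         (\<forall>t\<in>carrier T. \<forall>x\<in>carrier M. \<forall>y\<in>carrier N.
            e (t \<odot>\<^bsub>M\<^esub> x) y \<ominus>\<^bsub>F\<^esub> (t \<odot>\<^bsub>F\<^esub> e x y) \<in> R \<and>
            e x (t \<odot>\<^bsub>N\<^esub> y) \<ominus>\<^bsub>F\<^esub> (t \<odot>\<^bsub>F\<^esub> e x y) \<in> R)})"

definition pure_tensor ::
    "'a gring \<Rightarrow> ('a, 'b) gmodule \<Rightarrow> ('a, 'c) gmodule \<Rightarrow> 'b \<Rightarrow> 'c \<Rightarrow> ('b \<times> 'c \<Rightarrow> 'a) set" where
  "pure_tensor T M N x y =
     tensor_relations T M N +>\<^bsub>free_module T (carrier M \<times> carrier N)\<^esub> basis_vector T (x, y)"

definition tensor_module ::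
    "'a gring \<Rightarrow> ('a, 'b) gmodule \<Rightarrow> ('a, 'c) gmodule \<Rightarrow> ('a, ('b \<times> 'c \<Rightarrow> 'a) set) gmodule" where
  "tensor_module T M N =
     (let P = quotient_module T (free_module T (carrier M \<times> carrier N)) (tensor_relations T M N)
      in with_grading P (\<lambda>u. generate (add_monoid P)
           {pure_tensor T M N x y | x y v w. x \<in> mcomp M v \<and> y \<in> mcomp N w \<and> u = v + w}))"

text \<open>
  The map \<open>f \<otimes> id\<close> from \<open>M \<otimes> N\<close> to \<open>M' \<otimes> N\<close>, evaluated on a representative of the class \<open>X\<close>.
\<close>
definition tensor_map ::
    "'a gring \<Rightarrow> ('a, 'b) gmodule \<Rightarrow> ('a, 'c) gmodule \<Rightarrow> ('b' \<Rightarrow> 'b) \<Rightarrow>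
     ('b' \<times> 'c \<Rightarrow> 'a) set \<Rightarrow> ('b \<times> 'c \<Rightarrow> 'a) set" where
  "tensor_map T M' N f X =
     (let \<phi> = (SOME \<phi>. \<phi> \<in> X); P = tensor_module T M' N
      in \<Oplus>\<^bsub>P\<^esub>z\<in>{z. \<phi> z \<noteq> \<zero>\<^bsub>T\<^esub>}. \<phi> z \<odot>\<^bsub>P\<^esub> pure_tensor T M' N (f (fst z)) (snd z))"

definition cech_cohomology ::
    "'a gring \<Rightarrow> 'a set \<Rightarrow> 'a list \<Rightarrow> ('a, 'l) gmodule \<Rightarrow> nat \<Rightarrow>
     ('a, ((nat set \<Rightarrow> 'a frac_expr) \<times> 'l \<Rightarrow> 'a) set set) gmodule" where
  "cech_cohomology T J bs L i =
     cohomology T (\<lambda>p. tensor_module T (cech_module T J bs p) L)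
       (\<lambda>p. tensor_map T (cech_module T J bs (Suc p)) L (cech_differential T J bs p)) i"

end

theory Submission
  imports Defs
begin

text \<open>
  Let \<open>b\<^sub>1, \<dots>, b\<^sub>s\<close> be the generators of \<open>I\<close>, and for a set \<open>A\<close> of indices let \<open>S\<^sub>A\<close> be the submonoid
  of \<open>T\<close> generated by the sets \<open>{}\<^sup>*S\<^bsub>b,J\<^esub>\<close> of the \<open>b\<close> with index in \<open>A\<close> (\<open>denominators\<close>).  The iterated
  localization along \<open>A\<close> is the localization at \<open>S\<^sub>A\<close>, and tensoring with it is localizing at
  \<open>S\<^sub>A\<close>, hence exact.  The theorem follows by comparing the two edges of the double complex
  \<open>C\<^sup>p \<otimes> E\<^sup>q\<close>: its columns are exact because localization is, and its rows are exact in positive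
  degrees because graded injective modules are acyclic for the complex.  The edge \<open>p = 0\<close> is the
  torsion functor applied to \<open>E\<close>, the edge \<open>q = 0\<close> is the Cech complex of \<open>L\<close>.

  The double complex can be written without localizing any \<open>E\<^sup>q\<close>.  Let \<open>E\<close> be graded injective over
  the Noetherian ring \<open>T\<close>, and let \<open>S\<close> be a multiplicative set of homogeneous elements.  For \<open>s \<in> S\<close>
  the annihilators of the powers of \<open>s\<close> become stationary, say \<open>Ann(s\<^sup>n) = Ann(s\<^sup>n\<^sup>+\<^sup>1)\<close>, so
  \<open>t s\<^sup>n\<^sup>+\<^sup>1 \<mapsto> t s\<^sup>n y\<close> is a well-defined map on a principal ideal; its extension to \<open>T\<close> yields \<open>x\<close>
  with \<open>s\<^sup>n (s x - y) = 0\<close>.  Therefore \<open>E \<rightarrow> S\<^sup>-\<^sup>1E\<close> is onto (\<open>baer_divisible\<close>), and a cochain is a family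
  \<open>(x\<^sub>A)\<close> of elements of \<open>E\<close>, where \<open>x\<^sub>A\<close> matters only modulo the \<open>S\<^sub>A\<close>-torsion.  In this description
  the natural maps are identities and the differential is the simplicial one.

  Acyclicity (\<open>cech_acyclic\<close>) is an induction on the number of generators.  Subtracting a coboundary
  makes a cocycle vanish on all \<open>A\<close> that contain the last index \<open>m\<close>; then its other entries are
  torsion with respect to \<open>m\<close>, and the induction hypothesis applies to the \<open>m\<close>-torsion submodule.
  This submodule is again injective (\<open>baer_torsion\<close>), by the special case
  \<open>\<aa> \<inter> s\<^sup>n T \<subseteq> s \<aa>\<close> of the Artin-Rees lemma.

  The edges are identified as follows.  An element is \<open>(I,J)\<close>-torsion if and only if each \<open>{}\<^sup>*S\<^bsub>b,J\<^esub>\<close>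
  contains an element that annihilates it (\<open>torsion_part_iff\<close>); the point is that the homogeneous
  components of a ring element that annihilates \<open>y\<close> act nilpotently on \<open>y\<close>.  For the Cech complex of \<open>L\<close>,
  a fraction \<open>t/s\<close> and \<open>l \<in> L\<close> determine \<open>x \<in> E\<^sup>0\<close> with \<open>s x = t \<epsilon>(l)\<close>, up to \<open>S\<^sub>A\<close>-torsion; this gives
  a map from \<open>C\<^sup>p \<otimes> L\<close> to cochains of \<open>E\<^sup>0\<close>, which is injective with image the kernel of the vertical
  differential (\<open>Rel_null_iff\<close>, \<open>Rel_surjective\<close>).

  All isomorphisms of subquotients are given by linear relations (\<open>correspondence\<close>), since those that
  arise from a double complex are zigzags.
\<close>

section \<open>Linear maps\<close>

definition linear_map ::
    "('a, 'r) ring_scheme \<Rightarrow> ('a, 'b, 'm) module_scheme \<Rightarrow> ('a, 'c, 'n) module_scheme \<Rightarrow> ('b \<Rightarrow> 'c) set" where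
  "linear_map R M N = {f. f \<in> carrier M \<rightarrow> carrier N \<and>
     (\<forall>x\<in>carrier M. \<forall>y\<in>carrier M. f (x \<oplus>\<^bsub>M\<^esub> y) = f x \<oplus>\<^bsub>N\<^esub> f y) \<and>
     (\<forall>t\<in>carrier R. \<forall>x\<in>carrier M. f (t \<odot>\<^bsub>M\<^esub> x) = t \<odot>\<^bsub>N\<^esub> f x)}"

lemma linear_mapD:
  assumes "f \<in> linear_map R M N"
  shows "x \<in> carrier M \<Longrightarrow> f x \<in> carrier N"
    and "x \<in> carrier M \<Longrightarrow> y \<in> carrier M \<Longrightarrow> f (x \<oplus>\<^bsub>M\<^esub> y) = f x \<oplus>\<^bsub>N\<^esub> f y"
    and "t \<in> carrier R \<Longrightarrow> x \<in> carrier M \<Longrightarrow> f (t \<odot>\<^bsub>M\<^esub> x) = t \<odot>\<^bsub>N\<^esub> f x"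
  using assms unfolding linear_map_def by auto

lemma linear_map_zero:
  assumes "module R M" "module R N" "f \<in> linear_map R M N"
  shows "f \<zero>\<^bsub>M\<^esub> = \<zero>\<^bsub>N\<^esub>"
proof -
  interpret M: module R M by fact
  interpret N: module R N by fact
  have "f (\<zero>\<^bsub>R\<^esub> \<odot>\<^bsub>M\<^esub> \<zero>\<^bsub>M\<^esub>) = \<zero>\<^bsub>R\<^esub> \<odot>\<^bsub>N\<^esub> f \<zero>\<^bsub>M\<^esub>"
    by (rule linear_mapD(3)[OF assms(3)]) auto
  then show ?thesis using linear_mapD(1)[OF assms(3) M.zero_closed] by simp
qed

lemma linear_map_neg:
  assumes "module R M" "module R N" "f \<in> linear_map R M N" "x \<in> carrier M"
  shows "f (\<ominus>\<^bsub>M\<^esub> x) = \<ominus>\<^bsub>N\<^esub> f x"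
proof -
  interpret M: module R M by fact
  interpret N: module R N by fact
  have "f (\<ominus>\<^bsub>M\<^esub> x) = f ((\<ominus>\<^bsub>R\<^esub> \<one>\<^bsub>R\<^esub>) \<odot>\<^bsub>M\<^esub> x)" using assms(4) by (simp add: M.smult_l_minus)
  also have "\<dots> = (\<ominus>\<^bsub>R\<^esub> \<one>\<^bsub>R\<^esub>) \<odot>\<^bsub>N\<^esub> f x"
    by (rule linear_mapD(3)[OF assms(3)]) (use assms(4) in auto)
  finally show ?thesis using assms(4) linear_mapD(1)[OF assms(3)] by (simp add: N.smult_l_minus)
qed

lemma linear_map_minus:
  assumes "module R M" "module R N" "f \<in> linear_map R M N" "x \<in> carrier M" "y \<in> carrier M"
  shows "f (x \<ominus>\<^bsub>M\<^esub> y) = f x \<ominus>\<^bsub>N\<^esub> f y"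
proof -
  interpret M: module R M by fact
  interpret N: module R N by fact
  show ?thesis using assms(4,5) linear_mapD[OF assms(3)] linear_map_neg[OF assms(1-3)]
    by (simp add: a_minus_def)
qed

lemma linear_map_finsum:
  assumes "module R M" "module R N" "f \<in> linear_map R M N" "finite A" "g \<in> A \<rightarrow> carrier M"
  shows "f (\<Oplus>\<^bsub>M\<^esub>a\<in>A. g a) = (\<Oplus>\<^bsub>N\<^esub>a\<in>A. f (g a))"
proof -
  interpret M: module R M by fact
  interpret N: module R N by fact
  show ?thesis using assms(4,5)
  proof (induction A)
    case empty
    then show ?case using linear_map_zero[OF assms(1-3)] by simp
  next
    case (insert a A)
    have "f (\<Oplus>\<^bsub>M\<^esub>a\<in>insert a A. g a) = f (g a \<oplus>\<^bsub>M\<^esub> (\<Oplus>\<^bsub>M\<^esub>a\<in>A. g a))"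
      using insert by (subst M.finsum_insert) auto
    also have "\<dots> = f (g a) \<oplus>\<^bsub>N\<^esub> (\<Oplus>\<^bsub>N\<^esub>a\<in>A. f (g a))"
      using insert by (subst linear_mapD(2)[OF assms(3)]) (auto intro!: M.finsum_closed)
    also have "\<dots> = (\<Oplus>\<^bsub>N\<^esub>a\<in>insert a A. f (g a))"
      using insert linear_mapD(1)[OF assms(3)] by (subst N.finsum_insert) auto
    finally show ?case .
  qed
qed

lemma linear_map_comp:
  assumes "f \<in> linear_map R M N" "g \<in> linear_map R N P"
  shows "g \<circ> f \<in> linear_map R M P"
  using assms unfolding linear_map_def by (auto simp: Pi_iff)

lemma (in module) finsum_closed_subset:
  assumes "\<zero>\<^bsub>M\<^esub> \<in> H" "\<And>x y. x \<in> H \<Longrightarrow> y \<in> H \<Longrightarrow> x \<oplus>\<^bsub>M\<^esub> y \<in> H" "H \<subseteq> carrier M"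
    and "finite A" "\<And>a. a \<in> A \<Longrightarrow> f a \<in> H"
  shows "(\<Oplus>\<^bsub>M\<^esub>a\<in>A. f a) \<in> H"
  using assms(4,5)
proof (induction A)
  case empty
  then show ?case using assms(1) by simp
next
  case (insert a A)
  have "f \<in> A \<rightarrow> carrier M" "f a \<in> carrier M" using insert assms(3) by auto
  then show ?case using insert assms(2) by simp
qed

section \<open>Homogeneous components\<close>

text \<open>
  The component of \<open>x\<close> in degree \<open>u\<close>.  The type of degrees is left open because the ring is graded by
  natural numbers and its modules by integers.
\<close>
definition hcomp :: "('b, 'z) ring_scheme \<Rightarrow> ('i \<Rightarrow> 'b set) \<Rightarrow> 'i \<Rightarrow> 'b \<Rightarrow> 'b" where
  "hcomp M G u x = (THE f. (\<forall>u. f u \<in> G u) \<and> finite {u. f u \<noteq> \<zero>\<^bsub>M\<^esub>} \<and>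
     x = (\<Oplus>\<^bsub>M\<^esub>u\<in>{u. f u \<noteq> \<zero>\<^bsub>M\<^esub>}. f u)) u"

locale graded_group = abelian_group M for M :: "('b, 'z) ring_scheme" (structure) +
  fixes G :: "'i \<Rightarrow> 'b set"
  assumes decomposition: "direct_sum_decomposition M G"
begin

lemma subgroup_G: "additive_subgroup (G u) M"
  using decomposition unfolding direct_sum_decomposition_def by auto

lemma G_carrier: "x \<in> G u \<Longrightarrow> x \<in> carrier M"
  using additive_subgroup.a_subset[OF subgroup_G] by auto

lemma G_zero [simp]: "\<zero> \<in> G u"
  using additive_subgroup.zero_closed[OF subgroup_G] .

lemma G_add: "x \<in> G u \<Longrightarrow> y \<in> G u \<Longrightarrow> x \<oplus> y \<in> G u"
  using additive_subgroup.a_closed[OF subgroup_G] .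

lemma G_neg: "x \<in> G u \<Longrightarrow> \<ominus> x \<in> G u"
  using additive_subgroup.a_inv_closed[OF subgroup_G] .

lemma hcomp_spec:
  assumes "x \<in> carrier M"
  shows "(\<forall>u. hcomp M G u x \<in> G u) \<and> finite {u. hcomp M G u x \<noteq> \<zero>} \<and>
     x = (\<Oplus>u\<in>{u. hcomp M G u x \<noteq> \<zero>}. hcomp M G u x)"
proof -
  define P where "P = (\<lambda>f. (\<forall>u. f u \<in> G u) \<and> finite {u. f u \<noteq> \<zero>} \<and>
    x = (\<Oplus>u\<in>{u. f u \<noteq> \<zero>}. f u))"
  have "\<exists>!f. P f"
    using decomposition assms unfolding direct_sum_decomposition_def P_def by simp
  then have "P (THE f. P f)" by (rule theI')
  moreover have "(THE f. P f) = (\<lambda>u. hcomp M G u x)" unfolding hcomp_def P_def by simp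
  ultimately have "P (\<lambda>u. hcomp M G u x)" by simp
  then show ?thesis unfolding P_def .
qed

lemma hcomp_in: "x \<in> carrier M \<Longrightarrow> hcomp M G u x \<in> G u"
  using hcomp_spec by blast

lemma hcomp_closed [simp]: "x \<in> carrier M \<Longrightarrow> hcomp M G u x \<in> carrier M"
  using hcomp_in G_carrier by blast

lemma hcomp_eqI:
  assumes "\<And>u. f u \<in> G u" "finite U" "\<And>u. u \<notin> U \<Longrightarrow> f u = \<zero>" "x = (\<Oplus>u\<in>U. f u)"
  shows "hcomp M G u x = f u"
proof -
  have fc: "f v \<in> carrier M" for v using assms(1) G_carrier by blast
  have x: "x \<in> carrier M" unfolding assms(4) using fc by auto
  define P where "P = (\<lambda>f. (\<forall>u. f u \<in> G u) \<and> finite {u. f u \<noteq> \<zero>} \<and>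
    x = (\<Oplus>u\<in>{u. f u \<noteq> \<zero>}. f u))"
  have ex1: "\<exists>!f. P f"
    using decomposition x unfolding direct_sum_decomposition_def P_def by simp
  have sub: "{u. f u \<noteq> \<zero>} \<subseteq> U" using assms(3) by blast
  have "(\<Oplus>u\<in>U. f u) = (\<Oplus>u\<in>{u. f u \<noteq> \<zero>}. f u)"
    by (rule add.finprod_mono_neutral_cong_right[OF assms(2) sub]) (use fc in auto)
  then have "P f" unfolding P_def using assms sub finite_subset by auto
  moreover have "P (\<lambda>u. hcomp M G u x)" unfolding P_def using hcomp_spec[OF x] .
  ultimately have "(\<lambda>u. hcomp M G u x) = f" using ex1 by blast
  then show ?thesis by metis
qed

lemma hcomp_sum:
  assumes "x \<in> carrier M" "finite U" "\<And>u. u \<notin> U \<Longrightarrow> hcomp M G u x = \<zero>"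
  shows "x = (\<Oplus>u\<in>U. hcomp M G u x)"
proof -
  have sub: "{u. hcomp M G u x \<noteq> \<zero>} \<subseteq> U" using assms(3) by blast
  have "(\<Oplus>u\<in>U. hcomp M G u x) = (\<Oplus>u\<in>{u. hcomp M G u x \<noteq> \<zero>}. hcomp M G u x)"
    by (rule add.finprod_mono_neutral_cong_right[OF assms(2) sub]) (use assms in auto)
  then show ?thesis using hcomp_spec[OF assms(1)] by simp
qed

lemma hcomp_homogeneous:
  assumes "x \<in> G u"
  shows "hcomp M G v x = (if v = u then x else \<zero>)"
proof -
  have x: "x \<in> carrier M" using assms G_carrier by blast
  show ?thesis
    by (rule hcomp_eqI[where U = "{u}" and f = "\<lambda>v. if v = u then x else \<zero>"])
      (use assms x in \<open>auto simp: add.finprod_singleton\<close>)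
qed

lemma hcomp_zero [simp]: "hcomp M G u \<zero> = \<zero>"
  using hcomp_homogeneous[OF G_zero] by metis

lemma hcomp_add:
  assumes "x \<in> carrier M" "y \<in> carrier M"
  shows "hcomp M G u (x \<oplus> y) = hcomp M G u x \<oplus> hcomp M G u y"
proof -
  let ?U = "{u. hcomp M G u x \<noteq> \<zero>} \<union> {u. hcomp M G u y \<noteq> \<zero>}"
  have fin: "finite ?U" using hcomp_spec assms by simp
  show ?thesis
  proof (rule hcomp_eqI[where U = ?U])
    have "(\<Oplus>u\<in>?U. hcomp M G u x \<oplus> hcomp M G u y)
        = (\<Oplus>u\<in>?U. hcomp M G u x) \<oplus> (\<Oplus>u\<in>?U. hcomp M G u y)"
      by (rule finsum_addf) (use assms in auto)
    also have "\<dots> = x \<oplus> y"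
      using hcomp_sum[OF assms(1) fin] hcomp_sum[OF assms(2) fin] by simp
    finally show "x \<oplus> y = (\<Oplus>u\<in>?U. hcomp M G u x \<oplus> hcomp M G u y)" by simp
  qed (use assms fin in \<open>auto intro: G_add hcomp_in\<close>)
qed

lemma homogeneous_induct [consumes 1, case_names homogeneous add]:
  assumes "x \<in> carrier M" "\<And>u x. x \<in> G u \<Longrightarrow> P x"
    and "\<And>x y. x \<in> carrier M \<Longrightarrow> y \<in> carrier M \<Longrightarrow> P x \<Longrightarrow> P y \<Longrightarrow> P (x \<oplus> y)"
  shows "P x"
proof -
  have *: "finite U \<Longrightarrow> P (\<Oplus>u\<in>U. hcomp M G u x)" for U
  proof (induction U rule: finite_induct)
    case empty
    show ?case using assms(2)[OF G_zero[of undefined]] by simp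
  next
    case (insert u U)
    have "(\<Oplus>u\<in>insert u U. hcomp M G u x) = hcomp M G u x \<oplus> (\<Oplus>u\<in>U. hcomp M G u x)"
      by (rule finsum_insert) (use insert assms(1) in auto)
    then show ?case using assms(2)[OF hcomp_in[OF assms(1)]] insert assms(1)
      by (auto intro!: assms(3) finsum_closed)
  qed
  show ?thesis using *[of "{u. hcomp M G u x \<noteq> \<zero>}"] hcomp_spec[OF assms(1)] by simp
qed

lemma hcomp_ext:
  assumes "x \<in> carrier M" "y \<in> carrier M" "\<And>u. hcomp M G u x = hcomp M G u y"
  shows "x = y"
  using hcomp_spec[OF assms(1)] hcomp_spec[OF assms(2)] assms(3) by simp

end

text \<open>
  The degree map \<open>\<sigma>\<close> is the identity for graded homomorphisms and a translation for multiplication by a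
  homogeneous ring element.  For \<open>r \<mapsto> r z\<close> with \<open>z\<close> homogeneous it embeds the degrees of the ring into
  those of the module, whence the second claim.
\<close>
lemma hcomp_additive_map:
  assumes "graded_group M G" "graded_group N H"
    and f: "f \<in> carrier M \<rightarrow> carrier N"
      "\<And>x y. x \<in> carrier M \<Longrightarrow> y \<in> carrier M \<Longrightarrow> f (x \<oplus>\<^bsub>M\<^esub> y) = f x \<oplus>\<^bsub>N\<^esub> f y"
    and deg: "\<And>u x. x \<in> G u \<Longrightarrow> f x \<in> H (\<sigma> u)" and inj: "inj \<sigma>"
    and x: "x \<in> carrier M"
  shows "hcomp N H (\<sigma> u) (f x) = f (hcomp M G u x)"
    and "v \<notin> range \<sigma> \<Longrightarrow> hcomp N H v (f x) = \<zero>\<^bsub>N\<^esub>"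
proof -
  interpret M: graded_group M G by fact
  interpret N: graded_group N H by fact
  have fz: "f \<zero>\<^bsub>M\<^esub> = \<zero>\<^bsub>N\<^esub>"
  proof -
    have "f \<zero>\<^bsub>M\<^esub> \<in> carrier N" using f(1) by auto
    moreover have "f \<zero>\<^bsub>M\<^esub> \<oplus>\<^bsub>N\<^esub> f \<zero>\<^bsub>M\<^esub> = f \<zero>\<^bsub>M\<^esub>" using f(2)[of "\<zero>\<^bsub>M\<^esub>" "\<zero>\<^bsub>M\<^esub>"] by simp
    ultimately show ?thesis using N.add.r_cancel_one by blast
  qed
  have fc: "y \<in> carrier M \<Longrightarrow> f y \<in> carrier N" for y using f(1) by auto
  have "(\<forall>u. hcomp N H (\<sigma> u) (f x) = f (hcomp M G u x)) \<and>
        (\<forall>v. v \<notin> range \<sigma> \<longrightarrow> hcomp N H v (f x) = \<zero>\<^bsub>N\<^esub>)"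
    using x
  proof (induction x rule: M.homogeneous_induct)
    case (homogeneous w x)
    then show ?case using N.hcomp_homogeneous[OF deg[OF homogeneous]] M.hcomp_homogeneous[OF homogeneous]
      fz inj by (auto dest: injD)
  next
    case (add x y)
    then show ?case by (simp add: f(2) fc N.hcomp_add M.hcomp_add)
  qed
  then show "hcomp N H (\<sigma> u) (f x) = f (hcomp M G u x)"
    and "v \<notin> range \<sigma> \<Longrightarrow> hcomp N H v (f x) = \<zero>\<^bsub>N\<^esub>" by auto
qed

text \<open>
  Statements about degrees are made for all \<open>D\<close> at once, where \<open>None\<close> stands for the whole module and
  \<open>Some u\<close> for its component of degree \<open>u\<close>.  For instance, a map that takes \<open>part M D\<close> onto \<open>part N D\<close>
  for all \<open>D\<close> is surjective, and so is each of its restrictions to components.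
\<close>
definition part :: "('a, 'b) gmodule \<Rightarrow> int option \<Rightarrow> 'b set" where
  "part M D = (case D of None \<Rightarrow> carrier M | Some u \<Rightarrow> mcomp M u)"

definition shift :: "nat \<Rightarrow> int option \<Rightarrow> int option" where
  "shift k = map_option ((+) (int k))"

lemma part_simps [simp]: "part M None = carrier M" "part M (Some u) = mcomp M u"
  by (simp_all add: part_def)

lemma shift_simps [simp]: "shift k None = None" "shift k (Some u) = Some (int k + u)"
  by (simp_all add: shift_def)

lemma graded_ring_group: "graded_ring T \<Longrightarrow> graded_group T (rcomp T)"
  unfolding graded_ring_def graded_ring_axioms_def graded_group_def graded_group_axioms_def
  by (auto dest: cring.axioms(1) ring.axioms(1))

sublocale graded_ring \<subseteq> R: graded_group T "rcomp T"
  using graded_ring_group graded_ring_axioms by blast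

sublocale graded_module \<subseteq> G: graded_group M "mcomp M"
  using mcomp_decomposition by unfold_locales

section \<open>Quotient modules\<close>

lemma module_abelian_subgroup:
  assumes "module R M" "submodule N R M"
  shows "abelian_subgroup N M"
  using assms by (intro abelian_subgroupI3 additive_subgroup.intro)
    (auto simp: module_def submodule_def)

lemma submodule_minus:
  assumes "module R M" "submodule N R M" "x \<in> N" "y \<in> N"
  shows "x \<ominus>\<^bsub>M\<^esub> y \<in> N"
  using module.submoduleE[OF assms(1,2)] assms(3,4) by (simp add: a_minus_def)

lemma submodule_zero:
  assumes "module R M" "submodule N R M"
  shows "\<zero>\<^bsub>M\<^esub> \<in> N"
  using additive_subgroup.zero_closed[OF abelian_subgroup.axioms(1)[OF module_abelian_subgroup[OF assms]]] .

context module
begin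

lemma coset_mem:
  assumes "submodule N R M" "x \<in> carrier M"
  shows "y \<in> N +>\<^bsub>M\<^esub> x \<longleftrightarrow> y \<in> carrier M \<and> y \<ominus>\<^bsub>M\<^esub> x \<in> N"
proof -
  interpret abelian_subgroup N M by (rule module_abelian_subgroup[OF module_axioms assms(1)])
  show ?thesis
    using a_rcos_module[OF assms(2)] a_elemrcos_carrier[OF assms(2)] by (auto simp: a_minus_def)
qed

lemma coset_self:
  assumes "submodule N R M" "x \<in> carrier M"
  shows "x \<in> N +>\<^bsub>M\<^esub> x"
  using coset_mem[OF assms] submodule_zero[OF module_axioms assms(1)] assms(2)
  by (simp add: a_minus_def M.r_neg)

lemma coset_eq_iff:
  assumes "submodule N R M" "x \<in> carrier M" "y \<in> carrier M"
  shows "N +>\<^bsub>M\<^esub> x = N +>\<^bsub>M\<^esub> y \<longleftrightarrow> x \<ominus>\<^bsub>M\<^esub> y \<in> N"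
proof -
  interpret abelian_subgroup N M by (rule module_abelian_subgroup[OF module_axioms assms(1)])
  show ?thesis
    using a_repr_independence'[of x y] coset_mem[OF assms(1,3), of x] coset_self[OF assms(1,2)] assms(2,3)
    by auto
qed

lemma coset_eq_self_iff:
  assumes "submodule N R M" "x \<in> carrier M"
  shows "N +>\<^bsub>M\<^esub> x = N \<longleftrightarrow> x \<in> N"
proof -
  interpret abelian_subgroup N M by (rule module_abelian_subgroup[OF module_axioms assms(1)])
  show ?thesis using coset_self[OF assms] a_rcos_const by auto
qed

lemma coset_add:
  assumes "submodule N R M" "x \<in> carrier M" "y \<in> carrier M"
  shows "(N +>\<^bsub>M\<^esub> x) <+>\<^bsub>M\<^esub> (N +>\<^bsub>M\<^esub> y) = N +>\<^bsub>M\<^esub> (x \<oplus>\<^bsub>M\<^esub> y)"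
proof -
  interpret abelian_subgroup N M by (rule module_abelian_subgroup[OF module_axioms assms(1)])
  show ?thesis using a_rcos_sum[OF assms(2,3)] .
qed

lemma coset_smult:
  assumes "submodule N R M" "t \<in> carrier R" "x \<in> carrier M"
  shows "(\<Union>y\<in>N +>\<^bsub>M\<^esub> x. N +>\<^bsub>M\<^esub> (t \<odot>\<^bsub>M\<^esub> y)) = N +>\<^bsub>M\<^esub> (t \<odot>\<^bsub>M\<^esub> x)"
proof -
  have "N +>\<^bsub>M\<^esub> (t \<odot>\<^bsub>M\<^esub> y) = N +>\<^bsub>M\<^esub> (t \<odot>\<^bsub>M\<^esub> x)" if "y \<in> N +>\<^bsub>M\<^esub> x" for y
  proof -
    have y: "y \<in> carrier M" "y \<ominus>\<^bsub>M\<^esub> x \<in> N" using that coset_mem[OF assms(1,3)] by auto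
    have "t \<odot>\<^bsub>M\<^esub> y \<ominus>\<^bsub>M\<^esub> t \<odot>\<^bsub>M\<^esub> x = t \<odot>\<^bsub>M\<^esub> (y \<ominus>\<^bsub>M\<^esub> x)"
      using y assms(2,3) by (simp add: a_minus_def smult_r_distr smult_r_minus)
    then have "t \<odot>\<^bsub>M\<^esub> y \<ominus>\<^bsub>M\<^esub> t \<odot>\<^bsub>M\<^esub> x \<in> N"
      using submoduleE(4)[OF assms(1,2)] y by simp
    then show ?thesis using coset_eq_iff[OF assms(1)] y assms by simp
  qed
  then show ?thesis using coset_self[OF assms(1,3)] by blast
qed

end


lemma quotient_simps:
  "zero (quotient_module T M N) = N" "add (quotient_module T M N) = set_add M"
  "carrier (quotient_module T M N) = (\<lambda>x. N +>\<^bsub>M\<^esub> x) ` carrier M"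
  "smult (quotient_module T M N) = (\<lambda>t X. \<Union>x\<in>X. N +>\<^bsub>M\<^esub> (t \<odot>\<^bsub>M\<^esub> x))"
  by (auto simp: quotient_module_def A_RCOSETS_def')

lemma quotient_module_is_module:
  fixes T :: "'a gring"
  assumes "module T M" "submodule N T M"
  shows "module T (quotient_module T M N)"
proof -
  interpret M: module T M by fact
  let ?Q = "quotient_module T M N"
  have add: "(N +>\<^bsub>M\<^esub> x) \<oplus>\<^bsub>?Q\<^esub> (N +>\<^bsub>M\<^esub> y) = N +>\<^bsub>M\<^esub> (x \<oplus>\<^bsub>M\<^esub> y)"
    if "x \<in> carrier M" "y \<in> carrier M" for x y
    using M.coset_add[OF assms(2) that] by (simp add: quotient_simps)
  have smult: "t \<odot>\<^bsub>?Q\<^esub> (N +>\<^bsub>M\<^esub> x) = N +>\<^bsub>M\<^esub> (t \<odot>\<^bsub>M\<^esub> x)"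
    if "t \<in> carrier T" "x \<in> carrier M" for t x
    using M.coset_smult[OF assms(2) that] by (simp add: quotient_simps)
  note [simp] = quotient_simps(1,3) add smult
  have N: "N = N +>\<^bsub>M\<^esub> \<zero>\<^bsub>M\<^esub>"
    using M.coset_eq_self_iff[OF assms(2) M.zero_closed] submodule_zero[OF assms] by blast
  show ?thesis
  proof (intro moduleI abelian_groupI)
    fix X assume "X \<in> carrier ?Q"
    then obtain x where x: "x \<in> carrier M" "X = N +>\<^bsub>M\<^esub> x" by auto
    show "\<zero>\<^bsub>?Q\<^esub> \<oplus>\<^bsub>?Q\<^esub> X = X"
      using add[OF M.zero_closed x(1)] x N by simp
    show "\<exists>Y\<in>carrier ?Q. Y \<oplus>\<^bsub>?Q\<^esub> X = \<zero>\<^bsub>?Q\<^esub>"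
      using x N by (intro bexI[of _ "N +>\<^bsub>M\<^esub> (\<ominus>\<^bsub>M\<^esub> x)"]) (auto simp: M.l_neg)
  qed (use M.M.a_ac N in \<open>auto simp: M.smult_l_distr M.smult_r_distr M.smult_assoc1
        M.is_cring intro!: imageI\<close>)
qed

lemma coset_map_linear:
  fixes T :: "'a gring"
  assumes "module T M" "submodule N T M"
  shows "(\<lambda>x. N +>\<^bsub>M\<^esub> x) \<in> linear_map T M (quotient_module T M N)"
proof -
  interpret M: module T M by fact
  show ?thesis unfolding linear_map_def
    by (auto simp: quotient_simps M.coset_add[OF assms(2)] M.coset_smult[OF assms(2)])
qed

section \<open>Correspondences between subquotients\<close>

text \<open>
  An isomorphism of \<open>Z / B\<close> and \<open>Z' / B'\<close> given by a linear relation between representatives.  Unlike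
  maps, relations compose without a choice of representatives, and the zigzags of a double complex are
  relations.
\<close>
definition correspondence ::
    "'a gring \<Rightarrow> ('a, 'b) gmodule \<Rightarrow> 'b set \<Rightarrow> 'b set \<Rightarrow> ('a, 'c) gmodule \<Rightarrow> 'c set \<Rightarrow> 'c set \<Rightarrow>
     ('b \<Rightarrow> 'c \<Rightarrow> bool) \<Rightarrow> bool" where
  "correspondence T M Z B M' Z' B' R \<longleftrightarrow>
     (\<forall>x y. R x y \<longrightarrow> x \<in> Z \<and> y \<in> Z' \<and> (x \<in> B \<longleftrightarrow> y \<in> B')) \<and>
     (\<forall>x y x' y'. R x y \<longrightarrow> R x' y' \<longrightarrow> R (x \<oplus>\<^bsub>M\<^esub> x') (y \<oplus>\<^bsub>M'\<^esub> y')) \<and>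
     (\<forall>t\<in>carrier T. \<forall>x y. R x y \<longrightarrow> R (t \<odot>\<^bsub>M\<^esub> x) (t \<odot>\<^bsub>M'\<^esub> y)) \<and>
     (\<forall>D. \<forall>x\<in>Z \<inter> part M D. \<exists>y\<in>Z' \<inter> part M' D. R x y) \<and>
     (\<forall>D. \<forall>y\<in>Z' \<inter> part M' D. \<exists>x\<in>Z \<inter> part M D. R x y)"

lemma correspondenceD:
  assumes "correspondence T M Z B M' Z' B' R"
  shows "R x y \<Longrightarrow> x \<in> Z" "R x y \<Longrightarrow> y \<in> Z'" "R x y \<Longrightarrow> x \<in> B \<longleftrightarrow> y \<in> B'"
    and "R x y \<Longrightarrow> R x' y' \<Longrightarrow> R (x \<oplus>\<^bsub>M\<^esub> x') (y \<oplus>\<^bsub>M'\<^esub> y')"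
    and "t \<in> carrier T \<Longrightarrow> R x y \<Longrightarrow> R (t \<odot>\<^bsub>M\<^esub> x) (t \<odot>\<^bsub>M'\<^esub> y)"
    and "x \<in> Z \<Longrightarrow> x \<in> part M D \<Longrightarrow> \<exists>y\<in>Z' \<inter> part M' D. R x y"
    and "y \<in> Z' \<Longrightarrow> y \<in> part M' D \<Longrightarrow> \<exists>x\<in>Z \<inter> part M D. R x y"
  using assms unfolding correspondence_def by blast+

lemma correspondence_trans:
  assumes "correspondence T M Z B M' Z' B' R" "correspondence T M' Z' B' M'' Z'' B'' S"
  shows "correspondence T M Z B M'' Z'' B'' (R OO S)"
  unfolding correspondence_def
proof (intro conjI allI ballI impI)
  fix D x assume "x \<in> Z \<inter> part M D"
  then obtain y where y: "y \<in> Z' \<inter> part M' D" "R x y" using assms(1) unfolding correspondence_def by meson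
  then obtain z where "z \<in> Z'' \<inter> part M'' D" "S y z" using assms(2) unfolding correspondence_def by meson
  then show "\<exists>z\<in>Z'' \<inter> part M'' D. (R OO S) x z" using y by blast
next
  fix D z assume "z \<in> Z'' \<inter> part M'' D"
  then obtain y where y: "y \<in> Z' \<inter> part M' D" "S y z" using assms(2) unfolding correspondence_def by meson
  then obtain x where "x \<in> Z \<inter> part M D" "R x y" using assms(1) unfolding correspondence_def by meson
  then show "\<exists>x\<in>Z \<inter> part M D. (R OO S) x z" using y by blast
next
  note D = correspondenceD[OF assms(1)] and E = correspondenceD[OF assms(2)]
  fix x z assume "(R OO S) x z"
  then obtain y where y: "R x y" "S y z" by blast
  show "x \<in> Z" "z \<in> Z''" "x \<in> B \<longleftrightarrow> z \<in> B''"
    using D(1,3)[OF y(1)] E(2,3)[OF y(2)] by auto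
  show "(R OO S) (t \<odot>\<^bsub>M\<^esub> x) (t \<odot>\<^bsub>M''\<^esub> z)" if "t \<in> carrier T" for t
    using D(5)[OF that y(1)] E(5)[OF that y(2)] by blast
  fix x' z' assume "(R OO S) x' z'"
  then obtain y' where y': "R x' y'" "S y' z'" by blast
  show "(R OO S) (x \<oplus>\<^bsub>M\<^esub> x') (z \<oplus>\<^bsub>M''\<^esub> z')"
    using D(4)[OF y(1) y'(1)] E(4)[OF y(2) y'(2)] by blast
qed

lemma graded_submodule_simps [simp]:
  "carrier (graded_submodule M Z) = Z" "add (graded_submodule M Z) = add M"
  "zero (graded_submodule M Z) = zero M" "smult (graded_submodule M Z) = smult M"
  "mcomp (graded_submodule M Z) = (\<lambda>u. Z \<inter> mcomp M u)"
  by (simp_all add: graded_submodule_def)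

lemma graded_quotient_submodule_simps:
  "carrier (graded_quotient T (graded_submodule M Z) B) = (\<lambda>x. B +>\<^bsub>M\<^esub> x) ` Z"
  "add (graded_quotient T (graded_submodule M Z) B) = set_add M"
  "smult (graded_quotient T (graded_submodule M Z) B) = (\<lambda>t X. \<Union>x\<in>X. B +>\<^bsub>M\<^esub> (t \<odot>\<^bsub>M\<^esub> x))"
  "mcomp (graded_quotient T (graded_submodule M Z) B) = (\<lambda>u. (\<lambda>x. B +>\<^bsub>M\<^esub> x) ` (Z \<inter> mcomp M u))"
  by (auto simp: graded_quotient_def with_grading_def quotient_simps a_r_coset_def'
      set_add_def set_mult_def fun_eq_iff)

text \<open>
  If \<open>x\<close> is related to \<open>y\<close> and \<open>x'\<close> to \<open>y'\<close>, then the difference of \<open>x\<close> and \<open>x'\<close> is related to that of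
  \<open>y\<close> and \<open>y'\<close>; so one of them lies in \<open>B\<close> if and only if the other one lies in \<open>B'\<close>.  This makes the
  map of cosets both well-defined and injective.
\<close>
lemma correspondence_isomorphic:
  fixes T :: "'a gring"
  assumes M: "module T M" and Z: "submodule Z T M" and B: "submodule B T M"
    and M': "module T M'" and Z': "submodule Z' T M'" and B': "submodule B' T M'"
    and corr: "correspondence T M Z B M' Z' B' R"
  shows "graded_isomorphic T (graded_quotient T (graded_submodule M Z) B)
           (graded_quotient T (graded_submodule M' Z') B')"
proof -
  interpret M: module T M by fact
  interpret M': module T M' by fact
  have R: "R x y \<Longrightarrow> x \<in> Z \<and> y \<in> Z' \<and> (x \<in> B \<longleftrightarrow> y \<in> B')" for x y
    using corr unfolding correspondence_def by blast
  have Radd: "R x y \<Longrightarrow> R x' y' \<Longrightarrow> R (x \<oplus>\<^bsub>M\<^esub> x') (y \<oplus>\<^bsub>M'\<^esub> y')" for x y x' y'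
    using corr unfolding correspondence_def by blast
  have Rsmult: "t \<in> carrier T \<Longrightarrow> R x y \<Longrightarrow> R (t \<odot>\<^bsub>M\<^esub> x) (t \<odot>\<^bsub>M'\<^esub> y)" for t x y
    using corr unfolding correspondence_def by blast
  have Rtotal: "x \<in> Z \<Longrightarrow> x \<in> part M D \<Longrightarrow> \<exists>y\<in>Z' \<inter> part M' D. R x y" for x D
    using corr unfolding correspondence_def by blast
  have Rsurj: "y \<in> Z' \<Longrightarrow> y \<in> part M' D \<Longrightarrow> \<exists>x\<in>Z \<inter> part M D. R x y" for y D
    using corr unfolding correspondence_def by blast
  have Zc: "x \<in> Z \<Longrightarrow> x \<in> carrier M" for x using M.submoduleE(1)[OF Z] by auto
  have Zc': "y \<in> Z' \<Longrightarrow> y \<in> carrier M'" for y using M'.submoduleE(1)[OF Z'] by auto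
  have Rtotal0: "x \<in> Z \<Longrightarrow> \<exists>y\<in>Z'. R x y" for x using Rtotal[of x None] Zc by auto
  have Rsurj0: "y \<in> Z' \<Longrightarrow> \<exists>x\<in>Z. R x y" for y using Rsurj[of y None] Zc' by auto
  have Rminus: "R (x \<ominus>\<^bsub>M\<^esub> x') (y \<ominus>\<^bsub>M'\<^esub> y')" if "R x y" "R x' y'" for x y x' y'
  proof -
    have c: "x' \<in> carrier M" "y' \<in> carrier M'" using R[OF that(2)] Zc Zc' by auto
    have "R (x \<oplus>\<^bsub>M\<^esub> (\<ominus>\<^bsub>T\<^esub> \<one>\<^bsub>T\<^esub>) \<odot>\<^bsub>M\<^esub> x') (y \<oplus>\<^bsub>M'\<^esub> (\<ominus>\<^bsub>T\<^esub> \<one>\<^bsub>T\<^esub>) \<odot>\<^bsub>M'\<^esub> y')"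
      using Radd Rsmult that by simp
    then show ?thesis using c by (simp add: a_minus_def M.smult_l_minus M'.smult_l_minus)
  qed
  have key: "B +>\<^bsub>M\<^esub> x = B +>\<^bsub>M\<^esub> x' \<longleftrightarrow> B' +>\<^bsub>M'\<^esub> y = B' +>\<^bsub>M'\<^esub> y'" if "R x y" "R x' y'" for x y x' y'
    using M.coset_eq_iff[OF B, of x x'] M'.coset_eq_iff[OF B', of y y'] R[OF that(1)] R[OF that(2)]
      R[OF Rminus[OF that]] Zc Zc' by auto
  define f where "f X = B' +>\<^bsub>M'\<^esub> (SOME y. \<exists>x. X = B +>\<^bsub>M\<^esub> x \<and> R x y)" for X
  have f: "f (B +>\<^bsub>M\<^esub> x) = B' +>\<^bsub>M'\<^esub> y" if "R x y" for x y
  proof -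
    have "\<exists>y x'. B +>\<^bsub>M\<^esub> x = B +>\<^bsub>M\<^esub> x' \<and> R x' y" using that by blast
    from someI_ex[OF this] obtain x' where "B +>\<^bsub>M\<^esub> x = B +>\<^bsub>M\<^esub> x'"
        "R x' (SOME y. \<exists>x'. B +>\<^bsub>M\<^esub> x = B +>\<^bsub>M\<^esub> x' \<and> R x' y)" by blast
    then show ?thesis using key[OF that] unfolding f_def by blast
  qed
  let ?Q = "graded_quotient T (graded_submodule M Z) B"
  let ?Q' = "graded_quotient T (graded_submodule M' Z') B'"
  note simps [simp] = graded_quotient_submodule_simps
  have deg: "f ` mcomp ?Q u = mcomp ?Q' u" for u
  proof (intro equalityI subsetI)
    fix Y assume "Y \<in> f ` mcomp ?Q u"
    then obtain x where x: "x \<in> Z" "x \<in> mcomp M u" "Y = f (B +>\<^bsub>M\<^esub> x)" by auto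
    then obtain y where "y \<in> Z' \<inter> mcomp M' u" "R x y" using Rtotal[of x "Some u"] by auto
    then show "Y \<in> mcomp ?Q' u" using x f by auto
  next
    fix Y assume "Y \<in> mcomp ?Q' u"
    then obtain y where y: "y \<in> Z'" "y \<in> mcomp M' u" "Y = B' +>\<^bsub>M'\<^esub> y" by auto
    then obtain x where "x \<in> Z \<inter> mcomp M u" "R x y" using Rsurj[of y "Some u"] by auto
    then show "Y \<in> f ` mcomp ?Q u" using y f by (auto intro!: image_eqI[of _ f "B +>\<^bsub>M\<^esub> x"])
  qed
  have hom: "f \<in> graded_hom T ?Q ?Q'"
    unfolding graded_hom_def
  proof (intro CollectI conjI ballI allI)
    show "f \<in> carrier ?Q \<rightarrow> carrier ?Q'" using Rtotal0 f by fastforce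
  next
    fix X Y assume "X \<in> carrier ?Q" "Y \<in> carrier ?Q"
    then obtain x y where "x \<in> Z" "y \<in> Z" and X: "X = B +>\<^bsub>M\<^esub> x" "Y = B +>\<^bsub>M\<^esub> y" by auto
    moreover then obtain x' y' where R': "R x x'" "R y y'" using Rtotal0 by meson
    ultimately show "f (X \<oplus>\<^bsub>?Q\<^esub> Y) = f X \<oplus>\<^bsub>?Q'\<^esub> f Y"
      using f[OF Radd[OF R']] f[OF R'(1)] f[OF R'(2)] R[OF R'(1)] R[OF R'(2)]
      by (simp add: M.coset_add[OF B] M'.coset_add[OF B'] Zc Zc')
  next
    fix t X assume t: "t \<in> carrier T" "X \<in> carrier ?Q"
    then obtain x where "x \<in> Z" and X: "X = B +>\<^bsub>M\<^esub> x" by auto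
    moreover then obtain x' where R': "R x x'" using Rtotal0 by meson
    ultimately show "f (t \<odot>\<^bsub>?Q\<^esub> X) = t \<odot>\<^bsub>?Q'\<^esub> f X"
      using f[OF Rsmult[OF t(1) R']] f[OF R'] R[OF R'] t
      by (simp add: M.coset_smult[OF B] M'.coset_smult[OF B'] Zc Zc')
  next
    fix u show "f ` mcomp ?Q u \<subseteq> mcomp ?Q' u" using deg by simp
  qed
  have "inj_on f (carrier ?Q)"
  proof (rule inj_onI)
    fix X Y assume "X \<in> carrier ?Q" "Y \<in> carrier ?Q" and eq: "f X = f Y"
    then obtain x y where "x \<in> Z" "y \<in> Z" and X: "X = B +>\<^bsub>M\<^esub> x" "Y = B +>\<^bsub>M\<^esub> y" by auto
    moreover then obtain x' y' where R': "R x x'" "R y y'" using Rtotal0 by meson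
    ultimately show "X = Y" using key[OF R'] f[OF R'(1)] f[OF R'(2)] eq by simp
  qed
  moreover have "carrier ?Q' \<subseteq> f ` carrier ?Q"
  proof
    fix Y assume "Y \<in> carrier ?Q'"
    then obtain y where y: "y \<in> Z'" "Y = B' +>\<^bsub>M'\<^esub> y" by auto
    then obtain x where "x \<in> Z" "R x y" using Rsurj0 by blast
    then show "Y \<in> f ` carrier ?Q" using y f by (auto intro!: image_eqI[of _ f "B +>\<^bsub>M\<^esub> x"])
  qed
  moreover have "f ` carrier ?Q \<subseteq> carrier ?Q'" using hom unfolding graded_hom_def by auto
  ultimately have "bij_betw f (carrier ?Q) (carrier ?Q')" unfolding bij_betw_def by blast
  then show ?thesis using hom deg unfolding graded_isomorphic_def by blast
qed

lemma (in abelian_group) minus_add_cancel: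
  "x \<in> carrier G \<Longrightarrow> y \<in> carrier G \<Longrightarrow> (x \<ominus> y) \<oplus> y = x"
  by (simp add: a_minus_def a_assoc l_neg)

lemma (in abelian_group) minus_eq_zero_iff:
  assumes "x \<in> carrier G" "y \<in> carrier G"
  shows "x \<ominus> y = \<zero> \<longleftrightarrow> x = y"
  using minus_add_cancel[OF assms] assms by (auto simp: a_minus_def r_neg)

section \<open>Multiplicative sets\<close>

definition multiplicative_set :: "'a gring \<Rightarrow> 'a set \<Rightarrow> bool" where
  "multiplicative_set T S \<longleftrightarrow> S \<subseteq> homogeneous_elements T \<and> \<one>\<^bsub>T\<^esub> \<in> S \<and>
     (\<forall>s\<in>S. \<forall>t\<in>S. s \<otimes>\<^bsub>T\<^esub> t \<in> S)"

text \<open>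
  The submonoid generated by \<open>U\<close>.  For a union of submonoids it consists of the products of their
  elements, but it does not refer to an order of the factors.
\<close>
inductive_set mult_closure :: "'a gring \<Rightarrow> 'a set \<Rightarrow> 'a set" for T :: "'a gring" and U :: "'a set" where
  one: "\<one>\<^bsub>T\<^esub> \<in> mult_closure T U"
| mult: "u \<in> U \<Longrightarrow> s \<in> mult_closure T U \<Longrightarrow> u \<otimes>\<^bsub>T\<^esub> s \<in> mult_closure T U"

context graded_ring
begin

lemma homogeneous_carrier: "t \<in> homogeneous_elements T \<Longrightarrow> t \<in> carrier T"
  unfolding homogeneous_elements_def using R.G_carrier by auto

lemma multiplicative_setD:
  assumes "multiplicative_set T S"
  shows "s \<in> S \<Longrightarrow> s \<in> carrier T" "s \<in> S \<Longrightarrow> \<exists>k. s \<in> rcomp T k" "\<one> \<in> S"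
    "s \<in> S \<Longrightarrow> t \<in> S \<Longrightarrow> s \<otimes> t \<in> S"
proof -
  have S: "S \<subseteq> homogeneous_elements T" using assms unfolding multiplicative_set_def by blast
  show "s \<in> S \<Longrightarrow> s \<in> carrier T" using S homogeneous_carrier by blast
  show "s \<in> S \<Longrightarrow> \<exists>k. s \<in> rcomp T k" using S unfolding homogeneous_elements_def by blast
qed (use assms in \<open>auto simp: multiplicative_set_def\<close>)

lemma degree_unique:
  assumes "t \<in> rcomp T k" "t \<in> rcomp T l" "k \<noteq> l"
  shows "t = \<zero>"
  using R.hcomp_homogeneous[OF assms(1), of k] R.hcomp_homogeneous[OF assms(2), of k] assms(3) by simp

lemma mult_closure_mono:
  assumes "U \<subseteq> V" "s \<in> mult_closure T U"
  shows "s \<in> mult_closure T V"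
  using assms(2) by induction (use assms(1) in \<open>auto intro: mult_closure.intros\<close>)

lemma mult_closure_homogeneous:
  assumes "U \<subseteq> homogeneous_elements T" "s \<in> mult_closure T U"
  shows "s \<in> homogeneous_elements T"
  using assms(2)
proof induction
  case one
  then show ?case using one_rcomp unfolding homogeneous_elements_def by auto
next
  case (mult u s)
  then obtain k l where "u \<in> rcomp T k" "s \<in> rcomp T l"
    using assms(1) unfolding homogeneous_elements_def by auto
  then show ?case using mult_rcomp unfolding homogeneous_elements_def by blast
qed

lemma mult_closure_closed:
  assumes "U \<subseteq> homogeneous_elements T" "s \<in> mult_closure T U" "t \<in> mult_closure T U"
  shows "s \<otimes> t \<in> mult_closure T U"
  using assms(2)
proof induction
  case one
  show ?case using assms homogeneous_carrier[OF mult_closure_homogeneous] by simp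
next
  case (mult u s)
  have "u \<in> carrier T" "s \<in> carrier T" "t \<in> carrier T"
    using assms mult homogeneous_carrier[OF mult_closure_homogeneous] homogeneous_carrier by auto
  then show ?case using mult mult_closure.mult by (simp add: m_assoc)
qed

lemma multiplicative_mult_closure:
  assumes "U \<subseteq> homogeneous_elements T"
  shows "multiplicative_set T (mult_closure T U)"
  unfolding multiplicative_set_def
  using mult_closure_homogeneous[OF assms] mult_closure_closed[OF assms] mult_closure.one by auto

lemma mult_closure_self:
  assumes "multiplicative_set T S"
  shows "mult_closure T S = S"
proof (intro equalityI subsetI)
  show "s \<in> S" if "s \<in> mult_closure T S" for s
    using that by induction (use multiplicative_setD[OF assms] in auto)
  show "s \<in> mult_closure T S" if "s \<in> S" for s
    using mult_closure.mult[OF that mult_closure.one, where T = T] multiplicative_setD(1)[OF assms that] by simp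
qed

lemma mult_closure_Un:
  assumes "U \<subseteq> homogeneous_elements T" "V \<subseteq> homogeneous_elements T"
  shows "mult_closure T (U \<union> V) = {s \<otimes> t | s t. s \<in> mult_closure T U \<and> t \<in> mult_closure T V}"
proof (intro equalityI subsetI)
  note c = homogeneous_carrier[OF mult_closure_homogeneous[OF assms(1)]]
    homogeneous_carrier[OF mult_closure_homogeneous[OF assms(2)]]
    subsetD[OF assms(1), THEN homogeneous_carrier] subsetD[OF assms(2), THEN homogeneous_carrier]
  fix s assume "s \<in> mult_closure T (U \<union> V)"
  then show "s \<in> {s \<otimes> t | s t. s \<in> mult_closure T U \<and> t \<in> mult_closure T V}"
  proof induction
    case one
    have "\<one> = \<one> \<otimes> \<one>" by simp
    then show ?case using mult_closure.one by blast
  next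
    case (mult u s)
    then obtain a b where ab: "s = a \<otimes> b" "a \<in> mult_closure T U" "b \<in> mult_closure T V" by auto
    from mult(1) show ?case
    proof
      assume "u \<in> U"
      then have "u \<otimes> s = (u \<otimes> a) \<otimes> b" "u \<otimes> a \<in> mult_closure T U"
        using ab c by (auto simp: m_assoc intro: mult_closure.mult)
      then show ?case using ab by blast
    next
      assume "u \<in> V"
      then have "u \<otimes> s = a \<otimes> (u \<otimes> b)" "u \<otimes> b \<in> mult_closure T V"
        using ab c by (auto simp: m_lcomm intro: mult_closure.mult)
      then show ?case using ab by blast
    qed
  qed
next
  fix x assume "x \<in> {s \<otimes> t | s t. s \<in> mult_closure T U \<and> t \<in> mult_closure T V}"
  then obtain s t where "x = s \<otimes> t" "s \<in> mult_closure T U" "t \<in> mult_closure T V" by auto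
  then show "x \<in> mult_closure T (U \<union> V)"
    using mult_closure_closed[of "U \<union> V" s t] mult_closure_mono[of U "U \<union> V" s]
      mult_closure_mono[of V "U \<union> V" t] assms by auto
qed

end

section \<open>Localizations\<close>

lemma (in module) smult_lcomm:
  assumes "a \<in> carrier R" "b \<in> carrier R" "x \<in> carrier M"
  shows "a \<odot>\<^bsub>M\<^esub> (b \<odot>\<^bsub>M\<^esub> x) = b \<odot>\<^bsub>M\<^esub> (a \<odot>\<^bsub>M\<^esub> x)"
  using assms by (simp add: smult_assoc1[symmetric] R.m_comm)

text \<open>
  What is used of the grading of an iterated localization: sets of elements of given degree, compatible
  with the action of the ring.
\<close>
locale module_with_degrees = graded_ring T + module T M
  for T :: "'a gring" and M :: "('a, 'b) gmodule" (structure) +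
  assumes mcomp_carrier: "x \<in> mcomp M u \<Longrightarrow> x \<in> carrier M"
    and mcomp_zero: "\<zero> \<in> mcomp M u"
    and mcomp_smult: "t \<in> rcomp T n \<Longrightarrow> x \<in> mcomp M u \<Longrightarrow> t \<odot> x \<in> mcomp M (int n + u)"
begin

lemma part_carrier: "x \<in> part M D \<Longrightarrow> x \<in> carrier M"
  using mcomp_carrier by (cases D) auto

lemma part_zero: "\<zero> \<in> part M D"
  using mcomp_zero by (cases D) auto

lemma part_smult: "t \<in> rcomp T k \<Longrightarrow> x \<in> part M D \<Longrightarrow> t \<odot> x \<in> part M (shift k D)"
  using mcomp_smult R.G_carrier by (cases D) auto

end

sublocale graded_module \<subseteq> module_with_degrees
  using G.G_carrier smult_mcomp by unfold_locales auto

lemma shift_shift: "shift k (shift l D) = shift (k + l) D"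
  by (cases D) (auto simp: shift_def)

lemma shift_0 [simp]: "shift 0 D = D"
  by (cases D) auto

text \<open>
  The characterization of \<open>S\<inverse>N\<close> up to isomorphism: \<open>S\<close> acts by bijections, all elements are fractions,
  and the kernel of \<open>f\<close> is the \<open>S\<close>-torsion.  Fractions of degree \<open>D\<close> have a numerator and a denominator
  whose degrees differ by \<open>D\<close>.
\<close>
definition is_localization ::
    "'a gring \<Rightarrow> 'a set \<Rightarrow> ('b \<Rightarrow> 'c) \<Rightarrow> ('a, 'b) gmodule \<Rightarrow> ('a, 'c) gmodule \<Rightarrow> bool" where
  "is_localization T S f N M \<longleftrightarrow>
     f \<in> linear_map T N M \<and> (\<forall>D. \<forall>x\<in>part N D. f x \<in> part M D) \<and>
     (\<forall>s\<in>S. \<forall>c\<in>carrier M. s \<odot>\<^bsub>M\<^esub> c = \<zero>\<^bsub>M\<^esub> \<longrightarrow> c = \<zero>\<^bsub>M\<^esub>) \<and>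
     (\<forall>D k. \<forall>s\<in>S \<inter> rcomp T k. \<forall>c\<in>part M (shift k D). \<exists>c'\<in>part M D. s \<odot>\<^bsub>M\<^esub> c' = c) \<and>
     (\<forall>D. \<forall>c\<in>part M D. \<exists>k. \<exists>s\<in>S \<inter> rcomp T k. \<exists>n\<in>part N (shift k D). s \<odot>\<^bsub>M\<^esub> c = f n) \<and>
     (\<forall>n\<in>carrier N. f n = \<zero>\<^bsub>M\<^esub> \<longrightarrow> (\<exists>s\<in>S. s \<odot>\<^bsub>N\<^esub> n = \<zero>\<^bsub>N\<^esub>))"

lemma is_localizationD:
  assumes "is_localization T S f N M"
  shows "f \<in> linear_map T N M"
    and "x \<in> part N D \<Longrightarrow> f x \<in> part M D"
    and "s \<in> S \<Longrightarrow> c \<in> carrier M \<Longrightarrow> s \<odot>\<^bsub>M\<^esub> c = \<zero>\<^bsub>M\<^esub> \<Longrightarrow> c = \<zero>\<^bsub>M\<^esub>"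
    and "s \<in> S \<Longrightarrow> s \<in> rcomp T k \<Longrightarrow> c \<in> part M (shift k D) \<Longrightarrow> \<exists>c'\<in>part M D. s \<odot>\<^bsub>M\<^esub> c' = c"
    and "c \<in> part M D \<Longrightarrow> \<exists>k. \<exists>s\<in>S \<inter> rcomp T k. \<exists>n\<in>part N (shift k D). s \<odot>\<^bsub>M\<^esub> c = f n"
    and "n \<in> carrier N \<Longrightarrow> f n = \<zero>\<^bsub>M\<^esub> \<Longrightarrow> \<exists>s\<in>S. s \<odot>\<^bsub>N\<^esub> n = \<zero>\<^bsub>N\<^esub>"
proof -
  note conj = assms[unfolded is_localization_def]
  note 1 = conjunct1[OF conj] and c1 = conjunct2[OF conj]
  note 2 = conjunct1[OF c1] and c2 = conjunct2[OF c1]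
  note 3 = conjunct1[OF c2] and c3 = conjunct2[OF c2]
  note 4 = conjunct1[OF c3] and c4 = conjunct2[OF c3]
  note 5 = conjunct1[OF c4] and 6 = conjunct2[OF c4]
  show "f \<in> linear_map T N M" by (fact 1)
  show "x \<in> part N D \<Longrightarrow> f x \<in> part M D" by (rule 2[rule_format])
  show "s \<in> S \<Longrightarrow> c \<in> carrier M \<Longrightarrow> s \<odot>\<^bsub>M\<^esub> c = \<zero>\<^bsub>M\<^esub> \<Longrightarrow> c = \<zero>\<^bsub>M\<^esub>" by (rule 3[rule_format])
  show "s \<in> S \<Longrightarrow> s \<in> rcomp T k \<Longrightarrow> c \<in> part M (shift k D) \<Longrightarrow> \<exists>c'\<in>part M D. s \<odot>\<^bsub>M\<^esub> c' = c"
    by (rule 4[rule_format]) auto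
  show "c \<in> part M D \<Longrightarrow> \<exists>k. \<exists>s\<in>S \<inter> rcomp T k. \<exists>n\<in>part N (shift k D). s \<odot>\<^bsub>M\<^esub> c = f n"
    by (rule 5[rule_format])
  show "n \<in> carrier N \<Longrightarrow> f n = \<zero>\<^bsub>M\<^esub> \<Longrightarrow> \<exists>s\<in>S. s \<odot>\<^bsub>N\<^esub> n = \<zero>\<^bsub>N\<^esub>" by (rule 6[rule_format])
qed

lemma is_localizationI:
  assumes "f \<in> linear_map T N M"
    and "\<And>x D. x \<in> part N D \<Longrightarrow> f x \<in> part M D"
    and "\<And>s c. s \<in> S \<Longrightarrow> c \<in> carrier M \<Longrightarrow> s \<odot>\<^bsub>M\<^esub> c = \<zero>\<^bsub>M\<^esub> \<Longrightarrow> c = \<zero>\<^bsub>M\<^esub>"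
    and "\<And>s k c D. s \<in> S \<Longrightarrow> s \<in> rcomp T k \<Longrightarrow> c \<in> part M (shift k D) \<Longrightarrow>
      \<exists>c'\<in>part M D. s \<odot>\<^bsub>M\<^esub> c' = c"
    and "\<And>c D. c \<in> part M D \<Longrightarrow>
      \<exists>k. \<exists>s\<in>S \<inter> rcomp T k. \<exists>n\<in>part N (shift k D). s \<odot>\<^bsub>M\<^esub> c = f n"
    and "\<And>n. n \<in> carrier N \<Longrightarrow> f n = \<zero>\<^bsub>M\<^esub> \<Longrightarrow> \<exists>s\<in>S. s \<odot>\<^bsub>N\<^esub> n = \<zero>\<^bsub>N\<^esub>"
  shows "is_localization T S f N M"
  unfolding is_localization_def
proof (intro conjI allI ballI impI)
  show "\<exists>c'\<in>part M D. s \<odot>\<^bsub>M\<^esub> c' = c" if "s \<in> S \<inter> rcomp T k" "c \<in> part M (shift k D)" for D k s c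
    using assms(4) that by blast
qed (use assms(1,2,3,5,6) in blast)+

lemma is_localization_id:
  assumes "module_with_degrees T M"
  shows "is_localization T {\<one>\<^bsub>T\<^esub>} id M M"
proof -
  interpret module_with_degrees T M by fact
  have *: "\<exists>c'\<in>part M D. \<one>\<^bsub>T\<^esub> \<odot>\<^bsub>M\<^esub> c' = c"
    if "\<one>\<^bsub>T\<^esub> \<in> rcomp T k" "c \<in> part M (shift k D)" for k D c
  proof (cases "k = 0")
    case True
    then show ?thesis using that part_carrier by (auto intro!: bexI[of _ c])
  next
    case False
    then have "\<one>\<^bsub>T\<^esub> = \<zero>\<^bsub>T\<^esub>" using degree_unique one_rcomp that by blast
    then have "c = \<zero>\<^bsub>M\<^esub>" using smult_one[of c] smult_l_null[of c] part_carrier that(2) by simp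
    then show ?thesis using part_zero by (auto intro!: bexI[of _ "\<zero>\<^bsub>M\<^esub>"])
  qed
  have **: "\<exists>k. \<exists>s\<in>{\<one>\<^bsub>T\<^esub>} \<inter> rcomp T k. \<exists>n\<in>part M (shift k D). s \<odot>\<^bsub>M\<^esub> c = id n"
    if "c \<in> part M D" for c D
    using that one_rcomp part_carrier[OF that] by (intro exI[of _ 0]) auto
  have "id \<in> linear_map T M M" unfolding linear_map_def by auto
  then show ?thesis
  proof (rule is_localizationI)
    show "\<exists>c'\<in>part M D. s \<odot>\<^bsub>M\<^esub> c' = c"
      if "s \<in> {\<one>\<^bsub>T\<^esub>}" "s \<in> rcomp T k" "c \<in> part M (shift k D)" for s k c D
      using * that by simp
  qed (use ** in auto)
qed

text \<open>
  The elements of \<open>S\<close> act bijectively on \<open>P\<close> as well: they do so on the numerators, which are in \<open>M\<close>,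
  and \<open>S'\<close> acts bijectively on \<open>P\<close>.  The element 0 has all degrees; if it is a denominator, then \<open>P\<close> is
  zero.
\<close>
lemma is_localization_comp:
  assumes N: "module_with_degrees T N" and M: "module_with_degrees T M" and P: "module_with_degrees T P"
    and S: "multiplicative_set T S" and S': "multiplicative_set T S'"
    and f: "is_localization T S f N M" and g: "is_localization T S' g M P"
  shows "is_localization T {s' \<otimes>\<^bsub>T\<^esub> s | s' s. s' \<in> S' \<and> s \<in> S} (g \<circ> f) N P"
proof -
  interpret N: module_with_degrees T N by fact
  interpret M: module_with_degrees T M by fact
  interpret P: module_with_degrees T P by fact
  note Sc = N.multiplicative_setD[OF S] and Sc' = N.multiplicative_setD[OF S']
  note f = is_localizationD[OF f] and g = is_localizationD[OF g]
  note lf = linear_mapD[OF f(1)] and lg = linear_mapD[OF g(1)]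
  note f0 = linear_map_zero[OF N.module_axioms M.module_axioms f(1)]
  note g0 = linear_map_zero[OF M.module_axioms P.module_axioms g(1)]
  have inj: "c = \<zero>\<^bsub>P\<^esub>" if "s \<in> S" and c: "c \<in> carrier P" "s \<odot>\<^bsub>P\<^esub> c = \<zero>\<^bsub>P\<^esub>" for s c
  proof -
    have s: "s \<in> carrier T" using Sc that by auto
    obtain k s' m where m: "s' \<in> S'" "m \<in> carrier M" "s' \<odot>\<^bsub>P\<^esub> c = g m"
      using g(5)[of c None] c(1) by auto
    have "g (s \<odot>\<^bsub>M\<^esub> m) = s \<odot>\<^bsub>P\<^esub> (s' \<odot>\<^bsub>P\<^esub> c)" using lg(3)[OF s m(2)] m(3) by simp
    also have "\<dots> = s' \<odot>\<^bsub>P\<^esub> (s \<odot>\<^bsub>P\<^esub> c)" using s c m Sc' by (intro P.smult_lcomm) auto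
    finally have "g (s \<odot>\<^bsub>M\<^esub> m) = \<zero>\<^bsub>P\<^esub>" using c m Sc' by simp
    then obtain w where w: "w \<in> S'" "w \<odot>\<^bsub>M\<^esub> (s \<odot>\<^bsub>M\<^esub> m) = \<zero>\<^bsub>M\<^esub>" using g(6) s m by blast
    then have wc: "w \<in> carrier T" using Sc' by auto
    have "s \<odot>\<^bsub>M\<^esub> (w \<odot>\<^bsub>M\<^esub> m) = \<zero>\<^bsub>M\<^esub>" using w s m wc M.smult_lcomm by metis
    then have "w \<odot>\<^bsub>M\<^esub> m = \<zero>\<^bsub>M\<^esub>" using f(3)[OF that(1)] m wc by blast
    then have "w \<odot>\<^bsub>P\<^esub> (s' \<odot>\<^bsub>P\<^esub> c) = \<zero>\<^bsub>P\<^esub>" using lg(3)[OF wc m(2)] g0 m(3) by simp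
    then show ?thesis using g(3) w(1) m(1) c(1) wc Sc' P.smult_closed by meson
  qed
  have surj: "\<exists>c'\<in>part P D. s \<odot>\<^bsub>P\<^esub> c' = c"
    if s: "s \<in> S" "s \<in> rcomp T a" and c: "c \<in> part P (shift a D)" for s a c D
  proof -
    have sc: "s \<in> carrier T" using Sc s by auto
    obtain b s' m where m: "s' \<in> S'" "s' \<in> rcomp T b" "m \<in> part M (shift b (shift a D))"
        "s' \<odot>\<^bsub>P\<^esub> c = g m"
      using g(5)[OF c] by auto
    have "m \<in> part M (shift a (shift b D))" using m(3) by (simp add: shift_shift add.commute)
    then obtain m1 where m1: "m1 \<in> part M (shift b D)" "s \<odot>\<^bsub>M\<^esub> m1 = m" using f(4)[OF s] by blast
    obtain c1 where c1: "c1 \<in> part P D" "s' \<odot>\<^bsub>P\<^esub> c1 = g m1"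
      using g(4)[OF m(1,2) g(2)[OF m1(1)]] by blast
    have carr: "c1 \<in> carrier P" "c \<in> carrier P" "s' \<in> carrier T" "m1 \<in> carrier M"
      using c1 c m(1) m1 Sc' P.part_carrier M.part_carrier by auto
    have "s' \<odot>\<^bsub>P\<^esub> (s \<odot>\<^bsub>P\<^esub> c1) = s' \<odot>\<^bsub>P\<^esub> c"
      using P.smult_lcomm[of s' s c1] carr sc c1(2) m(4) lg(3)[OF sc carr(4)] m1(2) by simp
    then have "s' \<odot>\<^bsub>P\<^esub> (s \<odot>\<^bsub>P\<^esub> c1 \<ominus>\<^bsub>P\<^esub> c) = \<zero>\<^bsub>P\<^esub>"
      using carr sc by (simp add: a_minus_def P.smult_r_distr P.smult_r_minus P.M.r_neg)
    then have "s \<odot>\<^bsub>P\<^esub> c1 \<ominus>\<^bsub>P\<^esub> c = \<zero>\<^bsub>P\<^esub>" using g(3)[OF m(1)] carr sc by simp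
    then have "s \<odot>\<^bsub>P\<^esub> c1 = c" using carr sc P.M.minus_eq_zero_iff by simp
    then show ?thesis using c1(1) by blast
  qed
  let ?S = "{s' \<otimes>\<^bsub>T\<^esub> s | s' s. s' \<in> S' \<and> s \<in> S}"
  have inj': "c = \<zero>\<^bsub>P\<^esub>" if r: "r \<in> ?S" and c: "c \<in> carrier P" "r \<odot>\<^bsub>P\<^esub> c = \<zero>\<^bsub>P\<^esub>" for r c
  proof -
    obtain s' s where s: "r = s' \<otimes>\<^bsub>T\<^esub> s" "s' \<in> S'" "s \<in> S" using r by blast
    have "s' \<odot>\<^bsub>P\<^esub> (s \<odot>\<^bsub>P\<^esub> c) = \<zero>\<^bsub>P\<^esub>" using s c Sc Sc' by (simp add: P.smult_assoc1)
    then show ?thesis using g(3)[OF s(2)] inj[OF s(3) c(1)] c s Sc by auto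
  qed
  have surj': "\<exists>c'\<in>part P D. r \<odot>\<^bsub>P\<^esub> c' = c"
    if r: "r \<in> ?S" "r \<in> rcomp T k" and c: "c \<in> part P (shift k D)" for r k c D
  proof -
    obtain s' s where s: "r = s' \<otimes>\<^bsub>T\<^esub> s" "s' \<in> S'" "s \<in> S" using r(1) by blast
    obtain a b where ab: "s \<in> rcomp T a" "s' \<in> rcomp T b"
      using Sc(2)[OF s(3)] Sc'(2)[OF s(2)] by blast
    have "r \<in> rcomp T (b + a)" unfolding s(1) by (rule N.mult_rcomp[OF ab(2,1)])
    show ?thesis
    proof (cases "k = b + a")
      case True
      then have "c \<in> part P (shift b (shift a D))" using c by (simp add: shift_shift)
      then obtain c1 where c1: "c1 \<in> part P (shift a D)" "s' \<odot>\<^bsub>P\<^esub> c1 = c"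
        using g(4)[OF s(2) ab(2)] by blast
      then obtain c2 where c2: "c2 \<in> part P D" "s \<odot>\<^bsub>P\<^esub> c2 = c1" using surj[OF s(3) ab(1)] by blast
      then have "r \<odot>\<^bsub>P\<^esub> c2 = c" using c1 s Sc Sc' P.part_carrier by (simp add: P.smult_assoc1)
      then show ?thesis using c2 by blast
    next
      case False
      then have r0: "r = \<zero>\<^bsub>T\<^esub>" using N.degree_unique[of r k "b + a"] r(2) \<open>r \<in> rcomp T (b + a)\<close> by blast
      then have "c = \<zero>\<^bsub>P\<^esub>" using inj'[OF r(1)] c P.part_carrier by simp
      then show ?thesis using P.part_zero r0 by (auto intro!: bexI[of _ "\<zero>\<^bsub>P\<^esub>"])
    qed
  qed
  have frac: "\<exists>k. \<exists>r\<in>?S \<inter> rcomp T k. \<exists>n\<in>part N (shift k D). r \<odot>\<^bsub>P\<^esub> c = (g \<circ> f) n"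
    if c: "c \<in> part P D" for c D
  proof -
    obtain b s' m where m: "s' \<in> S'" "s' \<in> rcomp T b" "m \<in> part M (shift b D)" "s' \<odot>\<^bsub>P\<^esub> c = g m"
      using g(5)[OF c] by auto
    obtain a s n where n: "s \<in> S" "s \<in> rcomp T a" "n \<in> part N (shift a (shift b D))" "s \<odot>\<^bsub>M\<^esub> m = f n"
      using f(5)[OF m(3)] by auto
    have "(s' \<otimes>\<^bsub>T\<^esub> s) \<odot>\<^bsub>P\<^esub> c = s \<odot>\<^bsub>P\<^esub> (s' \<odot>\<^bsub>P\<^esub> c)"
      using m(1) n(1) Sc Sc' P.part_carrier[OF c] P.smult_lcomm[of s' s c] by (simp add: P.smult_assoc1)
    also have "\<dots> = g (f n)" using lg(3)[of s m] m n Sc M.part_carrier by simp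
    finally have "(s' \<otimes>\<^bsub>T\<^esub> s) \<odot>\<^bsub>P\<^esub> c = (g \<circ> f) n" by simp
    moreover have "s' \<otimes>\<^bsub>T\<^esub> s \<in> rcomp T (b + a)" using m n N.mult_rcomp by auto
    moreover have "n \<in> part N (shift (b + a) D)" using n by (simp add: shift_shift add.commute)
    ultimately show ?thesis using m n by blast
  qed
  have ker: "\<exists>r\<in>?S. r \<odot>\<^bsub>N\<^esub> n = \<zero>\<^bsub>N\<^esub>" if n: "n \<in> carrier N" "g (f n) = \<zero>\<^bsub>P\<^esub>" for n
  proof -
    obtain s' where s': "s' \<in> S'" "s' \<odot>\<^bsub>M\<^esub> f n = \<zero>\<^bsub>M\<^esub>" using g(6) n lf(1) by blast
    then have "f (s' \<odot>\<^bsub>N\<^esub> n) = \<zero>\<^bsub>M\<^esub>" using lf(3) n Sc' by simp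
    then obtain s where s: "s \<in> S" "s \<odot>\<^bsub>N\<^esub> (s' \<odot>\<^bsub>N\<^esub> n) = \<zero>\<^bsub>N\<^esub>" using f(6) n s' Sc' by blast
    then have "(s' \<otimes>\<^bsub>T\<^esub> s) \<odot>\<^bsub>N\<^esub> n = \<zero>\<^bsub>N\<^esub>"
      using N.smult_lcomm[of s s' n] N.smult_assoc1[of s' s n] Sc Sc' n(1) s'(1) by simp
    then show ?thesis using s s' by blast
  qed
  show ?thesis
  proof (rule is_localizationI)
    show "g \<circ> f \<in> linear_map T N P" by (rule linear_map_comp[OF f(1) g(1)])
    show "(g \<circ> f) x \<in> part P D" if "x \<in> part N D" for x D using f(2) g(2) that by simp
    show "\<exists>r\<in>?S. r \<odot>\<^bsub>N\<^esub> n = \<zero>\<^bsub>N\<^esub>" if "n \<in> carrier N" "(g \<circ> f) n = \<zero>\<^bsub>P\<^esub>" for n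
      using ker that by simp
  qed (fact inj' surj' frac)+
qed

section \<open>Localization by formal fractions\<close>

locale localization_setting = module_with_degrees T M
  for T :: "'a gring" and M :: "('a, 'a frac_expr) gmodule" (structure) +
  fixes S :: "'a set"
  assumes S: "multiplicative_set T S"
begin

abbreviation frac where "frac \<equiv> fraction T S M"
abbreviation Loc where "Loc \<equiv> localization T S M"

lemmas S_carrier [simp] = multiplicative_setD(1)[OF S]
lemmas S_one [simp] = multiplicative_setD(3)[OF S]
lemmas S_mult [simp] = multiplicative_setD(4)[OF S]

definition frac_rel where
  "frac_rel m s m' s' \<longleftrightarrow> (\<exists>w\<in>S. w \<odot> (s' \<odot> m) = w \<odot> (s \<odot> m'))"

lemma frac_rel_sym: "frac_rel m s m' s' \<Longrightarrow> frac_rel m' s' m s"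
  unfolding frac_rel_def by metis

text \<open>
  Cross-multiplication is an equivalence relation, so the chosen representative of a fraction depends
  only on the class of the fraction (\<open>frac_eq_iff\<close>).
\<close>
lemma frac_rel_trans:
  assumes "frac_rel m s m' s'" "frac_rel m' s' m'' s''"
    and [simp]: "m \<in> carrier M" "m' \<in> carrier M" "m'' \<in> carrier M" "s \<in> S" "s' \<in> S" "s'' \<in> S"
  shows "frac_rel m s m'' s''"
proof -
  obtain w v where [simp]: "w \<in> S" "v \<in> S" and w: "w \<odot> (s' \<odot> m) = w \<odot> (s \<odot> m')"
    and v: "v \<odot> (s'' \<odot> m') = v \<odot> (s' \<odot> m'')" using assms unfolding frac_rel_def by auto
  have "(w \<otimes>\<^bsub>T\<^esub> (v \<otimes>\<^bsub>T\<^esub> s')) \<odot> (s'' \<odot> m) = v \<odot> (s'' \<odot> (w \<odot> (s' \<odot> m)))"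
    by (simp add: smult_assoc1 smult_lcomm)
  also have "\<dots> = w \<odot> (s \<odot> (v \<odot> (s'' \<odot> m')))"
    unfolding w by (simp add: smult_lcomm)
  also have "\<dots> = (w \<otimes>\<^bsub>T\<^esub> (v \<otimes>\<^bsub>T\<^esub> s')) \<odot> (s \<odot> m'')"
    unfolding v by (simp add: smult_assoc1 smult_lcomm)
  finally show ?thesis unfolding frac_rel_def by (auto intro: bexI[of _ "w \<otimes>\<^bsub>T\<^esub> (v \<otimes>\<^bsub>T\<^esub> s')"])
qed

lemma frac_rep:
  assumes "m \<in> carrier M" "s \<in> S"
  obtains m' s' where "frac m s = Frac m' s'" "m' \<in> carrier M" "s' \<in> S" "frac_rel m s m' s'"
proof -
  have "\<exists>x. \<exists>m'\<in>carrier M. \<exists>s'\<in>S. x = Frac m' s' \<and> (\<exists>w\<in>S. w \<odot> (s' \<odot> m) = w \<odot> (s \<odot> m'))"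
    using assms by auto
  from someI_ex[OF this] show ?thesis using that unfolding fraction_def frac_rel_def by blast
qed

lemma frac_eq_iff:
  assumes "m \<in> carrier M" "s \<in> S" "m' \<in> carrier M" "s' \<in> S"
  shows "frac m s = frac m' s' \<longleftrightarrow> frac_rel m s m' s'"
proof
  assume "frac m s = frac m' s'"
  moreover obtain n t where "frac m s = Frac n t" "n \<in> carrier M" "t \<in> S" "frac_rel m s n t"
    using frac_rep assms by metis
  moreover obtain n' t' where "frac m' s' = Frac n' t'" "frac_rel m' s' n' t'"
    using frac_rep assms by metis
  ultimately show "frac_rel m s m' s'"
    using frac_rel_trans[of m s n t m' s'] frac_rel_sym assms by auto
next
  assume r: "frac_rel m s m' s'"
  have "frac_rel m s n t \<longleftrightarrow> frac_rel m' s' n t" if "n \<in> carrier M" "t \<in> S" for n t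
    using frac_rel_trans[OF r] frac_rel_trans[OF frac_rel_sym[OF r]] assms that by blast
  then show "frac m s = frac m' s'"
    unfolding fraction_def frac_rel_def[symmetric] by (metis (no_types, lifting))
qed

lemma frac_cong:
  assumes "m \<in> carrier M" "s \<in> S" "m' \<in> carrier M" "s' \<in> S" "s' \<odot> m = s \<odot> m'"
  shows "frac m s = frac m' s'"
  using frac_eq_iff assms S_one unfolding frac_rel_def by auto

lemma Loc_simps:
  "carrier Loc = {frac m s | m s. m \<in> carrier M \<and> s \<in> S}"
  "\<zero>\<^bsub>Loc\<^esub> = frac \<zero> \<one>\<^bsub>T\<^esub>"
  "mcomp Loc u = {frac m s | m s v n. m \<in> mcomp M v \<and> s \<in> S \<inter> rcomp T n \<and> u = v - int n}"
  by (simp_all add: localization_def)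

lemma frac_in [simp]: "m \<in> carrier M \<Longrightarrow> s \<in> S \<Longrightarrow> frac m s \<in> carrier Loc"
  by (auto simp: Loc_simps)

lemma frac_expand:
  assumes "m \<in> carrier M" "s \<in> S" "t \<in> S"
  shows "frac (t \<odot> m) (t \<otimes>\<^bsub>T\<^esub> s) = frac m s"
  by (rule frac_cong) (use assms in \<open>auto simp: smult_assoc1 smult_lcomm\<close>)

text \<open>
  With a common denominator the module axioms for fractions are those for numerators.
\<close>
lemma frac_add:
  assumes [simp]: "m \<in> carrier M" "n \<in> carrier M" "s \<in> S"
  shows "frac m s \<oplus>\<^bsub>Loc\<^esub> frac n s = frac (m \<oplus> n) s"
proof -
  obtain m' s' where m': "frac m s = Frac m' s'" "frac_rel m s m' s'"
    and [simp]: "m' \<in> carrier M" "s' \<in> S"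
    using frac_rep[of m s, OF assms(1,3)] by blast
  obtain n' t' where n': "frac n s = Frac n' t'" "frac_rel n s n' t'"
    and [simp]: "n' \<in> carrier M" "t' \<in> S"
    using frac_rep[of n s, OF assms(2,3)] by blast
  obtain w v where [simp]: "w \<in> S" "v \<in> S" and w: "w \<odot> (s' \<odot> m) = w \<odot> (s \<odot> m')"
    and v: "v \<odot> (t' \<odot> n) = v \<odot> (s \<odot> n')" using m' n' unfolding frac_rel_def by auto
  have 1: "v \<odot> (t' \<odot> (w \<odot> (s' \<odot> m))) = v \<odot> (t' \<odot> (w \<odot> (s \<odot> m')))"
    and 2: "w \<odot> (s' \<odot> (v \<odot> (t' \<odot> n))) = w \<odot> (s' \<odot> (v \<odot> (s \<odot> n')))"
    by (simp_all only: w v)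
  have "frac_rel (t' \<odot> m' \<oplus> s' \<odot> n') (s' \<otimes>\<^bsub>T\<^esub> t') (m \<oplus> n) s"
    unfolding frac_rel_def
    by (rule bexI[of _ "w \<otimes>\<^bsub>T\<^esub> v"])
      (use 1 2 in \<open>simp_all add: smult_assoc1 smult_lcomm smult_r_distr\<close>)
  then have "frac (t' \<odot> m' \<oplus> s' \<odot> n') (s' \<otimes>\<^bsub>T\<^esub> t') = frac (m \<oplus> n) s"
    by (subst frac_eq_iff) auto
  then show ?thesis using m' n' by (simp add: localization_def)
qed

lemma frac_smult:
  assumes [simp]: "m \<in> carrier M" "s \<in> S" "t \<in> carrier T"
  shows "t \<odot>\<^bsub>Loc\<^esub> frac m s = frac (t \<odot> m) s"
proof -
  obtain m' s' where m': "frac m s = Frac m' s'" "frac_rel m s m' s'"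
    and [simp]: "m' \<in> carrier M" "s' \<in> S"
    using frac_rep[of m s, OF assms(1,2)] by blast
  obtain w where [simp]: "w \<in> S" and w: "w \<odot> (s' \<odot> m) = w \<odot> (s \<odot> m')"
    using m' unfolding frac_rel_def by auto
  have "t \<odot> (w \<odot> (s' \<odot> m)) = t \<odot> (w \<odot> (s \<odot> m'))" by (simp only: w)
  then have "w \<odot> (s \<odot> (t \<odot> m')) = w \<odot> (s' \<odot> (t \<odot> m))"
    by (simp add: smult_lcomm)
  then have "frac (t \<odot> m') s' = frac (t \<odot> m) s"
    by (subst frac_eq_iff) (auto simp: frac_rel_def)
  then show ?thesis using m' by (simp add: localization_def)
qed

lemma frac_zero: "s \<in> S \<Longrightarrow> frac \<zero> s = \<zero>\<^bsub>Loc\<^esub>"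
  unfolding Loc_simps by (rule frac_cong) auto

lemma Loc_cases:
  assumes "x \<in> carrier Loc"
  obtains m s where "x = frac m s" "m \<in> carrier M" "s \<in> S"
  using assms by (auto simp: Loc_simps)

lemma common_denominator:
  assumes "x \<in> carrier Loc" "m \<in> carrier M" "s \<in> S"
  obtains n m' t where "x = frac n t" "frac m s = frac m' t" "n \<in> carrier M" "m' \<in> carrier M" "t \<in> S"
proof -
  obtain n r where n: "x = frac n r" "n \<in> carrier M" "r \<in> S" using Loc_cases assms(1) by blast
  have "frac n r = frac (s \<odot> n) (s \<otimes>\<^bsub>T\<^esub> r)" using frac_expand n assms by simp
  moreover have "frac m s = frac (r \<odot> m) (s \<otimes>\<^bsub>T\<^esub> r)"
    using frac_expand[of m s r] n assms m_comm[of r s] by simp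
  ultimately show ?thesis using that n assms by simp
qed

lemma module_Loc: "module T Loc"
proof (intro moduleI abelian_groupI)
  fix x y assume x: "x \<in> carrier Loc" and y: "y \<in> carrier Loc"
  obtain n t where y': "y = frac n t" "n \<in> carrier M" "t \<in> S" using Loc_cases[OF y] .
  obtain m n' r where m: "x = frac m r" "y = frac n' r" "m \<in> carrier M" "n' \<in> carrier M" "r \<in> S"
    using common_denominator[OF x y'(2,3)] y'(1) by metis
  show "x \<oplus>\<^bsub>Loc\<^esub> y \<in> carrier Loc" "x \<oplus>\<^bsub>Loc\<^esub> y = y \<oplus>\<^bsub>Loc\<^esub> x"
    unfolding m(1,2) using m(3-) by (simp_all add: frac_add M.a_comm)
  show "a \<odot>\<^bsub>Loc\<^esub> (x \<oplus>\<^bsub>Loc\<^esub> y) = a \<odot>\<^bsub>Loc\<^esub> x \<oplus>\<^bsub>Loc\<^esub> a \<odot>\<^bsub>Loc\<^esub> y" if "a \<in> carrier T" for a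
    unfolding m(1,2) using m(3-) that by (simp add: frac_add frac_smult smult_r_distr)
  fix z assume z: "z \<in> carrier Loc"
  obtain l q where l: "z = frac l q" "l \<in> carrier M" "q \<in> S" using Loc_cases[OF z] .
  have "x = frac (q \<odot> m) (q \<otimes>\<^bsub>T\<^esub> r)" "y = frac (q \<odot> n') (q \<otimes>\<^bsub>T\<^esub> r)" "z = frac (r \<odot> l) (q \<otimes>\<^bsub>T\<^esub> r)"
    using frac_expand[of m r q] frac_expand[of n' r q] frac_expand[of l q r] m l m_comm[of r q]
    by simp_all
  then show "(x \<oplus>\<^bsub>Loc\<^esub> y) \<oplus>\<^bsub>Loc\<^esub> z = x \<oplus>\<^bsub>Loc\<^esub> (y \<oplus>\<^bsub>Loc\<^esub> z)"
    using m(3-) l(2-) by (simp add: frac_add M.a_assoc)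
next
  fix x assume "x \<in> carrier Loc"
  then obtain m s where m: "x = frac m s" "m \<in> carrier M" "s \<in> S" by (rule Loc_cases)
  show "\<zero>\<^bsub>Loc\<^esub> \<oplus>\<^bsub>Loc\<^esub> x = x" using frac_add[of \<zero> m s] m by (simp add: frac_zero)
  show "\<exists>y\<in>carrier Loc. y \<oplus>\<^bsub>Loc\<^esub> x = \<zero>\<^bsub>Loc\<^esub>"
    by (rule bexI[of _ "frac (\<ominus> m) s"]) (use m in \<open>simp_all add: frac_add M.l_neg frac_zero\<close>)
  show "\<one>\<^bsub>T\<^esub> \<odot>\<^bsub>Loc\<^esub> x = x" using m by (simp add: frac_smult)
  fix a assume a: "a \<in> carrier T"
  show "a \<odot>\<^bsub>Loc\<^esub> x \<in> carrier Loc" using m a by (simp add: frac_smult)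
  fix b assume b: "b \<in> carrier T"
  show "(a \<oplus>\<^bsub>T\<^esub> b) \<odot>\<^bsub>Loc\<^esub> x = a \<odot>\<^bsub>Loc\<^esub> x \<oplus>\<^bsub>Loc\<^esub> b \<odot>\<^bsub>Loc\<^esub> x"
    using m a b by (simp add: frac_smult frac_add smult_l_distr)
  show "(a \<otimes>\<^bsub>T\<^esub> b) \<odot>\<^bsub>Loc\<^esub> x = a \<odot>\<^bsub>Loc\<^esub> (b \<odot>\<^bsub>Loc\<^esub> x)"
    using m a b by (simp add: frac_smult smult_assoc1)
qed (auto simp: Loc_simps(2) is_cring)

lemma part_LocE:
  assumes "x \<in> part Loc D"
  obtains m s k where "x = frac m s" "m \<in> part M (shift k D)" "s \<in> S" "s \<in> rcomp T k"
proof (cases D)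
  case None
  then obtain m s where "x = frac m s" "m \<in> carrier M" "s \<in> S"
    using assms Loc_cases by auto
  then show ?thesis using that None multiplicative_setD(2)[OF S] by fastforce
next
  case (Some u)
  then obtain m s v n where "x = frac m s" "m \<in> mcomp M v" "s \<in> S \<inter> rcomp T n" "u = v - int n"
    using assms by (auto simp: Loc_simps)
  then show ?thesis using that[of m s n] Some by auto
qed

lemma part_LocI:
  assumes "m \<in> part M (shift k D)" "s \<in> S" "s \<in> rcomp T k"
  shows "frac m s \<in> part Loc D"
proof (cases D)
  case None
  then show ?thesis using assms by simp
next
  case (Some u)
  then have "m \<in> mcomp M (int k + u)" "s \<in> S \<inter> rcomp T k" "u = (int k + u) - int k"
    using assms by auto
  then show ?thesis unfolding Some by (simp only: part_simps Loc_simps) blast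
qed

lemma module_with_degrees_Loc: "module_with_degrees T Loc"
proof -
  interpret L: module T Loc by (rule module_Loc)
  show ?thesis
  proof
    fix x u assume "x \<in> mcomp Loc u"
    then have "x \<in> part Loc (Some u)" by simp
    then show "x \<in> carrier Loc" by (rule part_LocE) (use mcomp_carrier in auto)
  next
    fix u
    show "\<zero>\<^bsub>Loc\<^esub> \<in> mcomp Loc u"
      using part_LocI[of \<zero> 0 "Some u" "\<one>\<^bsub>T\<^esub>"] mcomp_zero[of u] one_rcomp
      by (simp add: Loc_simps(2))
  next
    fix t n x u assume t: "t \<in> rcomp T n" and "x \<in> mcomp Loc u"
    then have "x \<in> part Loc (Some u)" by simp
    then obtain m s k where m: "x = frac m s" "m \<in> part M (shift k (Some u))" "s \<in> S" "s \<in> rcomp T k"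
      by (rule part_LocE)
    then have "t \<odot> m \<in> part M (shift k (Some (int n + u)))"
      using part_smult[OF t m(2)] by (simp add: add.left_commute)
    then show "t \<odot>\<^bsub>Loc\<^esub> x \<in> mcomp Loc (int n + u)"
      using part_LocI[OF _ m(3,4), of "t \<odot> m" "Some (int n + u)"] m(1,3) part_carrier[OF m(2)]
        t R.G_carrier by (simp add: frac_smult)
  qed
qed

lemma localization_map_is_localization: "is_localization T S (\<lambda>m. frac m \<one>\<^bsub>T\<^esub>) M Loc"
proof (rule is_localizationI)
  interpret L: module_with_degrees T Loc by (rule module_with_degrees_Loc)
  show "(\<lambda>m. frac m \<one>\<^bsub>T\<^esub>) \<in> linear_map T M Loc"
    unfolding linear_map_def by (auto simp: frac_add frac_smult)
  show "frac x \<one>\<^bsub>T\<^esub> \<in> part Loc D" if "x \<in> part M D" for x D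
    using part_LocI[of x 0 D "\<one>\<^bsub>T\<^esub>"] that one_rcomp by simp
  show "c = \<zero>\<^bsub>Loc\<^esub>" if s: "s \<in> S" and c: "c \<in> carrier Loc" "s \<odot>\<^bsub>Loc\<^esub> c = \<zero>\<^bsub>Loc\<^esub>" for s c
  proof -
    obtain m t where m: "c = frac m t" "m \<in> carrier M" "t \<in> S" using Loc_cases[OF c(1)] .
    have "frac (s \<odot> m) t = frac \<zero> t" using c(2) m s by (simp add: frac_smult frac_zero)
    then obtain w where w: "w \<in> S" "w \<odot> (t \<odot> (s \<odot> m)) = \<zero>"
      using m s by (subst (asm) frac_eq_iff) (auto simp: frac_rel_def)
    have "(w \<otimes>\<^bsub>T\<^esub> s) \<odot> (t \<odot> m) = (w \<otimes>\<^bsub>T\<^esub> s) \<odot> (t \<odot> \<zero>)"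
      using w m s by (simp add: smult_assoc1 smult_lcomm)
    then have "frac m t = frac \<zero> t"
      using m s w by (subst frac_eq_iff) (auto simp: frac_rel_def intro!: bexI[of _ "w \<otimes>\<^bsub>T\<^esub> s"])
    then show ?thesis using m by (simp add: frac_zero)
  qed
  show "\<exists>c'\<in>part Loc D. s \<odot>\<^bsub>Loc\<^esub> c' = c"
    if s: "s \<in> S" "s \<in> rcomp T k" and c: "c \<in> part Loc (shift k D)" for s k c D
  proof -
    obtain m t l where m: "c = frac m t" "m \<in> part M (shift l (shift k D))" "t \<in> S" "t \<in> rcomp T l"
      using part_LocE[OF c] .
    have mc: "m \<in> carrier M" using part_carrier[OF m(2)] .
    have "frac m (s \<otimes>\<^bsub>T\<^esub> t) \<in> part Loc D"
      by (rule part_LocI[of _ "k + l"])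
        (use m s mult_rcomp in \<open>auto simp: shift_shift add.commute\<close>)
    moreover have "s \<odot>\<^bsub>Loc\<^esub> frac m (s \<otimes>\<^bsub>T\<^esub> t) = c"
      using frac_expand[OF mc m(3) s(1)] mc m s by (simp add: frac_smult)
    ultimately show ?thesis by blast
  qed
  show "\<exists>k. \<exists>s\<in>S \<inter> rcomp T k. \<exists>n\<in>part M (shift k D). s \<odot>\<^bsub>Loc\<^esub> c = frac n \<one>\<^bsub>T\<^esub>"
    if c: "c \<in> part Loc D" for c D
  proof -
    obtain m t l where m: "c = frac m t" "m \<in> part M (shift l D)" "t \<in> S" "t \<in> rcomp T l"
      using part_LocE[OF c] .
    have mc: "m \<in> carrier M" using part_carrier[OF m(2)] .
    have "t \<odot>\<^bsub>Loc\<^esub> c = frac m \<one>\<^bsub>T\<^esub>"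
      using frac_expand[OF mc S_one m(3)] mc m by (simp add: frac_smult)
    then show ?thesis using m by blast
  qed
  show "\<exists>s\<in>S. s \<odot> n = \<zero>" if "n \<in> carrier M" "frac n \<one>\<^bsub>T\<^esub> = \<zero>\<^bsub>Loc\<^esub>" for n
    using that unfolding Loc_simps by (subst (asm) frac_eq_iff) (auto simp: frac_rel_def)
qed

end

text \<open>
  The formula for \<open>g\<close> acts on the chosen representative of a fraction; the first claim is its
  independence of that choice.
\<close>
lemma localized_map:
  assumes N: "localization_setting T N S" and M: "localization_setting T M S" and f: "f \<in> linear_map T N M"
  defines "g \<equiv> \<lambda>x. fraction T S M (f (numerator x)) (denominator x)"
  shows "n \<in> carrier N \<Longrightarrow> s \<in> S \<Longrightarrow> g (fraction T S N n s) = fraction T S M (f n) s"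
    and "g \<in> linear_map T (localization T S N) (localization T S M)"
proof -
  interpret N: localization_setting T N S by fact
  interpret M: localization_setting T M S by fact
  note lf [simp] = linear_mapD[OF f]
  show eq: "g (fraction T S N n s) = fraction T S M (f n) s" if n: "n \<in> carrier N" "s \<in> S" for n s
  proof -
    obtain n' s' where n': "N.frac n s = Frac n' s'" "n' \<in> carrier N" "s' \<in> S" "N.frac_rel n s n' s'"
      using N.frac_rep[OF n] .
    then obtain w where w: "w \<in> S" "w \<odot>\<^bsub>N\<^esub> (s' \<odot>\<^bsub>N\<^esub> n) = w \<odot>\<^bsub>N\<^esub> (s \<odot>\<^bsub>N\<^esub> n')"
      unfolding N.frac_rel_def by auto
    have "w \<odot>\<^bsub>M\<^esub> (s' \<odot>\<^bsub>M\<^esub> f n) = f (w \<odot>\<^bsub>N\<^esub> (s' \<odot>\<^bsub>N\<^esub> n))" using n n' w(1) by simp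
    also have "\<dots> = w \<odot>\<^bsub>M\<^esub> (s \<odot>\<^bsub>M\<^esub> f n')" unfolding w(2) using n n' w(1) by simp
    finally have "M.frac_rel (f n') s' (f n) s" unfolding M.frac_rel_def using w(1) by metis
    then show ?thesis using n n' by (simp add: g_def M.frac_eq_iff)
  qed
  show "g \<in> linear_map T (localization T S N) (localization T S M)"
    unfolding linear_map_def
  proof (intro CollectI conjI ballI)
    show "g \<in> carrier N.Loc \<rightarrow> carrier M.Loc" by (auto elim!: N.Loc_cases simp: eq)
  next
    fix x y assume x: "x \<in> carrier N.Loc" and y: "y \<in> carrier N.Loc"
    obtain n t where y': "y = N.frac n t" "n \<in> carrier N" "t \<in> S" using N.Loc_cases[OF y] .
    obtain m n' r where m: "x = N.frac m r" "y = N.frac n' r" "m \<in> carrier N" "n' \<in> carrier N" "r \<in> S"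
      using N.common_denominator[OF x y'(2,3)] y'(1) by metis
    show "g (x \<oplus>\<^bsub>N.Loc\<^esub> y) = g x \<oplus>\<^bsub>M.Loc\<^esub> g y"
      unfolding m(1,2) using m(3-) by (simp add: eq N.frac_add M.frac_add)
  next
    fix t x assume t: "t \<in> carrier T" and "x \<in> carrier N.Loc"
    then obtain m s where "x = N.frac m s" "m \<in> carrier N" "s \<in> S" by (blast elim: N.Loc_cases)
    then show "g (t \<odot>\<^bsub>N.Loc\<^esub> x) = t \<odot>\<^bsub>M.Loc\<^esub> g x"
      using t by (simp add: eq N.frac_smult M.frac_smult)
  qed
qed

section \<open>The modules of the Cech complex of the ring\<close>

lemma (in graded_ring) nat_pow_rcomp: "b \<in> rcomp T k \<Longrightarrow> b [^] (n::nat) \<in> rcomp T (n * k)"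
proof (induction n)
  case (Suc n)
  then show ?case using mult_rcomp[of "b [^] n" "n * k" b k] by (simp add: add.commute)
qed (use one_rcomp in simp)

text \<open>
  The product of \<open>b\<^sup>n + j\<close> and \<open>b\<^sup>m + i\<close> is \<open>b\<^sup>n\<^sup>+\<^sup>m\<close> plus an element of \<open>J\<close>, all of whose terms have the
  degree of the product.
\<close>
lemma (in graded_ring) multiplicative_star_S:
  assumes "ideal J T" "b \<in> homogeneous_elements T"
  shows "multiplicative_set T (star_S T J b)"
  unfolding multiplicative_set_def
proof (intro conjI ballI subsetI)
  interpret J: ideal J T by fact
  have b: "b \<in> carrier T" using assms(2) homogeneous_carrier by blast
  show "\<one> \<in> star_S T J b"
    unfolding star_S_def
    by (intro CollectI exI[of _ "0::nat"] exI[of _ \<zero>]) (use one_rcomp in \<open>auto intro!: exI[of _ 0]\<close>)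
  show "s \<in> homogeneous_elements T" if "s \<in> star_S T J b" for s
    using that R.G_add unfolding star_S_def homogeneous_elements_def by auto
  fix s t assume "s \<in> star_S T J b" "t \<in> star_S T J b"
  then obtain n j k m i l where s: "s = b [^] (n::nat) \<oplus> j" "j \<in> J" "b [^] n \<in> rcomp T k" "j \<in> rcomp T k"
    and t: "t = b [^] (m::nat) \<oplus> i" "i \<in> J" "b [^] m \<in> rcomp T l" "i \<in> rcomp T l"
    unfolding star_S_def by auto
  have c: "j \<in> carrier T" "i \<in> carrier T" using s t J.Icarr by auto
  let ?h = "b [^] n \<otimes> i \<oplus> (j \<otimes> b [^] m \<oplus> j \<otimes> i)"
  have "s \<otimes> t = b [^] (n + m) \<oplus> ?h"
    using b c s t by (simp add: nat_pow_mult[symmetric] l_distr r_distr a_ac)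
  moreover have "?h \<in> J"
    using s t b J.I_l_closed J.I_r_closed J.a_closed J.Icarr by simp
  moreover have "b [^] (n + m) \<in> rcomp T (k + l)"
    using mult_rcomp[OF s(3) t(3)] b by (simp add: nat_pow_mult)
  moreover have "?h \<in> rcomp T (k + l)"
    using s t mult_rcomp by (intro R.G_add) auto
  ultimately show "s \<otimes> t \<in> star_S T J b" unfolding star_S_def by blast
qed

lemma (in graded_ring) module_with_degrees_ring: "module_with_degrees T (ring_as_gmodule T)"
proof -
  let ?M = "ring_as_gmodule T"
  have simps: "carrier ?M = Elem ` carrier T" "\<zero>\<^bsub>?M\<^esub> = Elem \<zero>"
    "\<And>x y. Elem x \<oplus>\<^bsub>?M\<^esub> Elem y = Elem (x \<oplus> y)" "\<And>x y. x \<odot>\<^bsub>?M\<^esub> Elem y = Elem (x \<otimes> y)"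
    "\<And>u. mcomp ?M u = (if 0 \<le> u then Elem ` rcomp T (nat u) else {Elem \<zero>})"
    by (simp_all add: ring_as_gmodule_def)
  have "module T ?M"
  proof (intro moduleI abelian_groupI)
    fix x assume "x \<in> carrier ?M"
    then obtain y where "x = Elem y" "y \<in> carrier T" by (auto simp: simps)
    then show "\<exists>y\<in>carrier ?M. y \<oplus>\<^bsub>?M\<^esub> x = \<zero>\<^bsub>?M\<^esub>"
      by (intro bexI[of _ "Elem (\<ominus> y)"]) (auto simp: simps l_neg)
  qed (auto simp: simps is_cring a_ac m_assoc l_distr r_distr)
  then interpret M: module T ?M .
  show ?thesis
  proof
    show "x \<in> mcomp ?M u \<Longrightarrow> x \<in> carrier ?M" for x u
      using R.G_carrier by (auto simp: simps split: if_splits)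
    show "\<zero>\<^bsub>?M\<^esub> \<in> mcomp ?M u" for u by (auto simp: simps)
    fix t n x u assume t: "t \<in> rcomp T n" "x \<in> mcomp ?M u"
    show "t \<odot>\<^bsub>?M\<^esub> x \<in> mcomp ?M (int n + u)"
    proof (cases "0 \<le> u")
      case True
      then show ?thesis using t mult_rcomp by (auto simp: simps nat_add_distrib)
    next
      case False
      then show ?thesis using t R.G_carrier by (auto simp: simps)
    qed
  qed
qed

locale cech_setting = graded_ring T for T :: "'a gring" (structure) +
  fixes J :: "'a set" and bs :: "'a list"
  assumes ideal_J: "ideal J T" and bs_homogeneous: "set bs \<subseteq> homogeneous_elements T"
begin

definition denominators :: "nat set \<Rightarrow> 'a set" where
  "denominators A = mult_closure T (\<Union>i\<in>A. star_S T J (bs ! i))"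

abbreviation iter where "iter \<equiv> iterated_localization T J bs"

text \<open>
  The map from \<open>T\<close> to an iterated localization.
\<close>
primrec structure_map :: "nat list \<Rightarrow> 'a frac_expr \<Rightarrow> 'a frac_expr" where
  "structure_map [] = id"
| "structure_map (i # is) =
     (\<lambda>x. fraction T (star_S T J (bs ! i)) (iter is) x \<one>) \<circ> structure_map is"

lemma star_multiplicative: "i < length bs \<Longrightarrow> multiplicative_set T (star_S T J (bs ! i))"
  using bs_homogeneous ideal_J by (intro multiplicative_star_S) auto

lemma stars_homogeneous:
  assumes "A \<subseteq> {..<length bs}"
  shows "(\<Union>i\<in>A. star_S T J (bs ! i)) \<subseteq> homogeneous_elements T"
  using star_multiplicative assms unfolding multiplicative_set_def by blast

lemma denominators_multiplicative: "A \<subseteq> {..<length bs} \<Longrightarrow> multiplicative_set T (denominators A)"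
  unfolding denominators_def by (intro multiplicative_mult_closure stars_homogeneous)

lemma denominators_mono: "A \<subseteq> B \<Longrightarrow> s \<in> denominators A \<Longrightarrow> s \<in> denominators B"
  unfolding denominators_def by (rule mult_closure_mono[rotated]) auto

lemma denominators_empty: "denominators {} = {\<one>}"
proof (intro equalityI subsetI)
  show "s \<in> {\<one>}" if "s \<in> denominators {}" for s
    using that unfolding denominators_def by cases auto
qed (auto simp: denominators_def intro: mult_closure.one)

lemma denominators_singleton: "i < length bs \<Longrightarrow> denominators {i} = star_S T J (bs ! i)"
  unfolding denominators_def using mult_closure_self[OF star_multiplicative] by simp

lemma denominators_insert:
  assumes "insert i A \<subseteq> {..<length bs}"
  shows "denominators (insert i A) =
    {s \<otimes> t | s t. s \<in> star_S T J (bs ! i) \<and> t \<in> denominators A}"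
  using mult_closure_Un[of "star_S T J (bs ! i)" "\<Union>i\<in>A. star_S T J (bs ! i)"]
    mult_closure_self[OF star_multiplicative, of i] stars_homogeneous[of A] stars_homogeneous[of "{i}"] assms
  unfolding denominators_def by simp

lemma iterated_localization:
  assumes "set is \<subseteq> {..<length bs}"
  shows "module_with_degrees T (iter is) \<and>
    is_localization T (denominators (set is)) (structure_map is) (ring_as_gmodule T) (iter is)"
  using assms
proof (induction "is")
  case Nil
  then show ?case
    using module_with_degrees_ring is_localization_id[OF module_with_degrees_ring]
    by (simp add: denominators_empty id_def)
next
  case (Cons i "is")
  then have IH: "module_with_degrees T (iter is)"
    "is_localization T (denominators (set is)) (structure_map is) (ring_as_gmodule T) (iter is)"
    and i: "i < length bs" "set is \<subseteq> {..<length bs}" by auto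
  interpret L: localization_setting T "iter is" "star_S T J (bs ! i)"
    using IH star_multiplicative[OF i(1)]
    by (auto intro!: localization_setting.intro localization_setting_axioms.intro)
  have "is_localization T (denominators (set (i # is))) (structure_map (i # is)) (ring_as_gmodule T) (iter (i # is))"
    using is_localization_comp[OF module_with_degrees_ring IH(1) L.module_with_degrees_Loc
        denominators_multiplicative[OF i(2)] star_multiplicative[OF i(1)] IH(2)
        L.localization_map_is_localization] Cons.prems
    by (simp add: denominators_insert)
  then show ?case using L.module_with_degrees_Loc by (simp add: comp_def)
qed

text \<open>
  The natural maps commute with the maps from \<open>T\<close>.  As all elements are fractions over \<open>T\<close>, this
  determines them.
\<close>
lemma natural_map:
  assumes "set is \<subseteq> {..<length bs}" "distinct is" "k \<in> set is"
  shows "natural_map T J bs k is \<in> linear_map T (iter (filter (\<lambda>i. i \<noteq> k) is)) (iter is) \<and>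
    (\<forall>x\<in>carrier (ring_as_gmodule T). natural_map T J bs k is (structure_map (filter (\<lambda>i. i \<noteq> k) is) x)
       = structure_map is x)"
  using assms
proof (induction "is")
  case Nil
  then show ?case by simp
next
  case (Cons i "is")
  have i: "i < length bs" "set is \<subseteq> {..<length bs}" using Cons.prems by auto
  have setting: "localization_setting T (iter js) (star_S T J (bs ! i))" if "set js \<subseteq> {..<length bs}" for js
    using iterated_localization[OF that] star_multiplicative[OF i(1)]
    by (auto intro!: localization_setting.intro localization_setting_axioms.intro)
  interpret L: localization_setting T "iter is" "star_S T J (bs ! i)" using setting[OF i(2)] .
  show ?case
  proof (cases "i = k")
    case True
    then have "filter (\<lambda>i. i \<noteq> k) is = is" using Cons.prems by (auto intro: filter_True)
    then show ?thesis
      using True is_localizationD(1)[OF L.localization_map_is_localization] by simp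
  next
    case False
    let ?js = "filter (\<lambda>i. i \<noteq> k) is"
    let ?f = "natural_map T J bs k is"
    have js: "set ?js \<subseteq> {..<length bs}" using i by auto
    interpret L': localization_setting T "iter ?js" "star_S T J (bs ! i)" using setting[OF js] .
    have IH: "?f \<in> linear_map T (iter ?js) (iter is)"
      "\<forall>x\<in>carrier (ring_as_gmodule T). ?f (structure_map ?js x) = structure_map is x"
      using Cons False i by auto
    note g = localized_map[OF setting[OF js] setting[OF i(2)] IH(1)]
    have sm: "structure_map ?js x \<in> carrier (iter ?js)" if "x \<in> carrier (ring_as_gmodule T)" for x
      using iterated_localization[OF js] that is_localizationD(1) linear_mapD(1) by metis
    have "natural_map T J bs k (i # is) (structure_map (i # ?js) x) = structure_map (i # is) x"
      if x: "x \<in> carrier (ring_as_gmodule T)" for x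
      using g(1)[OF sm[OF x] L'.S_one] IH(2) x False by simp
    then show ?thesis using g(2) False by simp
  qed
qed

lemma descending_simps:
  assumes "finite A"
  shows "set (descending A) = A" "distinct (descending A)"
    "descending (A - {k}) = filter (\<lambda>i. i \<noteq> k) (descending A)"
  using assms
  by (simp_all add: descending_def sorted_list_of_set_remove distinct_remove1_removeAll
      removeAll_filter_not_eq rev_filter eq_commute[of k])

end

section \<open>Tensor products\<close>

lemma free_module_simps:
  "carrier (free_module T X) = {\<phi>. (\<forall>x. \<phi> x \<in> carrier T) \<and> finite {x. \<phi> x \<noteq> \<zero>\<^bsub>T\<^esub>} \<and>
     {x. \<phi> x \<noteq> \<zero>\<^bsub>T\<^esub>} \<subseteq> X}"
  "zero (free_module T X) = (\<lambda>x. \<zero>\<^bsub>T\<^esub>)" "add (free_module T X) = (\<lambda>\<phi> \<psi> x. \<phi> x \<oplus>\<^bsub>T\<^esub> \<psi> x)"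
  "smult (free_module T X) = (\<lambda>t \<phi> x. t \<otimes>\<^bsub>T\<^esub> \<phi> x)"
  by (simp_all add: free_module_def)

context graded_ring
begin

lemma free_moduleI:
  assumes "\<And>x. \<phi> x \<in> carrier T" "finite U" "U \<subseteq> X" "\<And>x. x \<notin> U \<Longrightarrow> \<phi> x = \<zero>"
  shows "\<phi> \<in> carrier (free_module T X)"
proof -
  have "{x. \<phi> x \<noteq> \<zero>} \<subseteq> U" using assms(4) by blast
  then show ?thesis using assms(1-3) finite_subset by (auto simp: free_module_simps)
qed

lemma module_free_module: "module T (free_module T X)"
proof (intro moduleI abelian_groupI)
  let ?F = "free_module T X"
  fix \<phi> assume \<phi>: "\<phi> \<in> carrier ?F"
  have "(\<lambda>x. \<ominus> \<phi> x) \<in> carrier ?F"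
    by (rule free_moduleI[where U = "{x. \<phi> x \<noteq> \<zero>}"]) (use \<phi> in \<open>auto simp: free_module_simps\<close>)
  then show "\<exists>\<psi>\<in>carrier ?F. \<psi> \<oplus>\<^bsub>?F\<^esub> \<phi> = \<zero>\<^bsub>?F\<^esub>"
    by (rule bexI[rotated]) (use \<phi> in \<open>auto simp: free_module_simps l_neg\<close>)
  fix t assume t: "t \<in> carrier T"
  show "t \<odot>\<^bsub>?F\<^esub> \<phi> \<in> carrier ?F"
    by (rule free_moduleI[where U = "{x. \<phi> x \<noteq> \<zero>}"]) (use \<phi> t in \<open>auto simp: free_module_simps\<close>)
next
  let ?F = "free_module T X"
  fix \<phi> \<psi> assume \<phi>: "\<phi> \<in> carrier ?F" "\<psi> \<in> carrier ?F"
  show "\<phi> \<oplus>\<^bsub>?F\<^esub> \<psi> \<in> carrier ?F"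
    by (rule free_moduleI[where U = "{x. \<phi> x \<noteq> \<zero>} \<union> {x. \<psi> x \<noteq> \<zero>}"])
      (use \<phi> in \<open>auto simp: free_module_simps\<close>)
qed (auto simp: free_module_simps is_cring a_ac m_assoc l_distr r_distr)

lemma basis_vector_in: "z \<in> X \<Longrightarrow> basis_vector T z \<in> carrier (free_module T X)"
  by (rule free_moduleI[where U = "{z}"]) (auto simp: basis_vector_def)

lemma free_module_induct [consumes 1, case_names zero basis]:
  assumes "\<phi> \<in> carrier (free_module T X)"
    and "P \<zero>\<^bsub>free_module T X\<^esub>"
    and "\<And>\<phi> t z. \<phi> \<in> carrier (free_module T X) \<Longrightarrow> P \<phi> \<Longrightarrow> t \<in> carrier T \<Longrightarrow> z \<in> X \<Longrightarrow>
      P (\<phi> \<oplus>\<^bsub>free_module T X\<^esub> t \<odot>\<^bsub>free_module T X\<^esub> basis_vector T z)"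
  shows "P \<phi>"
proof -
  let ?F = "free_module T X"
  have "finite U \<Longrightarrow> U \<subseteq> X \<Longrightarrow> \<forall>\<phi>\<in>carrier ?F. (\<forall>x. x \<notin> U \<longrightarrow> \<phi> x = \<zero>) \<longrightarrow> P \<phi>" for U
  proof (induction U rule: finite_induct)
    case empty
    have "\<phi> = \<zero>\<^bsub>?F\<^esub>" if "\<forall>x. \<phi> x = \<zero>" for \<phi> using that by (auto simp: free_module_simps)
    then show ?case using assms(2) by auto
  next
    case (insert z U)
    show ?case
    proof (intro ballI impI)
      fix \<phi> assume \<phi>: "\<phi> \<in> carrier ?F" "\<forall>x. x \<notin> insert z U \<longrightarrow> \<phi> x = \<zero>"
      let ?\<psi> = "\<phi>(z := \<zero>)"
      have c: "\<phi> x \<in> carrier T" for x using \<phi>(1) by (simp add: free_module_simps)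
      have \<psi>: "?\<psi> \<in> carrier ?F"
        by (rule free_moduleI[of _ U]) (use c insert \<phi>(2) in auto)
      have "P ?\<psi>" using insert.IH insert.prems \<psi> \<phi>(2) by auto
      moreover have "\<phi> = ?\<psi> \<oplus>\<^bsub>?F\<^esub> \<phi> z \<odot>\<^bsub>?F\<^esub> basis_vector T z"
        using c by (auto simp: free_module_simps basis_vector_def)
      ultimately show "P \<phi>" using assms(3)[OF \<psi> _ c, of z z] insert.prems by simp
    qed
  qed
  then show ?thesis
    using assms(1) by (auto simp: free_module_simps dest!: spec[of _ "{x. \<phi> x \<noteq> \<zero>}"])
qed

text \<open>
  The linear extension of \<open>g\<close> from the basis to the free module.
\<close>
definition free_lift :: "('a, 'c, 'n) module_scheme \<Rightarrow> ('x \<Rightarrow> 'c) \<Rightarrow> ('x \<Rightarrow> 'a) \<Rightarrow> 'c" where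
  "free_lift P g \<phi> = (\<Oplus>\<^bsub>P\<^esub>z\<in>{z. \<phi> z \<noteq> \<zero>}. \<phi> z \<odot>\<^bsub>P\<^esub> g z)"

lemma free_lift_linear:
  assumes "module T P" and g: "\<And>z. z \<in> X \<Longrightarrow> g z \<in> carrier P"
  shows "free_lift P g \<in> linear_map T (free_module T X) P"
    and "z \<in> X \<Longrightarrow> free_lift P g (basis_vector T z) = g z"
proof -
  interpret P: module T P by fact
  let ?F = "free_module T X"
  have c: "\<phi> \<in> carrier ?F \<Longrightarrow> \<phi> x \<in> carrier T" for \<phi> x by (simp add: free_module_simps)
  have on: "free_lift P g \<phi> = (\<Oplus>\<^bsub>P\<^esub>z\<in>U. \<phi> z \<odot>\<^bsub>P\<^esub> g z)"
    if \<phi>: "\<phi> \<in> carrier ?F" and U: "finite U" "{x. \<phi> x \<noteq> \<zero>} \<subseteq> U" "U \<subseteq> X" for \<phi> U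
    unfolding free_lift_def
    by (rule P.M.add.finprod_mono_neutral_cong_left[OF U(1,2)]) (use \<phi> U(3) g c in auto)
  show "free_lift P g \<in> linear_map T ?F P"
    unfolding linear_map_def
  proof (intro CollectI conjI ballI)
    show "free_lift P g \<in> carrier ?F \<rightarrow> carrier P"
      unfolding free_lift_def using c g by (auto simp: free_module_simps intro!: P.M.finsum_closed)
  next
    fix \<phi> \<psi> assume \<phi>: "\<phi> \<in> carrier ?F" and \<psi>: "\<psi> \<in> carrier ?F"
    interpret F: module T ?F by (rule module_free_module)
    let ?U = "{x. \<phi> x \<noteq> \<zero>} \<union> {x. \<psi> x \<noteq> \<zero>}"
    have U: "finite ?U" "?U \<subseteq> X" using \<phi> \<psi> by (auto simp: free_module_simps)
    have gU: "z \<in> ?U \<Longrightarrow> g z \<in> carrier P" for z using U(2) g by blast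
    have sub: "{x. (\<phi> \<oplus>\<^bsub>?F\<^esub> \<psi>) x \<noteq> \<zero>} \<subseteq> ?U" by (auto simp: free_module_simps)
    have "free_lift P g (\<phi> \<oplus>\<^bsub>?F\<^esub> \<psi>) = (\<Oplus>\<^bsub>P\<^esub>z\<in>?U. \<phi> z \<odot>\<^bsub>P\<^esub> g z \<oplus>\<^bsub>P\<^esub> \<psi> z \<odot>\<^bsub>P\<^esub> g z)"
      unfolding on[OF F.M.a_closed[OF \<phi> \<psi>] U(1) sub U(2)]
      by (rule P.M.finsum_cong')
        (use c[OF \<phi>] c[OF \<psi>] gU in \<open>auto simp: free_module_simps P.smult_l_distr\<close>)
    also have "\<dots> = free_lift P g \<phi> \<oplus>\<^bsub>P\<^esub> free_lift P g \<psi>"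
      using on[OF \<phi> U(1) _ U(2)] on[OF \<psi> U(1) _ U(2)] c[OF \<phi>] c[OF \<psi>] gU
      by (subst P.M.finsum_addf) auto
    finally show "free_lift P g (\<phi> \<oplus>\<^bsub>?F\<^esub> \<psi>) = free_lift P g \<phi> \<oplus>\<^bsub>P\<^esub> free_lift P g \<psi>" .
  next
    fix t \<phi> assume t: "t \<in> carrier T" and \<phi>: "\<phi> \<in> carrier ?F"
    interpret F: module T ?F by (rule module_free_module)
    let ?U = "{x. \<phi> x \<noteq> \<zero>}"
    have U: "finite ?U" "?U \<subseteq> X" using \<phi> by (auto simp: free_module_simps)
    have gU: "z \<in> ?U \<Longrightarrow> g z \<in> carrier P" for z using U(2) g by blast
    have sub: "{x. (t \<odot>\<^bsub>?F\<^esub> \<phi>) x \<noteq> \<zero>} \<subseteq> ?U" using t by (auto simp: free_module_simps)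
    have "free_lift P g (t \<odot>\<^bsub>?F\<^esub> \<phi>) = (\<Oplus>\<^bsub>P\<^esub>z\<in>?U. t \<odot>\<^bsub>P\<^esub> (\<phi> z \<odot>\<^bsub>P\<^esub> g z))"
      unfolding on[OF F.smult_closed[OF t \<phi>] U(1) sub U(2)]
      by (rule P.M.finsum_cong') (use c[OF \<phi>] t gU in \<open>auto simp: free_module_simps P.smult_assoc1\<close>)
    also have "\<dots> = t \<odot>\<^bsub>P\<^esub> free_lift P g \<phi>"
      unfolding free_lift_def using U(1) t c[OF \<phi>] gU by (subst P.finsum_smult_ldistr) auto
    finally show "free_lift P g (t \<odot>\<^bsub>?F\<^esub> \<phi>) = t \<odot>\<^bsub>P\<^esub> free_lift P g \<phi>" .
  qed
  show "free_lift P g (basis_vector T z) = g z" if z: "z \<in> X"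
  proof -
    have "free_lift P g (basis_vector T z) = (\<Oplus>\<^bsub>P\<^esub>z'\<in>{z}. basis_vector T z z' \<odot>\<^bsub>P\<^esub> g z')"
      by (rule on[OF basis_vector_in[OF z]]) (use z in \<open>auto simp: basis_vector_def\<close>)
    also have "\<dots> = g z" using g[OF z] by (simp add: basis_vector_def)
    finally show ?thesis .
  qed
qed

end

locale tensor_product = graded_ring T + M: module T M + N: module T N
  for T :: "'a gring" and M :: "('a, 'b) gmodule" and N :: "('a, 'c) gmodule"
begin

abbreviation F where "F \<equiv> free_module T (carrier M \<times> carrier N)"
abbreviation rel where "rel \<equiv> tensor_relations T M N"
abbreviation pure where "pure \<equiv> pure_tensor T M N"
abbreviation MN where "MN \<equiv> tensor_module T M N"

sublocale F: module T F by (rule module_free_module)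

lemma basis_in: "x \<in> carrier M \<Longrightarrow> y \<in> carrier N \<Longrightarrow> basis_vector T (x, y) \<in> carrier F"
  by (rule basis_vector_in) auto

text \<open>
  The condition on a submodule of the free module that the tensor product modulo it is bilinear; the
  relations of the tensor product form the least such submodule.
\<close>
definition kills_relations :: "('b \<times> 'c \<Rightarrow> 'a) set \<Rightarrow> bool" where
  "kills_relations R \<longleftrightarrow> (let e = (\<lambda>x y. basis_vector T (x, y)) in
         (\<forall>x\<in>carrier M. \<forall>x'\<in>carrier M. \<forall>y\<in>carrier N.
            e (x \<oplus>\<^bsub>M\<^esub> x') y \<ominus>\<^bsub>F\<^esub> (e x y \<oplus>\<^bsub>F\<^esub> e x' y) \<in> R) \<and>
         (\<forall>x\<in>carrier M. \<forall>y\<in>carrier N. \<forall>y'\<in>carrier N.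
            e x (y \<oplus>\<^bsub>N\<^esub> y') \<ominus>\<^bsub>F\<^esub> (e x y \<oplus>\<^bsub>F\<^esub> e x y') \<in> R) \<and>
         (\<forall>t\<in>carrier T. \<forall>x\<in>carrier M. \<forall>y\<in>carrier N.
            e (t \<odot>\<^bsub>M\<^esub> x) y \<ominus>\<^bsub>F\<^esub> (t \<odot>\<^bsub>F\<^esub> e x y) \<in> R \<and>
            e x (t \<odot>\<^bsub>N\<^esub> y) \<ominus>\<^bsub>F\<^esub> (t \<odot>\<^bsub>F\<^esub> e x y) \<in> R))"

lemma rel_eq: "rel = \<Inter>{R. submodule R T F \<and> kills_relations R}"
  unfolding tensor_relations_def kills_relations_def Let_def by (rule refl)

lemma kills_carrier: "kills_relations (carrier F)"
  unfolding kills_relations_def Let_def using basis_in by auto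

lemma submodule_rel: "submodule rel T F"
proof -
  have "carrier F \<in> {R. submodule R T F \<and> kills_relations R}"
    using F.carrier_is_submodule kills_carrier by simp
  then have c: "rel \<subseteq> carrier F" unfolding rel_eq by blast
  show ?thesis
    by (rule F.submoduleI) (use c in \<open>auto simp: rel_eq intro: F.submoduleE(3-5)
      submodule_zero[OF F.module_axioms]\<close>)
qed

lemma kills_rel: "kills_relations rel"
  unfolding rel_eq kills_relations_def Let_def by auto

lemma tensor_simps:
  "carrier MN = carrier (quotient_module T F rel)" "add MN = add (quotient_module T F rel)"
  "zero MN = zero (quotient_module T F rel)" "smult MN = smult (quotient_module T F rel)"
  "mcomp MN = (\<lambda>u. generate (add_monoid (quotient_module T F rel))
     {pure x y | x y v w. x \<in> mcomp M v \<and> y \<in> mcomp N w \<and> u = v + w})"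
  by (simp_all add: tensor_module_def Let_def with_grading_def)

lemma module_tensor: "module T MN"
proof -
  interpret Q: module T "quotient_module T F rel"
    by (rule quotient_module_is_module[OF F.module_axioms submodule_rel])
  have "abelian_group MN"
    by (rule abelian_groupI)
      (use Q.M.l_neg in \<open>auto simp: tensor_simps Q.M.a_ac intro!: bexI[of _ "\<ominus>\<^bsub>quotient_module T F rel\<^esub> _"]\<close>)
  then show ?thesis
    by (intro module.intro is_cring module_axioms.intro)
      (simp_all add: tensor_simps Q.smult_l_distr Q.smult_r_distr Q.smult_assoc1)
qed

sublocale MN: module T MN by (rule module_tensor)

lemma coset_linear: "(\<lambda>\<phi>. rel +>\<^bsub>F\<^esub> \<phi>) \<in> linear_map T F MN"
  using coset_map_linear[OF F.module_axioms submodule_rel]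
  unfolding linear_map_def by (simp add: tensor_simps)

lemma pure_closed [simp]: "x \<in> carrier M \<Longrightarrow> y \<in> carrier N \<Longrightarrow> pure x y \<in> carrier MN"
  unfolding pure_tensor_def using linear_mapD(1)[OF coset_linear basis_in] .

lemma tensor_carrierE:
  assumes "X \<in> carrier MN"
  obtains \<phi> where "\<phi> \<in> carrier F" "X = rel +>\<^bsub>F\<^esub> \<phi>"
  using assms unfolding tensor_simps by (auto simp: quotient_simps)

lemma coset_eqI:
  assumes "\<phi> \<in> carrier F" "\<psi> \<in> carrier F" "\<phi> \<ominus>\<^bsub>F\<^esub> \<psi> \<in> rel"
  shows "rel +>\<^bsub>F\<^esub> \<phi> = rel +>\<^bsub>F\<^esub> \<psi>"
  using F.coset_eq_iff[OF submodule_rel] assms by blast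

lemma pure_add_left:
  assumes "x \<in> carrier M" "x' \<in> carrier M" "y \<in> carrier N"
  shows "pure (x \<oplus>\<^bsub>M\<^esub> x') y = pure x y \<oplus>\<^bsub>MN\<^esub> pure x' y"
proof -
  have "rel +>\<^bsub>F\<^esub> basis_vector T (x \<oplus>\<^bsub>M\<^esub> x', y) = rel +>\<^bsub>F\<^esub> (basis_vector T (x, y) \<oplus>\<^bsub>F\<^esub> basis_vector T (x', y))"
    by (rule coset_eqI) (use assms kills_rel basis_in in \<open>auto simp: kills_relations_def Let_def\<close>)
  then show ?thesis
    unfolding pure_tensor_def using linear_mapD(2)[OF coset_linear basis_in basis_in] assms by simp
qed

lemma pure_add_right:
  assumes "x \<in> carrier M" "y \<in> carrier N" "y' \<in> carrier N"
  shows "pure x (y \<oplus>\<^bsub>N\<^esub> y') = pure x y \<oplus>\<^bsub>MN\<^esub> pure x y'"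
proof -
  have "rel +>\<^bsub>F\<^esub> basis_vector T (x, y \<oplus>\<^bsub>N\<^esub> y') = rel +>\<^bsub>F\<^esub> (basis_vector T (x, y) \<oplus>\<^bsub>F\<^esub> basis_vector T (x, y'))"
    by (rule coset_eqI) (use assms kills_rel basis_in in \<open>auto simp: kills_relations_def Let_def\<close>)
  then show ?thesis
    unfolding pure_tensor_def using linear_mapD(2)[OF coset_linear basis_in basis_in] assms by simp
qed

lemma pure_smult:
  assumes "t \<in> carrier T" "x \<in> carrier M" "y \<in> carrier N"
  shows "pure (t \<odot>\<^bsub>M\<^esub> x) y = t \<odot>\<^bsub>MN\<^esub> pure x y" "pure x (t \<odot>\<^bsub>N\<^esub> y) = t \<odot>\<^bsub>MN\<^esub> pure x y"
proof -
  have "rel +>\<^bsub>F\<^esub> basis_vector T (t \<odot>\<^bsub>M\<^esub> x, y) = rel +>\<^bsub>F\<^esub> (t \<odot>\<^bsub>F\<^esub> basis_vector T (x, y))"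
    and "rel +>\<^bsub>F\<^esub> basis_vector T (x, t \<odot>\<^bsub>N\<^esub> y) = rel +>\<^bsub>F\<^esub> (t \<odot>\<^bsub>F\<^esub> basis_vector T (x, y))"
    by (rule coset_eqI; use assms kills_rel basis_in in \<open>auto simp: kills_relations_def Let_def\<close>)+
  then show "pure (t \<odot>\<^bsub>M\<^esub> x) y = t \<odot>\<^bsub>MN\<^esub> pure x y" "pure x (t \<odot>\<^bsub>N\<^esub> y) = t \<odot>\<^bsub>MN\<^esub> pure x y"
    unfolding pure_tensor_def using linear_mapD(3)[OF coset_linear _ basis_in] assms by simp_all
qed

text \<open>
  Sums of pure tensors suffice, because scalars can be moved into the first factor.
\<close>
lemma tensor_induct [consumes 1, case_names zero pure add]:
  assumes "X \<in> carrier MN" "P \<zero>\<^bsub>MN\<^esub>"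
    and "\<And>x y. x \<in> carrier M \<Longrightarrow> y \<in> carrier N \<Longrightarrow> P (pure x y)"
    and "\<And>X Y. X \<in> carrier MN \<Longrightarrow> Y \<in> carrier MN \<Longrightarrow> P X \<Longrightarrow> P Y \<Longrightarrow> P (X \<oplus>\<^bsub>MN\<^esub> Y)"
  shows "P X"
proof -
  have "P (rel +>\<^bsub>F\<^esub> \<phi>)" if "\<phi> \<in> carrier F" for \<phi>
    using that
  proof (induction rule: free_module_induct)
    case zero
    then show ?case using linear_map_zero[OF F.module_axioms module_tensor coset_linear] assms(2) by simp
  next
    case (basis \<phi> t z)
    obtain x y where z: "z = (x, y)" "x \<in> carrier M" "y \<in> carrier N" using basis(3) by auto
    have "rel +>\<^bsub>F\<^esub> (\<phi> \<oplus>\<^bsub>F\<^esub> t \<odot>\<^bsub>F\<^esub> basis_vector T z) = (rel +>\<^bsub>F\<^esub> \<phi>) \<oplus>\<^bsub>MN\<^esub> pure (t \<odot>\<^bsub>M\<^esub> x) y"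
      using linear_mapD[OF coset_linear] basis z basis_in pure_smult
      by (simp add: pure_tensor_def)
    then show ?case
      using assms(4)[OF linear_mapD(1)[OF coset_linear basis(1)] pure_closed basis(4) assms(3)] basis(2) z by simp
  qed
  then show ?thesis using assms(1) tensor_carrierE by blast
qed

definition bilinear :: "('a, 'd, 'n) module_scheme \<Rightarrow> ('b \<Rightarrow> 'c \<Rightarrow> 'd) \<Rightarrow> bool" where
  "bilinear P \<beta> \<longleftrightarrow>
     (\<forall>x\<in>carrier M. \<forall>y\<in>carrier N. \<beta> x y \<in> carrier P) \<and>
     (\<forall>x\<in>carrier M. \<forall>x'\<in>carrier M. \<forall>y\<in>carrier N. \<beta> (x \<oplus>\<^bsub>M\<^esub> x') y = \<beta> x y \<oplus>\<^bsub>P\<^esub> \<beta> x' y) \<and>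
     (\<forall>x\<in>carrier M. \<forall>y\<in>carrier N. \<forall>y'\<in>carrier N. \<beta> x (y \<oplus>\<^bsub>N\<^esub> y') = \<beta> x y \<oplus>\<^bsub>P\<^esub> \<beta> x y') \<and>
     (\<forall>t\<in>carrier T. \<forall>x\<in>carrier M. \<forall>y\<in>carrier N.
        \<beta> (t \<odot>\<^bsub>M\<^esub> x) y = t \<odot>\<^bsub>P\<^esub> \<beta> x y \<and> \<beta> x (t \<odot>\<^bsub>N\<^esub> y) = t \<odot>\<^bsub>P\<^esub> \<beta> x y)"

definition tensor_lift :: "('a, 'd, 'n) module_scheme \<Rightarrow> ('b \<Rightarrow> 'c \<Rightarrow> 'd) \<Rightarrow> ('b \<times> 'c \<Rightarrow> 'a) set \<Rightarrow> 'd" where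
  "tensor_lift P \<beta> X = free_lift P (\<lambda>z. \<beta> (fst z) (snd z)) (SOME \<phi>. \<phi> \<in> X)"

text \<open>
  The universal property of the tensor product: the kernel of the linear extension of a bilinear map is
  one of the submodules whose intersection is divided out.
\<close>
lemma tensor_lift:
  assumes P: "module T P" and \<beta>: "bilinear P \<beta>"
  shows "tensor_lift P \<beta> \<in> linear_map T MN P"
    and "x \<in> carrier M \<Longrightarrow> y \<in> carrier N \<Longrightarrow> tensor_lift P \<beta> (pure x y) = \<beta> x y"
proof -
  interpret P: module T P by fact
  let ?g = "\<lambda>z. \<beta> (fst z) (snd z)"
  let ?L = "free_lift P ?g"
  have g: "z \<in> carrier M \<times> carrier N \<Longrightarrow> ?g z \<in> carrier P" for z
    using \<beta> unfolding bilinear_def by auto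
  note L = free_lift_linear[where X = "carrier M \<times> carrier N" and g = ?g, OF P g]
  note lL = linear_mapD[OF L(1)] and lminus = linear_map_minus[OF F.module_axioms P L(1)]
  have Lb: "?L (basis_vector T (x, y)) = \<beta> x y" if "x \<in> carrier M" "y \<in> carrier N" for x y
    using L(2)[where z = "(x, y)"] that by simp
  have zero: "?L \<phi> = \<zero>\<^bsub>P\<^esub>" if "\<phi> \<in> rel" for \<phi>
  proof -
    let ?K = "{\<phi> \<in> carrier F. ?L \<phi> = \<zero>\<^bsub>P\<^esub>}"
    have "submodule ?K T F"
      by (rule F.submoduleI)
        (use lL linear_map_zero[OF F.module_axioms P L(1)] linear_map_neg[OF F.module_axioms P L(1)] in auto)
    moreover have "kills_relations ?K"
    proof -
      have K: "\<phi> \<ominus>\<^bsub>F\<^esub> \<psi> \<in> ?K" if "\<phi> \<in> carrier F" "\<psi> \<in> carrier F" "?L \<phi> = ?L \<psi>" for \<phi> \<psi>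
        using that lminus lL(1) by (auto simp: P.M.minus_eq_zero_iff)
      show ?thesis
        unfolding kills_relations_def Let_def
        by (intro conjI ballI; rule K)
          (use basis_in \<beta> in \<open>simp_all add: lL(2,3) Lb bilinear_def\<close>)
    qed
    ultimately show ?thesis using that unfolding rel_eq by blast
  qed
  have eq: "tensor_lift P \<beta> (rel +>\<^bsub>F\<^esub> \<phi>) = ?L \<phi>" if \<phi>: "\<phi> \<in> carrier F" for \<phi>
  proof -
    define \<psi> where "\<psi> = (SOME \<psi>. \<psi> \<in> rel +>\<^bsub>F\<^esub> \<phi>)"
    have "\<psi> \<in> rel +>\<^bsub>F\<^esub> \<phi>"
      unfolding \<psi>_def some_in_eq using F.coset_self[OF submodule_rel \<phi>] by blast
    then have \<psi>: "\<psi> \<in> carrier F" "\<psi> \<ominus>\<^bsub>F\<^esub> \<phi> \<in> rel" using F.coset_mem[OF submodule_rel \<phi>] by auto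
    have "?L \<psi> \<ominus>\<^bsub>P\<^esub> ?L \<phi> = \<zero>\<^bsub>P\<^esub>" using zero[OF \<psi>(2)] lminus \<psi>(1) \<phi> by simp
    then have "?L \<psi> = ?L \<phi>" using P.M.minus_eq_zero_iff lL(1) \<psi>(1) \<phi> by auto
    then show ?thesis unfolding tensor_lift_def \<psi>_def .
  qed
  show "tensor_lift P \<beta> \<in> linear_map T MN P"
    unfolding linear_map_def
  proof (intro CollectI conjI ballI)
    show "tensor_lift P \<beta> \<in> carrier MN \<rightarrow> carrier P" by (auto elim!: tensor_carrierE simp: eq lL(1))
  next
    fix X Y assume "X \<in> carrier MN" "Y \<in> carrier MN"
    then obtain \<phi> \<psi> where "\<phi> \<in> carrier F" "X = rel +>\<^bsub>F\<^esub> \<phi>" "\<psi> \<in> carrier F" "Y = rel +>\<^bsub>F\<^esub> \<psi>"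
      by (metis tensor_carrierE)
    then show "tensor_lift P \<beta> (X \<oplus>\<^bsub>MN\<^esub> Y) = tensor_lift P \<beta> X \<oplus>\<^bsub>P\<^esub> tensor_lift P \<beta> Y"
      using linear_mapD(2)[OF coset_linear, symmetric] by (simp add: eq lL(2))
  next
    fix t X assume "t \<in> carrier T" "X \<in> carrier MN"
    moreover then obtain \<phi> where "\<phi> \<in> carrier F" "X = rel +>\<^bsub>F\<^esub> \<phi>"
      by (metis tensor_carrierE)
    ultimately show "tensor_lift P \<beta> (t \<odot>\<^bsub>MN\<^esub> X) = t \<odot>\<^bsub>P\<^esub> tensor_lift P \<beta> X"
      using linear_mapD(3)[OF coset_linear, symmetric] by (simp add: eq lL(3))
  qed
  show "tensor_lift P \<beta> (pure x y) = \<beta> x y" if "x \<in> carrier M" "y \<in> carrier N"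
    using eq[OF basis_in[OF that]] Lb[OF that] by (simp add: pure_tensor_def)
qed

end

lemma tensor_map_linear:
  assumes "tensor_product T M N" "tensor_product T M' N" and f: "f \<in> linear_map T M M'"
  shows "tensor_map T M' N f \<in> linear_map T (tensor_module T M N) (tensor_module T M' N)"
    and "x \<in> carrier M \<Longrightarrow> y \<in> carrier N \<Longrightarrow>
      tensor_map T M' N f (pure_tensor T M N x y) = pure_tensor T M' N (f x) y"
proof -
  interpret A: tensor_product T M N by fact
  interpret B: tensor_product T M' N by fact
  have eq: "tensor_map T M' N f = A.tensor_lift B.MN (\<lambda>x y. B.pure (f x) y)"
    by (simp add: fun_eq_iff tensor_map_def A.tensor_lift_def A.free_lift_def Let_def)
  have "A.bilinear B.MN (\<lambda>x y. B.pure (f x) y)"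
    unfolding A.bilinear_def using linear_mapD[OF f]
    by (auto simp: B.pure_add_left B.pure_add_right B.pure_smult)
  then show "tensor_map T M' N f \<in> linear_map T A.MN B.MN"
    and "x \<in> carrier M \<Longrightarrow> y \<in> carrier N \<Longrightarrow> tensor_map T M' N f (A.pure x y) = B.pure (f x) y"
    unfolding eq using A.tensor_lift[OF B.module_tensor] by auto
qed

section \<open>Ideals as graded modules\<close>

text \<open>
  A decomposition is unique if there are additive projections to the summands.
\<close>
lemma (in module) direct_sum_decompositionI:
  assumes G: "\<And>u. additive_subgroup (G u) M"
    and p: "\<And>u x. x \<in> carrier M \<Longrightarrow> p u x \<in> G u"
      "\<And>u x y. x \<in> carrier M \<Longrightarrow> y \<in> carrier M \<Longrightarrow> p u (x \<oplus>\<^bsub>M\<^esub> y) = p u x \<oplus>\<^bsub>M\<^esub> p u y"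
      "\<And>u v x. x \<in> G v \<Longrightarrow> p u x = (if u = v then x else \<zero>\<^bsub>M\<^esub>)"
    and ex: "\<And>x. x \<in> carrier M \<Longrightarrow> \<exists>U. finite U \<and> (\<forall>u. u \<notin> U \<longrightarrow> p u x = \<zero>\<^bsub>M\<^esub>) \<and> x = (\<Oplus>\<^bsub>M\<^esub>u\<in>U. p u x)"
  shows "direct_sum_decomposition M G"
  unfolding direct_sum_decomposition_def
proof (intro conjI allI ballI)
  fix x assume x: "x \<in> carrier M"
  have Gc: "y \<in> G u \<Longrightarrow> y \<in> carrier M" for y u using additive_subgroup.a_subset[OF G] by blast
  have pz: "p u \<zero>\<^bsub>M\<^esub> = \<zero>\<^bsub>M\<^esub>" for u using p(3)[OF additive_subgroup.zero_closed[OF G]] by metis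
  have pc: "y \<in> carrier M \<Longrightarrow> p u y \<in> carrier M" for u y using p(1) Gc by blast
  have psum: "p v (\<Oplus>\<^bsub>M\<^esub>u\<in>U. f u) = (\<Oplus>\<^bsub>M\<^esub>u\<in>U. p v (f u))"
    if "finite U" "f \<in> U \<rightarrow> carrier M" for f v U
    using that
  proof (induction U)
    case (insert u U)
    then have c: "f \<in> U \<rightarrow> carrier M" "f u \<in> carrier M" "(\<Oplus>\<^bsub>M\<^esub>u\<in>U. f u) \<in> carrier M"
      by (auto intro!: M.finsum_closed)
    have "(\<lambda>u. p v (f u)) \<in> U \<rightarrow> carrier M" "p v (f u) \<in> carrier M" using c pc by auto
    then show ?case using insert c by (simp add: p(2))
  qed (simp add: pz)
  obtain U where U: "finite U" "\<And>u. u \<notin> U \<Longrightarrow> p u x = \<zero>\<^bsub>M\<^esub>" "x = (\<Oplus>\<^bsub>M\<^esub>u\<in>U. p u x)"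
    using ex[OF x] by blast
  show "\<exists>!f. (\<forall>u. f u \<in> G u) \<and> finite {u. f u \<noteq> \<zero>\<^bsub>M\<^esub>} \<and> x = (\<Oplus>\<^bsub>M\<^esub>u\<in>{u. f u \<noteq> \<zero>\<^bsub>M\<^esub>}. f u)"
  proof (rule ex1I)
    have sub: "{u. p u x \<noteq> \<zero>\<^bsub>M\<^esub>} \<subseteq> U" using U(2) by blast
    have "(\<Oplus>\<^bsub>M\<^esub>u\<in>U. p u x) = (\<Oplus>\<^bsub>M\<^esub>u\<in>{u. p u x \<noteq> \<zero>\<^bsub>M\<^esub>}. p u x)"
      by (rule M.add.finprod_mono_neutral_cong_right[OF U(1) sub]) (use pc[OF x] in auto)
    then show "(\<forall>u. p u x \<in> G u) \<and> finite {u. p u x \<noteq> \<zero>\<^bsub>M\<^esub>} \<and>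
        x = (\<Oplus>\<^bsub>M\<^esub>u\<in>{u. p u x \<noteq> \<zero>\<^bsub>M\<^esub>}. p u x)"
      using p(1)[OF x] U finite_subset[OF sub] by simp
  next
    fix f assume f: "(\<forall>u. f u \<in> G u) \<and> finite {u. f u \<noteq> \<zero>\<^bsub>M\<^esub>} \<and> x = (\<Oplus>\<^bsub>M\<^esub>u\<in>{u. f u \<noteq> \<zero>\<^bsub>M\<^esub>}. f u)"
    show "f = (\<lambda>u. p u x)"
    proof
      fix v
      let ?V = "{u. f u \<noteq> \<zero>\<^bsub>M\<^esub>}"
      have fc: "f u \<in> carrier M" for u using f Gc by blast
      have "p v x = p v (\<Oplus>\<^bsub>M\<^esub>u\<in>?V. f u)" using f by simp
      also have "\<dots> = (\<Oplus>\<^bsub>M\<^esub>u\<in>?V. p v (f u))" by (rule psum) (use f fc in auto)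
      also have "\<dots> = (\<Oplus>\<^bsub>M\<^esub>u\<in>?V. if v = u then f u else \<zero>\<^bsub>M\<^esub>)"
        by (rule M.finsum_cong') (use fc f p(3) in auto)
      also have "\<dots> = f v"
      proof (cases "v \<in> ?V")
        case True
        then show ?thesis using M.add.finprod_singleton[of v ?V f] f fc by simp
      next
        case False
        then have "(\<Oplus>\<^bsub>M\<^esub>u\<in>?V. if v = u then f u else \<zero>\<^bsub>M\<^esub>) = (\<Oplus>\<^bsub>M\<^esub>u\<in>?V. \<zero>\<^bsub>M\<^esub>)"
          by (intro M.finsum_cong') auto
        then show ?thesis using False by simp
      qed
      finally show "f v = p v x" ..
    qed
  qed
qed (rule G)

context graded_ring
begin

text \<open>
  The components of ring elements, indexed by integers like those of module elements.
\<close>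
definition icomp :: "int \<Rightarrow> 'a \<Rightarrow> 'a" where
  "icomp n t = (if n < 0 then \<zero> else hcomp T (rcomp T) (nat n) t)"

text \<open>
  The homogeneous ideal \<open>X\<close>, with degrees shifted by \<open>u\<close>, as a test object for graded injectivity.  A
  degree is described by the vanishing of all other components, which includes the negative degrees,
  where only 0 is left.
\<close>
definition ideal_with_shift :: "'a set \<Rightarrow> int \<Rightarrow> ('a, 'a + 'e) gmodule" where
  "ideal_with_shift X u = \<lparr>carrier = Inl ` X, monoid.mult = undefined, one = undefined,
     zero = Inl \<zero>, add = (\<lambda>x y. Inl (projl x \<oplus> projl y)), smult = (\<lambda>t x. Inl (t \<otimes> projl x)),
     mcomp = (\<lambda>v. Inl ` {x \<in> X. \<forall>n. n \<noteq> v - u \<longrightarrow> icomp n x = \<zero>})\<rparr>"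

lemma ideal_with_shift_simps [simp]:
  "carrier (ideal_with_shift X u) = Inl ` X" "zero (ideal_with_shift X u) = Inl \<zero>"
  "add (ideal_with_shift X u) (Inl x) (Inl y) = Inl (x \<oplus> y)"
  "smult (ideal_with_shift X u) t (Inl x) = Inl (t \<otimes> x)"
  "mcomp (ideal_with_shift X u) v = Inl ` {x \<in> X. \<forall>n. n \<noteq> v - u \<longrightarrow> icomp n x = \<zero>}"
  by (simp_all add: ideal_with_shift_def)

lemma icomp_closed [simp]: "t \<in> carrier T \<Longrightarrow> icomp n t \<in> carrier T"
  by (simp add: icomp_def)

lemma icomp_add: "t \<in> carrier T \<Longrightarrow> r \<in> carrier T \<Longrightarrow> icomp n (t \<oplus> r) = icomp n t \<oplus> icomp n r"
  by (simp add: icomp_def R.hcomp_add)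

lemma icomp_icomp: "t \<in> carrier T \<Longrightarrow> icomp n (icomp m t) = (if n = m then icomp m t else \<zero>)"
  by (auto simp: icomp_def R.hcomp_homogeneous[OF R.hcomp_in])

lemma icomp_homogeneous: "t \<in> rcomp T k \<Longrightarrow> icomp n t = (if n = int k then t else \<zero>)"
  by (auto simp: icomp_def R.hcomp_homogeneous)

lemma icomp_zero [simp]: "icomp n \<zero> = \<zero>"
  by (simp add: icomp_def)

lemma icomp_neg: 
  assumes "t \<in> carrier T"
  shows "icomp n (\<ominus> t) = \<ominus> icomp n t"
proof -
  have "icomp n (\<ominus> t) \<oplus> icomp n t = \<zero>" using icomp_add[of "\<ominus> t" t n] assms by (simp add: l_neg)
  then show ?thesis using assms by (simp add: minus_equality)
qed

lemma icomp_rcomp: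
  assumes "t \<in> carrier T" "\<And>n. n \<noteq> m \<Longrightarrow> icomp n t = \<zero>" "0 \<le> m"
  shows "t \<in> rcomp T (nat m)"
proof -
  have "hcomp T (rcomp T) k t = \<zero>" if "k \<noteq> nat m" for k
    using assms(2)[of "int k"] that by (auto simp: icomp_def split: if_splits)
  then have "t = (\<Oplus>k\<in>{nat m}. hcomp T (rcomp T) k t)" using assms(1) by (intro R.hcomp_sum) auto
  then show ?thesis using R.hcomp_in[OF assms(1), of "nat m"] R.G_carrier by (simp add: assms(1))
qed

lemma icomp_smult:
  assumes "r \<in> carrier T" "a \<in> rcomp T d"
  shows "icomp n (r \<otimes> a) = icomp (n - int d) r \<otimes> a"
proof -
  have a: "a \<in> carrier T" using assms R.G_carrier by blast
  note add = hcomp_additive_map[OF R.graded_group_axioms R.graded_group_axioms,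
      of "\<lambda>r. r \<otimes> a" "\<lambda>k. k + d" r]
  have 1: "hcomp T (rcomp T) (k + d) (r \<otimes> a) = hcomp T (rcomp T) k r \<otimes> a" for k
    by (rule add(1)) (use assms a mult_rcomp in \<open>auto simp: l_distr\<close>)
  have 2: "hcomp T (rcomp T) k (r \<otimes> a) = \<zero>" if "k \<notin> range (\<lambda>k. k + d)" for k
    by (rule add(2)) (use assms a mult_rcomp that in \<open>auto simp: l_distr\<close>)
  consider "n < 0" | "0 \<le> n" "n < int d" | "int d \<le> n" by linarith
  then show ?thesis
  proof cases
    case 1
    then show ?thesis using a by (simp add: icomp_def)
  next
    case c: 2
    then have "nat n \<notin> range (\<lambda>k. k + d)" by auto
    then show ?thesis using c a 2 by (simp add: icomp_def)
  next
    case 3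
    then have "nat n = nat (n - int d) + d" by auto
    then show ?thesis using 3 1[of "nat (n - int d)"] by (simp add: icomp_def)
  qed
qed

lemma graded_module_ideal_with_shift:
  fixes X :: "'a set" and u :: int
  assumes X: "X \<subseteq> carrier T" "\<zero> \<in> X" "\<And>x y. x \<in> X \<Longrightarrow> y \<in> X \<Longrightarrow> x \<oplus> y \<in> X"
    "\<And>t x. t \<in> carrier T \<Longrightarrow> x \<in> X \<Longrightarrow> t \<otimes> x \<in> X" "\<And>n x. x \<in> X \<Longrightarrow> icomp n x \<in> X"
  shows "graded_module T (ideal_with_shift X u :: ('a, 'a + 'e) gmodule)" (is "graded_module T ?M")
proof -
  have Xc [simp]: "x \<in> X \<Longrightarrow> x \<in> carrier T" for x using X(1) by blast
  have Xneg: "\<ominus> x \<in> X" if "x \<in> X" for x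
    using X(4)[of "\<ominus> \<one>" x] that by (simp add: l_minus)
  have "module T ?M"
  proof (intro moduleI abelian_groupI)
    fix x assume "x \<in> carrier ?M"
    then obtain y where "x = Inl y" "y \<in> X" by auto
    then show "\<exists>y\<in>carrier ?M. y \<oplus>\<^bsub>?M\<^esub> x = \<zero>\<^bsub>?M\<^esub>"
      by (intro bexI[of _ "Inl (\<ominus> y)"]) (auto simp: l_neg Xneg)
  qed (auto simp: is_cring X a_ac m_assoc l_distr r_distr)
  then interpret M: module T ?M .
  have neg: "\<ominus>\<^bsub>?M\<^esub> (Inl x) = Inl (\<ominus> x)" if "x \<in> X" for x
    by (rule M.M.minus_equality) (use that Xneg in \<open>auto simp: l_neg\<close>)
  have sub: "additive_subgroup (mcomp ?M v) ?M" for v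
  proof (intro additive_subgroup.intro M.M.add.subgroupI)
    show "mcomp ?M v \<noteq> {}" using X(2) by auto
    show "\<ominus>\<^bsub>?M\<^esub> x \<in> mcomp ?M v" if "x \<in> mcomp ?M v" for x
      using that Xneg by (auto simp: neg icomp_neg)
    show "x \<oplus>\<^bsub>?M\<^esub> y \<in> mcomp ?M v" if "x \<in> mcomp ?M v" "y \<in> mcomp ?M v" for x y
      using that X(3) by (auto simp: icomp_add)
  qed auto
  have "direct_sum_decomposition ?M (mcomp ?M)"
  proof (rule M.direct_sum_decompositionI[where p = "\<lambda>v x. Inl (icomp (v - u) (projl x))"])
    fix x assume "x \<in> carrier ?M"
    then obtain t where t: "x = Inl t" "t \<in> X" by auto
    let ?U = "{n. hcomp T (rcomp T) n t \<noteq> \<zero>}"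
    let ?g = "\<lambda>n. u + int n"
    have fin: "finite ?U" and sum: "t = (\<Oplus>n\<in>?U. hcomp T (rcomp T) n t)"
      using R.hcomp_spec[of t] t by auto
    have hX: "hcomp T (rcomp T) n t \<in> X" for n using X(5)[OF t(2), of "int n"] by (simp add: icomp_def)
    have *: "finite V \<Longrightarrow> (\<Oplus>\<^bsub>?M\<^esub>n\<in>V. Inl (hcomp T (rcomp T) n t)) = Inl (\<Oplus>n\<in>V. hcomp T (rcomp T) n t) \<and>
        (\<Oplus>n\<in>V. hcomp T (rcomp T) n t) \<in> X" for V
    proof (induction V rule: finite_induct)
      case (insert n V)
      have "(\<lambda>n. Inl (hcomp T (rcomp T) n t)) \<in> V \<rightarrow> carrier ?M" "Inl (hcomp T (rcomp T) n t) \<in> carrier ?M"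
        using hX by auto
      then show ?case using insert hX t(2) X(3) by simp
    qed (use X in auto)
    have "x = (\<Oplus>\<^bsub>?M\<^esub>n\<in>?U. Inl (hcomp T (rcomp T) n t))" using * fin sum t by simp
    also have "\<dots> = (\<Oplus>\<^bsub>?M\<^esub>n\<in>?U. Inl (icomp (?g n - u) (projl x)))"
      by (rule M.M.finsum_cong') (use t hX in \<open>auto simp: icomp_def\<close>)
    also have "\<dots> = (\<Oplus>\<^bsub>?M\<^esub>v\<in>?g ` ?U. Inl (icomp (v - u) (projl x)))"
      by (rule M.M.finsum_reindex[symmetric]) (use t hX in \<open>auto simp: icomp_def inj_on_def\<close>)
    finally have "x = (\<Oplus>\<^bsub>?M\<^esub>v\<in>?g ` ?U. Inl (icomp (v - u) (projl x)))" .
    moreover have "icomp (v - u) (projl x) = \<zero>" if "v \<notin> ?g ` ?U" for v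
    proof (rule ccontr)
      assume c: "icomp (v - u) (projl x) \<noteq> \<zero>"
      then have "0 \<le> v - u" "hcomp T (rcomp T) (nat (v - u)) t \<noteq> \<zero>" using t by (auto simp: icomp_def split: if_splits)
      then show False using that by (auto intro!: image_eqI[of _ _ "nat (v - u)"])
    qed
    ultimately show "\<exists>U. finite U \<and> (\<forall>v. v \<notin> U \<longrightarrow> (Inl (icomp (v - u) (projl x)) :: 'a + 'e) = \<zero>\<^bsub>?M\<^esub>) \<and>
        x = (\<Oplus>\<^bsub>?M\<^esub>v\<in>U. Inl (icomp (v - u) (projl x)))"
      using fin by (intro exI[of _ "?g ` ?U"]) auto
  next
    fix v w x assume "x \<in> mcomp ?M w"
    then obtain t where t: "x = Inl t" "t \<in> X" "\<And>n. n \<noteq> w - u \<Longrightarrow> icomp n t = \<zero>" by auto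
    have "icomp (w - u) t = t"
    proof (cases "0 \<le> w - u")
      case True
      then show ?thesis using icomp_homogeneous[OF icomp_rcomp[of t "w - u"], of "w - u"] t by auto
    next
      case False
      then have "hcomp T (rcomp T) n t = \<zero>" for n using t(3)[of "int n"] by (simp add: icomp_def)
      then have "t = \<zero>" using R.hcomp_ext[of t \<zero>] t(2) by simp
      then show ?thesis by simp
    qed
    then show "Inl (icomp (v - u) (projl x)) = (if v = w then x else \<zero>\<^bsub>?M\<^esub>)" using t by auto
  qed (use sub X(5) in \<open>auto simp: icomp_icomp icomp_add\<close>)
  moreover have "t \<odot>\<^bsub>?M\<^esub> x \<in> mcomp ?M (int n + v)" if t: "t \<in> rcomp T n" "x \<in> mcomp ?M v" for t n x v
  proof -
    obtain r where r: "x = Inl r" "r \<in> X" "\<And>n. n \<noteq> v - u \<Longrightarrow> icomp n r = \<zero>" using t by auto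
    have "icomp m (t \<otimes> r) = \<zero>" if "m \<noteq> int n + v - u" for m
      using icomp_smult[OF _ t(1), of r m] r t(1) that R.G_carrier by (simp add: m_comm)
    then show ?thesis using r X(4) t(1) R.G_carrier by auto
  qed
  ultimately show ?thesis
    by (intro graded_module.intro graded_module_axioms.intro graded_ring_axioms M.module_axioms)
qed

end

section \<open>The graded Baer condition\<close>

text \<open>
  The ideals \<open>(a : s\<^sup>m)\<close> form an ascending chain.
\<close>
lemma (in noetherian_ring) colon_stabilizes:
  assumes "ideal a R" "s \<in> carrier R" "cring R"
  obtains m where "\<And>t. t \<in> carrier R \<Longrightarrow> s [^] Suc m \<otimes> t \<in> a \<Longrightarrow> s [^] (m::nat) \<otimes> t \<in> a"
proof -
  interpret cring R by fact
  interpret a: ideal a R by fact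
  define Q where "Q m = {t \<in> carrier R. s [^] (m::nat) \<otimes> t \<in> a}" for m
  have step: "Q m \<subseteq> Q (Suc m)" for m
  proof
    fix t assume "t \<in> Q m"
    then have "s \<otimes> (s [^] m \<otimes> t) \<in> a" "t \<in> carrier R"
      using a.I_l_closed assms(2) unfolding Q_def by auto
    then show "t \<in> Q (Suc m)" using assms(2) unfolding Q_def by (simp add: m_ac)
  qed
  have mono: "m \<le> n \<Longrightarrow> Q m \<subseteq> Q n" for m n by (rule lift_Suc_mono_le[of Q]) (use step in auto)
  have ideal: "ideal (Q m) R" for m
  proof (rule idealI)
    show "subgroup (Q m) (add_monoid R)"
    proof (rule add.subgroupI)
      show "Q m \<noteq> {}" unfolding Q_def using assms(2) by (auto intro!: exI[of _ \<zero>])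
    qed (use assms(2) in \<open>auto simp: Q_def r_minus r_distr\<close>)
    fix t x assume "t \<in> Q m" "x \<in> carrier R"
    then have "x \<otimes> (s [^] m \<otimes> t) \<in> a" "t \<in> carrier R" unfolding Q_def using a.I_l_closed by auto
    then show "x \<otimes> t \<in> Q m" "t \<otimes> x \<in> Q m"
      unfolding Q_def using assms(2) \<open>x \<in> carrier R\<close> by (simp_all add: m_ac)
  qed (rule ring_axioms)
  have "subset.chain {I. ideal I R} (range Q)"
    unfolding subset_chain_def using ideal mono nat_le_linear by blast
  then have "\<Union>(range Q) \<in> range Q" by (intro ideal_chain_is_trivial) auto
  then obtain m where "\<Union>(range Q) = Q m" by auto
  then have "Q (Suc m) \<subseteq> Q m" by blast
  then show ?thesis using that[of m] unfolding Q_def by auto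
qed

lemmas (in graded_ring) ring_subgroupI = add.subgroupI and ring_r_neg = r_neg and ring_a_ac = a_ac

context graded_module
begin

lemma hcomp_smult:
  assumes "t \<in> rcomp T k" "x \<in> carrier M"
  shows "hcomp M (mcomp M) (int k + u) (t \<odot> x) = t \<odot> hcomp M (mcomp M) u x"
  by (rule hcomp_additive_map(1)[OF G.graded_group_axioms G.graded_group_axioms,
        of "\<lambda>x. t \<odot> x" "\<lambda>u. int k + u" x])
    (use assms R.G_carrier smult_mcomp in \<open>auto simp: smult_r_distr inj_on_def\<close>)

lemma hcomp_smult_homogeneous:
  assumes "r \<in> carrier T" "z \<in> mcomp M e"
  shows "hcomp M (mcomp M) v (r \<odot> z) = icomp (v - e) r \<odot> z"
proof -
  have z: "z \<in> carrier M" using assms G.G_carrier by blast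
  note add = hcomp_additive_map[OF R.graded_group_axioms G.graded_group_axioms,
      of "\<lambda>r. r \<odot> z" "\<lambda>k. int k + e" r]
  have 1: "hcomp M (mcomp M) (int k + e) (r \<odot> z) = hcomp T (rcomp T) k r \<odot> z" for k
    by (rule add(1)) (use assms z smult_mcomp in \<open>auto simp: smult_l_distr inj_on_def\<close>)
  have 2: "hcomp M (mcomp M) v (r \<odot> z) = \<zero>" if "v \<notin> range (\<lambda>k. int k + e)" for v
    by (rule add(2)) (use assms z smult_mcomp that in \<open>auto simp: smult_l_distr inj_on_def\<close>)
  show ?thesis
  proof (cases "0 \<le> v - e")
    case True
    then have "v = int (nat (v - e)) + e" by simp
    then show ?thesis using 1[of "nat (v - e)"] True by (simp add: icomp_def)
  next
    case False
    then have "v \<notin> range (\<lambda>k. int k + e)" by auto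
    then show ?thesis using 2 False z by (simp add: icomp_def)
  qed
qed

text \<open>
  A homomorphism of degree \<open>u\<close> from a homogeneous ideal to \<open>M\<close>, described by its graph: a graded
  submodule of the direct sum of \<open>T\<close> and \<open>M\<close> shifted by \<open>u\<close>.  The graph is a convenient description,
  as sums of ideals and quotients need no well-definedness proof before
  \<open>single_valued_relation\<close> is known.
\<close>
definition graded_relation :: "int \<Rightarrow> ('a \<times> 'b) set \<Rightarrow> bool" where
  "graded_relation u \<R> \<longleftrightarrow> \<R> \<subseteq> carrier T \<times> carrier M \<and> (\<zero>\<^bsub>T\<^esub>, \<zero>) \<in> \<R> \<and>
     (\<forall>t y r z. (t, y) \<in> \<R> \<longrightarrow> (r, z) \<in> \<R> \<longrightarrow> (t \<oplus>\<^bsub>T\<^esub> r, y \<oplus> z) \<in> \<R>) \<and>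
     (\<forall>a\<in>carrier T. \<forall>t y. (t, y) \<in> \<R> \<longrightarrow> (a \<otimes>\<^bsub>T\<^esub> t, a \<odot> y) \<in> \<R>) \<and>
     (\<forall>t y n. (t, y) \<in> \<R> \<longrightarrow> (icomp n t, hcomp M (mcomp M) (n + u) y) \<in> \<R>)"

lemma graded_relationD:
  assumes "graded_relation u \<R>"
  shows "(t, y) \<in> \<R> \<Longrightarrow> t \<in> carrier T" "(t, y) \<in> \<R> \<Longrightarrow> y \<in> carrier M" "(\<zero>\<^bsub>T\<^esub>, \<zero>) \<in> \<R>"
    "(t, y) \<in> \<R> \<Longrightarrow> (r, z) \<in> \<R> \<Longrightarrow> (t \<oplus>\<^bsub>T\<^esub> r, y \<oplus> z) \<in> \<R>"
    "a \<in> carrier T \<Longrightarrow> (t, y) \<in> \<R> \<Longrightarrow> (a \<otimes>\<^bsub>T\<^esub> t, a \<odot> y) \<in> \<R>"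
    "(t, y) \<in> \<R> \<Longrightarrow> (icomp n t, hcomp M (mcomp M) (n + u) y) \<in> \<R>"
  using assms unfolding graded_relation_def by auto

definition single_valued_relation :: "('a \<times> 'b) set \<Rightarrow> bool" where
  "single_valued_relation \<R> \<longleftrightarrow> (\<forall>y. (\<zero>\<^bsub>T\<^esub>, y) \<in> \<R> \<longrightarrow> y = \<zero>)"

lemma single_valued_relationD:
  assumes "graded_relation u \<R>" "single_valued_relation \<R>" "(t, y) \<in> \<R>" "(t, z) \<in> \<R>"
  shows "y = z"
proof -
  note D = graded_relationD[OF assms(1)]
  have c: "t \<in> carrier T" "y \<in> carrier M" "z \<in> carrier M" using D assms by auto
  have "(\<ominus>\<^bsub>T\<^esub> \<one>\<^bsub>T\<^esub> \<otimes>\<^bsub>T\<^esub> t, (\<ominus>\<^bsub>T\<^esub> \<one>\<^bsub>T\<^esub>) \<odot> z) \<in> \<R>" using D(5)[OF _ assms(4)] by simp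
  then have "(t \<oplus>\<^bsub>T\<^esub> (\<ominus>\<^bsub>T\<^esub> \<one>\<^bsub>T\<^esub> \<otimes>\<^bsub>T\<^esub> t), y \<oplus> (\<ominus>\<^bsub>T\<^esub> \<one>\<^bsub>T\<^esub>) \<odot> z) \<in> \<R>" using D(4)[OF assms(3)] by blast
  then have "(\<zero>\<^bsub>T\<^esub>, y \<ominus> z) \<in> \<R>"
    using c by (simp add: smult_l_minus a_minus_def l_minus ring_r_neg)
  then show ?thesis using assms(2) c M.minus_eq_zero_iff unfolding single_valued_relation_def by blast
qed

text \<open>
  The graded Baer condition for a graded submodule of \<open>M\<close>.  It is stated for submodules of a fixed module
  because the torsion submodules of one injective module are compared in the proof of acyclicity.
\<close>
definition baer :: "'b set \<Rightarrow> bool" where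
  "baer N \<longleftrightarrow> submodule N T M \<and> (\<forall>y\<in>N. \<forall>u. hcomp M (mcomp M) u y \<in> N) \<and>
     (\<forall>u \<R>. graded_relation u \<R> \<longrightarrow> single_valued_relation \<R> \<longrightarrow> \<R> \<subseteq> carrier T \<times> N \<longrightarrow>
        (\<exists>x\<in>N \<inter> mcomp M u. \<forall>(t, y)\<in>\<R>. y = t \<odot> x))"

lemma baerD:
  assumes "baer N"
  shows "submodule N T M" "y \<in> N \<Longrightarrow> hcomp M (mcomp M) u y \<in> N"
    "graded_relation u \<R> \<Longrightarrow> single_valued_relation \<R> \<Longrightarrow> (\<And>t y. (t, y) \<in> \<R> \<Longrightarrow> y \<in> N) \<Longrightarrow>
       \<exists>x\<in>N \<inter> mcomp M u. \<forall>t y. (t, y) \<in> \<R> \<longrightarrow> y = t \<odot> x"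
proof -
  show "submodule N T M" "y \<in> N \<Longrightarrow> hcomp M (mcomp M) u y \<in> N"
    using assms unfolding baer_def by auto
  assume a: "graded_relation u \<R>" "single_valued_relation \<R>" "\<And>t y. (t, y) \<in> \<R> \<Longrightarrow> y \<in> N"
  then have "\<R> \<subseteq> carrier T \<times> N" using graded_relationD(1)[OF a(1)] by auto
  then have "\<exists>x\<in>N \<inter> mcomp M u. \<forall>(t, y)\<in>\<R>. y = t \<odot> x" using assms a unfolding baer_def by simp
  then show "\<exists>x\<in>N \<inter> mcomp M u. \<forall>t y. (t, y) \<in> \<R> \<longrightarrow> y = t \<odot> x" by auto
qed

lemma mcomp_concentrated:
  assumes "y \<in> carrier M" "\<And>w. w \<noteq> v \<Longrightarrow> hcomp M (mcomp M) w y = \<zero>"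
  shows "y \<in> mcomp M v"
proof -
  have "y = (\<Oplus>w\<in>{v}. hcomp M (mcomp M) w y)" using assms by (intro G.hcomp_sum) auto
  then show ?thesis using G.hcomp_in[OF assms(1), of v] assms(1) by simp
qed

lemma submodule_carrier: "submodule (carrier M) T M"
  by (rule carrier_is_submodule)

end

text \<open>
  The domain of a relation and \<open>T\<close>, both shifted, are test objects for injectivity; the element sought is
  the image of 1 under the extension of the homomorphism.
\<close>
theorem graded_injective_baer:
  fixes E :: "('a, 'e) gmodule"
  assumes inj: "graded_injective T E"
  shows "graded_module.baer T E (carrier E)"
proof -
  interpret E: graded_module T E using inj unfolding graded_injective_def by blast
  have "\<exists>x\<in>carrier E \<inter> mcomp E u. \<forall>(t, y)\<in>\<R>. y = t \<odot>\<^bsub>E\<^esub> x"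
    if R: "E.graded_relation u \<R>" "E.single_valued_relation \<R>" for u \<R>
  proof -
    note D = E.graded_relationD[OF R(1)] and S = E.single_valued_relationD[OF R]
    let ?X = "fst ` \<R>"
    let ?M = "E.ideal_with_shift ?X u :: ('a, 'a + 'e) gmodule"
    let ?N = "E.ideal_with_shift (carrier T) u :: ('a, 'a + 'e) gmodule"
    have X: "?X \<subseteq> carrier T" using D(1) by auto
    have M: "graded_module T ?M"
    proof (rule E.graded_module_ideal_with_shift[OF X])
      show "\<zero>\<^bsub>T\<^esub> \<in> ?X" using D(3) by (force)
      show "x \<oplus>\<^bsub>T\<^esub> y \<in> ?X" if "x \<in> ?X" "y \<in> ?X" for x y
        using that D(4) by (auto simp: image_iff) (metis fst_conv)
      show "t \<otimes>\<^bsub>T\<^esub> x \<in> ?X" if "t \<in> carrier T" "x \<in> ?X" for t x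
        using that D(5)[OF that(1)] by (auto simp: image_iff) (metis fst_conv)
      show "E.icomp n x \<in> ?X" if "x \<in> ?X" for n x
        using that D(6) by (auto simp: image_iff) (metis fst_conv)
    qed
    have N: "graded_module T ?N"
      by (rule E.graded_module_ideal_with_shift) auto
    have id: "id \<in> graded_hom T ?M ?N" "inj_on id (carrier ?M)"
      unfolding graded_hom_def using X by auto
    define g where "g x = (THE y. (projl x, y) \<in> \<R>)" for x :: "'a + 'e"
    have g: "g (Inl t) = y" if "(t, y) \<in> \<R>" for t y
      unfolding g_def using that S by auto
    have deg: "g x \<in> mcomp E v" if x: "x \<in> mcomp ?M v" for x v
    proof -
      obtain t where t1: "x = Inl t" "t \<in> ?X" "\<And>n. n \<noteq> v - u \<Longrightarrow> E.icomp n t = \<zero>\<^bsub>T\<^esub>"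
        using x unfolding E.ideal_with_shift_simps by blast
      then obtain y where t: "x = Inl t" "(t, y) \<in> \<R>" "\<And>n. n \<noteq> v - u \<Longrightarrow> E.icomp n t = \<zero>\<^bsub>T\<^esub>"
        by auto
      have "y \<in> mcomp E v"
      proof (rule E.mcomp_concentrated)
        show "y \<in> carrier E" using D(2) t(2) .
        fix w assume "w \<noteq> v"
        then have "(\<zero>\<^bsub>T\<^esub>, hcomp E (mcomp E) (w - u + u) y) \<in> \<R>"
          using D(6)[OF t(2), of "w - u"] t(3)[of "w - u"] by simp
        then show "hcomp E (mcomp E) w y = \<zero>\<^bsub>E\<^esub>" using S D(3) by simp
      qed
      then show ?thesis using g t by simp
    qed
    have "g \<in> graded_hom T ?M E"
      unfolding graded_hom_def
    proof (intro CollectI conjI ballI allI)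
      show "g \<in> carrier ?M \<rightarrow> carrier E" using g D(2) by auto
      show "g (x \<oplus>\<^bsub>?M\<^esub> y) = g x \<oplus>\<^bsub>E\<^esub> g y" if "x \<in> carrier ?M" "y \<in> carrier ?M" for x y
        using that g D(4) by auto
      show "g (t \<odot>\<^bsub>?M\<^esub> x) = t \<odot>\<^bsub>E\<^esub> g x" if "t \<in> carrier T" "x \<in> carrier ?M" for t x
        using that g D(5) by auto
      show "g ` mcomp ?M v \<subseteq> mcomp E v" for v using deg by blast
    qed
    then obtain h where h: "h \<in> graded_hom T ?N E" "\<And>x. x \<in> carrier ?M \<Longrightarrow> h (id x) = g x"
      using inj M N id unfolding graded_injective_def by meson
    have hl: "h \<in> linear_map T ?N E" using h(1) unfolding graded_hom_def linear_map_def by blast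
    have "Inl \<one>\<^bsub>T\<^esub> \<in> mcomp ?N u" using E.icomp_homogeneous[OF E.one_rcomp] by auto
    then have x: "h (Inl \<one>\<^bsub>T\<^esub>) \<in> mcomp E u" using h(1) unfolding graded_hom_def by blast
    have "y = t \<odot>\<^bsub>E\<^esub> h (Inl \<one>\<^bsub>T\<^esub>)" if "(t, y) \<in> \<R>" for t y
    proof -
      have t: "t \<in> carrier T" using D(1)[OF that] .
      have "h (Inl t) = y" using h(2)[of "Inl t"] g[OF that] that by force
      then show ?thesis using linear_mapD(3)[OF hl t, of "Inl \<one>\<^bsub>T\<^esub>"] t by simp
    qed
    then show ?thesis using x E.G.G_carrier by blast
  qed
  then show ?thesis
    unfolding E.baer_def using E.submodule_carrier by auto
qed

locale noetherian_graded_module = graded_module T M + noetherian_ring T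
  for T :: "'a gring" and M :: "('a, 'b) gmodule" (structure)
begin

definition torsion :: "'a set \<Rightarrow> 'b set" where
  "torsion S = {x \<in> carrier M. \<exists>s\<in>S. s \<odot> x = \<zero>}"

lemma pow_mem:
  assumes "multiplicative_set T S" "s \<in> S"
  shows "s [^]\<^bsub>T\<^esub> (n::nat) \<in> S"
  by (induction n) (use multiplicative_setD[OF assms(1)] assms(2) in auto)

text \<open>
  Extend \<open>r s\<^sup>m\<^sup>+\<^sup>1 \<mapsto> r s\<^sup>m y\<close> to \<open>T\<close>, where \<open>m\<close> is such that \<open>s\<^sup>m\<^sup>+\<^sup>1 r = 0\<close> implies \<open>s\<^sup>m r = 0\<close>.
\<close>
lemma baer_divisible_homogeneous:
  assumes N: "baer N" and S: "multiplicative_set T S"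
    and s: "s \<in> S" "s \<in> rcomp T k" and y: "y \<in> N" "y \<in> mcomp M (int k + u)"
  shows "\<exists>x\<in>N \<inter> mcomp M u. \<exists>w\<in>S. w \<odot> (s \<odot> x) = w \<odot> y"
proof -
  have sc: "s \<in> carrier T" using s R.G_carrier by blast
  have yc: "y \<in> carrier M" using y G.G_carrier by blast
  have "ideal {\<zero>\<^bsub>T\<^esub>} T" by (rule zeroideal)
  then obtain m where m: "\<And>t. t \<in> carrier T \<Longrightarrow> s [^]\<^bsub>T\<^esub> Suc m \<otimes>\<^bsub>T\<^esub> t \<in> {\<zero>\<^bsub>T\<^esub>} \<Longrightarrow> s [^]\<^bsub>T\<^esub> (m::nat) \<otimes>\<^bsub>T\<^esub> t \<in> {\<zero>\<^bsub>T\<^esub>}"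
    using colon_stabilizes sc is_cring by blast
  let ?a = "s [^]\<^bsub>T\<^esub> Suc m" and ?z = "s [^]\<^bsub>T\<^esub> m \<odot> y"
  have a: "?a \<in> rcomp T (Suc m * k)" using nat_pow_rcomp[OF s(2)] .
  have z: "?z \<in> mcomp M (int (m * k) + (int k + u))" using smult_mcomp[OF nat_pow_rcomp[OF s(2)] y(2)] .
  have ac: "?a \<in> carrier T" "?z \<in> carrier M" using sc yc by auto
  define \<R> where "\<R> = {(r \<otimes>\<^bsub>T\<^esub> ?a, r \<odot> ?z) | r. r \<in> carrier T}"
  have RI: "(r \<otimes>\<^bsub>T\<^esub> ?a, r \<odot> ?z) \<in> \<R>" if "r \<in> carrier T" for r using that unfolding \<R>_def by blast
  have "graded_relation u \<R>"
    unfolding graded_relation_def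
  proof (intro conjI allI ballI impI)
    show "\<R> \<subseteq> carrier T \<times> carrier M" unfolding \<R>_def using ac by auto
    show "(\<zero>\<^bsub>T\<^esub>, \<zero>) \<in> \<R>" using RI[of "\<zero>\<^bsub>T\<^esub>"] ac by simp
    show "(t \<oplus>\<^bsub>T\<^esub> r, x \<oplus> x') \<in> \<R>" if h: "(t, x) \<in> \<R>" "(r, x') \<in> \<R>" for t x r x'
    proof -
      obtain p q where "t = p \<otimes>\<^bsub>T\<^esub> ?a" "x = p \<odot> ?z" "r = q \<otimes>\<^bsub>T\<^esub> ?a" "x' = q \<odot> ?z"
        and pq: "p \<in> carrier T" "q \<in> carrier T" using h unfolding \<R>_def by auto
      then show ?thesis using RI[of "p \<oplus>\<^bsub>T\<^esub> q"] ac by (simp add: l_distr smult_l_distr)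
    qed
    show "(b \<otimes>\<^bsub>T\<^esub> t, b \<odot> x) \<in> \<R>" if b: "b \<in> carrier T" and h: "(t, x) \<in> \<R>" for b t x
    proof -
      obtain p where "t = p \<otimes>\<^bsub>T\<^esub> ?a" "x = p \<odot> ?z" "p \<in> carrier T" using h unfolding \<R>_def by auto
      then show ?thesis using RI[of "b \<otimes>\<^bsub>T\<^esub> p"] ac b by (simp add: m_assoc smult_assoc1)
    qed
    show "(icomp n t, hcomp M (mcomp M) (n + u) x) \<in> \<R>" if h: "(t, x) \<in> \<R>" for t x n
    proof -
      obtain p where p: "t = p \<otimes>\<^bsub>T\<^esub> ?a" "x = p \<odot> ?z" "p \<in> carrier T" using h unfolding \<R>_def by auto
      have "n + u - (int (m * k) + (int k + u)) = n - int (Suc m * k)" by (simp add: algebra_simps)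
      then have "hcomp M (mcomp M) (n + u) x = icomp (n - int (Suc m * k)) p \<odot> ?z"
        using hcomp_smult_homogeneous[OF p(3) z, of "n + u"] p(2) by metis
      moreover have "icomp n t = icomp (n - int (Suc m * k)) p \<otimes>\<^bsub>T\<^esub> ?a"
        using icomp_smult[OF p(3) a, of n] p(1) by metis
      ultimately show ?thesis using RI[of "icomp (n - int (Suc m * k)) p"] p(3) by simp
    qed
  qed
  moreover have "single_valued_relation \<R>"
    unfolding single_valued_relation_def
  proof (intro allI impI)
    fix x assume "(\<zero>\<^bsub>T\<^esub>, x) \<in> \<R>"
    then obtain p where p: "p \<otimes>\<^bsub>T\<^esub> ?a = \<zero>\<^bsub>T\<^esub>" "x = p \<odot> ?z" "p \<in> carrier T" unfolding \<R>_def by auto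
    then have "s [^]\<^bsub>T\<^esub> m \<otimes>\<^bsub>T\<^esub> p = \<zero>\<^bsub>T\<^esub>" using m[of p] ac(1) m_comm[of p ?a] by simp
    then have "(s [^]\<^bsub>T\<^esub> m \<otimes>\<^bsub>T\<^esub> p) \<odot> y = \<zero>" using yc by simp
    then show "x = \<zero>" using p sc yc smult_lcomm[of p "s [^]\<^bsub>T\<^esub> m" y] by (simp add: smult_assoc1)
  qed
  moreover have "x \<in> N" if "(t, x) \<in> \<R>" for t x
    using that submoduleE(4)[OF baerD(1)[OF N]] y(1) sc unfolding \<R>_def by auto
  ultimately obtain x where x: "x \<in> N \<inter> mcomp M u" "\<And>t y. (t, y) \<in> \<R> \<Longrightarrow> y = t \<odot> x"
    using baerD(3)[OF N] by blast
  have xc: "x \<in> carrier M" using x G.G_carrier by blast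
  have "?z = ?a \<odot> x" using x(2)[OF RI[of "\<one>\<^bsub>T\<^esub>"]] ac by simp
  then have "s [^]\<^bsub>T\<^esub> m \<odot> (s \<odot> x) = s [^]\<^bsub>T\<^esub> m \<odot> y" using sc xc by (simp add: smult_assoc1)
  then show ?thesis using x(1) pow_mem[OF S s(1)] by blast
qed

text \<open>
  The localization map is onto: \<open>y/s = x/1\<close>.
\<close>
lemma baer_divisible:
  assumes N: "baer N" and S: "multiplicative_set T S"
    and s: "s \<in> S" "s \<in> rcomp T k" and y: "y \<in> N" "y \<in> part M (shift k D)"
  shows "\<exists>x\<in>N \<inter> part M D. \<exists>w\<in>S. w \<odot> (s \<odot> x) = w \<odot> y"
proof (cases D)
  case (Some u)
  then show ?thesis using baer_divisible_homogeneous[OF assms(1-5), of u] y(2) by simp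
next
  case None
  note Nsub = submoduleE[OF baerD(1)[OF N]] and Sc = multiplicative_setD[OF S]
  have sc: "s \<in> carrier T" using s R.G_carrier by blast
  have yc: "y \<in> carrier M" using y Nsub by blast
  let ?H = "{y \<in> carrier M. \<exists>x\<in>N. \<exists>w\<in>S. w \<odot> (s \<odot> x) = w \<odot> y}"
  have comp: "hcomp M (mcomp M) v y \<in> ?H" for v
    using baer_divisible_homogeneous[OF N S s, of "hcomp M (mcomp M) v y" "v - int k"]
      baerD(2)[OF N y(1)] G.hcomp_in[OF yc] yc by auto
  let ?U = "{u. hcomp M (mcomp M) u y \<noteq> \<zero>}"
  have "(\<Oplus>u\<in>?U. hcomp M (mcomp M) u y) \<in> ?H"
  proof (rule finsum_closed_subset)
    show "\<zero> \<in> ?H" using submodule_zero[OF module_axioms baerD(1)[OF N]] Sc(3) sc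
      by (auto intro!: bexI[of _ \<zero>] bexI[of _ "\<one>\<^bsub>T\<^esub>"])
    show "y \<oplus> y' \<in> ?H" if H: "y \<in> ?H" "y' \<in> ?H" for y y'
    proof -
      obtain x w x' w' where x: "x \<in> N" "w \<in> S" "w \<odot> (s \<odot> x) = w \<odot> y" "y \<in> carrier M"
        and x': "x' \<in> N" "w' \<in> S" "w' \<odot> (s \<odot> x') = w' \<odot> y'" "y' \<in> carrier M" using H by blast
      have c: "x \<in> carrier M" "x' \<in> carrier M" "w \<in> carrier T" "w' \<in> carrier T" using x x' Nsub(1) Sc by auto
      have 1: "w' \<odot> (w \<odot> (s \<odot> x)) = w' \<odot> (w \<odot> y)" "w \<odot> (w' \<odot> (s \<odot> x')) = w \<odot> (w' \<odot> y')"
        using x x' by simp_all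
      have "(w \<otimes>\<^bsub>T\<^esub> w') \<odot> (s \<odot> (x \<oplus> x')) = (w \<otimes>\<^bsub>T\<^esub> w') \<odot> (y \<oplus> y')"
        using 1 c sc x(4) x'(4) by (simp add: smult_assoc1 smult_r_distr smult_lcomm)
      then show ?thesis using x x' Sc(4) Nsub(5) by blast
    qed
  qed (use comp G.hcomp_spec[OF yc] in auto)
  then have "y \<in> ?H" using G.hcomp_spec[OF yc] by simp
  then show ?thesis using None Nsub(1) by auto
qed

lemma submodule_torsion:
  assumes S: "multiplicative_set T S"
  shows "submodule (torsion S) T M"
proof (rule submoduleI)
  note Sc = multiplicative_setD[OF S]
  show "torsion S \<subseteq> carrier M" unfolding torsion_def by auto
  show "\<zero> \<in> torsion S" unfolding torsion_def using Sc by (auto intro!: bexI[of _ "\<one>\<^bsub>T\<^esub>"])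
  show "\<ominus> x \<in> torsion S" if "x \<in> torsion S" for x
    using that Sc unfolding torsion_def by (auto simp: smult_r_minus intro!: bexI)
  show "x \<oplus> y \<in> torsion S" if xy: "x \<in> torsion S" "y \<in> torsion S" for x y
  proof -
    obtain s t where s: "s \<in> S" "s \<odot> x = \<zero>" "t \<in> S" "t \<odot> y = \<zero>" "x \<in> carrier M" "y \<in> carrier M"
      using xy unfolding torsion_def by auto
    have "(s \<otimes>\<^bsub>T\<^esub> t) \<odot> (x \<oplus> y) = t \<odot> (s \<odot> x) \<oplus> s \<odot> (t \<odot> y)"
      using s Sc(1) smult_lcomm[of s t x] by (simp add: smult_assoc1 smult_r_distr del: s(2,4))
    then have "(s \<otimes>\<^bsub>T\<^esub> t) \<odot> (x \<oplus> y) = \<zero>" using s Sc(1) by simp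
    then show ?thesis unfolding torsion_def using s Sc(4) by blast
  qed
  show "a \<odot> x \<in> torsion S" if a: "a \<in> carrier T" and x: "x \<in> torsion S" for a x
  proof -
    obtain s where s: "s \<in> S" "s \<odot> x = \<zero>" "x \<in> carrier M" using x unfolding torsion_def by auto
    then have "s \<odot> (a \<odot> x) = \<zero>" using smult_lcomm[of s a x] a Sc(1) by simp
    then show ?thesis unfolding torsion_def using s a by auto
  qed
qed

text \<open>
  Let \<open>s \<in> S\<close> annihilate the values of a homomorphism on the ideal \<open>a\<close>.  If \<open>(a : s\<^sup>m) = (a : s\<^sup>m\<^sup>+\<^sup>1)\<close>,
  then \<open>s\<^sup>m\<^sup>+\<^sup>1 T \<inter> a \<subseteq> s a\<close>, where the homomorphism vanishes.  So it extends by 0 on \<open>s\<^sup>m\<^sup>+\<^sup>1 T\<close>, and then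
  to \<open>T\<close>, where the image of 1 is annihilated by \<open>s\<^sup>m\<^sup>+\<^sup>1\<close>.
\<close>
lemma baer_torsion:
  assumes N: "baer N" and S: "multiplicative_set T S"
  shows "baer (N \<inter> torsion S)"
proof -
  note Nsub = baerD(1)[OF N] and Sc = multiplicative_setD[OF S]
  note NE = submoduleE[OF Nsub] and tE = submoduleE[OF submodule_torsion[OF S]]
  have sub: "submodule (N \<inter> torsion S) T M"
    by (rule submoduleI) (use NE tE submodule_zero[OF module_axioms] Nsub submodule_torsion[OF S] in auto)
  have comp: "hcomp M (mcomp M) u y \<in> N \<inter> torsion S" if y: "y \<in> N \<inter> torsion S" for y u
  proof -
    obtain s where s: "s \<in> S" "s \<odot> y = \<zero>" "y \<in> carrier M" using y unfolding torsion_def by auto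
    obtain k where k: "s \<in> rcomp T k" using Sc(2)[OF s(1)] by blast
    have "s \<odot> hcomp M (mcomp M) u y = \<zero>" using hcomp_smult[OF k s(3), of u] s(2) by simp
    then show ?thesis using y baerD(2)[OF N] s unfolding torsion_def by auto
  qed
  \<comment> \<open>The relation is extended by 0 on the ideal generated by a power of \<open>s\<close>.\<close>
  have ext: "\<exists>x\<in>(N \<inter> torsion S) \<inter> mcomp M u. \<forall>(t, y)\<in>\<R>. y = t \<odot> x"
    if R: "graded_relation u \<R>" "single_valued_relation \<R>" and RN: "\<R> \<subseteq> carrier T \<times> (N \<inter> torsion S)" for u \<R>
  proof -
    note D = graded_relationD[OF R(1)] and SV = single_valued_relationD[OF R]
    let ?a = "fst ` \<R>"
    have aI: "t \<in> ?a" if "(t, y) \<in> \<R>" for t y using that by force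
    have a: "ideal ?a T"
    proof (rule idealI[OF ring_axioms])
      show "subgroup ?a (add_monoid T)"
      proof (rule ring_subgroupI)
        show "?a \<subseteq> carrier T" using D(1) by auto
        show "?a \<noteq> {}" using D(3) by auto
        show "\<ominus>\<^bsub>T\<^esub> t \<in> ?a" if t: "t \<in> ?a" for t
        proof -
          obtain y where y: "(t, y) \<in> \<R>" using t by auto
          then show ?thesis using aI[OF D(5)[of "\<ominus>\<^bsub>T\<^esub> \<one>\<^bsub>T\<^esub>", OF _ y]] D(1)[OF y] by (simp add: l_minus)
        qed
        show "t \<oplus>\<^bsub>T\<^esub> r \<in> ?a" if "t \<in> ?a" "r \<in> ?a" for t r using that D(4) aI by (metis imageE prod.collapse)
      qed
      fix t r assume t: "t \<in> ?a" and r: "r \<in> carrier T"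
      then obtain y where y: "(t, y) \<in> \<R>" by auto
      show "r \<otimes>\<^bsub>T\<^esub> t \<in> ?a" using aI[OF D(5)[OF r y]] .
      then show "t \<otimes>\<^bsub>T\<^esub> r \<in> ?a" using m_comm r D(1)[OF y] by simp
    qed
    \<comment> \<open>One denominator annihilates all values, because the domain is finitely generated.\<close>
    obtain A where A: "A \<subseteq> carrier T" "finite A" "?a = Idl\<^bsub>T\<^esub> A" using finetely_gen[OF a] by blast
    have "\<exists>s\<in>S. \<forall>t\<in>B. \<forall>y. (t, y) \<in> \<R> \<longrightarrow> s \<odot> y = \<zero>" if "finite B" "B \<subseteq> ?a" for B
      using that
    proof (induction B rule: finite_induct)
      case empty
      then show ?case using Sc(3) by blast
    next
      case (insert t B)
      then obtain s where s: "s \<in> S" "\<forall>t\<in>B. \<forall>y. (t, y) \<in> \<R> \<longrightarrow> s \<odot> y = \<zero>" by auto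
      obtain y where y: "(t, y) \<in> \<R>" using insert.prems by auto
      then have "y \<in> torsion S" using RN by auto
      then obtain r where r: "r \<in> S" "r \<odot> y = \<zero>" unfolding torsion_def by auto
      have "(s \<otimes>\<^bsub>T\<^esub> r) \<odot> z = \<zero>" if "(t', z) \<in> \<R>" "t' \<in> insert t B" for t' z
      proof (cases "t' = t")
        case True
        then have "z = y" using SV y that by blast
        then show ?thesis using r s Sc(1) D(2)[OF y] by (simp add: smult_assoc1)
      next
        case False
        then have "s \<odot> z = \<zero>" using s that by blast
        then show ?thesis using r s Sc(1) D(2)[OF that(1)] smult_lcomm[of s r z] by (simp add: smult_assoc1)
      qed
      then show ?case using Sc(4)[OF s(1) r(1)] by blast
    qed
    moreover have Aa: "A \<subseteq> ?a" unfolding A(3) using genideal_self[OF A(1)] .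
    ultimately obtain s where s: "s \<in> S" and sA: "\<And>t y. t \<in> A \<Longrightarrow> (t, y) \<in> \<R> \<Longrightarrow> s \<odot> y = \<zero>"
      using A(2) by metis
    have sc: "s \<in> carrier T" using s Sc by blast
    obtain k where k: "s \<in> rcomp T k" using Sc(2)[OF s] by blast
    have sR: "s \<odot> y = \<zero>" if ty: "(t, y) \<in> \<R>" for t y
    proof -
      let ?K = "{t. \<exists>y. (t, y) \<in> \<R> \<and> s \<odot> y = \<zero>}"
      have "ideal ?K T"
      proof (rule idealI[OF ring_axioms])
        show "subgroup ?K (add_monoid T)"
        proof (rule ring_subgroupI)
          show "?K \<subseteq> carrier T" using D(1) by auto
          show "?K \<noteq> {}" using D(3) smult_r_null[OF sc] by blast
          show "\<ominus>\<^bsub>T\<^esub> t \<in> ?K" if t: "t \<in> ?K" for t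
          proof -
            obtain y where y: "(t, y) \<in> \<R>" "s \<odot> y = \<zero>" using t by auto
            then have "(\<ominus>\<^bsub>T\<^esub> t, \<ominus> y) \<in> \<R>"
              using D(5)[of "\<ominus>\<^bsub>T\<^esub> \<one>\<^bsub>T\<^esub>", OF _ y(1)] D(1,2)[OF y(1)] by (simp add: l_minus smult_l_minus)
            moreover have "s \<odot> (\<ominus> y) = \<zero>" using y D(2)[OF y(1)] sc by (simp add: smult_r_minus)
            ultimately show ?thesis by blast
          qed
          show "t \<oplus>\<^bsub>T\<^esub> r \<in> ?K" if t: "t \<in> ?K" and r: "r \<in> ?K" for t r
          proof -
            obtain y z where y: "(t, y) \<in> \<R>" "s \<odot> y = \<zero>" "(r, z) \<in> \<R>" "s \<odot> z = \<zero>" using t r by auto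
            have "s \<odot> (y \<oplus> z) = \<zero>" using y D(2)[OF y(1)] D(2)[OF y(3)] sc by (simp add: smult_r_distr)
            then show ?thesis using D(4)[OF y(1,3)] by blast
          qed
        qed
        fix t r assume t: "t \<in> ?K" and r: "r \<in> carrier T"
        then obtain y where y: "(t, y) \<in> \<R>" "s \<odot> y = \<zero>" by auto
        have "s \<odot> (r \<odot> y) = \<zero>" using smult_lcomm[OF sc r D(2)[OF y(1)]] y r by simp
        then show "r \<otimes>\<^bsub>T\<^esub> t \<in> ?K" using D(5)[OF r y(1)] by blast
        then show "t \<otimes>\<^bsub>T\<^esub> r \<in> ?K" using m_comm r D(1)[OF y(1)] by simp
      qed
      moreover have "A \<subseteq> ?K"
      proof
        fix t assume t: "t \<in> A"
        then obtain y where "(t, y) \<in> \<R>" using Aa by force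
        then show "t \<in> ?K" using sA[OF t] by blast
      qed
      ultimately have "?a \<subseteq> ?K" unfolding A(3) by (rule genideal_minimal)
      then obtain z where "(t, z) \<in> \<R>" "s \<odot> z = \<zero>" using aI[OF ty] by auto
      then show ?thesis using SV[OF ty] by blast
    qed
    \<comment> \<open>This \<open>m\<close> gives the inclusion \<open>s\<^sup>m\<^sup>+\<^sup>1 T \<inter> a \<subseteq> s a\<close>, used in the single-valuedness of \<open>\<R>'\<close>.\<close>
    obtain m where m: "\<And>t. t \<in> carrier T \<Longrightarrow> s [^]\<^bsub>T\<^esub> Suc m \<otimes>\<^bsub>T\<^esub> t \<in> ?a \<Longrightarrow> s [^]\<^bsub>T\<^esub> (m::nat) \<otimes>\<^bsub>T\<^esub> t \<in> ?a"
      using colon_stabilizes[OF a sc is_cring] by blast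
    let ?b = "s [^]\<^bsub>T\<^esub> Suc m"
    have b: "?b \<in> rcomp T (Suc m * k)" using nat_pow_rcomp[OF k] .
    have bc: "?b \<in> carrier T" using sc by auto
    define \<R>' where "\<R>' = {(t \<oplus>\<^bsub>T\<^esub> r \<otimes>\<^bsub>T\<^esub> ?b, y) | t r y. (t, y) \<in> \<R> \<and> r \<in> carrier T}"
    have RI: "(t \<oplus>\<^bsub>T\<^esub> r \<otimes>\<^bsub>T\<^esub> ?b, y) \<in> \<R>'" if "(t, y) \<in> \<R>" "r \<in> carrier T" for t r y
      using that unfolding \<R>'_def by blast
    have RE: thesis if "(q, y) \<in> \<R>'" "\<And>t r. q = t \<oplus>\<^bsub>T\<^esub> r \<otimes>\<^bsub>T\<^esub> ?b \<Longrightarrow> (t, y) \<in> \<R> \<Longrightarrow> r \<in> carrier T \<Longrightarrow> t \<in> carrier T \<Longrightarrow> thesis" for q y thesis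
      using that D(1) unfolding \<R>'_def by blast
    have "graded_relation u \<R>'"
      unfolding graded_relation_def
    proof (intro conjI allI ballI impI)
      show "\<R>' \<subseteq> carrier T \<times> carrier M" using RE D bc by (auto simp del: nat_pow_Suc elim!: RE)
      show "(\<zero>\<^bsub>T\<^esub>, \<zero>) \<in> \<R>'" using RI[OF D(3), of "\<zero>\<^bsub>T\<^esub>"] bc by simp
      show "(q \<oplus>\<^bsub>T\<^esub> q', x \<oplus> x') \<in> \<R>'" if h: "(q, x) \<in> \<R>'" "(q', x') \<in> \<R>'" for q x q' x'
      proof -
        obtain t r where t: "q = t \<oplus>\<^bsub>T\<^esub> r \<otimes>\<^bsub>T\<^esub> ?b" "(t, x) \<in> \<R>" "r \<in> carrier T" "t \<in> carrier T" using RE[OF h(1)] .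
        obtain t' r' where t': "q' = t' \<oplus>\<^bsub>T\<^esub> r' \<otimes>\<^bsub>T\<^esub> ?b" "(t', x') \<in> \<R>" "r' \<in> carrier T" "t' \<in> carrier T" using RE[OF h(2)] .
        have "q \<oplus>\<^bsub>T\<^esub> q' = (t \<oplus>\<^bsub>T\<^esub> t') \<oplus>\<^bsub>T\<^esub> (r \<oplus>\<^bsub>T\<^esub> r') \<otimes>\<^bsub>T\<^esub> ?b"
          using t t' bc by (simp add: l_distr ring_a_ac del: nat_pow_Suc)
        then show ?thesis using RI[OF D(4)[OF t(2) t'(2)], of "r \<oplus>\<^bsub>T\<^esub> r'"] t t' by simp
      qed
      show "(p \<otimes>\<^bsub>T\<^esub> q, p \<odot> x) \<in> \<R>'" if p: "p \<in> carrier T" and h: "(q, x) \<in> \<R>'" for p q x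
      proof -
        obtain t r where t: "q = t \<oplus>\<^bsub>T\<^esub> r \<otimes>\<^bsub>T\<^esub> ?b" "(t, x) \<in> \<R>" "r \<in> carrier T" "t \<in> carrier T" using RE[OF h] .
        then show ?thesis using RI[OF D(5)[OF p t(2)], of "p \<otimes>\<^bsub>T\<^esub> r"] p bc
          by (simp add: r_distr m_assoc del: nat_pow_Suc)
      qed
      show "(icomp n q, hcomp M (mcomp M) (n + u) x) \<in> \<R>'" if h: "(q, x) \<in> \<R>'" for q x n
      proof -
        obtain t r where t: "q = t \<oplus>\<^bsub>T\<^esub> r \<otimes>\<^bsub>T\<^esub> ?b" "(t, x) \<in> \<R>" "r \<in> carrier T" "t \<in> carrier T" using RE[OF h] .
        then show ?thesis
          using RI[OF D(6)[OF t(2), of n], of "icomp (n - int (Suc m * k)) r"] icomp_smult[OF t(3) b, of n] bc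
          by (simp add: icomp_add del: nat_pow_Suc)
      qed
    qed
    moreover have "single_valued_relation \<R>'"
      unfolding single_valued_relation_def
    proof (intro allI impI)
      fix y assume "(\<zero>\<^bsub>T\<^esub>, y) \<in> \<R>'"
      then obtain t r where t: "\<zero>\<^bsub>T\<^esub> = t \<oplus>\<^bsub>T\<^esub> r \<otimes>\<^bsub>T\<^esub> ?b" "(t, y) \<in> \<R>" "r \<in> carrier T" "t \<in> carrier T" using RE by blast
      then have "t = ?b \<otimes>\<^bsub>T\<^esub> (\<ominus>\<^bsub>T\<^esub> r)"
        using bc sum_zero_eq_neg[of t "r \<otimes>\<^bsub>T\<^esub> ?b"] m_comm[of r ?b] by (simp add: r_minus del: nat_pow_Suc)
      moreover from this have "s [^]\<^bsub>T\<^esub> m \<otimes>\<^bsub>T\<^esub> (\<ominus>\<^bsub>T\<^esub> r) \<in> ?a" using m[of "\<ominus>\<^bsub>T\<^esub> r"] aI[OF t(2)] t(3) by simp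
      then obtain z where z: "(s [^]\<^bsub>T\<^esub> m \<otimes>\<^bsub>T\<^esub> (\<ominus>\<^bsub>T\<^esub> r), z) \<in> \<R>" by auto
      ultimately have "(t, s \<odot> z) \<in> \<R>" using D(5)[OF sc z] sc t(3) by (simp add: m_ac)
      then show "y = \<zero>" using SV[OF t(2)] sR[OF z] by simp
    qed
    moreover have "y \<in> N" if "(q, y) \<in> \<R>'" for q y using RE[OF that] RN by blast
    ultimately obtain x where x: "x \<in> N \<inter> mcomp M u" "\<And>t y. (t, y) \<in> \<R>' \<Longrightarrow> y = t \<odot> x"
      using baerD(3)[OF N] by blast
    have "?b \<odot> x = \<zero>" using x(2)[OF RI[OF D(3), of "\<one>\<^bsub>T\<^esub>"]] bc by (simp del: nat_pow_Suc)
    then have "x \<in> torsion S" unfolding torsion_def using pow_mem[OF S s, of "Suc m"] x(1) G.G_carrier by blast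
    moreover have "y = t \<odot> x" if "(t, y) \<in> \<R>" for t y
      using x(2)[OF RI[OF that, of "\<zero>\<^bsub>T\<^esub>"]] D(1)[OF that] bc by (simp del: nat_pow_Suc)
    ultimately show ?thesis using x(1) by blast
  qed
  show ?thesis unfolding baer_def using sub comp ext by blast
qed

end

section \<open>Double complexes\<close>

lemma (in abelian_group) minus_zero_right: "x \<in> carrier G \<Longrightarrow> x \<ominus> \<zero> = x"
  by (simp add: a_minus_def add.inv_one)

lemma correspondence_refl:
  assumes "module T M" "submodule Z T M"
  shows "correspondence T M Z B M Z B (\<lambda>x y. x = y \<and> x \<in> Z)"
  using module.submoduleE(4,5)[OF assms] unfolding correspondence_def by auto

text \<open>
  A double complex whose term at \<open>(p, q)\<close> is \<open>X p q\<close> modulo \<open>Null p q\<close>.  Elements are handled by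
  representatives, and equations hold modulo \<open>Null\<close>.  Rows are exact at all \<open>p > 0\<close>, columns at all
  \<open>q > 0\<close>.
\<close>
locale double_complex =
  fixes T :: "'a gring" and X :: "nat \<Rightarrow> nat \<Rightarrow> ('a, 'x) gmodule"
    and Null :: "nat \<Rightarrow> nat \<Rightarrow> 'x set" and dh dv :: "nat \<Rightarrow> nat \<Rightarrow> 'x \<Rightarrow> 'x"
  assumes mod: "module T (X p q)" and null: "submodule (Null p q) T (X p q)"
    and part_in: "x \<in> part (X p q) D \<Longrightarrow> x \<in> carrier (X p q)"
    and dh: "dh p q \<in> linear_map T (X p q) (X (Suc p) q)"
    and dv: "dv p q \<in> linear_map T (X p q) (X p (Suc q))"
    and dh_part: "x \<in> part (X p q) D \<Longrightarrow> dh p q x \<in> part (X (Suc p) q) D"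
    and dv_part: "x \<in> part (X p q) D \<Longrightarrow> dv p q x \<in> part (X p (Suc q)) D"
    and dh_null: "x \<in> Null p q \<Longrightarrow> dh p q x \<in> Null (Suc p) q"
    and dv_null: "x \<in> Null p q \<Longrightarrow> dv p q x \<in> Null p (Suc q)"
    and commute: "x \<in> carrier (X p q) \<Longrightarrow> dv (Suc p) q (dh p q x) = dh p (Suc q) (dv p q x)"
    and dh_dh: "x \<in> carrier (X p q) \<Longrightarrow> dh (Suc p) q (dh p q x) \<in> Null (Suc (Suc p)) q"
    and dv_dv: "x \<in> carrier (X p q) \<Longrightarrow> dv p (Suc q) (dv p q x) \<in> Null p (Suc (Suc q))"
    and row_exact: "x \<in> part (X (Suc p) q) D \<Longrightarrow> dh (Suc p) q x \<in> Null (Suc (Suc p)) q \<Longrightarrow>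
      \<exists>y\<in>part (X p q) D. x \<ominus>\<^bsub>X (Suc p) q\<^esub> dh p q y \<in> Null (Suc p) q"
    and column_exact: "x \<in> part (X p (Suc q)) D \<Longrightarrow> dv p (Suc q) x \<in> Null p (Suc (Suc q)) \<Longrightarrow>
      \<exists>y\<in>part (X p q) D. x \<ominus>\<^bsub>X p (Suc q)\<^esub> dv p q y \<in> Null p (Suc q)"
begin

definition cong :: "nat \<Rightarrow> nat \<Rightarrow> 'x \<Rightarrow> 'x \<Rightarrow> bool" where
  "cong p q x y \<longleftrightarrow> x \<in> carrier (X p q) \<and> y \<in> carrier (X p q) \<and> x \<ominus>\<^bsub>X p q\<^esub> y \<in> Null p q"

lemma null_carrier: "x \<in> Null p q \<Longrightarrow> x \<in> carrier (X p q)"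
  using module.submoduleE(1)[OF mod null] by blast

lemmas dh_closed = linear_mapD(1)[OF dh] and dv_closed = linear_mapD(1)[OF dv]

lemma cong_carrier: "cong p q x y \<Longrightarrow> x \<in> carrier (X p q)" "cong p q x y \<Longrightarrow> y \<in> carrier (X p q)"
  unfolding cong_def by auto

lemma cong_iff_coset:
  assumes "x \<in> carrier (X p q)" "y \<in> carrier (X p q)"
  shows "cong p q x y \<longleftrightarrow> Null p q +>\<^bsub>X p q\<^esub> x = Null p q +>\<^bsub>X p q\<^esub> y"
  using module.coset_eq_iff[OF mod null assms] assms unfolding cong_def by blast

lemma cong_refl: "x \<in> carrier (X p q) \<Longrightarrow> cong p q x x"
  using cong_iff_coset by blast

lemma cong_sym: "cong p q x y \<Longrightarrow> cong p q y x"
  using cong_iff_coset cong_carrier by metis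

lemma cong_trans: "cong p q x y \<Longrightarrow> cong p q y z \<Longrightarrow> cong p q x z"
  using cong_iff_coset cong_carrier by metis

lemma null_iff: "x \<in> carrier (X p q) \<Longrightarrow> x \<in> Null p q \<longleftrightarrow> cong p q x \<zero>\<^bsub>X p q\<^esub>"
proof -
  interpret module T "X p q" by (rule mod)
  assume "x \<in> carrier (X p q)"
  then show ?thesis unfolding cong_def by (simp add: M.minus_zero_right)
qed

lemma cong_add:
  assumes "cong p q x y" "cong p q x' y'"
  shows "cong p q (x \<oplus>\<^bsub>X p q\<^esub> x') (y \<oplus>\<^bsub>X p q\<^esub> y')"
proof -
  interpret module T "X p q" by (rule mod)
  show ?thesis
    using coset_add[OF null cong_carrier(1)[OF assms(1)] cong_carrier(1)[OF assms(2)]]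
      coset_add[OF null cong_carrier(2)[OF assms(1)] cong_carrier(2)[OF assms(2)]]
      cong_iff_coset cong_carrier[OF assms(1)] cong_carrier[OF assms(2)] assms by simp
qed

lemma cong_smult:
  assumes "t \<in> carrier T" "cong p q x y"
  shows "cong p q (t \<odot>\<^bsub>X p q\<^esub> x) (t \<odot>\<^bsub>X p q\<^esub> y)"
proof -
  interpret module T "X p q" by (rule mod)
  show ?thesis
    using coset_smult[OF null assms(1) cong_carrier(1)[OF assms(2)]]
      coset_smult[OF null assms(1) cong_carrier(2)[OF assms(2)]]
      cong_iff_coset cong_carrier[OF assms(2)] assms by simp
qed

lemma cong_minus:
  assumes "cong p q x y" "cong p q x' y'"
  shows "cong p q (x \<ominus>\<^bsub>X p q\<^esub> x') (y \<ominus>\<^bsub>X p q\<^esub> y')"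
proof -
  interpret module T "X p q" by (rule mod)
  have "cong p q (x \<oplus>\<^bsub>X p q\<^esub> (\<ominus>\<^bsub>T\<^esub> \<one>\<^bsub>T\<^esub>) \<odot>\<^bsub>X p q\<^esub> x') (y \<oplus>\<^bsub>X p q\<^esub> (\<ominus>\<^bsub>T\<^esub> \<one>\<^bsub>T\<^esub>) \<odot>\<^bsub>X p q\<^esub> y')"
    using assms by (intro cong_add cong_smult) auto
  then show ?thesis
    using cong_carrier[OF assms(2)] by (simp add: a_minus_def smult_l_minus)
qed

lemma cong_dh: "cong p q x y \<Longrightarrow> cong (Suc p) q (dh p q x) (dh p q y)"
  unfolding cong_def using linear_map_minus[OF mod mod dh, of x p q y] dh_null dh_closed by metis

lemma cong_dv: "cong p q x y \<Longrightarrow> cong p (Suc q) (dv p q x) (dv p q y)"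
  unfolding cong_def using linear_map_minus[OF mod mod dv, of x p q y] dv_null dv_closed by metis

lemma null_cong: "cong p q x y \<Longrightarrow> x \<in> Null p q \<longleftrightarrow> y \<in> Null p q"
  using null_iff cong_trans cong_sym cong_carrier by metis

lemma minus_null: "x \<in> carrier (X p q) \<Longrightarrow> z \<in> Null p q \<Longrightarrow> cong p q (x \<ominus>\<^bsub>X p q\<^esub> z) x"
proof -
  interpret module T "X p q" by (rule mod)
  assume x: "x \<in> carrier (X p q)" and z: "z \<in> Null p q"
  have "cong p q (x \<ominus>\<^bsub>X p q\<^esub> z) (x \<ominus>\<^bsub>X p q\<^esub> \<zero>\<^bsub>X p q\<^esub>)"
    using x null_iff[OF null_carrier[OF z]] z by (intro cong_minus cong_refl) auto
  then show ?thesis using x by (simp add: M.minus_zero_right)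
qed

lemma cong_minus_null:
  assumes "cong p q x y"
  shows "x \<ominus>\<^bsub>X p q\<^esub> y \<in> Null p q"
  using assms unfolding cong_def by blast

lemma row: "x \<in> part (X (Suc p) q) D \<Longrightarrow> dh (Suc p) q x \<in> Null (Suc (Suc p)) q \<Longrightarrow>
    \<exists>y\<in>part (X p q) D. cong (Suc p) q x (dh p q y)"
  using row_exact part_in dh_closed unfolding cong_def by meson

lemma column: "x \<in> part (X p (Suc q)) D \<Longrightarrow> dv p (Suc q) x \<in> Null p (Suc (Suc q)) \<Longrightarrow>
    \<exists>y\<in>part (X p q) D. cong p (Suc q) x (dv p q y)"
  using column_exact part_in dv_closed unfolding cong_def by meson

text \<open>
  With \<open>Z p 0\<close> and \<open>B p 0\<close> one obtains the cohomology of the edge \<open>q = 0\<close>, that is, of the kernels of the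
  first vertical differentials, and with \<open>p = 0\<close> that of the other edge.  In between, \<open>Z p q / B p q\<close> is
  the row cohomology at \<open>p\<close> of the kernels of the vertical differentials out of \<open>X p q\<close>.
\<close>
definition Z :: "nat \<Rightarrow> nat \<Rightarrow> 'x set" where
  "Z p q = {x \<in> carrier (X p q). dh p q x \<in> Null (Suc p) q \<and> dv p q x \<in> Null p (Suc q)}"

definition B :: "nat \<Rightarrow> nat \<Rightarrow> 'x set" where
  "B p q = (case p of
     0 \<Rightarrow> (case q of 0 \<Rightarrow> Null 0 0
       | Suc q' \<Rightarrow> {x. \<exists>u. u \<in> carrier (X 0 q') \<and> dh 0 q' u \<in> Null 1 q' \<and> cong 0 q x (dv 0 q' u)})
   | Suc p' \<Rightarrow> {x. \<exists>u. u \<in> carrier (X p' q) \<and> dv p' q u \<in> Null p' (Suc q) \<and> cong p q x (dh p' q u)})"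

lemma submodule_Z: "submodule (Z p q) T (X p q)"
proof -
  interpret module T "X p q" by (rule mod)
  note N = module.submoduleE[OF mod null]
  show ?thesis
    by (rule submoduleI)
      (auto simp: Z_def linear_mapD[OF dh] linear_mapD[OF dv] linear_map_zero[OF mod mod dh]
        linear_map_zero[OF mod mod dv] linear_map_neg[OF mod mod dh] linear_map_neg[OF mod mod dv]
        intro: N submodule_zero[OF mod null])
qed

text \<open>
  The element \<open>w\<close> links \<open>x\<close> and \<open>y\<close>.  If \<open>x\<close> bounds, then \<open>w\<close> can be changed, without changing \<open>dh w\<close>, so
  that \<open>dv w\<close> vanishes; then \<open>y\<close> bounds.  The converse exchanges the roles of rows and columns.  The case
  \<open>p = 0\<close> is separate because boundaries at \<open>(0, q)\<close> come from the column.
\<close>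
lemma staircase_boundary:
  assumes x: "x \<in> Z p (Suc q)" and y: "y \<in> Z (Suc p) q" and w: "w \<in> carrier (X p q)"
    and xw: "cong p (Suc q) x (dv p q w)" and yw: "cong (Suc p) q y (dh p q w)"
  shows "x \<in> B p (Suc q) \<longleftrightarrow> y \<in> B (Suc p) q"
proof -
  interpret P: module T "X p q" by (rule mod)
  have diff: "cong p (Suc q) (dv p q (w \<ominus>\<^bsub>X p q\<^esub> u)) (x \<ominus>\<^bsub>X p (Suc q)\<^esub> dv p q u)"
    "cong (Suc p) q (dh p q (w \<ominus>\<^bsub>X p q\<^esub> u)) (y \<ominus>\<^bsub>X (Suc p) q\<^esub> dh p q u)"
    if "u \<in> carrier (X p q)" for u
    using linear_map_minus[OF mod mod dv w that] linear_map_minus[OF mod mod dh w that]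
      cong_minus[OF cong_sym[OF xw] cong_refl[OF dv_closed[OF that]]]
      cong_minus[OF cong_sym[OF yw] cong_refl[OF dh_closed[OF that]]] by simp_all
  have c: "w \<ominus>\<^bsub>X p q\<^esub> u \<in> carrier (X p q)" if "u \<in> carrier (X p q)" for u using w that by simp
  have xc: "x \<in> carrier (X p (Suc q))" "y \<in> carrier (X (Suc p) q)" using x y unfolding Z_def by auto
  have to: "y \<in> B (Suc p) q" if "u \<in> carrier (X p q)" "cong p (Suc q) x (dv p q u)" "dh p q u \<in> Null (Suc p) q" for u
  proof -
    have "dv p q (w \<ominus>\<^bsub>X p q\<^esub> u) \<in> Null p (Suc q)"
      using null_cong[OF diff(1)] that cong_minus_null by blast
    moreover have "cong (Suc p) q y (dh p q (w \<ominus>\<^bsub>X p q\<^esub> u))"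
      using cong_sym[OF cong_trans[OF diff(2)[OF that(1)] minus_null[OF xc(2) that(3)]]] .
    ultimately show ?thesis unfolding B_def using c[OF that(1)] by auto
  qed
  have from_: "dh p q (w \<ominus>\<^bsub>X p q\<^esub> u) \<in> Null (Suc p) q \<and> cong p (Suc q) x (dv p q (w \<ominus>\<^bsub>X p q\<^esub> u))"
    if "u \<in> carrier (X p q)" "cong (Suc p) q y (dh p q u)" "dv p q u \<in> Null p (Suc q)" for u
  proof
    show "dh p q (w \<ominus>\<^bsub>X p q\<^esub> u) \<in> Null (Suc p) q"
      using null_cong[OF diff(2)] that cong_minus_null by blast
    show "cong p (Suc q) x (dv p q (w \<ominus>\<^bsub>X p q\<^esub> u))"
      using cong_sym[OF cong_trans[OF diff(1)[OF that(1)] minus_null[OF xc(1) that(3)]]] .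
  qed
  show ?thesis
  proof (cases p)
    case 0
    show ?thesis
    proof
      assume "x \<in> B p (Suc q)"
      then show "y \<in> B (Suc p) q" using to 0 unfolding B_def by auto
    next
      assume "y \<in> B (Suc p) q"
      then obtain u where "u \<in> carrier (X p q)" "cong (Suc p) q y (dh p q u)" "dv p q u \<in> Null p (Suc q)"
        unfolding B_def by auto
      then show "x \<in> B p (Suc q)" using from_[of u] c[of u] 0 unfolding B_def by auto
    qed
  next
    case (Suc p')
    show ?thesis
    proof
      assume "x \<in> B p (Suc q)"
      then obtain u where u: "u \<in> carrier (X p' (Suc q))" "dv p' (Suc q) u \<in> Null p' (Suc (Suc q))"
          "cong p (Suc q) x (dh p' (Suc q) u)"
        unfolding B_def Suc by auto
      obtain v where v: "v \<in> carrier (X p' q)" "cong p' (Suc q) u (dv p' q v)"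
        using column[of u p' q None] u by auto
      have "cong p (Suc q) x (dv p q (dh p' q v))"
        using cong_trans[OF u(3)[unfolded Suc] cong_dh[OF v(2)]] commute[OF v(1)] Suc by simp
      then show "y \<in> B (Suc p) q"
        using to[of "dh p' q v"] dh_closed[OF v(1)] dh_dh[OF v(1)] Suc by simp
    next
      assume "y \<in> B (Suc p) q"
      then obtain u where u: "u \<in> carrier (X p q)" "cong (Suc p) q y (dh p q u)" "dv p q u \<in> Null p (Suc q)"
        unfolding B_def by auto
      note f = from_[OF u]
      obtain v where v: "v \<in> carrier (X p' q)" "cong p q (w \<ominus>\<^bsub>X p q\<^esub> u) (dh p' q v)"
        using row[of "w \<ominus>\<^bsub>X p q\<^esub> u" p' q None] f c[OF u(1)] Suc by auto
      have "cong p (Suc q) x (dh p' (Suc q) (dv p' q v))"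
        using cong_trans[OF conjunct2[OF f] cong_dv[OF v(2)]] commute[OF v(1)] Suc by simp
      then show "x \<in> B p (Suc q)"
        unfolding B_def Suc using dv_closed[OF v(1)] dv_dv[OF v(1)] by auto
    qed
  qed
qed

lemma staircase_step:
  "correspondence T (X p (Suc q)) (Z p (Suc q)) (B p (Suc q)) (X (Suc p) q) (Z (Suc p) q) (B (Suc p) q)
     (\<lambda>x y. x \<in> Z p (Suc q) \<and> y \<in> Z (Suc p) q \<and>
        (\<exists>w\<in>carrier (X p q). cong p (Suc q) x (dv p q w) \<and> cong (Suc p) q y (dh p q w)))"
  unfolding correspondence_def
proof (intro conjI allI ballI impI; (elim conjE)?)
  interpret P: module T "X p q" by (rule mod)
  let ?R = "\<lambda>x y. x \<in> Z p (Suc q) \<and> y \<in> Z (Suc p) q \<and>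
        (\<exists>w\<in>carrier (X p q). cong p (Suc q) x (dv p q w) \<and> cong (Suc p) q y (dh p q w))"
  note Z1 = module.submoduleE[OF mod submodule_Z[of p "Suc q"]]
    and Z2 = module.submoduleE[OF mod submodule_Z[of "Suc p" q]]
  {
    fix x y assume xy: "x \<in> Z p (Suc q)" "y \<in> Z (Suc p) q"
      and "\<exists>w\<in>carrier (X p q). cong p (Suc q) x (dv p q w) \<and> cong (Suc p) q y (dh p q w)"
    then obtain w where w: "w \<in> carrier (X p q)" "cong p (Suc q) x (dv p q w)" "cong (Suc p) q y (dh p q w)"
      by blast
    show "x \<in> Z p (Suc q)" "y \<in> Z (Suc p) q" by fact+
    show "x \<in> B p (Suc q) \<longleftrightarrow> y \<in> B (Suc p) q" using staircase_boundary[OF xy w] .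
    {
      fix x' y' assume xy': "x' \<in> Z p (Suc q)" "y' \<in> Z (Suc p) q"
        and "\<exists>w\<in>carrier (X p q). cong p (Suc q) x' (dv p q w) \<and> cong (Suc p) q y' (dh p q w)"
      then obtain w' where w': "w' \<in> carrier (X p q)" "cong p (Suc q) x' (dv p q w')" "cong (Suc p) q y' (dh p q w')"
        by blast
      show "x \<oplus>\<^bsub>X p (Suc q)\<^esub> x' \<in> Z p (Suc q)" "y \<oplus>\<^bsub>X (Suc p) q\<^esub> y' \<in> Z (Suc p) q"
        using Z1(5) Z2(5) xy xy' by auto
      show "\<exists>w\<in>carrier (X p q). cong p (Suc q) (x \<oplus>\<^bsub>X p (Suc q)\<^esub> x') (dv p q w) \<and>
          cong (Suc p) q (y \<oplus>\<^bsub>X (Suc p) q\<^esub> y') (dh p q w)"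
        using cong_add[OF w(2) w'(2)] cong_add[OF w(3) w'(3)] w(1) w'(1)
        by (intro bexI[of _ "w \<oplus>\<^bsub>X p q\<^esub> w'"]) (auto simp: linear_mapD(2)[OF dh] linear_mapD(2)[OF dv])
    }
    fix t assume t: "t \<in> carrier T"
    show "t \<odot>\<^bsub>X p (Suc q)\<^esub> x \<in> Z p (Suc q)" "t \<odot>\<^bsub>X (Suc p) q\<^esub> y \<in> Z (Suc p) q"
      using Z1(4) Z2(4) t xy by auto
    show "\<exists>w\<in>carrier (X p q). cong p (Suc q) (t \<odot>\<^bsub>X p (Suc q)\<^esub> x) (dv p q w) \<and>
        cong (Suc p) q (t \<odot>\<^bsub>X (Suc p) q\<^esub> y) (dh p q w)"
      using cong_smult[OF t w(2)] cong_smult[OF t w(3)] w(1) t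
      by (intro bexI[of _ "t \<odot>\<^bsub>X p q\<^esub> w"]) (auto simp: linear_mapD(3)[OF dh] linear_mapD(3)[OF dv])
  }
  fix D
  {
    fix x assume x: "x \<in> Z p (Suc q) \<inter> part (X p (Suc q)) D"
    then obtain w where w: "w \<in> part (X p q) D" "cong p (Suc q) x (dv p q w)"
      using column[of x p q D] unfolding Z_def by auto
    have wc: "w \<in> carrier (X p q)" using part_in[OF w(1)] .
    have "dv (Suc p) q (dh p q w) \<in> Null (Suc p) (Suc q)"
      using null_cong[OF cong_dh[OF w(2)]] x commute[OF wc] unfolding Z_def by simp
    then have "dh p q w \<in> Z (Suc p) q" unfolding Z_def using dh_closed[OF wc] dh_dh[OF wc] by simp
    then show "\<exists>y\<in>Z (Suc p) q \<inter> part (X (Suc p) q) D. ?R x y"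
      using x w wc dh_part[OF w(1)] cong_refl dh_closed[OF wc] by (intro bexI[of _ "dh p q w"]) auto
  }
  {
    fix y assume y: "y \<in> Z (Suc p) q \<inter> part (X (Suc p) q) D"
    then obtain w where w: "w \<in> part (X p q) D" "cong (Suc p) q y (dh p q w)"
      using row[of y p q D] unfolding Z_def by auto
    have wc: "w \<in> carrier (X p q)" using part_in[OF w(1)] .
    have "dh p (Suc q) (dv p q w) \<in> Null (Suc p) (Suc q)"
      using null_cong[OF cong_dv[OF w(2)]] y commute[OF wc] unfolding Z_def by simp
    then have "dv p q w \<in> Z p (Suc q)" unfolding Z_def using dv_closed[OF wc] dv_dv[OF wc] by simp
    then show "\<exists>x\<in>Z p (Suc q) \<inter> part (X p (Suc q)) D. ?R x y"
      using y w wc dv_part[OF w(1)] cong_refl dv_closed[OF wc] by (intro bexI[of _ "dv p q w"]) auto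
  }
qed

text \<open>
  The connecting zigzags along the antidiagonal lead from one edge to the other.
\<close>
theorem staircase: "\<exists>R. correspondence T (X 0 (p + q)) (Z 0 (p + q)) (B 0 (p + q)) (X p q) (Z p q) (B p q) R"
proof (induction p arbitrary: q)
  case 0
  then show ?case using correspondence_refl[OF mod submodule_Z, of 0 q] by auto
next
  case (Suc p)
  obtain R where "correspondence T (X 0 (p + Suc q)) (Z 0 (p + Suc q)) (B 0 (p + Suc q))
      (X p (Suc q)) (Z p (Suc q)) (B p (Suc q)) R"
    using Suc.IH[of "Suc q"] by blast
  from correspondence_trans[OF this staircase_step] show ?case by auto
qed

end

section \<open>The Cech complex of a graded injective module\<close>

definition (in graded_ring) sign :: "nat \<Rightarrow> 'a" where
  "sign n = (\<ominus> \<one>) [^] n"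

context graded_ring
begin

lemma sign_rcomp: "sign n \<in> rcomp T 0"
  using nat_pow_rcomp[OF R.G_neg[OF one_rcomp], of n] by (simp add: sign_def)

lemma sign_closed [simp]: "sign n \<in> carrier T"
  using R.G_carrier[OF sign_rcomp] .

lemma sign_Suc: "sign (Suc n) = \<ominus> sign n"
  by (simp add: sign_def r_minus)

lemma sign_0 [simp]: "sign 0 = \<one>"
  by (simp add: sign_def)

lemma sign_square: "sign n \<otimes> sign n = \<one>"
proof (induction n)
  case (Suc n)
  then show ?case by (simp only: sign_Suc) (simp add: l_minus r_minus)
qed simp

end

locale cech_module_setting = cech_setting T J bs + noetherian_graded_module T M
  for T :: "'a gring" and J :: "'a set" and bs :: "'a list" and M :: "('a, 'b) gmodule" (structure)
begin

text \<open>
  The simplicial coboundary of a family indexed by sets.  All restriction maps are identities.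
\<close>
definition boundary :: "(nat set \<Rightarrow> 'b) \<Rightarrow> nat set \<Rightarrow> 'b" where
  "boundary x B = (\<Oplus>k\<in>B. sign (card {i \<in> B. i < k}) \<odot> x (B - {k}))"

lemma sign_part: "x \<in> part M D \<Longrightarrow> sign n \<odot> x \<in> part M D"
  using part_smult[OF sign_rcomp] by simp

lemma part_add: "x \<in> part M D \<Longrightarrow> y \<in> part M D \<Longrightarrow> x \<oplus> y \<in> part M D"
  using G.G_add by (cases D) auto

lemma part_minus: "x \<in> part M D \<Longrightarrow> y \<in> part M D \<Longrightarrow> x \<ominus> y \<in> part M D"
  using G.G_add G.G_neg unfolding a_minus_def by (cases D) auto

lemma boundary_in:
  assumes "\<zero> \<in> H" "\<And>x y. x \<in> H \<Longrightarrow> y \<in> H \<Longrightarrow> x \<oplus> y \<in> H" "H \<subseteq> carrier M"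
    and "\<And>n x. x \<in> H \<Longrightarrow> sign n \<odot> x \<in> H" and "\<And>k. k \<in> B \<Longrightarrow> x (B - {k}) \<in> H" "finite B"
  shows "boundary x B \<in> H"
  unfolding boundary_def by (rule finsum_closed_subset) (use assms in auto)

lemma boundary_closed: "(\<And>k. k \<in> B \<Longrightarrow> x (B - {k}) \<in> carrier M) \<Longrightarrow> boundary x B \<in> carrier M"
  unfolding boundary_def by (auto intro!: M.finsum_closed)

lemma boundary_submodule:
  assumes "submodule N T M" "\<And>k. k \<in> B \<Longrightarrow> x (B - {k}) \<in> N" "finite B"
  shows "boundary x B \<in> N"
  by (rule boundary_in) (use submoduleE[OF assms(1)] submodule_zero[OF module_axioms assms(1)] assms in auto)

lemma boundary_part:
  assumes "\<And>k. k \<in> B \<Longrightarrow> x (B - {k}) \<in> part M D" "finite B"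
  shows "boundary x B \<in> part M D"
  by (rule boundary_in) (use assms sign_part part_zero part_carrier part_add in auto)

lemma boundary_cong: "(\<And>k. k \<in> B \<Longrightarrow> x (B - {k}) = y (B - {k})) \<Longrightarrow> (\<And>k. k \<in> B \<Longrightarrow> y (B - {k}) \<in> carrier M) \<Longrightarrow>
    boundary x B = boundary y B"
  unfolding boundary_def by (rule M.finsum_cong') auto

lemma boundary_add:
  assumes "\<And>k. k \<in> B \<Longrightarrow> x (B - {k}) \<in> carrier M" "\<And>k. k \<in> B \<Longrightarrow> y (B - {k}) \<in> carrier M"
  shows "boundary (\<lambda>A. x A \<oplus> y A) B = boundary x B \<oplus> boundary y B"
proof -
  have "boundary (\<lambda>A. x A \<oplus> y A) B = (\<Oplus>k\<in>B. sign (card {i \<in> B. i < k}) \<odot> x (B - {k}) \<oplus>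
      sign (card {i \<in> B. i < k}) \<odot> y (B - {k}))"
    unfolding boundary_def by (rule M.finsum_cong') (use assms in \<open>auto simp: smult_r_distr\<close>)
  also have "\<dots> = boundary x B \<oplus> boundary y B"
    unfolding boundary_def by (rule M.finsum_addf) (use assms in auto)
  finally show ?thesis .
qed

lemma boundary_zero: "(\<And>k. k \<in> B \<Longrightarrow> x (B - {k}) = \<zero>) \<Longrightarrow> boundary x B = \<zero>"
proof -
  assume "\<And>k. k \<in> B \<Longrightarrow> x (B - {k}) = \<zero>"
  then have "boundary x B = (\<Oplus>k\<in>B. \<zero>)"
    unfolding boundary_def by (intro M.finsum_cong') auto
  then show ?thesis by simp
qed

lemma boundary_smult:
  assumes "\<And>k. k \<in> B \<Longrightarrow> x (B - {k}) \<in> carrier M" "t \<in> carrier T" "finite B"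
  shows "boundary (\<lambda>A. t \<odot> x A) B = t \<odot> boundary x B"
proof -
  have "t \<odot> boundary x B = (\<Oplus>k\<in>B. t \<odot> (sign (card {i \<in> B. i < k}) \<odot> x (B - {k})))"
    unfolding boundary_def by (rule finsum_smult_ldistr) (use assms in auto)
  also have "\<dots> = boundary (\<lambda>A. t \<odot> x A) B"
    unfolding boundary_def by (rule M.finsum_cong') (use assms smult_lcomm in auto)
  finally show ?thesis ..
qed

lemma boundary_minus:
  assumes "\<And>k. k \<in> B \<Longrightarrow> x (B - {k}) \<in> carrier M" "\<And>k. k \<in> B \<Longrightarrow> y (B - {k}) \<in> carrier M" "finite B"
  shows "boundary (\<lambda>A. x A \<ominus> y A) B = boundary x B \<ominus> boundary y B"
proof -
  have "boundary (\<lambda>A. x A \<ominus> y A) B = boundary (\<lambda>A. x A \<oplus> (\<ominus>\<^bsub>T\<^esub> \<one>\<^bsub>T\<^esub>) \<odot> y A) B"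
    by (rule boundary_cong) (use assms in \<open>auto simp: a_minus_def smult_l_minus\<close>)
  also have "\<dots> = boundary x B \<oplus> (\<ominus>\<^bsub>T\<^esub> \<one>\<^bsub>T\<^esub>) \<odot> boundary y B"
    using assms boundary_smult[of B y "\<ominus>\<^bsub>T\<^esub> \<one>\<^bsub>T\<^esub>"] by (subst boundary_add) auto
  finally show ?thesis using boundary_closed[of B y] assms by (simp add: a_minus_def smult_l_minus)
qed

text \<open>
  For \<open>m\<close> above \<open>C\<close> the coboundary is that of the cone: this formula is the inductive step of the proofs
  that follow.
\<close>
lemma boundary_insert:
  assumes "finite C" "\<And>c. c \<in> C \<Longrightarrow> c < m" "\<And>A. x A \<in> carrier M"
  shows "boundary x (insert m C) = boundary (\<lambda>A. x (insert m A)) C \<oplus> sign (card C) \<odot> x C"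
proof -
  have m: "m \<notin> C" using assms(2) by blast
  have "boundary x (insert m C) = sign (card {i \<in> insert m C. i < m}) \<odot> x (insert m C - {m}) \<oplus>
      (\<Oplus>k\<in>C. sign (card {i \<in> insert m C. i < k}) \<odot> x (insert m C - {k}))"
    unfolding boundary_def by (rule M.finsum_insert) (use assms m in auto)
  moreover have "{i \<in> insert m C. i < m} = C" using assms(2) by auto
  moreover have "insert m C - {m} = C" using m by auto
  moreover have "(\<Oplus>k\<in>C. sign (card {i \<in> insert m C. i < k}) \<odot> x (insert m C - {k})) =
      boundary (\<lambda>A. x (insert m A)) C"
    unfolding boundary_def
  proof (rule M.finsum_cong')
    fix k assume k: "k \<in> C"
    then have "{i \<in> insert m C. i < k} = {i \<in> C. i < k}" "insert m C - {k} = insert m (C - {k})"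
      using assms(2) by force+
    then show "sign (card {i \<in> insert m C. i < k}) \<odot> x (insert m C - {k}) =
        sign (card {i \<in> C. i < k}) \<odot> x (insert m (C - {k}))" by simp
  qed (use assms in auto)
  moreover have "boundary (\<lambda>A. x (insert m A)) C \<in> carrier M" using assms(3) by (intro boundary_closed)
  ultimately show ?thesis using assms(3) by (simp add: M.a_comm)
qed

lemma boundary_boundary:
  assumes "finite B" "\<And>A. x A \<in> carrier M"
  shows "boundary (boundary x) B = \<zero>"
  using assms
proof (induction B arbitrary: x rule: finite_linorder_max_induct)
  case empty
  show ?case by (simp add: boundary_def)
next
  case (insert m C)
  let ?y = "\<lambda>A. x (insert m A)"
  have bc: "boundary x A \<in> carrier M" "boundary ?y A \<in> carrier M" for A
    using insert.prems boundary_closed by auto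
  have eq: "boundary (boundary x) (insert m C) =
      boundary (\<lambda>A. boundary x (insert m A)) C \<oplus> sign (card C) \<odot> boundary x C"
    by (rule boundary_insert) (use insert bc in auto)
  show ?case
  proof (cases "C = {}")
    case True
    then show ?thesis using eq by (simp add: boundary_def)
  next
    case False
    then obtain n where n: "card C = Suc n" using insert.hyps(1) by (metis card_eq_0_iff not0_implies_Suc)
    have "boundary (\<lambda>A. boundary x (insert m A)) C = boundary (\<lambda>A. boundary ?y A \<oplus> sign n \<odot> x A) C"
    proof (rule boundary_cong)
      fix k assume k: "k \<in> C"
      then have "card (C - {k}) = n" using n insert.hyps(1) by simp
      then show "boundary x (insert m (C - {k})) = boundary ?y (C - {k}) \<oplus> sign n \<odot> x (C - {k})"
        using boundary_insert[of "C - {k}" m x] insert by simp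
    qed (use bc insert.prems in auto)
    also have "\<dots> = boundary (boundary ?y) C \<oplus> sign n \<odot> boundary x C"
      using bc insert.prems boundary_smult[of C x "sign n"] insert.hyps(1)
      by (subst boundary_add) auto
    also have "\<dots> = sign n \<odot> boundary x C" using insert.IH[of ?y] insert.prems bc by simp
    finally show ?thesis using eq bc n by (simp add: sign_Suc smult_l_minus M.r_neg)
  qed
qed

abbreviation tor :: "nat set \<Rightarrow> 'b set" where
  "tor A \<equiv> torsion (denominators A)"

lemma submodule_tor: "A \<subseteq> {..<length bs} \<Longrightarrow> submodule (tor A) T M"
  using submodule_torsion[OF denominators_multiplicative] .

lemma tor_mono: "A \<subseteq> B \<Longrightarrow> x \<in> tor A \<Longrightarrow> x \<in> tor B"
  using denominators_mono unfolding torsion_def by blast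

text \<open>
  Let \<open>t s e = 0\<close> with \<open>t \<in> S\<^sub>A\<close> and \<open>s\<close> a denominator for \<open>m\<close>.  Then \<open>t e\<close> is \<open>m\<close>-torsion, and by
  divisibility of the \<open>m\<close>-torsion submodule \<open>e\<close> agrees with an \<open>m\<close>-torsion element up to \<open>S\<^sub>A\<close>-torsion.
\<close>
lemma lift_to_torsion:
  assumes N: "baer N" and A: "insert m A \<subseteq> {..<length bs}"
    and e: "e \<in> N" "e \<in> part M D" "e \<in> tor (insert m A)"
  shows "\<exists>e'. e' \<in> N \<inter> tor {m} \<and> e' \<in> part M D \<and> e \<ominus> e' \<in> tor A"
proof -
  note DA = denominators_multiplicative[of A] and Dm = denominators_multiplicative[of "{m}"]
  note DAc = multiplicative_setD[OF DA] and Dmc = multiplicative_setD[OF Dm]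
  have A': "A \<subseteq> {..<length bs}" "{m} \<subseteq> {..<length bs}" using A by auto
  have N': "baer (N \<inter> tor {m})" using baer_torsion[OF N Dm[OF A'(2)]] .
  obtain s t where s: "s \<in> denominators {m}" "t \<in> denominators A" "(s \<otimes>\<^bsub>T\<^esub> t) \<odot> e = \<zero>"
    using e(3) denominators_insert[OF A] denominators_singleton[of m] A unfolding torsion_def by auto
  have c: "s \<in> carrier T" "t \<in> carrier T" "e \<in> carrier M"
    using s DAc[OF A'(1)] Dmc[OF A'(2)] part_carrier[OF e(2)] by auto
  obtain k where k: "t \<in> rcomp T k" using DAc(2)[OF A'(1) s(2)] by blast
  have te: "t \<odot> e \<in> N \<inter> tor {m}"
    using submoduleE(4)[OF baerD(1)[OF N] c(2) e(1)] s c unfolding torsion_def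
    by (auto simp: smult_assoc1)
  obtain e' w where e': "e' \<in> (N \<inter> tor {m}) \<inter> part M D" "w \<in> denominators A" "w \<odot> (t \<odot> e') = w \<odot> (t \<odot> e)"
    using baer_divisible[OF N' DA[OF A'(1)] s(2) k te part_smult[OF k e(2)]] by blast
  have c': "e' \<in> carrier M" "w \<in> carrier T" using e' part_carrier DAc[OF A'(1)] by auto
  have "(w \<otimes>\<^bsub>T\<^esub> t) \<odot> (e \<ominus> e') = \<zero>"
    using e'(3) c c' by (simp add: a_minus_def smult_assoc1 smult_r_distr smult_r_minus M.r_neg)
  then have "e \<ominus> e' \<in> tor A" unfolding torsion_def using c c' DAc(4)[OF A'(1) e'(2) s(2)] by auto
  then show ?thesis using e'(1) by blast
qed

text \<open>
  Induction on the largest index \<open>m\<close>.  First \<open>x\<close> is made to vanish on the sets that contain \<open>m\<close>; the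
  cocycle condition for \<open>insert m B\<close> then says that \<open>x B\<close> is torsion for \<open>insert m B\<close>.  By
  \<open>lift_to_torsion\<close> it can be replaced by an \<open>m\<close>-torsion element, and the induction hypothesis for the
  \<open>m\<close>-torsion submodule applies.
\<close>
lemma cech_acyclic:
  assumes "finite U" "U \<subseteq> {..<length bs}" "baer N"
    and "\<And>A. x A \<in> carrier M"
    and "\<And>B. B \<subseteq> U \<Longrightarrow> card B = Suc p \<Longrightarrow> x B \<in> N \<inter> part M D"
    and "\<And>C. C \<subseteq> U \<Longrightarrow> card C = Suc (Suc p) \<Longrightarrow> boundary x C \<in> tor C"
  shows "\<exists>y. (\<forall>A. y A \<in> carrier M) \<and> (\<forall>A. A \<subseteq> U \<longrightarrow> card A = p \<longrightarrow> y A \<in> N \<inter> part M D) \<and>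
     (\<forall>B. B \<subseteq> U \<longrightarrow> card B = Suc p \<longrightarrow> x B \<ominus> boundary y B \<in> tor B)"
  using assms
proof (induction U arbitrary: x N rule: finite_linorder_max_induct)
  case empty
  then show ?case
    using submodule_zero[OF module_axioms baerD(1)[OF empty(2)]] part_zero
    by (intro exI[of _ "\<lambda>_. \<zero>"]) auto
next
  case (insert m U)
  note xc [simp] = insert.prems(3) and baer = insert.prems(2)
  note Nsub = submoduleE[OF baerD(1)[OF baer]] and N0 = submodule_zero[OF module_axioms baerD(1)[OF baer]]
  have m: "m \<notin> U" "m < length bs" "U \<subseteq> {..<length bs}" using insert.hyps(2) insert.prems(1) by auto
  have fin: "A \<subseteq> insert m U \<Longrightarrow> finite A" for A using insert.hyps(1) finite_subset by blast
  have finU: "A \<subseteq> U \<Longrightarrow> finite A" for A using insert.hyps(1) finite_subset by blast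
  have below: "A \<subseteq> U \<Longrightarrow> c \<in> A \<Longrightarrow> c < m" for A c using insert.hyps(2) by blast
  have torU: "submodule (tor B) T M" if "B \<subseteq> insert m U" for B
    using that submodule_tor insert.prems(1) by blast
  define y0 where "y0 A = (if m \<in> A then \<zero> else sign p \<odot> x (insert m A))" for A
  have y0c [simp]: "y0 A \<in> carrier M" for A unfolding y0_def by simp
  have insert_card: "card (insert m A) = Suc p" if "A \<subseteq> U" "card A = p" for A
    using that m(1) fin[of A] by (subst card_insert_disjoint) auto
  have y0N: "y0 A \<in> N \<inter> part M D" if "A \<subseteq> insert m U" "card A = p" for A
  proof (cases "m \<in> A")
    case True
    then show ?thesis using N0 part_zero unfolding y0_def by simp
  next
    case False
    then have "x (insert m A) \<in> N \<inter> part M D"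
      using that insert.prems(4)[of "insert m A"] insert_card[of A] by blast
    then show ?thesis unfolding y0_def using False Nsub(4) sign_part by auto
  qed
  \<comment> \<open>On the sets that contain \<open>m\<close>, the boundary of \<open>y0\<close> is \<open>x\<close>.\<close>
  have y0_top: "boundary y0 (insert m A) = x (insert m A)" if "A \<subseteq> U" "card A = p" for A
  proof -
    have "boundary y0 (insert m A) = boundary (\<lambda>A. y0 (insert m A)) A \<oplus> sign (card A) \<odot> y0 A"
      by (rule boundary_insert) (use that finU below in auto)
    moreover have "boundary (\<lambda>A. y0 (insert m A)) A = \<zero>" by (rule boundary_zero) (simp add: y0_def)
    moreover have "sign (card A) \<odot> y0 A = x (insert m A)"
      unfolding y0_def using that m(1) by (auto simp: smult_assoc1[symmetric] sign_square)
    ultimately show ?thesis by simp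
  qed
  define x1 where "x1 B = x B \<ominus> boundary y0 B" for B
  have by0 [simp]: "boundary y0 B \<in> carrier M" for B by (rule boundary_closed) simp
  have x1c [simp]: "x1 B \<in> carrier M" for B unfolding x1_def by simp
  have x1N: "x1 B \<in> N \<inter> part M D" if "B \<subseteq> insert m U" "card B = Suc p" for B
  proof -
    have sub: "B - {k} \<subseteq> insert m U" "card (B - {k}) = p" if "k \<in> B" for k
      using \<open>B \<subseteq> insert m U\<close> \<open>card B = Suc p\<close> that fin by auto
    have "boundary y0 B \<in> N \<inter> part M D"
      using boundary_submodule[OF baerD(1)[OF baer], of B y0] boundary_part[of B y0 D] y0N[OF sub] fin that by auto
    then show ?thesis
      unfolding x1_def using insert.prems(4)[OF that] submodule_minus[OF module_axioms baerD(1)[OF baer]] part_minus by auto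
  qed
  have x1_boundary: "boundary x1 C = boundary x C" if "C \<subseteq> insert m U" for C
  proof -
    have "boundary x1 C = boundary x C \<ominus> boundary (boundary y0) C"
      unfolding x1_def by (rule boundary_minus) (use fin that in auto)
    then show ?thesis using boundary_boundary[of C y0] fin[OF that] boundary_closed[of C x]
      by (simp add: M.minus_zero_right)
  qed
  have x1_tor: "x1 B \<in> tor (insert m B)" if B: "B \<subseteq> U" "card B = Suc p" for B
  proof -
    have cardm: "card (insert m B) = Suc (Suc p)" using that m(1) fin[of B] by (subst card_insert_disjoint) auto
    have "boundary x1 (insert m B) = boundary (\<lambda>A. x1 (insert m A)) B \<oplus> sign (card B) \<odot> x1 B"
      by (rule boundary_insert) (use B finU below in auto)
    moreover have "boundary (\<lambda>A. x1 (insert m A)) B = \<zero>"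
    proof (rule boundary_zero)
      fix k assume "k \<in> B"
      then have "B - {k} \<subseteq> U" "card (B - {k}) = p" using B fin[of B] by auto
      then show "x1 (insert m (B - {k})) = \<zero>" unfolding x1_def using y0_top M.minus_eq_zero_iff by simp
    qed
    ultimately have "sign (card B) \<odot> x1 B \<in> tor (insert m B)"
      using insert.prems(5)[of "insert m B"] x1_boundary[of "insert m B"] subset_trans[OF B(1) subset_insertI] cardm
      by auto
    then have "sign (card B) \<odot> (sign (card B) \<odot> x1 B) \<in> tor (insert m B)"
      using submoduleE(4)[OF torU[of "insert m B"]] subset_trans[OF B(1) subset_insertI] by auto
    then show ?thesis by (simp add: smult_assoc1[symmetric] sign_square)
  qed
  have mS: "multiplicative_set T (denominators {m})" using denominators_multiplicative m(2) by auto
  have "\<forall>B. \<exists>e'. B \<subseteq> U \<longrightarrow> card B = Suc p \<longrightarrow> e' \<in> N \<inter> tor {m} \<and> e' \<in> part M D \<and> x1 B \<ominus> e' \<in> tor B"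
  proof (intro allI)
    fix B
    show "\<exists>e'. B \<subseteq> U \<longrightarrow> card B = Suc p \<longrightarrow> e' \<in> N \<inter> tor {m} \<and> e' \<in> part M D \<and> x1 B \<ominus> e' \<in> tor B"
    proof (cases "B \<subseteq> U \<and> card B = Suc p")
      case True
      then have B: "B \<subseteq> insert m U" "insert m B \<subseteq> {..<length bs}" using m by auto
      have "x1 B \<in> N" "x1 B \<in> part M D" "x1 B \<in> tor (insert m B)"
        using x1N[OF B(1)] x1_tor[of B] True by auto
      from lift_to_torsion[OF baer B(2) this] show ?thesis by blast
    qed blast
  qed
  then obtain z where z: "\<And>B. B \<subseteq> U \<Longrightarrow> card B = Suc p \<Longrightarrow> z B \<in> N \<inter> tor {m} \<and> z B \<in> part M D \<and> x1 B \<ominus> z B \<in> tor B"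
    by metis
  \<comment> \<open>Outside the relevant sets the value 0 only serves to keep all entries in the module.\<close>
  define x2 where "x2 B = (if B \<subseteq> U \<and> card B = Suc p then z B else \<zero>)" for B
  have x2c [simp]: "x2 B \<in> carrier M" for B unfolding x2_def using z part_carrier by auto
  have x2_tor: "boundary x2 C \<in> tor C" if C: "C \<subseteq> U" "card C = Suc (Suc p)" for C
  proof -
    have d: "x1 (C - {k}) \<ominus> x2 (C - {k}) \<in> tor C" if "k \<in> C" for k
    proof -
      have "C - {k} \<subseteq> U" "card (C - {k}) = Suc p" using C that fin[of C] by auto
      then show ?thesis using z[of "C - {k}"] tor_mono[of "C - {k}" C] unfolding x2_def by auto
    qed
    have C': "C \<subseteq> insert m U" using C by blast
    have "boundary (\<lambda>A. x1 A \<ominus> x2 A) C \<in> tor C"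
      by (rule boundary_submodule[OF torU[OF C']]) (use d fin C in auto)
    then have "boundary x1 C \<ominus> boundary x2 C \<in> tor C"
      using boundary_minus[of C x1 x2] fin[OF C'] by simp
    moreover have "boundary x1 C \<in> tor C" using x1_boundary[OF C'] insert.prems(5)[OF C' C(2)] by simp
    ultimately have "boundary x1 C \<ominus> (boundary x1 C \<ominus> boundary x2 C) \<in> tor C"
      using submodule_minus[OF module_axioms torU[OF C']] by blast
    moreover have "boundary x1 C \<in> carrier M" "boundary x2 C \<in> carrier M" by (rule boundary_closed, simp)+
    ultimately show ?thesis by (simp add: a_minus_def M.minus_add M.r_neg2)
  qed
  have "\<exists>y. (\<forall>A. y A \<in> carrier M) \<and> (\<forall>A. A \<subseteq> U \<longrightarrow> card A = p \<longrightarrow> y A \<in> (N \<inter> tor {m}) \<inter> part M D) \<and>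
     (\<forall>B. B \<subseteq> U \<longrightarrow> card B = Suc p \<longrightarrow> x2 B \<ominus> boundary y B \<in> tor B)"
  proof (rule insert.IH[OF m(3) baer_torsion[OF baer mS]])
    show "x2 B \<in> (N \<inter> tor {m}) \<inter> part M D" if "B \<subseteq> U" "card B = Suc p" for B
      unfolding x2_def using z[OF that] that by auto
  qed (use x2_tor in auto)
  then obtain y1 where y1c [simp]: "\<And>A. y1 A \<in> carrier M"
    and y1: "\<And>A. A \<subseteq> U \<Longrightarrow> card A = p \<Longrightarrow> y1 A \<in> N \<inter> tor {m} \<inter> part M D"
    "\<And>B. B \<subseteq> U \<Longrightarrow> card B = Suc p \<Longrightarrow> x2 B \<ominus> boundary y1 B \<in> tor B" by blast
  define y2 where "y2 A = (if m \<in> A then \<zero> else y1 A)" for A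
  have y2c [simp]: "y2 A \<in> carrier M" for A unfolding y2_def by simp
  have by2 [simp]: "boundary y2 B \<in> carrier M" for B by (rule boundary_closed) simp
  have y2_tor: "x1 B \<ominus> boundary y2 B \<in> tor B" if B: "B \<subseteq> insert m U" "card B = Suc p" for B
  proof (cases "m \<in> B")
    case True
    define A where "A = B - {m}"
    have A: "B = insert m A" "A \<subseteq> U" "card A = p" using True B fin[of B] unfolding A_def by auto
    have "boundary y2 B = boundary (\<lambda>A. y2 (insert m A)) A \<oplus> sign (card A) \<odot> y2 A"
      unfolding A(1) by (rule boundary_insert) (use A finU below in auto)
    moreover have "boundary (\<lambda>A. y2 (insert m A)) A = \<zero>" by (rule boundary_zero) (simp add: y2_def)
    moreover have "y2 A = y1 A" unfolding y2_def using A m by auto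
    ultimately have "boundary y2 B = sign p \<odot> y1 A" using A by simp
    moreover have "x1 B = \<zero>" unfolding x1_def using y0_top[OF A(2,3)] A(1) M.minus_eq_zero_iff by simp
    moreover have "y1 A \<in> tor B" using y1(1)[OF A(2,3)] tor_mono[of "{m}" B] True by auto
    ultimately show ?thesis
      using submodule_minus[OF module_axioms torU[OF B(1)]] submoduleE(4)[OF torU[OF B(1)]]
        submodule_zero[OF module_axioms torU[OF B(1)]] by simp
  next
    case False
    then have BU: "B \<subseteq> U" using B by blast
    have "boundary y2 B = boundary y1 B"
      by (rule boundary_cong) (use False in \<open>auto simp: y2_def\<close>)
    moreover have "x2 B = z B" unfolding x2_def using BU B by simp
    ultimately have "(x1 B \<ominus> x2 B) \<oplus> (x2 B \<ominus> boundary y2 B) \<in> tor B"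
      using submoduleE(5)[OF torU[OF B(1)]] z[OF BU B(2)] y1(2)[OF BU B(2)] by auto
    moreover have "(x1 B \<ominus> x2 B) \<oplus> (x2 B \<ominus> boundary y2 B) = x1 B \<ominus> boundary y2 B"
      by (simp add: a_minus_def M.a_assoc M.r_neg1)
    ultimately show ?thesis by simp
  qed
  show ?case
  proof (intro exI[of _ "\<lambda>A. y0 A \<oplus> y2 A"] conjI allI impI)
    fix A assume A: "A \<subseteq> insert m U" "card A = p"
    have "y2 A \<in> N \<inter> part M D" unfolding y2_def using A y1(1)[of A] N0 part_zero by auto
    then show "y0 A \<oplus> y2 A \<in> N \<inter> part M D" using y0N[OF A] Nsub(5) part_add by auto
  next
    fix B assume B: "B \<subseteq> insert m U" "card B = Suc p"
    have "boundary (\<lambda>A. y0 A \<oplus> y2 A) B = boundary y0 B \<oplus> boundary y2 B" by (rule boundary_add) simp_all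
    then have "x B \<ominus> boundary (\<lambda>A. y0 A \<oplus> y2 A) B = x1 B \<ominus> boundary y2 B"
      unfolding x1_def by (simp add: a_minus_def M.minus_add M.a_assoc)
    then show "x B \<ominus> boundary (\<lambda>A. y0 A \<oplus> y2 A) B \<in> tor B" using y2_tor[OF B] by simp
  qed auto
qed

end

section \<open>The torsion functor by homogeneous denominators\<close>

lemmas (in graded_ring) ring_minus_add_cancel = minus_add_cancel
  and ring_finsum_insert = finsum_insert
  and ring_r_cancel_one = add.r_cancel_one
  and ring_minus_closed = minus_closed

context graded_module
begin

text \<open>
  If \<open>g\<close> has components only above \<open>l\<close> and \<open>y\<close> only from \<open>p\<close> on, then \<open>g y\<close> has components only above
  \<open>l + p\<close>.
\<close>
lemma filtration_smult:
  assumes g: "g \<in> carrier T" "\<And>k. k \<le> l \<Longrightarrow> hcomp T (rcomp T) k g = \<zero>\<^bsub>T\<^esub>"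
    and y: "y \<in> carrier M" "\<And>u. u < p \<Longrightarrow> hcomp M (mcomp M) u y = \<zero>"
    and v: "v \<le> int l + p"
  shows "hcomp M (mcomp M) v (g \<odot> y) = \<zero>"
proof -
  let ?c = "\<lambda>k. hcomp T (rcomp T) k g"
  have 0: "hcomp M (mcomp M) v (?c k \<odot> y) = \<zero>" for k
  proof (cases "k \<le> l")
    case True
    then show ?thesis using g y by simp
  next
    case False
    then have "hcomp M (mcomp M) (v - int k) y = \<zero>" using v y(2) by simp
    then show ?thesis
      using hcomp_smult[OF R.hcomp_in[OF g(1)] y(1), of k "v - int k"] g by simp
  qed
  have *: "finite U \<Longrightarrow> hcomp M (mcomp M) v (finsum T ?c U \<odot> y) = \<zero> \<and> finsum T ?c U \<in> carrier T" for U
  proof (induction U rule: finite_induct)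
    case (insert k U)
    have "finsum T ?c (insert k U) = ?c k \<oplus>\<^bsub>T\<^esub> finsum T ?c U"
      by (rule ring_finsum_insert) (use insert g in auto)
    then show ?case using insert g y 0 by (simp add: smult_l_distr G.hcomp_add)
  qed (use y in simp)
  show ?thesis using *[of "{k. ?c k \<noteq> \<zero>\<^bsub>T\<^esub>}"] R.hcomp_spec[OF g(1)] by simp
qed

text \<open>
  The lowest component of \<open>h\<close> annihilates the lowest component of \<open>y\<close>, so multiplication by it leaves
  fewer components of \<open>y\<close>, and \<open>h\<close> still annihilates the result.
\<close>
lemma lowest_component_nilpotent:
  assumes h: "h \<in> carrier T" "\<And>k. k < l \<Longrightarrow> hcomp T (rcomp T) k h = \<zero>\<^bsub>T\<^esub>"
    and y: "y \<in> carrier M" "h \<odot> y = \<zero>"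
  shows "\<exists>c::nat. hcomp T (rcomp T) l h [^]\<^bsub>T\<^esub> c \<odot> y = \<zero>"
  using y
proof (induction "card {u. hcomp M (mcomp M) u y \<noteq> \<zero>}" arbitrary: y rule: less_induct)
  case less
  let ?supp = "\<lambda>y. {u. hcomp M (mcomp M) u y \<noteq> \<zero>}"
  have fin: "finite (?supp y)" using G.hcomp_spec[OF less.prems(1)] by blast
  show ?case
  proof (cases "?supp y = {}")
    case True
    then have "y = \<zero>" using G.hcomp_ext[OF less.prems(1) M.zero_closed] by simp
    then show ?thesis using h by (intro exI[of _ 0]) simp
  next
    case False
    define p where "p = Min (?supp y)"
    have p: "p \<in> ?supp y" "\<And>u. u < p \<Longrightarrow> hcomp M (mcomp M) u y = \<zero>"
      using Min_in[OF fin False] Min_le[OF fin] unfolding p_def by (auto simp: not_less[symmetric])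
    define hl where "hl = hcomp T (rcomp T) l h"
    have hl: "hl \<in> rcomp T l" "hl \<in> carrier T" unfolding hl_def using h R.hcomp_in by auto
    have "hcomp T (rcomp T) k (h \<ominus>\<^bsub>T\<^esub> hl) = \<zero>\<^bsub>T\<^esub>" if "k \<le> l" for k
    proof -
      have "hcomp T (rcomp T) k (h \<ominus>\<^bsub>T\<^esub> hl \<oplus>\<^bsub>T\<^esub> hl) = hcomp T (rcomp T) k (h \<ominus>\<^bsub>T\<^esub> hl) \<oplus>\<^bsub>T\<^esub> hcomp T (rcomp T) k hl"
        using R.hcomp_add h hl by simp
      moreover have "h \<ominus>\<^bsub>T\<^esub> hl \<oplus>\<^bsub>T\<^esub> hl = h" using h hl ring_minus_add_cancel by simp
      moreover have "hcomp T (rcomp T) k hl = hcomp T (rcomp T) k h"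
        using R.hcomp_homogeneous[OF hl(1), of k] h(2)[of k] that unfolding hl_def by auto
      ultimately have "hcomp T (rcomp T) k (h \<ominus>\<^bsub>T\<^esub> hl) \<oplus>\<^bsub>T\<^esub> hcomp T (rcomp T) k h = hcomp T (rcomp T) k h"
        by simp
      then show ?thesis using ring_r_cancel_one h hl by simp
    qed
    then have "hcomp M (mcomp M) (int l + p) ((h \<ominus>\<^bsub>T\<^esub> hl) \<odot> y) = \<zero>"
      using filtration_smult[of "h \<ominus>\<^bsub>T\<^esub> hl" l y p "int l + p"] h hl less.prems(1) p(2) by simp
    moreover have "h \<odot> y = (h \<ominus>\<^bsub>T\<^esub> hl) \<odot> y \<oplus> hl \<odot> y"
      using smult_l_distr[of "h \<ominus>\<^bsub>T\<^esub> hl" hl y] ring_minus_add_cancel[of h hl] h hl less.prems(1) by simp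
    ultimately have "hl \<odot> hcomp M (mcomp M) p y = \<zero>"
      using less.prems hl h hcomp_smult[OF hl(1) less.prems(1), of p]
      by (metis G.hcomp_add G.hcomp_zero G.hcomp_closed M.l_zero ring_minus_closed smult_closed)
    then have zero: "hcomp M (mcomp M) (int l + p) (hl \<odot> y) = \<zero>"
      using hcomp_smult[OF hl(1) less.prems(1), of p] by simp
    have sub: "?supp (hl \<odot> y) \<subseteq> (\<lambda>u. int l + u) ` (?supp y - {p})"
    proof
      fix v assume v: "v \<in> ?supp (hl \<odot> y)"
      have "hcomp M (mcomp M) (int l + (v - int l)) (hl \<odot> y) = hl \<odot> hcomp M (mcomp M) (v - int l) y"
        by (rule hcomp_smult[OF hl(1) less.prems(1)])
      then have "hcomp M (mcomp M) (v - int l) y \<noteq> \<zero>" using v hl by auto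
      moreover have "v - int l \<noteq> p" using v zero by auto
      ultimately show "v \<in> (\<lambda>u. int l + u) ` (?supp y - {p})"
        by (intro image_eqI[of _ _ "v - int l"]) auto
    qed
    have "card (?supp (hl \<odot> y)) \<le> card (?supp y - {p})"
      using card_mono[OF _ sub] card_image_le[of "?supp y - {p}" "\<lambda>u. int l + u"] fin by simp
    also have "\<dots> < card (?supp y)" using p(1) fin by (intro card_Diff1_less)
    finally have "card (?supp (hl \<odot> y)) < card (?supp y)" .
    moreover have "h \<odot> (hl \<odot> y) = \<zero>"
      using smult_lcomm[OF h(1) hl(2) less.prems(1)] less.prems hl by simp
    ultimately obtain c where c: "hl [^]\<^bsub>T\<^esub> (c::nat) \<odot> (hl \<odot> y) = \<zero>"
      using less.hyps[of "hl \<odot> y"] hl less.prems(1) unfolding hl_def by auto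
    then have "hl [^]\<^bsub>T\<^esub> Suc c \<odot> y = \<zero>" using hl less.prems(1) by (simp add: smult_assoc1)
    then show ?thesis unfolding hl_def by blast
  qed
qed

text \<open>
  Induction on the number of components of \<open>f\<close>.  Let \<open>f\<^sub>l\<close> be the lowest one, which acts nilpotently on
  \<open>y\<close>.  On elements that \<open>f\<^sub>l\<close> annihilates, \<open>f - f\<^sub>l\<close> acts as \<open>f\<close> does, and it has fewer components; from
  these one ascends to \<open>y\<close> through the powers of \<open>f\<^sub>l\<close>.
\<close>
lemma component_nilpotent:
  assumes "f \<in> carrier T" "y \<in> carrier M" "f \<odot> y = \<zero>"
  shows "\<exists>m::nat. hcomp T (rcomp T) k f [^]\<^bsub>T\<^esub> m \<odot> y = \<zero>"
  using assms
proof (induction "card {k. hcomp T (rcomp T) k f \<noteq> \<zero>\<^bsub>T\<^esub>}" arbitrary: f y rule: less_induct)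
  case less
  let ?supp = "\<lambda>f. {k. hcomp T (rcomp T) k f \<noteq> \<zero>\<^bsub>T\<^esub>}"
  note f = less.prems(1)
  have fin: "finite (?supp f)" using R.hcomp_spec[OF f] by blast
  show ?case
  proof (cases "k \<in> ?supp f")
    case False
    then show ?thesis using less.prems(2) by (intro exI[of _ "Suc 0"]) simp
  next
    case True
    define l where "l = Min (?supp f)"
    have l: "l \<in> ?supp f" "\<And>k. k < l \<Longrightarrow> hcomp T (rcomp T) k f = \<zero>\<^bsub>T\<^esub>"
      using Min_in[OF fin] Min_le[OF fin] True unfolding l_def by (auto simp: not_less[symmetric])
    define fl where "fl = hcomp T (rcomp T) l f"
    define fk where "fk = hcomp T (rcomp T) k f"
    have c: "fl \<in> rcomp T l" "fl \<in> carrier T" "fk \<in> carrier T" unfolding fl_def fk_def using f R.hcomp_in by auto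
    let ?g = "f \<ominus>\<^bsub>T\<^esub> fl"
    have g: "?g \<in> carrier T" using f c by simp
    have gcomp: "hcomp T (rcomp T) j ?g = (if j = l then \<zero>\<^bsub>T\<^esub> else hcomp T (rcomp T) j f)" for j
    proof -
      have "hcomp T (rcomp T) j (?g \<oplus>\<^bsub>T\<^esub> fl) = hcomp T (rcomp T) j ?g \<oplus>\<^bsub>T\<^esub> hcomp T (rcomp T) j fl"
        using R.hcomp_add g c by simp
      moreover have "?g \<oplus>\<^bsub>T\<^esub> fl = f" using f c ring_minus_add_cancel by simp
      ultimately have e: "hcomp T (rcomp T) j f = hcomp T (rcomp T) j ?g \<oplus>\<^bsub>T\<^esub> (if j = l then fl else \<zero>\<^bsub>T\<^esub>)"
        using R.hcomp_homogeneous[OF c(1), of j] by simp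
      show ?thesis
      proof (cases "j = l")
        case True
        then have "hcomp T (rcomp T) j ?g \<oplus>\<^bsub>T\<^esub> fl = fl" using e fl_def by simp
        then show ?thesis using True ring_r_cancel_one g c by simp
      next
        case False
        then show ?thesis using e g by simp
      qed
    qed
    have "?supp ?g \<subset> ?supp f" using gcomp l(1) by auto
    then have smaller: "card (?supp ?g) < card (?supp f)" using fin psubset_card_mono by blast
    have "\<exists>m::nat. fk [^]\<^bsub>T\<^esub> m \<odot> y = \<zero>"
      if "y \<in> carrier M" "f \<odot> y = \<zero>" "fl [^]\<^bsub>T\<^esub> (j::nat) \<odot> y = \<zero>" for y j
      using that
    proof (induction j arbitrary: y)
      case 0
      then show ?case by (intro exI[of _ 0]) simp
    next
      case (Suc j)
      have "f \<odot> (fl \<odot> y) = \<zero>" using smult_lcomm[OF f c(2) Suc.prems(1)] Suc.prems c by simp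
      moreover have "fl [^]\<^bsub>T\<^esub> j \<odot> (fl \<odot> y) = \<zero>" using Suc.prems c by (simp add: smult_assoc1)
      ultimately obtain m where m: "fk [^]\<^bsub>T\<^esub> (m::nat) \<odot> (fl \<odot> y) = \<zero>"
        using Suc.IH[of "fl \<odot> y"] Suc.prems c by auto
      let ?z = "fk [^]\<^bsub>T\<^esub> m \<odot> y"
      have z: "?z \<in> carrier M" using c Suc.prems by simp
      have "fl \<odot> ?z = \<zero>" using m smult_lcomm[of fl "fk [^]\<^bsub>T\<^esub> m" y] c Suc.prems by simp
      moreover have "f \<odot> ?z = \<zero>" using smult_lcomm[of f "fk [^]\<^bsub>T\<^esub> m" y] f c Suc.prems by simp
      ultimately have "?g \<odot> ?z = \<zero>"
        using smult_l_distr[of ?g fl ?z] ring_minus_add_cancel[of f fl] f g c z by simp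
      then obtain m' where m': "hcomp T (rcomp T) k ?g [^]\<^bsub>T\<^esub> (m'::nat) \<odot> ?z = \<zero>"
        using less.hyps[OF smaller g z] by blast
      show ?case
      proof (cases "k = l")
        case True
        then show ?thesis using Suc.prems(3) unfolding fk_def fl_def by blast
      next
        case False
        then have "fk [^]\<^bsub>T\<^esub> m' \<odot> ?z = \<zero>" using m' gcomp fk_def by simp
        then have "fk [^]\<^bsub>T\<^esub> (m' + m) \<odot> y = \<zero>"
          using c Suc.prems(1) by (simp add: smult_assoc1 flip: nat_pow_mult)
        then show ?thesis by blast
      qed
    qed
    then show ?thesis
      using lowest_component_nilpotent[OF f l(2) less.prems(2,3)] less.prems(2,3) unfolding fk_def fl_def by blast
  qed
qed

end

text \<open>
  Induction on the sum of the exponents: for each generator \<open>b\<close> the ideal \<open>(K : b)\<close> needs one power of \<open>b\<close>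
  less, so it contains the previous power of the ideal generated by \<open>B\<close>.
\<close>
lemma (in cring) ideal_power_subset:
  assumes "finite B" "B \<subseteq> carrier R" and K: "ideal K R" and n: "\<And>b. b \<in> B \<Longrightarrow> b [^] (n b :: nat) \<in> K"
  shows "(Idl B) [^]\<^bsub>ideals_set R\<^esub> Suc (\<Sum>b\<in>B. n b) \<subseteq> K"
  using K n
proof (induction "\<Sum>b\<in>B. n b" arbitrary: n K)
  let ?I = "Idl B" and ?pow = "\<lambda>m. (Idl B) [^]\<^bsub>ideals_set R\<^esub> (m::nat)"
  have pow_Suc: "?pow (Suc m) = ?pow m \<cdot> ?I" and pow_0: "?pow 0 = carrier R" for m
    by (simp_all add: nat_pow_def ideals_set_def)
  have I: "ideal ?I R" using genideal_ideal assms(2) by blast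
  have pow_ideal: "ideal (?pow m) R" for m
  proof (induction m)
    case 0
    show ?case unfolding pow_0 by (rule oneideal)
  next
    case (Suc m)
    then show ?case unfolding pow_Suc using I by (rule ideal_prod_is_ideal)
  qed
  have step: "?pow (Suc m) \<subseteq> K" if K: "ideal K R" and *: "\<And>b t. b \<in> B \<Longrightarrow> t \<in> ?pow m \<Longrightarrow> t \<otimes> b \<in> K" for m K
  proof -
    interpret K: ideal K R by fact
    interpret P: ideal "?pow m" R by (rule pow_ideal)
    let ?Q = "{r \<in> carrier R. \<forall>t\<in>?pow m. t \<otimes> r \<in> K}"
    have "ideal ?Q R"
    proof (rule idealI[OF ring_axioms])
      show "subgroup ?Q (add_monoid R)"
      proof (rule add.subgroupI)
        have "\<zero> \<in> ?Q" using P.Icarr by auto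
        then show "?Q \<noteq> {}" by blast
      qed (use P.Icarr in \<open>auto simp: r_minus r_distr\<close>)
      fix r x assume r: "r \<in> ?Q" and x: "x \<in> carrier R"
      have "t \<otimes> (x \<otimes> r) \<in> K" if "t \<in> ?pow m" for t
      proof -
        have "t \<otimes> (x \<otimes> r) = x \<otimes> (t \<otimes> r)" using r x P.Icarr[OF that] m_lcomm by simp
        then show ?thesis using r x that K.I_l_closed by simp
      qed
      then show "x \<otimes> r \<in> ?Q" using r x by simp
      then show "r \<otimes> x \<in> ?Q" using r x m_comm by simp
    qed
    moreover have "B \<subseteq> ?Q" using * assms(2) by auto
    ultimately have "?I \<subseteq> ?Q" by (rule genideal_minimal)
    then show ?thesis unfolding pow_Suc
    proof (intro subsetI)
      fix s assume "s \<in> ?pow m \<cdot> ?I"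
      then show "s \<in> K" by induction (use \<open>?I \<subseteq> ?Q\<close> K.a_closed in auto)
    qed
  qed
  {
    case 0
    have "B = {} \<or> K = carrier R"
    proof (cases "B = {}")
      case False
      then obtain b where "b \<in> B" "n b = 0" using 0(1) assms(1) by auto
      then have "\<one> \<in> K" using 0(3)[of b] by simp
      then show ?thesis using ideal.one_imp_carrier[OF 0(2)] by blast
    qed simp
    then show ?case
    proof
      assume "B = {}"
      then show ?case using step[OF 0(2), of 0] 0(1) by (simp del: nat_pow_Suc)
    next
      assume "K = carrier R"
      then show ?case using ideal.Icarr[OF pow_ideal] by blast
    qed
  next
    case (Suc m)
    interpret K: ideal K R by (rule Suc.prems)
    show ?case
    proof (cases "\<exists>b\<in>B. n b = 0")
      case True
      then have "\<one> \<in> K" using Suc.prems(2) by (metis nat_pow_0)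
      then have "K = carrier R" using K.one_imp_carrier by blast
      then show ?thesis using ideal.Icarr[OF pow_ideal] by blast
    next
      case False
      have "t \<otimes> b \<in> K" if b: "b \<in> B" and t: "t \<in> ?pow (Suc m)" for b t
      proof -
        have bc: "b \<in> carrier R" using b assms(2) by blast
        let ?K = "{t \<in> carrier R. t \<otimes> b \<in> K}"
        have K': "ideal ?K R"
        proof (rule idealI[OF ring_axioms])
          show "subgroup ?K (add_monoid R)"
          proof (rule add.subgroupI)
            have "\<zero> \<in> ?K" using bc by simp
            then show "?K \<noteq> {}" by blast
          qed (use bc in \<open>auto simp: l_minus l_distr\<close>)
          fix t x assume "t \<in> ?K" "x \<in> carrier R"
          then show "x \<otimes> t \<in> ?K" using K.I_l_closed[of "t \<otimes> b" x] bc by (simp add: m_assoc)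
          then show "t \<otimes> x \<in> ?K" using \<open>t \<in> ?K\<close> \<open>x \<in> carrier R\<close> m_comm by simp
        qed
        let ?n = "n(b := n b - 1)"
        have pos: "n b = Suc (n b - 1)" using False b by auto
        have "(\<Sum>b\<in>B. n b) = Suc (\<Sum>b\<in>B. ?n b)"
          using assms(1) b pos by (simp add: sum.remove[of B b])
        then have "m = (\<Sum>b\<in>B. ?n b)" using Suc.hyps(2) by simp
        moreover have "c [^] (?n c) \<in> ?K" if "c \<in> B" for c
        proof (cases "c = b")
          case True
          have "b [^] (n b - 1) \<otimes> b \<in> K" using Suc.prems(2)[OF b] pos by (metis nat_pow_Suc)
          then show ?thesis using True bc by simp
        next
          case False
          then show ?thesis
            using Suc.prems(2)[OF that] K.I_r_closed bc that assms(2) by auto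
        qed
        ultimately have "?pow (Suc m) \<subseteq> ?K" using Suc.hyps(1)[of ?n ?K] K' by metis
        then show ?thesis using t by blast
      qed
      then show ?thesis using step[OF Suc.prems(1), of "Suc m"] Suc.hyps(2) by metis
    qed
  }
qed

lemma (in graded_ring) homogeneous_ideal_component:
  assumes "homogeneous_ideal T J" "j \<in> J"
  shows "hcomp T (rcomp T) k j \<in> J"
proof -
  interpret J: ideal J T using assms(1) unfolding homogeneous_ideal_def by blast
  let ?K = "{j \<in> carrier T. \<forall>k. hcomp T (rcomp T) k j \<in> J}"
  have gen: "J \<inter> homogeneous_elements T \<subseteq> ?K"
    using R.hcomp_homogeneous J.Icarr unfolding homogeneous_elements_def by auto
  have add: "x \<oplus> y \<in> ?K" if "x \<in> ?K" "y \<in> ?K" for x y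
    using that J.a_closed by (auto simp: R.hcomp_add)
  have hom: "t \<otimes> x \<in> ?K" if t: "t \<in> rcomp T n" and x: "x \<in> ?K" for t x n
  proof -
    have tc: "t \<in> carrier T" using t R.G_carrier by blast
    have "hcomp T (rcomp T) k (t \<otimes> x) \<in> J" for k
    proof -
      have "icomp (int k) (x \<otimes> t) = icomp (int k - int n) x \<otimes> t" using icomp_smult[of x t n "int k"] t x by blast
      moreover have "icomp (int k - int n) x \<in> J" using x unfolding icomp_def by auto
      ultimately have "icomp (int k) (x \<otimes> t) \<in> J" using J.I_r_closed tc by simp
      then show ?thesis using x tc m_comm[of x t] by (simp add: icomp_def)
    qed
    then show ?thesis using x tc by simp
  qed
  have mult: "t \<otimes> x \<in> ?K" if t: "t \<in> carrier T" and x: "x \<in> ?K" for t x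
    using t
  proof (induction t rule: R.homogeneous_induct)
    case (homogeneous u t)
    then show ?case using hom x by blast
  next
    case (add t r)
    then show ?case using \<open>\<And>x y. x \<in> ?K \<Longrightarrow> y \<in> ?K \<Longrightarrow> x \<oplus> y \<in> ?K\<close>[OF add(3,4)] x
      by (simp add: l_distr)
  qed
  have "ideal ?K T"
  proof (rule idealI[OF ring_axioms])
    show "subgroup ?K (add_monoid T)"
    proof (rule ring_subgroupI)
      have "\<zero> \<in> ?K" by simp
      then show "?K \<noteq> {}" by blast
      show "\<ominus> x \<in> ?K" if "x \<in> ?K" for x using mult[of "\<ominus> \<one>" x] that by (simp add: l_minus)
    qed (use add in auto)
    fix x t assume "x \<in> ?K" "t \<in> carrier T"
    then show "t \<otimes> x \<in> ?K" using mult by blast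
    then show "x \<otimes> t \<in> ?K" using m_comm \<open>x \<in> ?K\<close> \<open>t \<in> carrier T\<close> by simp
  qed
  then have "Idl (J \<inter> homogeneous_elements T) \<subseteq> ?K" using gen by (rule genideal_minimal)
  then show ?thesis using assms unfolding homogeneous_ideal_def by blast
qed

text \<open>
  If \<open>b\<^sup>n y = j y\<close> with \<open>j \<in> J\<close>, then the component of \<open>b\<^sup>n - j\<close> in the degree of \<open>b\<^sup>n\<close> lies in
  \<open>{}\<^sup>*S\<^bsub>b,J\<^esub>\<close>, and a power of it annihilates \<open>y\<close>.  Conversely, if \<open>b\<^sup>n + j\<close> annihilates \<open>y\<close>, then \<open>b\<^sup>n\<close>
  lies in the ideal of all \<open>t\<close> with \<open>t y \<in> J y\<close>; it contains a power of \<open>I\<close> as soon as it contains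
  powers of the generators.
\<close>
theorem (in cech_module_setting) torsion_part_iff:
  assumes J: "homogeneous_ideal T J" and y: "y \<in> carrier M"
  shows "y \<in> torsion_part T (Idl\<^bsub>T\<^esub> (set bs)) J M \<longleftrightarrow> (\<forall>i<length bs. y \<in> tor {i})"
proof
  let ?I = "Idl\<^bsub>T\<^esub> (set bs)"
  have bsc: "set bs \<subseteq> carrier T" using bs_homogeneous homogeneous_carrier by blast
  interpret J: ideal J T by (rule ideal_J)
  {
    assume "y \<in> torsion_part T ?I J M"
    then obtain n where n: "(\<lambda>a. a \<odot> y) ` (?I [^]\<^bsub>ideals_set T\<^esub> (n::nat)) \<subseteq> (\<lambda>j. j \<odot> y) ` J"
      unfolding torsion_part_def by blast
    show "\<forall>i<length bs. y \<in> tor {i}"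
    proof (intro allI impI)
      fix i assume i: "i < length bs"
      let ?b = "bs ! i"
      have bI: "?b \<in> ?I" using genideal_self[OF bsc] i by auto
      have bc: "?b \<in> carrier T" using i bsc by auto
      have "?b [^]\<^bsub>T\<^esub> m \<in> ?I [^]\<^bsub>ideals_set T\<^esub> m" for m :: nat
      proof (induction m)
        case 0
        show ?case by (simp add: nat_pow_def ideals_set_def)
      next
        case (Suc m)
        then have "?b [^]\<^bsub>T\<^esub> m \<otimes>\<^bsub>T\<^esub> ?b \<in> (?I [^]\<^bsub>ideals_set T\<^esub> m) \<cdot>\<^bsub>T\<^esub> ?I" using bI by (rule ideal_prod.prod)
        then show ?case by (simp add: nat_pow_def ideals_set_def)
      qed
      then obtain j where j: "j \<in> J" "?b [^]\<^bsub>T\<^esub> n \<odot> y = j \<odot> y" using n by blast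
      obtain e where e: "?b \<in> rcomp T e" using nth_mem[OF i] bs_homogeneous unfolding homogeneous_elements_def by blast
      have bn: "?b [^]\<^bsub>T\<^esub> n \<in> rcomp T (n * e)" using nat_pow_rcomp[OF e] .
      have jc: "j \<in> carrier T" using j J.Icarr by blast
      let ?f = "?b [^]\<^bsub>T\<^esub> n \<oplus>\<^bsub>T\<^esub> \<ominus>\<^bsub>T\<^esub> j"
      have "?f \<odot> y = \<zero>" using j bc jc y by (simp add: smult_l_distr smult_l_minus M.r_neg)
      then obtain m where m: "hcomp T (rcomp T) (n * e) ?f [^]\<^bsub>T\<^esub> (m::nat) \<odot> y = \<zero>"
        using component_nilpotent[of ?f y] bc jc y by blast
      let ?j = "hcomp T (rcomp T) (n * e) (\<ominus>\<^bsub>T\<^esub> j)"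
      have "hcomp T (rcomp T) (n * e) ?f = ?b [^]\<^bsub>T\<^esub> n \<oplus>\<^bsub>T\<^esub> ?j"
        using R.hcomp_add[of "?b [^]\<^bsub>T\<^esub> n" "\<ominus>\<^bsub>T\<^esub> j" "n * e"] R.hcomp_homogeneous[OF bn, of "n * e"] bc jc by simp
      moreover have "?j \<in> J" using homogeneous_ideal_component[OF J] j J.a_inv_closed by blast
      moreover have "?j \<in> rcomp T (n * e)" using R.hcomp_in jc by simp
      ultimately have "hcomp T (rcomp T) (n * e) ?f \<in> star_S T J ?b"
        using bn unfolding star_S_def by blast
      then have "hcomp T (rcomp T) (n * e) ?f [^]\<^bsub>T\<^esub> m \<in> star_S T J ?b"
        using pow_mem[OF star_multiplicative[OF i]] by blast
      then show "y \<in> tor {i}"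
        using m y unfolding torsion_def denominators_singleton[OF i] by blast
    qed
  }
  {
    assume *: "\<forall>i<length bs. y \<in> tor {i}"
    let ?K = "{t \<in> carrier T. \<exists>j\<in>J. t \<odot> y = j \<odot> y}"
    have "ideal ?K T"
    proof (rule idealI[OF ring_axioms])
      show "subgroup ?K (add_monoid T)"
      proof (rule ring_subgroupI)
        show "?K \<noteq> {}" using J.zero_closed by (auto intro!: exI[of _ "\<zero>\<^bsub>T\<^esub>"])
        show "\<ominus>\<^bsub>T\<^esub> t \<in> ?K" if t: "t \<in> ?K" for t
        proof -
          obtain j where "j \<in> J" "t \<odot> y = j \<odot> y" using t by auto
          then show ?thesis using t y J.Icarr by (auto simp: smult_l_minus intro!: bexI[of _ "\<ominus>\<^bsub>T\<^esub> j"])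
        qed
        show "t \<oplus>\<^bsub>T\<^esub> r \<in> ?K" if t: "t \<in> ?K" and r: "r \<in> ?K" for t r
        proof -
          obtain j i where "j \<in> J" "t \<odot> y = j \<odot> y" "i \<in> J" "r \<odot> y = i \<odot> y" using t r by auto
          then show ?thesis using t r y J.Icarr by (auto simp: smult_l_distr intro!: bexI[of _ "j \<oplus>\<^bsub>T\<^esub> i"])
        qed
      qed auto
      fix t x assume t: "t \<in> ?K" and x: "x \<in> carrier T"
      then obtain j where "j \<in> J" "t \<odot> y = j \<odot> y" by auto
      then show "x \<otimes>\<^bsub>T\<^esub> t \<in> ?K"
        using t x y J.Icarr J.I_l_closed by (auto simp: smult_assoc1 intro!: bexI[of _ "x \<otimes>\<^bsub>T\<^esub> j"])
      then show "t \<otimes>\<^bsub>T\<^esub> x \<in> ?K" using t x m_comm by simp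
    qed
    moreover have "\<exists>n::nat. b [^]\<^bsub>T\<^esub> n \<in> ?K" if b: "b \<in> set bs" for b
    proof -
      obtain i where i: "i < length bs" "b = bs ! i" using b by (auto simp: in_set_conv_nth)
      then obtain s where s: "s \<in> star_S T J b" "s \<odot> y = \<zero>"
        using * denominators_singleton unfolding torsion_def by auto
      then obtain n j where n: "s = b [^]\<^bsub>T\<^esub> (n::nat) \<oplus>\<^bsub>T\<^esub> j" "j \<in> J" unfolding star_S_def by blast
      have c: "b \<in> carrier T" "j \<in> carrier T" using b bsc n J.Icarr by auto
      have "b [^]\<^bsub>T\<^esub> n \<odot> y \<oplus> j \<odot> y = \<zero>" using s n c y by (simp add: smult_l_distr)
      then have "b [^]\<^bsub>T\<^esub> n \<odot> y = (\<ominus>\<^bsub>T\<^esub> j) \<odot> y"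
        using c y M.minus_equality[of "b [^]\<^bsub>T\<^esub> n \<odot> y" "j \<odot> y"] by (simp add: smult_l_minus)
      then show ?thesis using c n J.a_inv_closed by blast
    qed
    moreover from this have "\<forall>b\<in>set bs. \<exists>n::nat. b [^]\<^bsub>T\<^esub> n \<in> ?K" by blast
    then obtain n where "\<forall>b\<in>set bs. b [^]\<^bsub>T\<^esub> (n b :: nat) \<in> ?K" by (rule bchoice[THEN exE])
    ultimately have "?I [^]\<^bsub>ideals_set T\<^esub> Suc (\<Sum>b\<in>set bs. n b) \<subseteq> ?K"
      by (intro ideal_power_subset) (use bsc in auto)
    then show "y \<in> torsion_part T ?I J M"
      unfolding torsion_part_def using y by (auto simp del: nat_pow_Suc intro!: exI[of _ "Suc (\<Sum>b\<in>set bs. n b)"])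
  }
qed

section \<open>The double complex of a graded injective resolution\<close>

lemma graded_product_simps:
  "carrier (graded_product K M) = (\<Pi>\<^sub>E k\<in>K. carrier (M k))"
  "zero (graded_product K M) = (\<lambda>k\<in>K. \<zero>\<^bsub>M k\<^esub>)"
  "add (graded_product K M) = (\<lambda>x y. \<lambda>k\<in>K. x k \<oplus>\<^bsub>M k\<^esub> y k)"
  "smult (graded_product K M) = (\<lambda>t x. \<lambda>k\<in>K. t \<odot>\<^bsub>M k\<^esub> x k)"
  "mcomp (graded_product K M) = (\<lambda>u. \<Pi>\<^sub>E k\<in>K. mcomp (M k) u)"
  by (simp_all add: graded_product_def)

lemma part_graded_product: "part (graded_product K M) D = (\<Pi>\<^sub>E k\<in>K. part (M k) D)"
  by (cases D) (simp_all add: graded_product_simps)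

lemma module_graded_product:
  fixes T :: "'a gring"
  assumes "cring T" "\<And>k. k \<in> K \<Longrightarrow> module T (M k)"
  shows "module T (graded_product K M)"
proof -
  have ag: "abelian_group (M k)" if "k \<in> K" for k using module.axioms(2)[OF assms(2)[OF that]] .
  have am: "abelian_monoid (M k)" if "k \<in> K" for k using abelian_group.axioms(1)[OF ag[OF that]] .
  note abelian_monoid.a_closed[OF am, simp] abelian_monoid.zero_closed[OF am, simp]
    abelian_monoid.l_zero[OF am, simp] module.smult_closed[OF assms(2), simp] module.smult_one[OF assms(2), simp]
  let ?P = "graded_product K M"
  have ext: "x = y" if "x \<in> carrier ?P" "y \<in> carrier ?P" "\<And>k. k \<in> K \<Longrightarrow> x k = y k" for x y
    using that unfolding graded_product_simps by (rule PiE_ext)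
  have mem: "k \<in> K \<Longrightarrow> x \<in> carrier ?P \<Longrightarrow> x k \<in> carrier (M k)" for x k
    unfolding graded_product_simps by auto
  have app: "k \<in> K \<Longrightarrow> (x \<oplus>\<^bsub>?P\<^esub> y) k = x k \<oplus>\<^bsub>M k\<^esub> y k" "k \<in> K \<Longrightarrow> (t \<odot>\<^bsub>?P\<^esub> x) k = t \<odot>\<^bsub>M k\<^esub> x k"
    "k \<in> K \<Longrightarrow> \<zero>\<^bsub>?P\<^esub> k = \<zero>\<^bsub>M k\<^esub>" for x y t k
    unfolding graded_product_simps by auto
  have closed: "x \<in> carrier ?P \<Longrightarrow> y \<in> carrier ?P \<Longrightarrow> x \<oplus>\<^bsub>?P\<^esub> y \<in> carrier ?P" "\<zero>\<^bsub>?P\<^esub> \<in> carrier ?P"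
    "t \<in> carrier T \<Longrightarrow> x \<in> carrier ?P \<Longrightarrow> t \<odot>\<^bsub>?P\<^esub> x \<in> carrier ?P" for x y t
    unfolding graded_product_simps by (auto simp: PiE_iff)
  note [simp] = closed mem app
  show ?thesis
  proof (intro moduleI abelian_groupI)
    fix x y z assume x: "x \<in> carrier ?P" "y \<in> carrier ?P" "z \<in> carrier ?P"
    show "x \<oplus>\<^bsub>?P\<^esub> y \<oplus>\<^bsub>?P\<^esub> z = x \<oplus>\<^bsub>?P\<^esub> (y \<oplus>\<^bsub>?P\<^esub> z)"
      by (rule ext) (use x abelian_monoid.a_assoc[OF am] in auto)
  next
    fix x y assume x: "x \<in> carrier ?P" "y \<in> carrier ?P"
    show "x \<oplus>\<^bsub>?P\<^esub> y = y \<oplus>\<^bsub>?P\<^esub> x"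
      by (rule ext) (use x abelian_monoid.a_comm[OF am] in auto)
  next
    fix x assume x: "x \<in> carrier ?P"
    show "\<zero>\<^bsub>?P\<^esub> \<oplus>\<^bsub>?P\<^esub> x = x" "\<one>\<^bsub>T\<^esub> \<odot>\<^bsub>?P\<^esub> x = x"
      by (rule ext; use x cring.cring_simprules(6)[OF assms(1)] in auto)+
    show "\<exists>y\<in>carrier ?P. y \<oplus>\<^bsub>?P\<^esub> x = \<zero>\<^bsub>?P\<^esub>"
    proof
      show c: "(\<lambda>k\<in>K. \<ominus>\<^bsub>M k\<^esub> x k) \<in> carrier ?P"
        using x abelian_group.a_inv_closed[OF ag] by (auto simp: graded_product_simps)
      show "(\<lambda>k\<in>K. \<ominus>\<^bsub>M k\<^esub> x k) \<oplus>\<^bsub>?P\<^esub> x = \<zero>\<^bsub>?P\<^esub>"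
        by (rule ext) (use x c abelian_group.l_neg[OF ag] in auto)
    qed
  next
    fix a x y assume x: "a \<in> carrier T" "x \<in> carrier ?P" "y \<in> carrier ?P"
    show "a \<odot>\<^bsub>?P\<^esub> (x \<oplus>\<^bsub>?P\<^esub> y) = a \<odot>\<^bsub>?P\<^esub> x \<oplus>\<^bsub>?P\<^esub> a \<odot>\<^bsub>?P\<^esub> y"
      by (rule ext) (use x module.smult_r_distr[OF assms(2)] in auto)
  next
    fix a b x assume x: "a \<in> carrier T" "b \<in> carrier T" "x \<in> carrier ?P"
    show "(a \<oplus>\<^bsub>T\<^esub> b) \<odot>\<^bsub>?P\<^esub> x = a \<odot>\<^bsub>?P\<^esub> x \<oplus>\<^bsub>?P\<^esub> b \<odot>\<^bsub>?P\<^esub> x"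
      by (rule ext) (use x cring.cring_simprules(1)[OF assms(1)] module.smult_l_distr[OF assms(2)] in auto)
    show "(a \<otimes>\<^bsub>T\<^esub> b) \<odot>\<^bsub>?P\<^esub> x = a \<odot>\<^bsub>?P\<^esub> (b \<odot>\<^bsub>?P\<^esub> x)"
      by (rule ext) (use x cring.cring_simprules(5)[OF assms(1)] module.smult_assoc1[OF assms(2)] in auto)
  qed (use assms(1) closed in auto)
qed

lemma graded_product_minus:
  fixes T :: "'a gring"
  assumes "cring T" "\<And>k. k \<in> K \<Longrightarrow> module T (M k)"
    and "x \<in> carrier (graded_product K M)" "y \<in> carrier (graded_product K M)" "k \<in> K"
  shows "(x \<ominus>\<^bsub>graded_product K M\<^esub> y) k = x k \<ominus>\<^bsub>M k\<^esub> y k"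
proof -
  let ?P = "graded_product K M"
  interpret P: module T ?P by (rule module_graded_product[OF assms(1,2)])
  interpret M: module T "M k" by (rule assms(2)[OF assms(5)])
  have c: "x k \<in> carrier (M k)" "y k \<in> carrier (M k)" "(x \<ominus>\<^bsub>?P\<^esub> y) k \<in> carrier (M k)"
    using assms(3-5) P.M.minus_closed[OF assms(3,4)] by (auto simp: graded_product_simps)
  have "((x \<ominus>\<^bsub>?P\<^esub> y) \<oplus>\<^bsub>?P\<^esub> y) k = x k" using P.M.minus_add_cancel[OF assms(3,4)] by simp
  then have "(x \<ominus>\<^bsub>?P\<^esub> y) k \<oplus>\<^bsub>M k\<^esub> y k = x k" using assms(5) by (simp add: graded_product_simps)
  also have "\<dots> = (x k \<ominus>\<^bsub>M k\<^esub> y k) \<oplus>\<^bsub>M k\<^esub> y k" using M.M.minus_add_cancel[OF c(1,2)] by simp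
  finally show ?thesis using c M.M.add.r_cancel[of "(x \<ominus>\<^bsub>?P\<^esub> y) k" "y k" "x k \<ominus>\<^bsub>M k\<^esub> y k"] by simp
qed

lemma graded_hom_linear: "f \<in> graded_hom T M N \<Longrightarrow> f \<in> linear_map T M N"
  unfolding graded_hom_def linear_map_def by blast

lemma graded_hom_part: "f \<in> graded_hom T M N \<Longrightarrow> x \<in> part M D \<Longrightarrow> f x \<in> part N D"
  unfolding graded_hom_def by (cases D) (auto simp: image_subset_iff)

lemma graded_hom_hcomp:
  assumes "graded_module T M" "graded_module T N" "f \<in> graded_hom T M N" "x \<in> carrier M"
  shows "hcomp N (mcomp N) u (f x) = f (hcomp M (mcomp M) u x)"
proof -
  interpret M: graded_module T M by fact
  interpret N: graded_module T N by fact
  note f = graded_hom_linear[OF assms(3)]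
  show ?thesis
    by (rule hcomp_additive_map(1)[OF M.G.graded_group_axioms N.G.graded_group_axioms, where \<sigma> = "\<lambda>u. u"])
      (use linear_mapD[OF f] graded_hom_part[OF assms(3), of _ "Some _"] assms(4) in auto)
qed

lemma graded_hom_preimage:
  assumes "graded_module T M" "graded_module T N" "f \<in> graded_hom T M N"
    and "x \<in> carrier M" "f x \<in> part N D"
  shows "\<exists>x'\<in>part M D. f x' = f x"
proof (cases D)
  case None
  then show ?thesis using assms(4) by auto
next
  case (Some u)
  interpret M: graded_module T M by fact
  interpret N: graded_module T N by fact
  have "hcomp N (mcomp N) u (f x) = f x" using N.G.hcomp_homogeneous[of "f x" u u] assms(5) Some by simp
  then show ?thesis
    using graded_hom_hcomp[OF assms(1-4), of u] M.G.hcomp_in[OF assms(4), of u] Some by auto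
qed

locale cech_resolution = cech_setting T J bs + noetherian_ring T
  for T :: "'a gring" (structure) and J :: "'a set" and bs :: "'a list" +
  fixes L :: "('a, 'l) gmodule" and E :: "nat \<Rightarrow> ('a, 'e) gmodule" and d :: "nat \<Rightarrow> 'e \<Rightarrow> 'e"
    and \<epsilon> :: "'l \<Rightarrow> 'e"
  assumes J_homogeneous: "homogeneous_ideal T J"
    and L: "graded_module T L" and resolution: "graded_injective_resolution T L \<epsilon> E d"
begin

lemma E_injective: "graded_injective T (E q)"
  using resolution unfolding graded_injective_resolution_def by blast

lemma E_module: "graded_module T (E q)"
  using E_injective unfolding graded_injective_def by blast

sublocale E: cech_module_setting T J bs "E q" for q
  using E_module cech_setting_axioms noetherian_ring_axioms
  unfolding cech_module_setting_def noetherian_graded_module_def by blast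

sublocale L: graded_module T L by (rule L)

lemma E_baer: "E.baer q (carrier (E q))"
  by (rule graded_injective_baer[OF E_injective])

lemma d_hom: "d q \<in> graded_hom T (E q) (E (Suc q))"
  using resolution unfolding graded_injective_resolution_def by blast

lemma \<epsilon>_hom: "\<epsilon> \<in> graded_hom T L (E 0)" and \<epsilon>_inj: "inj_on \<epsilon> (carrier L)"
  and \<epsilon>_image: "\<epsilon> ` carrier L = cocycles E d 0"
  using resolution unfolding graded_injective_resolution_def by blast+

lemma d_image: "d q ` carrier (E q) = cocycles E d (Suc q)"
  using resolution unfolding graded_injective_resolution_def by blast

lemmas d_linear = graded_hom_linear[OF d_hom] and \<epsilon>_linear = graded_hom_linear[OF \<epsilon>_hom]
lemmas d_closed = linear_mapD(1)[OF d_linear] and d_add = linear_mapD(2)[OF d_linear]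
  and d_smult = linear_mapD(3)[OF d_linear]
  and d_zero = linear_map_zero[OF E.module_axioms E.module_axioms d_linear]
  and d_minus = linear_map_minus[OF E.module_axioms E.module_axioms d_linear]

lemma d_d: "x \<in> carrier (E q) \<Longrightarrow> d (Suc q) (d q x) = \<zero>\<^bsub>E (Suc (Suc q))\<^esub>"
  using d_image[of q] unfolding cocycles_def by blast

lemma d_exact:
  assumes "y \<in> part (E (Suc q)) D" "d (Suc q) y = \<zero>\<^bsub>E (Suc (Suc q))\<^esub>"
  shows "\<exists>x\<in>part (E q) D. d q x = y"
proof -
  have "y \<in> cocycles E d (Suc q)" 
    unfolding cocycles_def by (intro CollectI conjI E.part_carrier[OF assms(1)] assms(2))
  then obtain x where x: "x \<in> carrier (E q)" "d q x = y"
    unfolding d_image[symmetric] by (metis imageE)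
  have "\<exists>x'\<in>part (E q) D. d q x' = d q x"
    by (rule graded_hom_preimage[OF E_module E_module d_hom x(1)]) (simp only: x(2) assms(1))
  then show ?thesis by (simp only: x(2))
qed

lemma \<epsilon>_exact:
  assumes "y \<in> part (E 0) D" "d 0 y = \<zero>\<^bsub>E (Suc 0)\<^esub>"
  shows "\<exists>x\<in>part L D. \<epsilon> x = y"
proof -
  have "y \<in> cocycles E d 0" 
    unfolding cocycles_def by (intro CollectI conjI E.part_carrier[OF assms(1)] assms(2))
  then obtain x where x: "x \<in> carrier L" "\<epsilon> x = y"
    unfolding \<epsilon>_image[symmetric] by (metis imageE)
  have "\<exists>x'\<in>part L D. \<epsilon> x' = \<epsilon> x"
    by (rule graded_hom_preimage[OF L E_module \<epsilon>_hom x(1)]) (simp only: x(2) assms(1))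
  then show ?thesis by (simp only: x(2))
qed

lemma d_\<epsilon>: "x \<in> carrier L \<Longrightarrow> d 0 (\<epsilon> x) = \<zero>\<^bsub>E (Suc 0)\<^esub>"
  using \<epsilon>_image unfolding cocycles_def by blast

abbreviation K :: "nat \<Rightarrow> nat set set" where "K p \<equiv> cech_indices bs p"

lemma K_subset: "A \<in> K p \<Longrightarrow> A \<subseteq> {..<length bs}"
  unfolding cech_indices_def by blast

lemma K_finite: "A \<in> K p \<Longrightarrow> finite A"
  using K_subset finite_subset by blast

lemma K_remove: "B \<in> K (Suc p) \<Longrightarrow> k \<in> B \<Longrightarrow> B - {k} \<in> K p"
  using K_finite[of B "Suc p"] unfolding cech_indices_def by auto

lemma K_0: "K 0 = {{}}"
  unfolding cech_indices_def using finite_subset by fastforce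

text \<open>
  The term at \<open>(p, q)\<close> of the double complex: by \<open>baer_divisible\<close>, the localization of \<open>E q\<close> at
  \<open>denominators A\<close> is \<open>E q\<close> modulo torsion, so families of elements of \<open>E q\<close> modulo the families in
  \<open>null_fam\<close> are the Cech cochains of \<open>E q\<close>.
\<close>
definition fam :: "nat \<Rightarrow> nat \<Rightarrow> ('a, nat set \<Rightarrow> 'e) gmodule" where
  "fam p q = graded_product (K p) (\<lambda>_. E q)"

definition null_fam :: "nat \<Rightarrow> nat \<Rightarrow> (nat set \<Rightarrow> 'e) set" where
  "null_fam p q = {x \<in> carrier (fam p q). \<forall>A\<in>K p. x A \<in> E.tor q A}"

definition fam_dh :: "nat \<Rightarrow> nat \<Rightarrow> (nat set \<Rightarrow> 'e) \<Rightarrow> nat set \<Rightarrow> 'e" where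
  "fam_dh p q x = (\<lambda>B\<in>K (Suc p). E.boundary q x B)"

definition fam_dv :: "nat \<Rightarrow> nat \<Rightarrow> (nat set \<Rightarrow> 'e) \<Rightarrow> nat set \<Rightarrow> 'e" where
  "fam_dv p q x = (\<lambda>A\<in>K p. d q (x A))"

lemma module_fam: "module T (fam p q)"
  unfolding fam_def by (rule module_graded_product[OF is_cring E.module_axioms])

lemmas fam_simps = graded_product_simps[of "K p" "\<lambda>_. E q" for p q, folded fam_def]

lemma fam_mem: "x \<in> carrier (fam p q) \<Longrightarrow> A \<in> K p \<Longrightarrow> x A \<in> carrier (E q)"
  unfolding fam_simps by auto

lemma fam_part: "part (fam p q) D = (\<Pi>\<^sub>E A\<in>K p. part (E q) D)"
  unfolding fam_def by (rule part_graded_product)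

lemma fam_minus: "x \<in> carrier (fam p q) \<Longrightarrow> y \<in> carrier (fam p q) \<Longrightarrow> A \<in> K p \<Longrightarrow>
    (x \<ominus>\<^bsub>fam p q\<^esub> y) A = x A \<ominus>\<^bsub>E q\<^esub> y A"
  unfolding fam_def by (rule graded_product_minus[OF is_cring E.module_axioms])

lemma fam_dh_linear: "fam_dh p q \<in> linear_map T (fam p q) (fam (Suc p) q)"
  unfolding linear_map_def
proof (intro CollectI conjI ballI)
  show "fam_dh p q \<in> carrier (fam p q) \<rightarrow> carrier (fam (Suc p) q)"
    unfolding fam_dh_def by (auto simp: fam_simps PiE_iff K_remove intro!: E.boundary_closed)
next
  fix x y assume xy: "x \<in> carrier (fam p q)" "y \<in> carrier (fam p q)"
  have "E.boundary q (x \<oplus>\<^bsub>fam p q\<^esub> y) B = E.boundary q x B \<oplus>\<^bsub>E q\<^esub> E.boundary q y B" if B: "B \<in> K (Suc p)" for B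
  proof -
    have "E.boundary q (x \<oplus>\<^bsub>fam p q\<^esub> y) B = E.boundary q (\<lambda>A. x A \<oplus>\<^bsub>E q\<^esub> y A) B"
      by (rule E.boundary_cong) (use xy K_remove[OF B] fam_mem in \<open>auto simp: fam_simps(3)\<close>)
    also have "\<dots> = E.boundary q x B \<oplus>\<^bsub>E q\<^esub> E.boundary q y B"
      by (rule E.boundary_add) (use xy K_remove[OF B] fam_mem in auto)
    finally show ?thesis .
  qed
  then show "fam_dh p q (x \<oplus>\<^bsub>fam p q\<^esub> y) = fam_dh p q x \<oplus>\<^bsub>fam (Suc p) q\<^esub> fam_dh p q y"
    unfolding fam_dh_def by (auto simp: fam_simps(3) fun_eq_iff)
next
  fix t x assume x: "t \<in> carrier T" "x \<in> carrier (fam p q)"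
  have "E.boundary q (t \<odot>\<^bsub>fam p q\<^esub> x) B = t \<odot>\<^bsub>E q\<^esub> E.boundary q x B" if B: "B \<in> K (Suc p)" for B
  proof -
    have "E.boundary q (t \<odot>\<^bsub>fam p q\<^esub> x) B = E.boundary q (\<lambda>A. t \<odot>\<^bsub>E q\<^esub> x A) B"
      by (rule E.boundary_cong) (use x K_remove[OF B] fam_mem in \<open>auto simp: fam_simps(4)\<close>)
    also have "\<dots> = t \<odot>\<^bsub>E q\<^esub> E.boundary q x B"
      by (rule E.boundary_smult) (use x K_remove[OF B] fam_mem K_finite[OF B] in auto)
    finally show ?thesis .
  qed
  then show "fam_dh p q (t \<odot>\<^bsub>fam p q\<^esub> x) = t \<odot>\<^bsub>fam (Suc p) q\<^esub> fam_dh p q x"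
    unfolding fam_dh_def by (auto simp: fam_simps(4) fun_eq_iff)
qed

lemma fam_dv_linear: "fam_dv p q \<in> linear_map T (fam p q) (fam p (Suc q))"
  unfolding linear_map_def fam_dv_def
  by (auto simp: fam_simps d_closed d_add d_smult PiE_iff fun_eq_iff)

lemma d_tor: "x \<in> E.tor q A \<Longrightarrow> A \<subseteq> {..<length bs} \<Longrightarrow> d q x \<in> E.tor (Suc q) A"
proof -
  assume A: "A \<subseteq> {..<length bs}" and "x \<in> E.tor q A"
  then obtain s where s: "s \<in> denominators A" "s \<odot>\<^bsub>E q\<^esub> x = \<zero>\<^bsub>E q\<^esub>" "x \<in> carrier (E q)"
    unfolding E.torsion_def by auto
  have "s \<odot>\<^bsub>E (Suc q)\<^esub> d q x = \<zero>\<^bsub>E (Suc q)\<^esub>"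
    using d_smult[of s x q] s multiplicative_setD(1)[OF denominators_multiplicative[OF A]] d_zero by simp
  then show ?thesis unfolding E.torsion_def using s d_closed by blast
qed

lemma d_boundary:
  assumes "finite B" "\<And>k. k \<in> B \<Longrightarrow> x (B - {k}) \<in> carrier (E q)"
  shows "d q (E.boundary q x B) = E.boundary (Suc q) (\<lambda>A. d q (x A)) B"
  unfolding E.boundary_def using assms
  by (subst linear_map_finsum[OF E.module_axioms E.module_axioms d_linear])
    (auto simp: d_smult d_closed intro!: E.M.finsum_cong')

text \<open>
  Localization preserves the exactness of the resolution: \<open>s x\<close> is a coboundary \<open>d y\<close> for some
  denominator \<open>s\<close>, and \<open>y/s\<close> is represented by an element of \<open>E q\<close>.
\<close>
lemma column_exact:
  assumes A: "A \<subseteq> {..<length bs}" and x: "x \<in> part (E (Suc q)) D" "d (Suc q) x \<in> E.tor (Suc (Suc q)) A"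
  shows "\<exists>y\<in>part (E q) D. x \<ominus>\<^bsub>E (Suc q)\<^esub> d q y \<in> E.tor (Suc q) A"
proof -
  note S = denominators_multiplicative[OF A]
  note Sc = multiplicative_setD[OF S]
  have xc: "x \<in> carrier (E (Suc q))" by (rule E.part_carrier[OF x(1)])
  obtain s where s: "s \<in> denominators A" "s \<odot>\<^bsub>E (Suc (Suc q))\<^esub> d (Suc q) x = \<zero>\<^bsub>E (Suc (Suc q))\<^esub>"
    using x(2) unfolding E.torsion_def by auto
  obtain k where k: "s \<in> rcomp T k" using Sc(2)[OF s(1)] by blast
  have sc: "s \<in> carrier T" using Sc s by blast
  obtain y where y: "y \<in> part (E q) (shift k D)" "d q y = s \<odot>\<^bsub>E (Suc q)\<^esub> x"
    using d_exact[OF E.part_smult[OF k x(1)]] d_smult[OF sc xc] s(2) by auto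
  have yc: "y \<in> carrier (E q)" by (rule E.part_carrier[OF y(1)])
  obtain z w where z: "z \<in> part (E q) D" "w \<in> denominators A" "w \<odot>\<^bsub>E q\<^esub> (s \<odot>\<^bsub>E q\<^esub> z) = w \<odot>\<^bsub>E q\<^esub> y"
    using E.baer_divisible[OF E_baer S s(1) k yc y(1)] by blast
  have zc: "z \<in> carrier (E q)" "w \<in> carrier T" by (rule E.part_carrier[OF z(1)], rule Sc(1)[OF z(2)])
  have "w \<odot>\<^bsub>E (Suc q)\<^esub> (s \<odot>\<^bsub>E (Suc q)\<^esub> d q z) = d q (w \<odot>\<^bsub>E q\<^esub> (s \<odot>\<^bsub>E q\<^esub> z))"
    using zc sc d_closed by (simp add: d_smult)
  also have "\<dots> = w \<odot>\<^bsub>E (Suc q)\<^esub> (s \<odot>\<^bsub>E (Suc q)\<^esub> x)" unfolding z(3) using zc yc y(2) by (simp add: d_smult)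
  finally have "(w \<otimes> s) \<odot>\<^bsub>E (Suc q)\<^esub> (x \<ominus>\<^bsub>E (Suc q)\<^esub> d q z) = \<zero>\<^bsub>E (Suc q)\<^esub>"
    using zc sc xc d_closed[OF zc(1)]
    by (simp add: E.smult_assoc1 a_minus_def E.smult_r_distr E.smult_r_minus E.M.r_neg)
  then have "x \<ominus>\<^bsub>E (Suc q)\<^esub> d q z \<in> E.tor (Suc q) A"
    unfolding E.torsion_def using xc d_closed[OF zc(1)] Sc(4)[OF z(2) s(1)] by auto
  then show ?thesis using z(1) by blast
qed

sublocale DC: double_complex T fam null_fam fam_dh fam_dv
proof (rule double_complex.intro)
  fix p q x
  interpret F: module T "fam p q" by (rule module_fam)
  show "module T (fam p q)" by (rule module_fam)
  show "submodule (null_fam p q) T (fam p q)"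
  proof (rule F.submoduleI)
    note t = E.submoduleE[OF E.submodule_tor[OF K_subset]]
    show "null_fam p q \<subseteq> carrier (fam p q)" unfolding null_fam_def by blast
    show "\<zero>\<^bsub>fam p q\<^esub> \<in> null_fam p q"
      unfolding null_fam_def using submodule_zero[OF E.module_axioms E.submodule_tor[OF K_subset]] F.M.zero_closed
      by (auto simp: fam_simps(2))
    show "x \<oplus>\<^bsub>fam p q\<^esub> y \<in> null_fam p q" if "x \<in> null_fam p q" "y \<in> null_fam p q" for x y
      using that F.M.a_closed t(5) unfolding null_fam_def by (auto simp: fam_simps(3))
    show smult: "a \<odot>\<^bsub>fam p q\<^esub> x \<in> null_fam p q" if "a \<in> carrier T" "x \<in> null_fam p q" for a x
      using that F.smult_closed t(4) unfolding null_fam_def by (auto simp: fam_simps(4))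
    show "\<ominus>\<^bsub>fam p q\<^esub> x \<in> null_fam p q" if "x \<in> null_fam p q" for x
      using smult[of "\<ominus> \<one>" x] that F.smult_l_minus[of \<one> x] unfolding null_fam_def by simp
  qed
  show "x \<in> carrier (fam p q)" if "x \<in> part (fam p q) D" for D
    using that E.part_carrier unfolding fam_part fam_simps by (auto simp: PiE_iff)
  show "fam_dh p q \<in> linear_map T (fam p q) (fam (Suc p) q)" by (rule fam_dh_linear)
  show "fam_dv p q \<in> linear_map T (fam p q) (fam p (Suc q))" by (rule fam_dv_linear)
  show "fam_dh p q x \<in> part (fam (Suc p) q) D" if "x \<in> part (fam p q) D" for D
    using that K_remove K_finite unfolding fam_part fam_dh_def by (auto simp: PiE_iff intro!: E.boundary_part)
  show "fam_dv p q x \<in> part (fam p (Suc q)) D" if "x \<in> part (fam p q) D" for D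
    using that graded_hom_part[OF d_hom] unfolding fam_part fam_dv_def by (auto simp: PiE_iff)
  show "fam_dh p q x \<in> null_fam (Suc p) q" if x: "x \<in> null_fam p q"
  proof -
    have "E.boundary q x B \<in> E.tor q B" if B: "B \<in> K (Suc p)" for B
    proof (rule E.boundary_submodule[OF E.submodule_tor[OF K_subset[OF B]] _ K_finite[OF B]])
      fix k assume "k \<in> B"
      then have "x (B - {k}) \<in> E.tor q (B - {k})" using x K_remove[OF B] unfolding null_fam_def by blast
      then show "x (B - {k}) \<in> E.tor q B" by (rule E.tor_mono[rotated]) blast
    qed
    then show ?thesis
      using linear_mapD(1)[OF fam_dh_linear] x unfolding null_fam_def fam_dh_def by auto
  qed
  show "fam_dv p q x \<in> null_fam p (Suc q)" if "x \<in> null_fam p q"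
    using linear_mapD(1)[OF fam_dv_linear] that d_tor K_subset unfolding null_fam_def fam_dv_def by auto
  show "fam_dv (Suc p) q (fam_dh p q x) = fam_dh p (Suc q) (fam_dv p q x)" if x: "x \<in> carrier (fam p q)"
  proof -
    have "d q (E.boundary q x B) = E.boundary (Suc q) (\<lambda>A\<in>K p. d q (x A)) B" if B: "B \<in> K (Suc p)" for B
    proof -
      have "d q (E.boundary q x B) = E.boundary (Suc q) (\<lambda>A. d q (x A)) B"
        by (rule d_boundary) (use x K_remove[OF B] K_finite[OF B] fam_mem in auto)
      also have "\<dots> = E.boundary (Suc q) (\<lambda>A\<in>K p. d q (x A)) B"
        by (rule E.boundary_cong) (use x K_remove[OF B] fam_mem d_closed in auto)
      finally show ?thesis .
    qed
    then show ?thesis unfolding fam_dh_def fam_dv_def by (auto simp: fun_eq_iff)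
  qed
  show "fam_dh (Suc p) q (fam_dh p q x) \<in> null_fam (Suc (Suc p)) q" if x: "x \<in> carrier (fam p q)"
  proof -
    let ?x = "\<lambda>A. if A \<in> K p then x A else \<zero>\<^bsub>E q\<^esub>"
    have "E.boundary q (\<lambda>B\<in>K (Suc p). E.boundary q x B) C = \<zero>\<^bsub>E q\<^esub>" if C: "C \<in> K (Suc (Suc p))" for C
    proof -
      have xc: "?x A \<in> carrier (E q)" for A using x fam_mem by auto
      have "E.boundary q x B = E.boundary q ?x B" if B: "B \<in> K (Suc p)" for B
        by (rule E.boundary_cong) (use K_remove[OF B] x fam_mem in auto)
      then have "E.boundary q (\<lambda>B\<in>K (Suc p). E.boundary q x B) C = E.boundary q (E.boundary q ?x) C"
        by (intro E.boundary_cong) (use K_remove[OF C] E.boundary_closed xc in auto)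
      then show ?thesis using E.boundary_boundary[OF K_finite[OF C] xc] by simp
    qed
    then have "fam_dh (Suc p) q (fam_dh p q x) = \<zero>\<^bsub>fam (Suc (Suc p)) q\<^esub>"
      unfolding fam_dh_def fam_simps(2) by (auto simp: fun_eq_iff)
    then show ?thesis
      unfolding null_fam_def fam_simps
      using submodule_zero[OF E.module_axioms E.submodule_tor[OF K_subset]] by auto
  qed
  show "fam_dv p (Suc q) (fam_dv p q x) \<in> null_fam p (Suc (Suc q))" if x: "x \<in> carrier (fam p q)"
    unfolding null_fam_def fam_dv_def fam_simps
    using x fam_mem d_d submodule_zero[OF E.module_axioms E.submodule_tor[OF K_subset]] by auto
  show "\<exists>y\<in>part (fam p q) D. x \<ominus>\<^bsub>fam p (Suc q)\<^esub> fam_dv p q y \<in> null_fam p (Suc q)"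
    if x: "x \<in> part (fam p (Suc q)) D" "fam_dv p (Suc q) x \<in> null_fam p (Suc (Suc q))" for D
  proof -
    have "\<exists>y\<in>part (E q) D. x A \<ominus>\<^bsub>E (Suc q)\<^esub> d q y \<in> E.tor (Suc q) A" if A: "A \<in> K p" for A
      by (rule column_exact[OF K_subset[OF A]])
        (use x A in \<open>auto simp: fam_part null_fam_def fam_dv_def\<close>)
    then have "\<forall>A\<in>K p. \<exists>y. y \<in> part (E q) D \<and> x A \<ominus>\<^bsub>E (Suc q)\<^esub> d q y \<in> E.tor (Suc q) A" by blast
    then obtain y where y: "\<forall>A\<in>K p. y A \<in> part (E q) D \<and> x A \<ominus>\<^bsub>E (Suc q)\<^esub> d q (y A) \<in> E.tor (Suc q) A"
      by (rule bchoice[THEN exE])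
    have c: "restrict y (K p) \<in> carrier (fam p q)" "x \<in> carrier (fam p (Suc q))"
      using y x(1) E.part_carrier unfolding fam_simps fam_part by (auto simp: PiE_iff)
    interpret F': module T "fam p (Suc q)" by (rule module_fam)
    have c': "fam_dv p q (restrict y (K p)) \<in> carrier (fam p (Suc q))" using linear_mapD(1)[OF fam_dv_linear c(1)] .
    have "x \<ominus>\<^bsub>fam p (Suc q)\<^esub> fam_dv p q (restrict y (K p)) \<in> null_fam p (Suc q)"
      unfolding null_fam_def using c c' y F'.M.minus_closed[OF c(2) c']
      by (auto simp: fam_minus fam_dv_def)
    moreover have "restrict y (K p) \<in> part (fam p q) D" using y unfolding fam_part by auto
    ultimately show ?thesis by blast
  qed
  show "\<exists>y\<in>part (fam p q) D. x \<ominus>\<^bsub>fam (Suc p) q\<^esub> fam_dh p q y \<in> null_fam (Suc p) q"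
    if x: "x \<in> part (fam (Suc p) q) D" "fam_dh (Suc p) q x \<in> null_fam (Suc (Suc p)) q" for D
  proof -
    let ?x = "\<lambda>A. if A \<in> K (Suc p) then x A else \<zero>\<^bsub>E q\<^esub>"
    have xp: "A \<in> K (Suc p) \<Longrightarrow> x A \<in> part (E q) D" for A using x(1) unfolding fam_part by auto
    have xp': "A \<in> K (Suc p) \<Longrightarrow> x A \<in> carrier (E q)" for A by (rule E.part_carrier[OF xp])
    then have xc: "?x A \<in> carrier (E q)" for A by simp
    have inK: "A \<subseteq> {..<length bs} \<Longrightarrow> card A = n \<Longrightarrow> A \<in> K n" for A n unfolding cech_indices_def by blast
    have "\<exists>y. (\<forall>A. y A \<in> carrier (E q)) \<and>
        (\<forall>A. A \<subseteq> {..<length bs} \<longrightarrow> card A = p \<longrightarrow> y A \<in> carrier (E q) \<inter> part (E q) D) \<and>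
        (\<forall>B. B \<subseteq> {..<length bs} \<longrightarrow> card B = Suc p \<longrightarrow> ?x B \<ominus>\<^bsub>E q\<^esub> E.boundary q y B \<in> E.tor q B)"
    proof (rule E.cech_acyclic[OF _ _ E_baer xc])
      show "E.boundary q ?x C \<in> E.tor q C" if "C \<subseteq> {..<length bs}" "card C = Suc (Suc p)" for C
      proof -
        have C: "C \<in> K (Suc (Suc p))" using inK that by blast
        have "E.boundary q ?x C = E.boundary q x C"
          by (rule E.boundary_cong) (use K_remove[OF C] xp' in auto)
        then show ?thesis using x(2) C unfolding null_fam_def fam_dh_def by auto
      qed
    qed (use xp inK xp' in auto)
    then obtain y where y': "\<And>A. y A \<in> carrier (E q)"
        "\<And>A. A \<subseteq> {..<length bs} \<Longrightarrow> card A = p \<Longrightarrow> y A \<in> carrier (E q) \<inter> part (E q) D"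
        "\<And>B. B \<subseteq> {..<length bs} \<Longrightarrow> card B = Suc p \<Longrightarrow> ?x B \<ominus>\<^bsub>E q\<^esub> E.boundary q y B \<in> E.tor q B"
      by meson
    have y: "\<And>A. y A \<in> carrier (E q)" "\<And>A. A \<in> K p \<Longrightarrow> y A \<in> part (E q) D"
        "\<And>B. B \<in> K (Suc p) \<Longrightarrow> x B \<ominus>\<^bsub>E q\<^esub> E.boundary q y B \<in> E.tor q B"
      using y'(1) y'(2) y'(3) inK unfolding cech_indices_def by auto
    have c: "restrict y (K p) \<in> carrier (fam p q)" "x \<in> carrier (fam (Suc p) q)"
      using y x(1) E.part_carrier unfolding fam_simps fam_part by (auto simp: PiE_iff)
    interpret F': module T "fam (Suc p) q" by (rule module_fam)
    have c': "fam_dh p q (restrict y (K p)) \<in> carrier (fam (Suc p) q)" using linear_mapD(1)[OF fam_dh_linear c(1)] .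
    have b: "E.boundary q (restrict y (K p)) B = E.boundary q y B" if "B \<in> K (Suc p)" for B
      by (rule E.boundary_cong) (use y(1) K_remove[OF that] in auto)
    have "x \<ominus>\<^bsub>fam (Suc p) q\<^esub> fam_dh p q (restrict y (K p)) \<in> null_fam (Suc p) q"
      unfolding null_fam_def using c c' y(3) F'.M.minus_closed[OF c(2) c']
      by (auto simp: fam_minus b fam_dh_def)
    moreover have "restrict y (K p) \<in> part (fam p q) D" using y(2) unfolding fam_part by auto
    ultimately show ?thesis by blast
  qed
qed

end

section \<open>The edge of the double complex given by the torsion functor\<close>

context cech_resolution
begin

abbreviation I :: "'a set" where "I \<equiv> Idl (set bs)"

abbreviation \<Gamma>E :: "nat \<Rightarrow> ('a, 'e) gmodule" where "\<Gamma>E q \<equiv> \<Gamma> T I J (E q)"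

lemma \<Gamma>E_simps:
  "carrier (\<Gamma>E q) = torsion_part T I J (E q)" "zero (\<Gamma>E q) = zero (E q)"
  by (simp_all add: \<Gamma>_def)

lemma torsion_carrier: "x \<in> torsion_part T I J (E q) \<Longrightarrow> x \<in> carrier (E q)"
  unfolding torsion_part_def by blast

lemma tor_empty: "E.tor q {} = {\<zero>\<^bsub>E q\<^esub>}"
  unfolding E.torsion_def denominators_empty by auto

lemma K_1: "K (Suc 0) = (\<lambda>k. {k}) ` {..<length bs}"
  unfolding cech_indices_def by (auto simp: card_1_singleton_iff)

lemma boundary_singleton: "x {} \<in> carrier (E q) \<Longrightarrow> E.boundary q x {k} = x {}"
proof -
  assume x: "x {} \<in> carrier (E q)"
  have none: "{i. i = k \<and> i < k} = {}" by blast
  have "E.boundary q x {k} = (\<Oplus>\<^bsub>E q\<^esub>j\<in>{k}. x {})"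
    unfolding E.boundary_def using x by (intro E.M.finsum_cong') (auto simp: none)
  then show ?thesis using x by simp
qed

lemma fam_0: "x \<in> carrier (fam 0 q) \<longleftrightarrow> (\<exists>a\<in>carrier (E q). x = (\<lambda>A\<in>{{}}. a))"
  unfolding fam_simps K_0 by (auto simp: PiE_iff extensional_def fun_eq_iff restrict_def intro!: bexI[of _ "x {}"])

lemma null_fam_0: "x \<in> null_fam 0 q \<longleftrightarrow> x \<in> carrier (fam 0 q) \<and> x {} = \<zero>\<^bsub>E q\<^esub>"
  unfolding null_fam_def K_0 by (auto simp: tor_empty)

lemma fam_dh_0:
  assumes "x \<in> carrier (fam 0 q)"
  shows "fam_dh 0 q x \<in> null_fam (Suc 0) q \<longleftrightarrow> x {} \<in> torsion_part T I J (E q)"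
proof -
  have x: "x {} \<in> carrier (E q)" using assms fam_mem K_0 by blast
  have c: "fam_dh 0 q x \<in> carrier (fam (Suc 0) q)" using linear_mapD(1)[OF fam_dh_linear assms] .
  have "fam_dh 0 q x \<in> null_fam (Suc 0) q \<longleftrightarrow> (\<forall>k<length bs. x {} \<in> E.tor q {k})"
  proof -
    have "fam_dh 0 q x {k} = x {}" if "k < length bs" for k
    proof -
      have "{k} \<in> K (Suc 0)" unfolding K_1 using that by blast
      then show ?thesis unfolding fam_dh_def by (simp add: boundary_singleton[of x q k, OF x])
    qed
    moreover have "(\<forall>A\<in>K (Suc 0). fam_dh 0 q x A \<in> E.tor q A) \<longleftrightarrow> (\<forall>k<length bs. fam_dh 0 q x {k} \<in> E.tor q {k})"
      unfolding K_1 by auto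
    ultimately show ?thesis unfolding null_fam_def using c by simp
  qed
  then show ?thesis using E.torsion_part_iff[OF J_homogeneous x] by simp
qed

definition torsion_cocycles :: "nat \<Rightarrow> 'e set" where
  "torsion_cocycles i = cocycles \<Gamma>E d i"

definition torsion_coboundaries :: "nat \<Rightarrow> 'e set" where
  "torsion_coboundaries i = coboundaries \<Gamma>E d i"

lemma torsion_cocycles_iff:
  "x \<in> torsion_cocycles i \<longleftrightarrow> x \<in> torsion_part T I J (E i) \<and> d i x = \<zero>\<^bsub>E (Suc i)\<^esub>"
  unfolding torsion_cocycles_def cocycles_def \<Gamma>E_simps by blast

lemma fam_dv_0: "x \<in> carrier (fam 0 q) \<Longrightarrow> fam_dv 0 q x {} = d q (x {})"
  unfolding fam_dv_def K_0 by simp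

lemma DC_Z_0: "x \<in> DC.Z 0 i \<longleftrightarrow> x \<in> carrier (fam 0 i) \<and> x {} \<in> torsion_cocycles i"
  unfolding DC.Z_def torsion_cocycles_iff
  using fam_dh_0[of x i] fam_dv_0[of x i] null_fam_0[of "fam_dv 0 i x" "Suc i"] linear_mapD(1)[OF fam_dv_linear, of x 0 i]
  by auto

lemma cong_0:
  "DC.cong 0 q x y \<longleftrightarrow> x \<in> carrier (fam 0 q) \<and> y \<in> carrier (fam 0 q) \<and> x {} = y {}"
proof -
  interpret F: module T "fam 0 q" by (rule module_fam)
  have c: "x {} \<in> carrier (E q)" if "x \<in> carrier (fam 0 q)" for x using that fam_mem K_0 by blast
  have "x \<ominus>\<^bsub>fam 0 q\<^esub> y \<in> null_fam 0 q \<longleftrightarrow> x {} = y {}"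
    if xy: "x \<in> carrier (fam 0 q)" "y \<in> carrier (fam 0 q)"
  proof -
    have "(x \<ominus>\<^bsub>fam 0 q\<^esub> y) {} = x {} \<ominus>\<^bsub>E q\<^esub> y {}"
      by (rule fam_minus) (use xy K_0 in auto)
    then show ?thesis
      unfolding null_fam_0 using F.M.minus_closed[OF xy] E.M.minus_eq_zero_iff[OF c[OF xy(1)] c[OF xy(2)]] by simp
  qed
  then show ?thesis unfolding DC.cong_def by blast
qed

lemma DC_B_0:
  assumes "x \<in> carrier (fam 0 i)"
  shows "x \<in> DC.B 0 i \<longleftrightarrow> x {} \<in> torsion_coboundaries i"
proof (cases i)
  case 0
  then show ?thesis using assms null_fam_0
    unfolding DC.B_def torsion_coboundaries_def coboundaries_def \<Gamma>E_simps by simp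
next
  case (Suc k)
  show ?thesis
  proof
    assume "x \<in> DC.B 0 i"
    then obtain u where u: "u \<in> carrier (fam 0 k)" "fam_dh 0 k u \<in> null_fam (Suc 0) k"
        "DC.cong 0 (Suc k) x (fam_dv 0 k u)"
      unfolding DC.B_def Suc by auto
    then have "x {} = d k (u {})" using fam_dv_0 unfolding cong_0 by simp
    then show "x {} \<in> torsion_coboundaries i"
      using fam_dh_0[OF u(1)] u(2) unfolding torsion_coboundaries_def coboundaries_def Suc \<Gamma>E_simps by simp
  next
    assume "x {} \<in> torsion_coboundaries i"
    then obtain a where a: "a \<in> torsion_part T I J (E k)" "x {} = d k a"
      unfolding torsion_coboundaries_def coboundaries_def Suc \<Gamma>E_simps by auto
    let ?u = "\<lambda>A\<in>{{}}. a"
    have u: "?u \<in> carrier (fam 0 k)" using fam_0 torsion_carrier[OF a(1)] by blast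
    have "DC.cong 0 (Suc k) x (fam_dv 0 k ?u)"
      unfolding cong_0 using assms Suc linear_mapD(1)[OF fam_dv_linear u] fam_dv_0[OF u] a by simp
    then show "x \<in> DC.B 0 i" unfolding DC.B_def Suc using u fam_dh_0[OF u] a by auto
  qed
qed

lemma submodule_torsion_part: "submodule (torsion_part T I J (E q)) T (E q)"
proof -
  have eq: "torsion_part T I J (E q) = {x \<in> carrier (E q). \<forall>k<length bs. x \<in> E.tor q {k}}"
    using E.torsion_part_iff[OF J_homogeneous] torsion_carrier by blast
  have t: "submodule (E.tor q {k}) T (E q)" if "k < length bs" for k
    using that by (intro E.submodule_tor) auto
  show ?thesis
    unfolding eq
    by (rule E.submoduleI) (use E.submoduleE(3-5)[OF t] submodule_zero[OF E.module_axioms t] in auto)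
qed

lemma submodule_torsion_cocycles: "submodule (torsion_cocycles i) T (E i)"
proof -
  note t = E.submoduleE[OF submodule_torsion_part[of i]] and c = torsion_carrier[of _ i]
  show ?thesis
  proof (rule E.submoduleI)
    show "torsion_cocycles i \<subseteq> carrier (E i)" using c torsion_cocycles_iff by blast
    show "\<zero>\<^bsub>E i\<^esub> \<in> torsion_cocycles i"
      using submodule_zero[OF E.module_axioms submodule_torsion_part] d_zero torsion_cocycles_iff by simp
    show "\<ominus>\<^bsub>E i\<^esub> x \<in> torsion_cocycles i" if "x \<in> torsion_cocycles i" for x
      using that linear_map_neg[OF E.module_axioms E.module_axioms d_linear c] t(3)
      unfolding torsion_cocycles_iff by (simp add: E.M.add.inv_one)
    show "x \<oplus>\<^bsub>E i\<^esub> y \<in> torsion_cocycles i" if "x \<in> torsion_cocycles i" "y \<in> torsion_cocycles i" for x y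
      using that t(5) d_add[OF c c] unfolding torsion_cocycles_iff by simp
    show "r \<odot>\<^bsub>E i\<^esub> x \<in> torsion_cocycles i" if "r \<in> carrier T" "x \<in> torsion_cocycles i" for r x
      using that t(4) d_smult[OF _ c] unfolding torsion_cocycles_iff by simp
  qed
qed

lemma submodule_torsion_coboundaries: "submodule (torsion_coboundaries i) T (E i)"
proof (cases i)
  case 0
  show ?thesis
    unfolding torsion_coboundaries_def coboundaries_def \<Gamma>E_simps 0
    by (rule E.submoduleI) (auto simp: E.M.add.inv_one)
next
  case (Suc k)
  note t = E.submoduleE[OF submodule_torsion_part[of k]]
  have eq: "torsion_coboundaries i = d k ` torsion_part T I J (E k)"
    unfolding torsion_coboundaries_def coboundaries_def Suc \<Gamma>E_simps by simp
  have c: "a \<in> torsion_part T I J (E k) \<Longrightarrow> a \<in> carrier (E k)" for a by (rule torsion_carrier)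
  have "submodule (d k ` torsion_part T I J (E k)) T (E (Suc k))"
  proof (rule E.submoduleI)
    show "d k ` torsion_part T I J (E k) \<subseteq> carrier (E (Suc k))" using c d_closed by blast
    show "\<zero>\<^bsub>E (Suc k)\<^esub> \<in> d k ` torsion_part T I J (E k)"
      using submodule_zero[OF E.module_axioms submodule_torsion_part[of k]] d_zero[of k]
      by (metis image_eqI)
    show "\<ominus>\<^bsub>E (Suc k)\<^esub> x \<in> d k ` torsion_part T I J (E k)" if x: "x \<in> d k ` torsion_part T I J (E k)" for x
    proof -
      obtain a where a: "a \<in> torsion_part T I J (E k)" "x = d k a" using x by blast
      then show ?thesis
        using linear_map_neg[OF E.module_axioms E.module_axioms d_linear c[OF a(1)]] t(3)[OF a(1)]
        by (metis image_eqI)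
    qed
    show "x \<oplus>\<^bsub>E (Suc k)\<^esub> y \<in> d k ` torsion_part T I J (E k)"
      if x: "x \<in> d k ` torsion_part T I J (E k)" and y: "y \<in> d k ` torsion_part T I J (E k)" for x y
    proof -
      obtain a b where a: "a \<in> torsion_part T I J (E k)" "x = d k a" "b \<in> torsion_part T I J (E k)" "y = d k b"
        using x y by blast
      then show ?thesis using d_add[OF c[OF a(1)] c[OF a(3)]] t(5)[OF a(1,3)] by (metis image_eqI)
    qed
    show "r \<odot>\<^bsub>E (Suc k)\<^esub> x \<in> d k ` torsion_part T I J (E k)"
      if r: "r \<in> carrier T" and x: "x \<in> d k ` torsion_part T I J (E k)" for r x
    proof -
      obtain a where a: "a \<in> torsion_part T I J (E k)" "x = d k a" using x by blast
      then show ?thesis using d_smult[OF r c[OF a(1)]] t(4)[OF r a(1)] by (metis image_eqI)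
    qed
  qed
  then show ?thesis unfolding eq using Suc by simp
qed

lemma local_cohomology_eq:
  "local_cohomology T I J E d i =
     graded_quotient T (graded_submodule (E i) (torsion_cocycles i)) (torsion_coboundaries i)"
proof -
  have "torsion_cocycles i \<subseteq> torsion_part T I J (E i)" using torsion_cocycles_iff by blast
  then have "(\<lambda>u. torsion_cocycles i \<inter> (torsion_part T I J (E i) \<inter> mcomp (E i) u)) =
      (\<lambda>u. torsion_cocycles i \<inter> mcomp (E i) u)" by blast
  then have "graded_submodule (\<Gamma>E i) (torsion_cocycles i) = graded_submodule (E i) (torsion_cocycles i)"
    by (simp add: \<Gamma>_def graded_submodule_def)
  then show ?thesis
    unfolding local_cohomology_def cohomology_def torsion_cocycles_def[symmetric]
      torsion_coboundaries_def[symmetric] by simp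
qed

text \<open>
  The families indexed by the sets with 0 elements have a single entry, for the empty set, and their null
  families are zero.  By \<open>torsion_part_iff\<close> the cocycle condition for the horizontal differential
  says that this entry is torsion.
\<close>
theorem torsion_edge:
  "correspondence T (E i) (torsion_cocycles i) (torsion_coboundaries i) (fam 0 i) (DC.Z 0 i) (DC.B 0 i)
     (\<lambda>a x. a \<in> torsion_cocycles i \<and> x \<in> carrier (fam 0 i) \<and> x {} = a)"
  unfolding correspondence_def
proof (intro conjI allI ballI impI; (elim conjE)?)
  interpret F: module T "fam 0 i" by (rule module_fam)
  note Z = E.submoduleE[OF submodule_torsion_cocycles[of i]]
  {
    fix a x assume a: "a \<in> torsion_cocycles i" and x: "x \<in> carrier (fam 0 i)" "x {} = a"
    show "a \<in> torsion_cocycles i" "x \<in> DC.Z 0 i" using a x DC_Z_0 by auto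
    show "a \<in> torsion_coboundaries i \<longleftrightarrow> x \<in> DC.B 0 i" using DC_B_0 x by simp
    {
      fix b y assume b: "b \<in> torsion_cocycles i" and y: "y \<in> carrier (fam 0 i)" "y {} = b"
      show "a \<oplus>\<^bsub>E i\<^esub> b \<in> torsion_cocycles i" "x \<oplus>\<^bsub>fam 0 i\<^esub> y \<in> carrier (fam 0 i)"
        using Z(5) a b x y by auto
      show "(x \<oplus>\<^bsub>fam 0 i\<^esub> y) {} = a \<oplus>\<^bsub>E i\<^esub> b" using x y by (simp add: fam_simps(3) K_0)
    }
    fix t assume t: "t \<in> carrier T"
    show "t \<odot>\<^bsub>E i\<^esub> a \<in> torsion_cocycles i" "t \<odot>\<^bsub>fam 0 i\<^esub> x \<in> carrier (fam 0 i)"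
      using Z(4) a x t by auto
    show "(t \<odot>\<^bsub>fam 0 i\<^esub> x) {} = t \<odot>\<^bsub>E i\<^esub> a" using x by (simp add: fam_simps(4) K_0)
  }
  fix D
  {
    fix a assume a: "a \<in> torsion_cocycles i \<inter> part (E i) D"
    let ?x = "\<lambda>A\<in>{{}}. a"
    have "?x \<in> carrier (fam 0 i)" using fam_0 a torsion_carrier torsion_cocycles_iff by blast
    moreover have "?x \<in> part (fam 0 i) D" using a unfolding fam_part K_0 by auto
    ultimately show "\<exists>x\<in>DC.Z 0 i \<inter> part (fam 0 i) D. a \<in> torsion_cocycles i \<and> x \<in> carrier (fam 0 i) \<and> x {} = a"
      using a by (intro bexI[of _ ?x]) (auto simp: DC_Z_0)
  }
  {
    fix x assume x: "x \<in> DC.Z 0 i \<inter> part (fam 0 i) D"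
    then have "x {} \<in> part (E i) D" unfolding fam_part K_0 by auto
    then show "\<exists>a\<in>torsion_cocycles i \<inter> part (E i) D. a \<in> torsion_cocycles i \<and> x \<in> carrier (fam 0 i) \<and> x {} = a"
      using x DC_Z_0 by auto
  }
qed

end

section \<open>Products of fractions with elements of the module\<close>

context cech_resolution
begin

abbreviation Rg :: "('a, 'a frac_expr) gmodule" where "Rg \<equiv> ring_as_gmodule T"
abbreviation loc :: "nat set \<Rightarrow> ('a, 'a frac_expr) gmodule" where "loc A \<equiv> iter (descending A)"
abbreviation from_ring :: "nat set \<Rightarrow> 'a \<Rightarrow> 'a frac_expr" where
  "from_ring A t \<equiv> structure_map (descending A) (Elem t)"
abbreviation C :: "nat \<Rightarrow> ('a, nat set \<Rightarrow> 'a frac_expr) gmodule" where "C p \<equiv> cech_module T J bs p"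

lemma Rg_simps:
  "carrier Rg = Elem ` carrier T" "Elem x \<oplus>\<^bsub>Rg\<^esub> Elem y = Elem (x \<oplus> y)" "t \<odot>\<^bsub>Rg\<^esub> Elem y = Elem (t \<otimes> y)"
  "\<zero>\<^bsub>Rg\<^esub> = Elem \<zero>"
  by (simp_all add: ring_as_gmodule_def)

lemma subset_finite: "A \<subseteq> {..<length bs} \<Longrightarrow> finite A"
  using finite_subset by blast

lemma loc:
  assumes "A \<subseteq> {..<length bs}"
  shows "module_with_degrees T (loc A)"
    and "is_localization T (denominators A) (structure_map (descending A)) Rg (loc A)"
  using iterated_localization[of "descending A"] descending_simps(1)[OF subset_finite[OF assms]] assms
  by simp_all

lemma module_loc: "A \<subseteq> {..<length bs} \<Longrightarrow> module T (loc A)"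
  using loc(1) module_with_degrees.axioms(2) by blast

lemma from_ring:
  assumes "A \<subseteq> {..<length bs}"
  shows "t \<in> carrier T \<Longrightarrow> from_ring A t \<in> carrier (loc A)"
    and "t \<in> carrier T \<Longrightarrow> r \<in> carrier T \<Longrightarrow> from_ring A (t \<oplus> r) = from_ring A t \<oplus>\<^bsub>loc A\<^esub> from_ring A r"
    and "t \<in> carrier T \<Longrightarrow> r \<in> carrier T \<Longrightarrow> from_ring A (t \<otimes> r) = t \<odot>\<^bsub>loc A\<^esub> from_ring A r"
    and "from_ring A \<zero> = \<zero>\<^bsub>loc A\<^esub>"
proof -
  note f = is_localizationD(1)[OF loc(2)[OF assms]]
  show "t \<in> carrier T \<Longrightarrow> from_ring A t \<in> carrier (loc A)"
    using linear_mapD(1)[OF f, of "Elem t"] by (simp add: Rg_simps)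
  show "t \<in> carrier T \<Longrightarrow> r \<in> carrier T \<Longrightarrow> from_ring A (t \<oplus> r) = from_ring A t \<oplus>\<^bsub>loc A\<^esub> from_ring A r"
    using linear_mapD(2)[OF f, of "Elem t" "Elem r"] by (simp add: Rg_simps)
  show "t \<in> carrier T \<Longrightarrow> r \<in> carrier T \<Longrightarrow> from_ring A (t \<otimes> r) = t \<odot>\<^bsub>loc A\<^esub> from_ring A r"
    using linear_mapD(3)[OF f, of t "Elem r"] by (simp add: Rg_simps)
  show "from_ring A \<zero> = \<zero>\<^bsub>loc A\<^esub>"
    using linear_map_zero[OF module_with_degrees.axioms(2)[OF module_with_degrees_ring] module_loc[OF assms] f]
    by (simp add: Rg_simps)
qed

lemma den_carrier: "A \<subseteq> {..<length bs} \<Longrightarrow> s \<in> denominators A \<Longrightarrow> s \<in> carrier T"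
  using multiplicative_setD(1)[OF denominators_multiplicative] .

lemma den_mult: "A \<subseteq> {..<length bs} \<Longrightarrow> s \<in> denominators A \<Longrightarrow> t \<in> denominators A \<Longrightarrow> s \<otimes> t \<in> denominators A"
  using multiplicative_setD(4)[OF denominators_multiplicative] .

lemma from_ring_eq:
  assumes A: "A \<subseteq> {..<length bs}" and t: "t \<in> carrier T" "r \<in> carrier T" "from_ring A t = from_ring A r"
  shows "\<exists>w\<in>denominators A. w \<otimes> t = w \<otimes> r"
proof -
  interpret P: module T "loc A" by (rule module_loc[OF A])
  have "from_ring A (t \<oplus> \<ominus> \<one> \<otimes> r) = from_ring A t \<oplus>\<^bsub>loc A\<^esub> (\<ominus> \<one>) \<odot>\<^bsub>loc A\<^esub> from_ring A r"
    using from_ring(2,3)[OF A] t(1,2) by simp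
  also have "\<dots> = \<zero>\<^bsub>loc A\<^esub>"
    using t(3) from_ring(1)[OF A t(2)] by (simp add: P.smult_l_minus P.M.r_neg)
  finally obtain w where w: "w \<in> denominators A" "w \<odot>\<^bsub>Rg\<^esub> Elem (t \<oplus> \<ominus> \<one> \<otimes> r) = \<zero>\<^bsub>Rg\<^esub>"
    using is_localizationD(6)[OF loc(2)[OF A], of "Elem (t \<oplus> \<ominus> \<one> \<otimes> r)"] t by (auto simp: Rg_simps)
  have wc: "w \<in> carrier T" using den_carrier[OF A w(1)] .
  have "w \<otimes> (t \<ominus> r) = \<zero>" using w(2) t by (simp add: Rg_simps a_minus_def l_minus)
  then have "w \<otimes> t \<ominus> w \<otimes> r = \<zero>" using wc t by (simp add: a_minus_def r_distr r_minus)
  then show ?thesis using w(1) wc t minus_eq_zero_iff[of "w \<otimes> t" "w \<otimes> r"] by auto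
qed

text \<open>
  The product of the fraction \<open>c\<close> and \<open>\<epsilon> l\<close> in the localization of \<open>E 0\<close>, as a coset of the torsion
  submodule of \<open>E 0\<close>: all \<open>x\<close> with \<open>s x = t \<epsilon>(l)\<close> for some representation of \<open>c\<close> as \<open>t/s\<close>.
\<close>
definition act :: "nat set \<Rightarrow> 'a frac_expr \<Rightarrow> 'l \<Rightarrow> 'e set" where
  "act A c l = {x \<in> carrier (E 0). \<exists>s\<in>denominators A. \<exists>t\<in>carrier T.
     s \<odot>\<^bsub>loc A\<^esub> c = from_ring A t \<and> s \<odot>\<^bsub>E 0\<^esub> x = t \<odot>\<^bsub>E 0\<^esub> \<epsilon> l}"

lemma \<epsilon>_closed: "l \<in> carrier L \<Longrightarrow> \<epsilon> l \<in> carrier (E 0)"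
  using linear_mapD(1)[OF \<epsilon>_linear] .

lemma act_rescale:
  assumes A: "A \<subseteq> {..<length bs}" and "s \<in> denominators A" "t \<in> carrier T" "w \<in> denominators A"
    and "c \<in> carrier (loc A)" "x \<in> carrier (E 0)" "l \<in> carrier L"
    and "s \<odot>\<^bsub>loc A\<^esub> c = from_ring A t" "s \<odot>\<^bsub>E 0\<^esub> x = t \<odot>\<^bsub>E 0\<^esub> \<epsilon> l"
  shows "(w \<otimes> s) \<odot>\<^bsub>loc A\<^esub> c = from_ring A (w \<otimes> t)" "(w \<otimes> s) \<odot>\<^bsub>E 0\<^esub> x = (w \<otimes> t) \<odot>\<^bsub>E 0\<^esub> \<epsilon> l"
proof -
  interpret P: module T "loc A" by (rule module_loc[OF A])
  show "(w \<otimes> s) \<odot>\<^bsub>loc A\<^esub> c = from_ring A (w \<otimes> t)" "(w \<otimes> s) \<odot>\<^bsub>E 0\<^esub> x = (w \<otimes> t) \<odot>\<^bsub>E 0\<^esub> \<epsilon> l"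
    using assms den_carrier[OF A] \<epsilon>_closed[of l] from_ring(3)[OF A]
    by (simp_all add: P.smult_assoc1 E.smult_assoc1)
qed

lemma actE:
  assumes "x \<in> act A c l"
  obtains s t where "s \<in> denominators A" "t \<in> carrier T" "x \<in> carrier (E 0)"
    "s \<odot>\<^bsub>loc A\<^esub> c = from_ring A t" "s \<odot>\<^bsub>E 0\<^esub> x = t \<odot>\<^bsub>E 0\<^esub> \<epsilon> l"
  using assms unfolding act_def by blast

lemma actI:
  assumes "s \<in> denominators A" "t \<in> carrier T" "x \<in> carrier (E 0)"
    "s \<odot>\<^bsub>loc A\<^esub> c = from_ring A t" "s \<odot>\<^bsub>E 0\<^esub> x = t \<odot>\<^bsub>E 0\<^esub> \<epsilon> l"
  shows "x \<in> act A c l"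
  using assms unfolding act_def by blast

lemma act_add_left:
  assumes A: "A \<subseteq> {..<length bs}" and c: "c \<in> carrier (loc A)" "c' \<in> carrier (loc A)" and l: "l \<in> carrier L"
    and x: "x \<in> act A c l" "x' \<in> act A c' l"
  shows "x \<oplus>\<^bsub>E 0\<^esub> x' \<in> act A (c \<oplus>\<^bsub>loc A\<^esub> c') l"
proof -
  interpret P: module T "loc A" by (rule module_loc[OF A])
  obtain s t where s: "s \<in> denominators A" "t \<in> carrier T" "x \<in> carrier (E 0)"
    "s \<odot>\<^bsub>loc A\<^esub> c = from_ring A t" "s \<odot>\<^bsub>E 0\<^esub> x = t \<odot>\<^bsub>E 0\<^esub> \<epsilon> l" using actE[OF x(1)] .
  obtain s' t' where s': "s' \<in> denominators A" "t' \<in> carrier T" "x' \<in> carrier (E 0)"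
    "s' \<odot>\<^bsub>loc A\<^esub> c' = from_ring A t'" "s' \<odot>\<^bsub>E 0\<^esub> x' = t' \<odot>\<^bsub>E 0\<^esub> \<epsilon> l" using actE[OF x(2)] .
  note sc = den_carrier[OF A s(1)] den_carrier[OF A s'(1)]
  note r = act_rescale[OF A s(1,2) s'(1) c(1) s(3) l s(4,5)]
  note r' = act_rescale[OF A s'(1,2) s(1) c(2) s'(3) l s'(4,5)]
  show ?thesis
  proof (rule actI)
    show "s' \<otimes> s \<in> denominators A" using den_mult[OF A s'(1) s(1)] .
    show "s' \<otimes> t \<oplus> s \<otimes> t' \<in> carrier T" "x \<oplus>\<^bsub>E 0\<^esub> x' \<in> carrier (E 0)" using s s' sc by auto
    show "(s' \<otimes> s) \<odot>\<^bsub>loc A\<^esub> (c \<oplus>\<^bsub>loc A\<^esub> c') = from_ring A (s' \<otimes> t \<oplus> s \<otimes> t')"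
      using r(1) r'(1) c s(2) s'(2) sc m_comm[OF sc] from_ring(2)[OF A] by (simp add: P.smult_r_distr)
    show "(s' \<otimes> s) \<odot>\<^bsub>E 0\<^esub> (x \<oplus>\<^bsub>E 0\<^esub> x') = (s' \<otimes> t \<oplus> s \<otimes> t') \<odot>\<^bsub>E 0\<^esub> \<epsilon> l"
      using r(2) r'(2) s(2,3) s'(2,3) sc m_comm[OF sc] \<epsilon>_closed[OF l]
      by (simp add: E.smult_r_distr E.smult_l_distr)
  qed
qed

lemma act_add_right:
  assumes A: "A \<subseteq> {..<length bs}" and c: "c \<in> carrier (loc A)" and l: "l \<in> carrier L" "l' \<in> carrier L"
    and x: "x \<in> act A c l" "x' \<in> act A c l'"
  shows "x \<oplus>\<^bsub>E 0\<^esub> x' \<in> act A c (l \<oplus>\<^bsub>L\<^esub> l')"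
proof -
  interpret P: module T "loc A" by (rule module_loc[OF A])
  obtain s t where s: "s \<in> denominators A" "t \<in> carrier T" "x \<in> carrier (E 0)"
    "s \<odot>\<^bsub>loc A\<^esub> c = from_ring A t" "s \<odot>\<^bsub>E 0\<^esub> x = t \<odot>\<^bsub>E 0\<^esub> \<epsilon> l" using actE[OF x(1)] .
  obtain s' t' where s': "s' \<in> denominators A" "t' \<in> carrier T" "x' \<in> carrier (E 0)"
    "s' \<odot>\<^bsub>loc A\<^esub> c = from_ring A t'" "s' \<odot>\<^bsub>E 0\<^esub> x' = t' \<odot>\<^bsub>E 0\<^esub> \<epsilon> l'" using actE[OF x(2)] .
  note sc = den_carrier[OF A s(1)] den_carrier[OF A s'(1)]
  note r = act_rescale[OF A s(1,2) s'(1) c s(3) l(1) s(4,5)]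
  note r' = act_rescale[OF A s'(1,2) s(1) c s'(3) l(2) s'(4,5)]
  have "from_ring A (s' \<otimes> t) = from_ring A (s \<otimes> t')" using r(1) r'(1) m_comm[OF sc] by simp
  then obtain w where w: "w \<in> denominators A" "w \<otimes> (s' \<otimes> t) = w \<otimes> (s \<otimes> t')"
    using from_ring_eq[OF A] s(2) s'(2) sc by (metis m_closed)
  have wc: "w \<in> carrier T" using den_carrier[OF A w(1)] .
  show ?thesis
  proof (rule actI)
    show "w \<otimes> (s' \<otimes> s) \<in> denominators A" using den_mult[OF A w(1) den_mult[OF A s'(1) s(1)]] .
    show "w \<otimes> (s' \<otimes> t) \<in> carrier T" "x \<oplus>\<^bsub>E 0\<^esub> x' \<in> carrier (E 0)" using s s' sc wc by auto
    show "(w \<otimes> (s' \<otimes> s)) \<odot>\<^bsub>loc A\<^esub> c = from_ring A (w \<otimes> (s' \<otimes> t))"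
      using r(1) wc sc c s(2) from_ring(3)[OF A wc, of "s' \<otimes> t"] P.smult_assoc1[of w "s' \<otimes> s" c] by simp
    have "(w \<otimes> (s' \<otimes> s)) \<odot>\<^bsub>E 0\<^esub> (x \<oplus>\<^bsub>E 0\<^esub> x') = w \<odot>\<^bsub>E 0\<^esub> ((s' \<otimes> s) \<odot>\<^bsub>E 0\<^esub> x) \<oplus>\<^bsub>E 0\<^esub> w \<odot>\<^bsub>E 0\<^esub> ((s \<otimes> s') \<odot>\<^bsub>E 0\<^esub> x')"
      using wc sc s(3) s'(3) m_comm[OF sc] by (simp add: E.smult_assoc1[of w] E.smult_r_distr)
    also have "\<dots> = (w \<otimes> (s' \<otimes> t)) \<odot>\<^bsub>E 0\<^esub> \<epsilon> l \<oplus>\<^bsub>E 0\<^esub> (w \<otimes> (s \<otimes> t')) \<odot>\<^bsub>E 0\<^esub> \<epsilon> l'"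
      unfolding r(2) r'(2) using wc sc s(2) s'(2) \<epsilon>_closed l by (simp add: E.smult_assoc1[of w])
    also have "\<dots> = (w \<otimes> (s' \<otimes> t)) \<odot>\<^bsub>E 0\<^esub> \<epsilon> (l \<oplus>\<^bsub>L\<^esub> l')"
      unfolding w(2)[symmetric] using wc sc s(2) \<epsilon>_closed l linear_mapD(2)[OF \<epsilon>_linear l]
      by (simp add: E.smult_r_distr)
    finally show "(w \<otimes> (s' \<otimes> s)) \<odot>\<^bsub>E 0\<^esub> (x \<oplus>\<^bsub>E 0\<^esub> x') = (w \<otimes> (s' \<otimes> t)) \<odot>\<^bsub>E 0\<^esub> \<epsilon> (l \<oplus>\<^bsub>L\<^esub> l')" .
  qed
qed

lemma act_smult:
  assumes A: "A \<subseteq> {..<length bs}" and c: "c \<in> carrier (loc A)" and l: "l \<in> carrier L"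
    and x: "x \<in> act A c l" and r: "r \<in> carrier T"
  shows "r \<odot>\<^bsub>E 0\<^esub> x \<in> act A (r \<odot>\<^bsub>loc A\<^esub> c) l" "r \<odot>\<^bsub>E 0\<^esub> x \<in> act A c (r \<odot>\<^bsub>L\<^esub> l)"
proof -
  interpret P: module T "loc A" by (rule module_loc[OF A])
  obtain s t where s: "s \<in> denominators A" "t \<in> carrier T" "x \<in> carrier (E 0)"
    "s \<odot>\<^bsub>loc A\<^esub> c = from_ring A t" "s \<odot>\<^bsub>E 0\<^esub> x = t \<odot>\<^bsub>E 0\<^esub> \<epsilon> l" using actE[OF x] .
  have sc: "s \<in> carrier T" using den_carrier[OF A s(1)] .
  have rx: "s \<odot>\<^bsub>E 0\<^esub> (r \<odot>\<^bsub>E 0\<^esub> x) = (r \<otimes> t) \<odot>\<^bsub>E 0\<^esub> \<epsilon> l"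
    using E.smult_lcomm[OF sc r s(3)] s(2,5) r \<epsilon>_closed[OF l] by (simp add: E.smult_assoc1)
  have rc: "s \<odot>\<^bsub>loc A\<^esub> (r \<odot>\<^bsub>loc A\<^esub> c) = from_ring A (r \<otimes> t)"
    using P.smult_lcomm[OF sc r c] s(4) from_ring(3)[OF A r s(2)] by simp
  show "r \<odot>\<^bsub>E 0\<^esub> x \<in> act A (r \<odot>\<^bsub>loc A\<^esub> c) l" by (rule actI[OF s(1) _ _ rc rx]) (use r s in auto)
  have "s \<odot>\<^bsub>E 0\<^esub> (r \<odot>\<^bsub>E 0\<^esub> x) = t \<odot>\<^bsub>E 0\<^esub> \<epsilon> (r \<odot>\<^bsub>L\<^esub> l)"
    using rx linear_mapD(3)[OF \<epsilon>_linear r l] m_comm[OF r s(2)] r s(2) \<epsilon>_closed[OF l] by (simp add: E.smult_assoc1)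
  then show "r \<odot>\<^bsub>E 0\<^esub> x \<in> act A c (r \<odot>\<^bsub>L\<^esub> l)" using actI[OF s(1,2) _ s(4)] s(3) r by simp
qed

lemma act_unique:
  assumes A: "A \<subseteq> {..<length bs}" and c: "c \<in> carrier (loc A)" and l: "l \<in> carrier L"
    and x: "x \<in> act A c l" "x' \<in> act A c l"
  shows "x \<ominus>\<^bsub>E 0\<^esub> x' \<in> E.tor 0 A"
proof -
  obtain s t where s: "s \<in> denominators A" "t \<in> carrier T" "x \<in> carrier (E 0)"
    "s \<odot>\<^bsub>loc A\<^esub> c = from_ring A t" "s \<odot>\<^bsub>E 0\<^esub> x = t \<odot>\<^bsub>E 0\<^esub> \<epsilon> l" using actE[OF x(1)] .
  obtain s' t' where s': "s' \<in> denominators A" "t' \<in> carrier T" "x' \<in> carrier (E 0)"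
    "s' \<odot>\<^bsub>loc A\<^esub> c = from_ring A t'" "s' \<odot>\<^bsub>E 0\<^esub> x' = t' \<odot>\<^bsub>E 0\<^esub> \<epsilon> l" using actE[OF x(2)] .
  note sc = den_carrier[OF A s(1)] den_carrier[OF A s'(1)]
  note r = act_rescale[OF A s(1,2) s'(1) c s(3) l s(4,5)]
  note r' = act_rescale[OF A s'(1,2) s(1) c s'(3) l s'(4,5)]
  have "from_ring A (s' \<otimes> t) = from_ring A (s \<otimes> t')" using r(1) r'(1) m_comm[OF sc] by simp
  then obtain w where w: "w \<in> denominators A" "w \<otimes> (s' \<otimes> t) = w \<otimes> (s \<otimes> t')"
    using from_ring_eq[OF A] s(2) s'(2) sc by (metis m_closed)
  have wc: "w \<in> carrier T" using den_carrier[OF A w(1)] .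
  have 1: "(w \<otimes> (s' \<otimes> s)) \<odot>\<^bsub>E 0\<^esub> x = (w \<otimes> (s' \<otimes> t)) \<odot>\<^bsub>E 0\<^esub> \<epsilon> l"
    using r(2) wc sc s(2,3) \<epsilon>_closed[OF l] by (simp add: E.smult_assoc1[of w])
  have 2: "(w \<otimes> (s' \<otimes> s)) \<odot>\<^bsub>E 0\<^esub> x' = (w \<otimes> (s \<otimes> t')) \<odot>\<^bsub>E 0\<^esub> \<epsilon> l"
    using r'(2) wc sc s'(2,3) \<epsilon>_closed[OF l] m_comm[OF sc] by (simp add: E.smult_assoc1[of w])
  let ?q = "w \<otimes> (s' \<otimes> s)"
  have q: "?q \<in> denominators A" using den_mult[OF A w(1) den_mult[OF A s'(1) s(1)]] .
  have qc: "?q \<in> carrier T" using den_carrier[OF A q] .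
  have "?q \<odot>\<^bsub>E 0\<^esub> x = ?q \<odot>\<^bsub>E 0\<^esub> x'" using 1 2 w(2) by simp
  then have "?q \<odot>\<^bsub>E 0\<^esub> (x \<ominus>\<^bsub>E 0\<^esub> x') = \<zero>\<^bsub>E 0\<^esub>"
    using qc s(3) s'(3) by (simp add: a_minus_def E.smult_r_distr E.smult_r_minus E.M.r_neg del: m_closed)
  then show ?thesis unfolding E.torsion_def using q s(3) s'(3) by auto
qed

lemma act_tor:
  assumes A: "A \<subseteq> {..<length bs}" and c: "c \<in> carrier (loc A)" and l: "l \<in> carrier L"
    and x: "x \<in> act A c l" and z: "z \<in> carrier (E 0)" "z \<ominus>\<^bsub>E 0\<^esub> x \<in> E.tor 0 A"
  shows "z \<in> act A c l"
proof -
  obtain s t where s: "s \<in> denominators A" "t \<in> carrier T" "x \<in> carrier (E 0)"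
    "s \<odot>\<^bsub>loc A\<^esub> c = from_ring A t" "s \<odot>\<^bsub>E 0\<^esub> x = t \<odot>\<^bsub>E 0\<^esub> \<epsilon> l" using actE[OF x] .
  obtain w where w: "w \<in> denominators A" "w \<odot>\<^bsub>E 0\<^esub> (z \<ominus>\<^bsub>E 0\<^esub> x) = \<zero>\<^bsub>E 0\<^esub>"
    using z(2) unfolding E.torsion_def by auto
  note sc = den_carrier[OF A s(1)] den_carrier[OF A w(1)]
  note r = act_rescale[OF A s(1,2) w(1) c s(3) l s(4,5)]
  have "w \<odot>\<^bsub>E 0\<^esub> z \<ominus>\<^bsub>E 0\<^esub> w \<odot>\<^bsub>E 0\<^esub> x = \<zero>\<^bsub>E 0\<^esub>"
    using w(2) sc z(1) s(3) by (simp add: a_minus_def E.smult_r_distr E.smult_r_minus)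
  then have "w \<odot>\<^bsub>E 0\<^esub> z = w \<odot>\<^bsub>E 0\<^esub> x" using sc z(1) s(3) E.M.minus_eq_zero_iff by simp
  then have "(w \<otimes> s) \<odot>\<^bsub>E 0\<^esub> z = (w \<otimes> s) \<odot>\<^bsub>E 0\<^esub> x"
    using sc z(1) s(3) m_comm[OF sc] by (metis E.smult_assoc1)
  then show ?thesis
    using actI[OF den_mult[OF A w(1) s(1)] _ z(1) r(1)] r(2) sc s(2) by simp
qed

text \<open>
  The degrees of \<open>c\<close> and \<open>l\<close> are either both prescribed or both ignored.
\<close>
lemma act_exists:
  assumes A: "A \<subseteq> {..<length bs}" and c: "c \<in> part (loc A) D" and l: "l \<in> part L D'"
    and D: "(D = None \<and> D' = None \<and> D'' = None) \<or> (\<exists>v w. D = Some v \<and> D' = Some w \<and> D'' = Some (v + w))"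
  shows "\<exists>x\<in>act A c l. x \<in> part (E 0) D''"
proof -
  interpret R: module_with_degrees T Rg by (rule module_with_degrees_ring)
  note S = denominators_multiplicative[OF A]
  obtain k s n where s: "s \<in> denominators A" "s \<in> rcomp T k" "n \<in> part Rg (shift k D)"
      "s \<odot>\<^bsub>loc A\<^esub> c = structure_map (descending A) n"
    using is_localizationD(5)[OF loc(2)[OF A] c] by blast
  obtain t where t: "n = Elem t" "t \<in> carrier T" using R.part_carrier[OF s(3)] by (auto simp: Rg_simps)
  have lc: "l \<in> carrier L" using L.part_carrier[OF l] .
  have \<epsilon>l: "\<epsilon> l \<in> part (E 0) D'" using graded_hom_part[OF \<epsilon>_hom l] .
  have "t \<odot>\<^bsub>E 0\<^esub> \<epsilon> l \<in> part (E 0) (shift k D'')"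
  proof (cases D)
    case None
    then show ?thesis using D t \<epsilon>_closed[OF lc] by simp
  next
    case (Some v)
    then obtain w where w: "D' = Some w" "D'' = Some (v + w)" using D by auto
    have n: "n \<in> mcomp Rg (int k + v)" using s(3) Some by simp
    show ?thesis
    proof (cases "0 \<le> int k + v")
      case True
      then have "t \<in> rcomp T (nat (int k + v))" using n t by (auto simp: ring_as_gmodule_def)
      then show ?thesis
        using E.smult_mcomp[of t "nat (int k + v)" "\<epsilon> l" 0 w] \<epsilon>l w True by (simp add: add.assoc)
    next
      case False
      then have "t = \<zero>" using n t by (auto simp: ring_as_gmodule_def)
      then show ?thesis using \<epsilon>_closed[OF lc] E.part_zero by simp
    qed
  qed
  moreover have tl: "t \<odot>\<^bsub>E 0\<^esub> \<epsilon> l \<in> carrier (E 0)" using t \<epsilon>_closed[OF lc] by simp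
  ultimately obtain x w where x: "x \<in> part (E 0) D''" "w \<in> denominators A"
      "w \<odot>\<^bsub>E 0\<^esub> (s \<odot>\<^bsub>E 0\<^esub> x) = w \<odot>\<^bsub>E 0\<^esub> (t \<odot>\<^bsub>E 0\<^esub> \<epsilon> l)"
    using E.baer_divisible[OF E_baer S s(1,2)] by blast
  interpret P: module_with_degrees T "loc A" by (rule loc(1)[OF A])
  have c': "x \<in> carrier (E 0)" "s \<in> carrier T" "w \<in> carrier T" "c \<in> carrier (loc A)"
    using E.part_carrier[OF x(1)] den_carrier[OF A] s x P.part_carrier[OF c] by auto
  have "x \<in> act A c l"
  proof (rule actI[OF den_mult[OF A x(2) s(1)] _ c'(1)])
    show "w \<otimes> t \<in> carrier T" using c' t by simp
    show "(w \<otimes> s) \<odot>\<^bsub>loc A\<^esub> c = from_ring A (w \<otimes> t)"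
      using s(4) t c' from_ring(3)[OF A c'(3) t(2)] by (simp add: P.smult_assoc1)
    show "(w \<otimes> s) \<odot>\<^bsub>E 0\<^esub> x = (w \<otimes> t) \<odot>\<^bsub>E 0\<^esub> \<epsilon> l"
      using x(3) c' t \<epsilon>_closed[OF lc] by (simp add: E.smult_assoc1)
  qed
  then show ?thesis using x(1) by blast
qed

lemma act_zero:
  assumes A: "A \<subseteq> {..<length bs}" and l: "l \<in> carrier L"
  shows "\<zero>\<^bsub>E 0\<^esub> \<in> act A \<zero>\<^bsub>loc A\<^esub> l"
proof -
  interpret P: module T "loc A" by (rule module_loc[OF A])
  show ?thesis
    by (rule actI[of "\<one>" _ "\<zero>"])
      (use multiplicative_setD(3)[OF denominators_multiplicative[OF A]] \<epsilon>_closed[OF l] from_ring(4)[OF A] in auto)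
qed

lemma act_coset:
  assumes A: "A \<subseteq> {..<length bs}" and c: "c \<in> carrier (loc A)" and l: "l \<in> carrier L" and x: "x \<in> act A c l"
  shows "act A c l = E.tor 0 A +>\<^bsub>E 0\<^esub> x"
proof -
  have xc: "x \<in> carrier (E 0)" using x unfolding act_def by blast
  have "act A c l \<subseteq> carrier (E 0)" unfolding act_def by blast
  then show ?thesis
    using E.coset_mem[OF E.submodule_tor[OF A] xc] act_unique[OF A c l _ x] act_tor[OF A c l x] by blast
qed

end

section \<open>The comparison map\<close>

context cech_resolution
begin

lemma C_eq: "C p = graded_product (K p) loc"
  by (simp add: cech_module_def)

lemmas C_simps = graded_product_simps[of "K p" loc for p, folded C_eq]

lemma module_C: "module T (C p)"
  unfolding C_eq by (rule module_graded_product[OF is_cring module_loc[OF K_subset]])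

lemma C_mem: "c \<in> carrier (C p) \<Longrightarrow> A \<in> K p \<Longrightarrow> c A \<in> carrier (loc A)"
  unfolding C_simps by auto

sublocale TP: tensor_product T "C p" L for p
  by (intro tensor_product.intro graded_ring_axioms module_C L.module_axioms)

abbreviation Q :: "nat set \<Rightarrow> ('a, 'e set) module" where "Q A \<equiv> quotient_module T (E 0) (E.tor 0 A)"

lemma module_Q: "A \<subseteq> {..<length bs} \<Longrightarrow> module T (Q A)"
  by (rule quotient_module_is_module[OF E.module_axioms E.submodule_tor])

lemma coset_Q:
  assumes "A \<subseteq> {..<length bs}"
  shows "x \<in> carrier (E 0) \<Longrightarrow> E.tor 0 A +>\<^bsub>E 0\<^esub> x \<in> carrier (Q A)"
    and "x \<in> carrier (E 0) \<Longrightarrow> y \<in> carrier (E 0) \<Longrightarrow>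
      E.tor 0 A +>\<^bsub>E 0\<^esub> (x \<oplus>\<^bsub>E 0\<^esub> y) = (E.tor 0 A +>\<^bsub>E 0\<^esub> x) \<oplus>\<^bsub>Q A\<^esub> (E.tor 0 A +>\<^bsub>E 0\<^esub> y)"
    and "t \<in> carrier T \<Longrightarrow> x \<in> carrier (E 0) \<Longrightarrow>
      E.tor 0 A +>\<^bsub>E 0\<^esub> (t \<odot>\<^bsub>E 0\<^esub> x) = t \<odot>\<^bsub>Q A\<^esub> (E.tor 0 A +>\<^bsub>E 0\<^esub> x)"
  using linear_mapD[OF coset_map_linear[OF E.module_axioms E.submodule_tor[OF assms], of 0]] by auto

lemma act_in_E: "x \<in> act A c l \<Longrightarrow> x \<in> carrier (E 0)"
  unfolding act_def by blast

lemma act_nonempty: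
  assumes "A \<subseteq> {..<length bs}" "c \<in> carrier (loc A)" "l \<in> carrier L"
  obtains x where "x \<in> act A c l"
  using act_exists[OF assms(1), of c None l None None] assms by auto

text \<open>
  The component at \<open>A\<close> of the comparison map from the tensor product to the cochains of \<open>E 0\<close>.
\<close>
definition Psi :: "nat \<Rightarrow> nat set \<Rightarrow> ((nat set \<Rightarrow> 'a frac_expr) \<times> 'l \<Rightarrow> 'a) set \<Rightarrow> 'e set" where
  "Psi p A = TP.tensor_lift (Q A) (\<lambda>c l. act A (c A) l)"

lemma Psi:
  assumes A: "A \<in> K p"
  shows "Psi p A \<in> linear_map T (TP.MN p) (Q A)"
    and "c \<in> carrier (C p) \<Longrightarrow> l \<in> carrier L \<Longrightarrow> Psi p A (TP.pure p c l) = act A (c A) l"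
proof -
  note A' = K_subset[OF A]
  interpret P: module T "loc A" by (rule module_loc[OF A'])
  have "TP.bilinear p (Q A) (\<lambda>c l. act A (c A) l)"
    unfolding TP.bilinear_def
  proof (intro conjI ballI)
    fix c l assume c: "c \<in> carrier (C p)" and l: "l \<in> carrier L"
    note cA = C_mem[OF c A]
    obtain x where x: "x \<in> act A (c A) l" using act_nonempty[OF A' cA l] .
    note ax = act_coset[OF A' cA l x]
    show "act A (c A) l \<in> carrier (Q A)" unfolding ax using coset_Q(1)[OF A' act_in_E[OF x]] .
    {
      fix t assume t: "t \<in> carrier T"
      have e: "(t \<odot>\<^bsub>C p\<^esub> c) A = t \<odot>\<^bsub>loc A\<^esub> c A" using A by (simp add: C_simps(4))
      have tc: "t \<odot>\<^bsub>loc A\<^esub> c A \<in> carrier (loc A)" using t cA by simp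
      show "act A ((t \<odot>\<^bsub>C p\<^esub> c) A) l = t \<odot>\<^bsub>Q A\<^esub> act A (c A) l"
        unfolding ax e using act_coset[OF A' tc l act_smult(1)[OF A' cA l x t]] coset_Q(3)[OF A' t act_in_E[OF x]] by simp
      show "act A (c A) (t \<odot>\<^bsub>L\<^esub> l) = t \<odot>\<^bsub>Q A\<^esub> act A (c A) l"
        unfolding ax using act_coset[OF A' cA _ act_smult(2)[OF A' cA l x t]] coset_Q(3)[OF A' t act_in_E[OF x]] t l by simp
    }
    {
      fix c' assume c': "c' \<in> carrier (C p)"
      note cA' = C_mem[OF c' A]
      obtain y where y: "y \<in> act A (c' A) l" using act_nonempty[OF A' cA' l] .
      have e: "(c \<oplus>\<^bsub>C p\<^esub> c') A = c A \<oplus>\<^bsub>loc A\<^esub> c' A" using A by (simp add: C_simps(3))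
      have s: "c A \<oplus>\<^bsub>loc A\<^esub> c' A \<in> carrier (loc A)" using cA cA' by simp
      show "act A ((c \<oplus>\<^bsub>C p\<^esub> c') A) l = act A (c A) l \<oplus>\<^bsub>Q A\<^esub> act A (c' A) l"
        unfolding ax act_coset[OF A' cA' l y] e
        using act_coset[OF A' s l act_add_left[OF A' cA cA' l x y]] coset_Q(2)[OF A' act_in_E[OF x] act_in_E[OF y]] by simp
    }
    fix l' assume l': "l' \<in> carrier L"
    obtain y where y: "y \<in> act A (c A) l'" using act_nonempty[OF A' cA l'] .
    show "act A (c A) (l \<oplus>\<^bsub>L\<^esub> l') = act A (c A) l \<oplus>\<^bsub>Q A\<^esub> act A (c A) l'"
      unfolding ax act_coset[OF A' cA l' y]
      using act_coset[OF A' cA _ act_add_right[OF A' cA l l' x y]] coset_Q(2)[OF A' act_in_E[OF x] act_in_E[OF y]] l l' by simp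
  qed
  note lift = TP.tensor_lift[OF module_Q[OF A'] this]
  show "Psi p A \<in> linear_map T (TP.MN p) (Q A)" unfolding Psi_def by (rule lift(1))
  show "c \<in> carrier (C p) \<Longrightarrow> l \<in> carrier L \<Longrightarrow> Psi p A (TP.pure p c l) = act A (c A) l"
    unfolding Psi_def by (rule lift(2))
qed

text \<open>
  The family \<open>x\<close> represents the image of the tensor \<open>X\<close> under the comparison map.
\<close>
definition Rel :: "nat \<Rightarrow> (nat set \<Rightarrow> 'e) \<Rightarrow> ((nat set \<Rightarrow> 'a frac_expr) \<times> 'l \<Rightarrow> 'a) set \<Rightarrow> bool" where
  "Rel p x X \<longleftrightarrow> x \<in> carrier (fam p 0) \<and> X \<in> carrier (TP.MN p) \<and>
     (\<forall>A\<in>K p. Psi p A X = E.tor 0 A +>\<^bsub>E 0\<^esub> x A)"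

lemma Rel_carrier: "Rel p x X \<Longrightarrow> x \<in> carrier (fam p 0)" "Rel p x X \<Longrightarrow> X \<in> carrier (TP.MN p)"
  unfolding Rel_def by auto

lemma Rel_add:
  assumes "Rel p x X" "Rel p y Y"
  shows "Rel p (x \<oplus>\<^bsub>fam p 0\<^esub> y) (X \<oplus>\<^bsub>TP.MN p\<^esub> Y)"
proof -
  interpret F: module T "fam p 0" by (rule module_fam)
  note c = Rel_carrier[OF assms(1)] Rel_carrier[OF assms(2)]
  have "Psi p A (X \<oplus>\<^bsub>TP.MN p\<^esub> Y) = E.tor 0 A +>\<^bsub>E 0\<^esub> (x \<oplus>\<^bsub>fam p 0\<^esub> y) A" if A: "A \<in> K p" for A
    using linear_mapD(2)[OF Psi(1)[OF A] c(2,4)] coset_Q(2)[OF K_subset[OF A] fam_mem[OF c(1) A] fam_mem[OF c(3) A]]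
      assms A unfolding Rel_def by (simp add: fam_simps(3))
  then show ?thesis unfolding Rel_def using c by simp
qed

lemma Rel_smult:
  assumes "t \<in> carrier T" "Rel p x X"
  shows "Rel p (t \<odot>\<^bsub>fam p 0\<^esub> x) (t \<odot>\<^bsub>TP.MN p\<^esub> X)"
proof -
  interpret F: module T "fam p 0" by (rule module_fam)
  note c = Rel_carrier[OF assms(2)]
  have "Psi p A (t \<odot>\<^bsub>TP.MN p\<^esub> X) = E.tor 0 A +>\<^bsub>E 0\<^esub> (t \<odot>\<^bsub>fam p 0\<^esub> x) A" if A: "A \<in> K p" for A
    using linear_mapD(3)[OF Psi(1)[OF A] assms(1) c(2)] coset_Q(3)[OF K_subset[OF A] assms(1) fam_mem[OF c(1) A]]
      assms A unfolding Rel_def by (simp add: fam_simps(4))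
  then show ?thesis unfolding Rel_def using c assms(1) by simp
qed

lemma Rel_minus:
  assumes "Rel p x X" "Rel p y Y"
  shows "Rel p (x \<ominus>\<^bsub>fam p 0\<^esub> y) (X \<ominus>\<^bsub>TP.MN p\<^esub> Y)"
proof -
  interpret F: module T "fam p 0" by (rule module_fam)
  have "Rel p (x \<oplus>\<^bsub>fam p 0\<^esub> (\<ominus> \<one>) \<odot>\<^bsub>fam p 0\<^esub> y) (X \<oplus>\<^bsub>TP.MN p\<^esub> (\<ominus> \<one>) \<odot>\<^bsub>TP.MN p\<^esub> Y)"
    using assms by (intro Rel_add Rel_smult) auto
  then show ?thesis
    using Rel_carrier[OF assms(2)] by (simp add: a_minus_def F.smult_l_minus TP.MN.smult_l_minus)
qed

lemma Rel_cong:
  assumes "Rel p x X" "DC.cong p 0 x y"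
  shows "Rel p y X"
proof -
  have "E.tor 0 A +>\<^bsub>E 0\<^esub> x A = E.tor 0 A +>\<^bsub>E 0\<^esub> y A" if A: "A \<in> K p" for A
  proof -
    note c = DC.cong_carrier[OF assms(2)]
    have "x A \<ominus>\<^bsub>E 0\<^esub> y A \<in> E.tor 0 A"
      using DC.cong_minus_null[OF assms(2)] fam_minus[OF c A] A unfolding null_fam_def by auto
    then show ?thesis
      using E.coset_eq_iff[OF E.submodule_tor[OF K_subset[OF A]] fam_mem[OF c(1) A] fam_mem[OF c(2) A]] by simp
  qed
  then show ?thesis using assms DC.cong_carrier[OF assms(2)] unfolding Rel_def by simp
qed

lemma Rel_pure:
  assumes "c \<in> carrier (C p)" "l \<in> carrier L" "x \<in> carrier (fam p 0)" "\<And>A. A \<in> K p \<Longrightarrow> x A \<in> act A (c A) l"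
  shows "Rel p x (TP.pure p c l)"
  unfolding Rel_def
  using assms Psi(2)[OF _ assms(1,2)] act_coset[OF K_subset C_mem[OF assms(1)] assms(2)] by auto

lemma Rel_zero_fam: "X \<in> carrier (TP.MN p) \<Longrightarrow> X = \<zero>\<^bsub>TP.MN p\<^esub> \<Longrightarrow> Rel p \<zero>\<^bsub>fam p 0\<^esub> X"
proof -
  interpret F: module T "fam p 0" by (rule module_fam)
  assume X: "X \<in> carrier (TP.MN p)" "X = \<zero>\<^bsub>TP.MN p\<^esub>"
  have "Psi p A X = E.tor 0 A +>\<^bsub>E 0\<^esub> \<zero>\<^bsub>E 0\<^esub>" if A: "A \<in> K p" for A
  proof -
    have "E.tor 0 A +>\<^bsub>E 0\<^esub> \<zero>\<^bsub>E 0\<^esub> = E.tor 0 A"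
      using E.coset_eq_self_iff[OF E.submodule_tor[OF K_subset[OF A]] E.M.zero_closed]
        submodule_zero[OF E.module_axioms E.submodule_tor[OF K_subset[OF A]]] by blast
    then show ?thesis
      using linear_map_zero[OF TP.module_tensor module_Q[OF K_subset[OF A]] Psi(1)[OF A]] X(2)
      by (simp add: quotient_simps(1))
  qed
  then show ?thesis unfolding Rel_def using X F.M.zero_closed by (simp add: fam_simps(2))
qed

text \<open>
  For homogeneous \<open>X\<close> the representative can be chosen homogeneous, since it can for pure tensors of
  homogeneous elements.
\<close>
lemma Rel_total:
  assumes "X \<in> part (TP.MN p) D"
  shows "\<exists>x\<in>part (fam p 0) D. Rel p x X"
proof (cases D)
  case None
  have X: "X \<in> carrier (TP.MN p)" using assms None by simp
  have "\<forall>A\<in>K p. \<exists>x. x \<in> carrier (E 0) \<and> Psi p A X = E.tor 0 A +>\<^bsub>E 0\<^esub> x"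
  proof
    fix A assume A: "A \<in> K p"
    have "Psi p A X \<in> (\<lambda>x. E.tor 0 A +>\<^bsub>E 0\<^esub> x) ` carrier (E 0)"
      using linear_mapD(1)[OF Psi(1)[OF A] X] unfolding quotient_simps(3) .
    then show "\<exists>x. x \<in> carrier (E 0) \<and> Psi p A X = E.tor 0 A +>\<^bsub>E 0\<^esub> x" by blast
  qed
  then obtain x where x: "\<forall>A\<in>K p. x A \<in> carrier (E 0) \<and> Psi p A X = E.tor 0 A +>\<^bsub>E 0\<^esub> x A"
    by (rule bchoice[THEN exE])
  have "restrict x (K p) \<in> carrier (fam p 0)" using x unfolding fam_simps by auto
  then show ?thesis using x X None unfolding Rel_def by (intro bexI[of _ "restrict x (K p)"]) auto
next
  case (Some u)
  interpret F: module T "fam p 0" by (rule module_fam)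
  let ?QF = "quotient_module T (TP.F p) (TP.rel p)"
  interpret QF: module T ?QF by (rule quotient_module_is_module[OF TP.F.module_axioms TP.submodule_rel])
  let ?H = "{TP.pure p c l | c l v w. c \<in> mcomp (C p) v \<and> l \<in> mcomp L w \<and> u = v + w}"
  have part0: "\<zero>\<^bsub>fam p 0\<^esub> \<in> part (fam p 0) (Some u)"
    using E.part_zero[of 0 "Some u"] unfolding fam_part fam_simps(2) by auto
  have part_add: "x \<oplus>\<^bsub>fam p 0\<^esub> y \<in> part (fam p 0) (Some u)"
    if "x \<in> part (fam p 0) (Some u)" "y \<in> part (fam p 0) (Some u)" for x y
    using that E.part_add[of _ 0 "Some u"] unfolding fam_part fam_simps(3) by (auto simp: PiE_iff)
  have part_smult: "\<ominus> \<one> \<odot>\<^bsub>fam p 0\<^esub> x \<in> part (fam p 0) (Some u)" if "x \<in> part (fam p 0) (Some u)" for x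
    using that E.sign_part[of _ 0 "Some u" 1] unfolding fam_part fam_simps(4)
    by (auto simp: PiE_iff sign_def)
  have pure: "\<exists>x\<in>part (fam p 0) (Some u). Rel p x (TP.pure p c l)"
    if c: "c \<in> mcomp (C p) v" and l: "l \<in> mcomp L w" and u: "u = v + w" for c l v w
  proof -
    have cA: "A \<in> K p \<Longrightarrow> c A \<in> part (loc A) (Some v)" for A using c unfolding C_simps by auto
    have cc: "c \<in> carrier (C p)"
      using c module_with_degrees.part_carrier[OF loc(1)[OF K_subset] cA] unfolding C_simps by (auto simp: PiE_iff)
    have "\<exists>x. x \<in> act A (c A) l \<and> x \<in> part (E 0) (Some u)" if A: "A \<in> K p" for A
      using act_exists[OF K_subset[OF A] cA[OF A], of l "Some w" "Some u"] l u by auto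
    then have "\<forall>A\<in>K p. \<exists>x. x \<in> act A (c A) l \<and> x \<in> part (E 0) (Some u)" by blast
    then obtain x where x: "\<forall>A\<in>K p. x A \<in> act A (c A) l \<and> x A \<in> part (E 0) (Some u)"
      by (rule bchoice[THEN exE])
    have "restrict x (K p) \<in> part (fam p 0) (Some u)" using x unfolding fam_part by auto
    moreover from DC.part_in[OF this] have "Rel p (restrict x (K p)) (TP.pure p c l)"
      by (intro Rel_pure) (use cc l x L.G.G_carrier in auto)
    ultimately show ?thesis by blast
  qed
  have carr: "Y \<in> carrier ?QF" if "\<exists>x. Rel p x Y" for Y using that Rel_carrier(2) TP.tensor_simps(1) by auto
  have "X \<in> generate (add_monoid ?QF) ?H" using assms Some by (simp add: TP.tensor_simps)
  then have "\<exists>x\<in>part (fam p 0) (Some u). Rel p x X"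
  proof induction
    case one
    have "\<one>\<^bsub>add_monoid ?QF\<^esub> = \<zero>\<^bsub>TP.MN p\<^esub>" by (simp add: TP.tensor_simps)
    then show ?case using Rel_zero_fam[of "\<zero>\<^bsub>TP.MN p\<^esub>" p] part0 by auto
  next
    case (incl h)
    then show ?case using pure by blast
  next
    case (inv h)
    then obtain x where x: "x \<in> part (fam p 0) (Some u)" "Rel p x h" using pure by blast
    have h: "h \<in> carrier ?QF" using carr x by blast
    have "inv\<^bsub>add_monoid ?QF\<^esub> h = \<ominus>\<^bsub>?QF\<^esub> h" by (simp add: a_inv_def)
    also have "\<dots> = \<ominus> \<one> \<odot>\<^bsub>TP.MN p\<^esub> h" using QF.smult_l_minus[of \<one> h] h by (simp add: TP.tensor_simps)
    finally show ?case using Rel_smult[OF _ x(2), of "\<ominus> \<one>"] part_smult[OF x(1)] by auto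
  next
    case (eng h g)
    then obtain x y where "x \<in> part (fam p 0) (Some u)" "Rel p x h" "y \<in> part (fam p 0) (Some u)" "Rel p y g"
      by blast
    moreover have "h \<otimes>\<^bsub>add_monoid ?QF\<^esub> g = h \<oplus>\<^bsub>TP.MN p\<^esub> g" by (simp add: TP.tensor_simps)
    ultimately show ?case using Rel_add[of p x h y g] part_add[of x y] by auto
  qed
  then show ?thesis using Some by simp
qed

definition \<iota> :: "nat \<Rightarrow> nat set \<Rightarrow> 'a frac_expr \<Rightarrow> nat set \<Rightarrow> 'a frac_expr" where
  "\<iota> p A c = (\<lambda>B\<in>K p. if B = A then c else \<zero>\<^bsub>loc B\<^esub>)"

lemma loc_zero: "A \<subseteq> {..<length bs} \<Longrightarrow> \<zero>\<^bsub>loc A\<^esub> \<in> carrier (loc A)"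
  using from_ring(1,4) by (metis zero_closed)

lemma \<iota>_closed: "A \<in> K p \<Longrightarrow> c \<in> carrier (loc A) \<Longrightarrow> \<iota> p A c \<in> carrier (C p)"
  unfolding \<iota>_def C_simps using loc_zero K_subset by auto

lemma \<iota>_smult:
  assumes "A \<in> K p" "c \<in> carrier (loc A)" "t \<in> carrier T"
  shows "\<iota> p A (t \<odot>\<^bsub>loc A\<^esub> c) = t \<odot>\<^bsub>C p\<^esub> \<iota> p A c"
  unfolding \<iota>_def C_simps using module.smult_r_null[OF module_loc[OF K_subset] assms(3)]
  by (auto simp: fun_eq_iff)

lemma K_finite_set: "finite (K p)"
  unfolding cech_indices_def by (rule finite_subset[of _ "Pow {..<length bs}"]) auto

lemma C_decomposition:
  assumes c: "c \<in> carrier (C p)"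
  shows "c = (\<Oplus>\<^bsub>C p\<^esub>A\<in>K p. \<iota> p A (c A))"
proof -
  have "finite F \<Longrightarrow> F \<subseteq> K p \<Longrightarrow> (\<Oplus>\<^bsub>C p\<^esub>A\<in>F. \<iota> p A (c A)) = (\<lambda>B\<in>K p. if B \<in> F then c B else \<zero>\<^bsub>loc B\<^esub>)" for F
  proof (induction F rule: finite_induct)
    case empty
    show ?case by (simp add: C_simps(2))
  next
    case (insert A F)
    have "(\<Oplus>\<^bsub>C p\<^esub>A\<in>insert A F. \<iota> p A (c A)) = \<iota> p A (c A) \<oplus>\<^bsub>C p\<^esub> (\<Oplus>\<^bsub>C p\<^esub>A\<in>F. \<iota> p A (c A))"
      using insert \<iota>_closed C_mem[OF c] by (intro TP.M.M.finsum_insert) auto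
    also have "\<dots> = (\<lambda>B\<in>K p. if B \<in> insert A F then c B else \<zero>\<^bsub>loc B\<^esub>)"
    proof -
      have "(if B = A then c A else \<zero>\<^bsub>loc B\<^esub>) \<oplus>\<^bsub>loc B\<^esub> (if B \<in> F then c B else \<zero>\<^bsub>loc B\<^esub>)
          = (if B \<in> insert A F then c B else \<zero>\<^bsub>loc B\<^esub>)" if B: "B \<in> K p" for B
      proof -
        interpret P: module T "loc B" by (rule module_loc[OF K_subset[OF B]])
        have "c B \<oplus>\<^bsub>loc B\<^esub> \<zero>\<^bsub>loc B\<^esub> = c B" "\<zero>\<^bsub>loc B\<^esub> \<oplus>\<^bsub>loc B\<^esub> c B = c B"
          "\<zero>\<^bsub>loc B\<^esub> \<oplus>\<^bsub>loc B\<^esub> \<zero>\<^bsub>loc B\<^esub> = \<zero>\<^bsub>loc B\<^esub>"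
          using C_mem[OF c B] by simp_all
        then show ?thesis using insert.hyps(2) by auto
      qed
      moreover have "(\<Oplus>\<^bsub>C p\<^esub>A\<in>F. \<iota> p A (c A)) = (\<lambda>B\<in>K p. if B \<in> F then c B else \<zero>\<^bsub>loc B\<^esub>)"
        using insert.IH insert.prems by blast
      moreover have "\<iota> p A (c A) = (\<lambda>B\<in>K p. if B = A then c A else \<zero>\<^bsub>loc B\<^esub>)"
        unfolding \<iota>_def ..
      ultimately show ?thesis unfolding C_simps(3) by (simp only:) (simp cong: restrict_cong)
    qed
    finally show ?case .
  qed
  from this[OF K_finite_set order_refl] have "(\<Oplus>\<^bsub>C p\<^esub>A\<in>K p. \<iota> p A (c A)) = (\<lambda>B\<in>K p. c B)"
    by (simp cong: restrict_cong)
  also have "\<dots> = c" using c unfolding C_simps by (simp add: PiE_iff extensional_restrict)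
  finally show ?thesis ..
qed

text \<open>
  The fraction \<open>u\<close> is \<open>1/s\<close>.  The element \<open>s\<close> is recorded because it is needed for common denominators.
\<close>
definition reciprocal :: "nat set \<Rightarrow> 'a frac_expr \<Rightarrow> 'a \<Rightarrow> bool" where
  "reciprocal A u s \<longleftrightarrow> u \<in> carrier (loc A) \<and> s \<in> denominators A \<and> s \<odot>\<^bsub>loc A\<^esub> u = from_ring A \<one>"

lemma loc_cancel:
  assumes A: "A \<subseteq> {..<length bs}" and "s \<in> denominators A" "c \<in> carrier (loc A)" "c' \<in> carrier (loc A)"
    and "s \<odot>\<^bsub>loc A\<^esub> c = s \<odot>\<^bsub>loc A\<^esub> c'"
  shows "c = c'"
proof -
  interpret P: module T "loc A" by (rule module_loc[OF A])
  have "s \<odot>\<^bsub>loc A\<^esub> (c \<ominus>\<^bsub>loc A\<^esub> c') = \<zero>\<^bsub>loc A\<^esub>"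
    using assms den_carrier[OF A] by (simp add: a_minus_def P.smult_r_distr P.smult_r_minus P.M.r_neg)
  then have "c \<ominus>\<^bsub>loc A\<^esub> c' = \<zero>\<^bsub>loc A\<^esub>"
    using is_localizationD(3)[OF loc(2)[OF A] assms(2)] assms(3,4) by simp
  then show ?thesis using P.M.minus_eq_zero_iff assms(3,4) by simp
qed

lemma loc_divide:
  assumes A: "A \<subseteq> {..<length bs}" and s: "s \<in> denominators A" "c \<in> carrier (loc A)"
  obtains c' where "c' \<in> carrier (loc A)" "s \<odot>\<^bsub>loc A\<^esub> c' = c"
proof -
  obtain k where "s \<in> rcomp T k" using multiplicative_setD(2)[OF denominators_multiplicative[OF A] s(1)] by blast
  then show ?thesis using is_localizationD(4)[OF loc(2)[OF A] s(1), of k c None] s(2) that by auto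
qed

lemma reciprocal_exists:
  assumes A: "A \<subseteq> {..<length bs}" and s: "s \<in> denominators A"
  obtains u where "reciprocal A u s"
  using loc_divide[OF A s from_ring(1)[OF A one_closed]] s unfolding reciprocal_def by blast

lemma reciprocal_refine:
  assumes A: "A \<subseteq> {..<length bs}" and u: "reciprocal A u s" and t: "t \<in> denominators A"
  obtains v where "reciprocal A v (t \<otimes> s)" "u = t \<odot>\<^bsub>loc A\<^esub> v"
proof -
  interpret P: module T "loc A" by (rule module_loc[OF A])
  have u': "u \<in> carrier (loc A)" "s \<in> denominators A" "s \<odot>\<^bsub>loc A\<^esub> u = from_ring A \<one>"
    using u unfolding reciprocal_def by auto
  note c = den_carrier[OF A t] den_carrier[OF A u'(2)]
  obtain v where v: "v \<in> carrier (loc A)" "t \<odot>\<^bsub>loc A\<^esub> v = u" using loc_divide[OF A t u'(1)] .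
  have "(t \<otimes> s) \<odot>\<^bsub>loc A\<^esub> v = from_ring A \<one>"
    using P.smult_lcomm[OF c v(1)] v u' c by (simp add: P.smult_assoc1)
  then show ?thesis using that v den_mult[OF A t u'(2)] unfolding reciprocal_def by auto
qed

lemma fraction_reciprocal:
  assumes A: "A \<subseteq> {..<length bs}" and c: "c \<in> carrier (loc A)"
  obtains u s t where "reciprocal A u s" "t \<in> carrier T" "c = t \<odot>\<^bsub>loc A\<^esub> u"
proof -
  interpret P: module T "loc A" by (rule module_loc[OF A])
  obtain s n where s: "s \<in> denominators A" "n \<in> carrier Rg" "s \<odot>\<^bsub>loc A\<^esub> c = structure_map (descending A) n"
    using is_localizationD(5)[OF loc(2)[OF A], of c None] c by auto
  then obtain t where t: "n = Elem t" "t \<in> carrier T" by (auto simp: Rg_simps)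
  obtain u where u: "reciprocal A u s" using reciprocal_exists[OF A s(1)] .
  then have u': "u \<in> carrier (loc A)" "s \<odot>\<^bsub>loc A\<^esub> u = from_ring A \<one>" unfolding reciprocal_def by auto
  have sc: "s \<in> carrier T" using den_carrier[OF A s(1)] .
  have "s \<odot>\<^bsub>loc A\<^esub> (t \<odot>\<^bsub>loc A\<^esub> u) = s \<odot>\<^bsub>loc A\<^esub> c"
    using P.smult_lcomm[OF sc t(2) u'(1)] u'(2) s(3) t from_ring(3)[OF A t(2) one_closed] by simp
  then have "c = t \<odot>\<^bsub>loc A\<^esub> u" using loc_cancel[OF A s(1) c] u' t by simp
  then show ?thesis using that u t by blast
qed

text \<open>
  A tensor is a sum of terms \<open>(1/s) \<otimes> l\<close>, one for each index: it is a common denominator that turns the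
  tensor product with a localization into the localization of the second factor.
\<close>
definition normal_form :: "nat \<Rightarrow> ((nat set \<Rightarrow> 'a frac_expr) \<times> 'l \<Rightarrow> 'a) set \<Rightarrow> (nat set \<Rightarrow> 'a frac_expr) \<Rightarrow>
    (nat set \<Rightarrow> 'a) \<Rightarrow> (nat set \<Rightarrow> 'l) \<Rightarrow> bool" where
  "normal_form p X u s l \<longleftrightarrow> (\<forall>A\<in>K p. reciprocal A (u A) (s A) \<and> l A \<in> carrier L) \<and>
     X = (\<Oplus>\<^bsub>TP.MN p\<^esub>A\<in>K p. TP.pure p (\<iota> p A (u A)) (l A))"

lemma reciprocal_closed: "reciprocal A u s \<Longrightarrow> u \<in> carrier (loc A)"
  unfolding reciprocal_def by blast

lemma normal_form_exists:
  assumes "X \<in> carrier (TP.MN p)"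
  shows "\<exists>u s l. normal_form p X u s l"
  using assms
proof (induction rule: TP.tensor_induct)
  case zero
  have "\<forall>A\<in>K p. \<exists>u. reciprocal A u \<one>"
    using reciprocal_exists[OF K_subset multiplicative_setD(3)[OF denominators_multiplicative[OF K_subset]]] by metis
  then obtain u where u: "\<forall>A\<in>K p. reciprocal A (u A) \<one>" by (rule bchoice[THEN exE])
  have "TP.pure p (\<iota> p A (u A)) \<zero>\<^bsub>L\<^esub> = \<zero>\<^bsub>TP.MN p\<^esub>" if A: "A \<in> K p" for A
  proof -
    have i: "\<iota> p A (u A) \<in> carrier (C p)" using \<iota>_closed[OF A reciprocal_closed] u A by blast
    then show ?thesis using TP.pure_smult(2)[OF zero_closed i L.M.zero_closed] i by simp
  qed
  then have "(\<Oplus>\<^bsub>TP.MN p\<^esub>A\<in>K p. TP.pure p (\<iota> p A (u A)) \<zero>\<^bsub>L\<^esub>) = (\<Oplus>\<^bsub>TP.MN p\<^esub>A\<in>K p. \<zero>\<^bsub>TP.MN p\<^esub>)"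
    by (intro TP.MN.M.finsum_cong') auto
  then have "normal_form p \<zero>\<^bsub>TP.MN p\<^esub> u (\<lambda>_. \<one>) (\<lambda>_. \<zero>\<^bsub>L\<^esub>)" unfolding normal_form_def using u by simp
  then show ?case by blast
next
  case (pure c l)
  have "\<forall>A\<in>K p. \<exists>y. reciprocal A (fst y) (fst (snd y)) \<and> snd (snd y) \<in> carrier T \<and> c A = snd (snd y) \<odot>\<^bsub>loc A\<^esub> fst y"
  proof
    fix A assume A: "A \<in> K p"
    obtain u s t where "reciprocal A u s" "t \<in> carrier T" "c A = t \<odot>\<^bsub>loc A\<^esub> u"
      using fraction_reciprocal[OF K_subset[OF A] C_mem[OF pure(1) A]] .
    then show "\<exists>y. reciprocal A (fst y) (fst (snd y)) \<and> snd (snd y) \<in> carrier T \<and> c A = snd (snd y) \<odot>\<^bsub>loc A\<^esub> fst y"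
      by (intro exI[of _ "(u, s, t)"]) simp
  qed
  then obtain y where y: "\<forall>A\<in>K p. reciprocal A (fst (y A)) (fst (snd (y A))) \<and> snd (snd (y A)) \<in> carrier T \<and>
      c A = snd (snd (y A)) \<odot>\<^bsub>loc A\<^esub> fst (y A)" by (rule bchoice[THEN exE])
  define u s t where "u A = fst (y A)" and "s A = fst (snd (y A))" and "t A = snd (snd (y A))" for A
  have ust: "reciprocal A (u A) (s A)" "t A \<in> carrier T" "c A = t A \<odot>\<^bsub>loc A\<^esub> u A" if "A \<in> K p" for A
    using y that unfolding u_def s_def t_def by auto
  have lin: "(\<lambda>c. TP.pure p c l) \<in> linear_map T (C p) (TP.MN p)"
    unfolding linear_map_def using pure(2) by (auto simp: TP.pure_add_left TP.pure_smult)
  have i: "\<iota> p A (u A) \<in> carrier (C p)" if "A \<in> K p" for A using \<iota>_closed[OF that reciprocal_closed[OF ust(1)[OF that]]] .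
  have "TP.pure p c l = TP.pure p (\<Oplus>\<^bsub>C p\<^esub>A\<in>K p. \<iota> p A (c A)) l"
    by (rule arg_cong[OF C_decomposition[OF pure(1)]])
  also have "\<dots> = (\<Oplus>\<^bsub>TP.MN p\<^esub>A\<in>K p. TP.pure p (\<iota> p A (c A)) l)"
    by (rule linear_map_finsum[OF module_C TP.module_tensor lin K_finite_set])
      (use \<iota>_closed C_mem[OF pure(1)] in auto)
  also have "\<dots> = (\<Oplus>\<^bsub>TP.MN p\<^esub>A\<in>K p. TP.pure p (\<iota> p A (u A)) (t A \<odot>\<^bsub>L\<^esub> l))"
  proof (rule TP.MN.M.finsum_cong')
    show "TP.pure p (\<iota> p A (c A)) l = TP.pure p (\<iota> p A (u A)) (t A \<odot>\<^bsub>L\<^esub> l)" if A: "A \<in> K p" for A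
      using ust(3)[OF A] \<iota>_smult[OF A reciprocal_closed[OF ust(1)[OF A]] ust(2)[OF A]]
        TP.pure_smult[OF ust(2)[OF A] i[OF A] pure(2)] by simp
  qed (use i ust(2) pure(2) in auto)
  finally have "normal_form p (TP.pure p c l) u s (\<lambda>A. t A \<odot>\<^bsub>L\<^esub> l)"
    unfolding normal_form_def using ust pure(2) by auto
  then show ?case by blast
next
  case (add X Y)
  then obtain u s l u' s' l' where X: "normal_form p X u s l" and Y: "normal_form p Y u' s' l'" by blast
  have r: "reciprocal A (u A) (s A)" "l A \<in> carrier L" "reciprocal A (u' A) (s' A)" "l' A \<in> carrier L" if "A \<in> K p" for A
    using X Y that unfolding normal_form_def by auto
  have rs: "s A \<in> denominators A" "s' A \<in> denominators A" if "A \<in> K p" for A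
    using r[OF that] unfolding reciprocal_def by auto
  have "\<forall>A\<in>K p. \<exists>v. reciprocal A v (s' A \<otimes> s A) \<and> u A = s' A \<odot>\<^bsub>loc A\<^esub> v \<and> u' A = s A \<odot>\<^bsub>loc A\<^esub> v"
  proof
    fix A assume A: "A \<in> K p"
    note A' = K_subset[OF A]
    interpret P: module T "loc A" by (rule module_loc[OF A'])
    obtain v where v: "reciprocal A v (s' A \<otimes> s A)" "u A = s' A \<odot>\<^bsub>loc A\<^esub> v"
      using reciprocal_refine[OF A' r(1)[OF A] rs(2)[OF A]] .
    note sc = den_carrier[OF A' rs(1)[OF A]] den_carrier[OF A' rs(2)[OF A]]
    have vc: "v \<in> carrier (loc A)" using reciprocal_closed[OF v(1)] .
    have "s' A \<odot>\<^bsub>loc A\<^esub> u' A = s' A \<odot>\<^bsub>loc A\<^esub> (s A \<odot>\<^bsub>loc A\<^esub> v)"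
      using v(1) r(3)[OF A] sc vc unfolding reciprocal_def by (simp add: P.smult_assoc1)
    then have "u' A = s A \<odot>\<^bsub>loc A\<^esub> v"
      using loc_cancel[OF A' rs(2)[OF A] reciprocal_closed[OF r(3)[OF A]]] sc vc by simp
    then show "\<exists>v. reciprocal A v (s' A \<otimes> s A) \<and> u A = s' A \<odot>\<^bsub>loc A\<^esub> v \<and> u' A = s A \<odot>\<^bsub>loc A\<^esub> v"
      using v by blast
  qed
  then obtain v where v: "\<forall>A\<in>K p. reciprocal A (v A) (s' A \<otimes> s A) \<and> u A = s' A \<odot>\<^bsub>loc A\<^esub> v A \<and> u' A = s A \<odot>\<^bsub>loc A\<^esub> v A"
    by (rule bchoice[THEN exE])
  have sc: "s A \<in> carrier T" "s' A \<in> carrier T" if "A \<in> K p" for A using rs[OF that] den_carrier[OF K_subset[OF that]] by auto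
  have i: "\<iota> p A (v A) \<in> carrier (C p)" "\<iota> p A (u A) \<in> carrier (C p)" "\<iota> p A (u' A) \<in> carrier (C p)" if "A \<in> K p" for A
    using \<iota>_closed[OF that reciprocal_closed] v r that by blast+
  have "X \<oplus>\<^bsub>TP.MN p\<^esub> Y = (\<Oplus>\<^bsub>TP.MN p\<^esub>A\<in>K p. TP.pure p (\<iota> p A (u A)) (l A) \<oplus>\<^bsub>TP.MN p\<^esub> TP.pure p (\<iota> p A (u' A)) (l' A))"
    using X Y i r unfolding normal_form_def by (subst TP.MN.M.finsum_addf) auto
  also have "\<dots> = (\<Oplus>\<^bsub>TP.MN p\<^esub>A\<in>K p. TP.pure p (\<iota> p A (v A)) (s' A \<odot>\<^bsub>L\<^esub> l A \<oplus>\<^bsub>L\<^esub> s A \<odot>\<^bsub>L\<^esub> l' A))"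
  proof (rule TP.MN.M.finsum_cong')
    fix A assume A: "A \<in> K p"
    have vc: "v A \<in> carrier (loc A)" using v A reciprocal_closed by blast
    have "TP.pure p (\<iota> p A (u A)) (l A) = TP.pure p (\<iota> p A (v A)) (s' A \<odot>\<^bsub>L\<^esub> l A)"
      using v A \<iota>_smult[OF A vc sc(2)[OF A]] TP.pure_smult[OF sc(2)[OF A] i(1)[OF A] r(2)[OF A]] by simp
    moreover have "TP.pure p (\<iota> p A (u' A)) (l' A) = TP.pure p (\<iota> p A (v A)) (s A \<odot>\<^bsub>L\<^esub> l' A)"
      using v A \<iota>_smult[OF A vc sc(1)[OF A]] TP.pure_smult[OF sc(1)[OF A] i(1)[OF A] r(4)[OF A]] by simp
    ultimately show "TP.pure p (\<iota> p A (u A)) (l A) \<oplus>\<^bsub>TP.MN p\<^esub> TP.pure p (\<iota> p A (u' A)) (l' A)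
        = TP.pure p (\<iota> p A (v A)) (s' A \<odot>\<^bsub>L\<^esub> l A \<oplus>\<^bsub>L\<^esub> s A \<odot>\<^bsub>L\<^esub> l' A)"
      using TP.pure_add_right[OF i(1)[OF A]] sc[OF A] r[OF A] by simp
  qed (use i sc r in auto)
  finally have "normal_form p (X \<oplus>\<^bsub>TP.MN p\<^esub> Y) v (\<lambda>A. s' A \<otimes> s A) (\<lambda>A. s' A \<odot>\<^bsub>L\<^esub> l A \<oplus>\<^bsub>L\<^esub> s A \<odot>\<^bsub>L\<^esub> l' A)"
    unfolding normal_form_def using v sc r by auto
  then show ?case by blast
qed

lemma Psi_normal_form:
  assumes nf: "normal_form p X u s l" and B: "B \<in> K p"
  shows "Psi p B X = act B (u B) (l B)"
proof -
  note B' = K_subset[OF B]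
  interpret QB: module T "Q B" by (rule module_Q[OF B'])
  have r: "reciprocal A (u A) (s A)" "l A \<in> carrier L" if "A \<in> K p" for A
    using nf that unfolding normal_form_def by auto
  have i: "\<iota> p A (u A) \<in> carrier (C p)" if "A \<in> K p" for A using \<iota>_closed[OF that reciprocal_closed[OF r(1)[OF that]]] .
  have val: "Psi p B (TP.pure p (\<iota> p A (u A)) (l A)) = (if B = A then act B (u B) (l B) else \<zero>\<^bsub>Q B\<^esub>)" if A: "A \<in> K p" for A
  proof (cases "B = A")
    case True
    then show ?thesis using Psi(2)[OF B i[OF A] r(2)[OF A]] B by (simp add: \<iota>_def)
  next
    case False
    have "Psi p B (TP.pure p (\<iota> p A (u A)) (l A)) = act B \<zero>\<^bsub>loc B\<^esub> (l A)"
      using Psi(2)[OF B i[OF A] r(2)[OF A]] B False by (simp add: \<iota>_def)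
    also have "\<dots> = E.tor 0 B +>\<^bsub>E 0\<^esub> \<zero>\<^bsub>E 0\<^esub>"
      by (rule act_coset[OF B' loc_zero[OF B'] r(2)[OF A] act_zero[OF B' r(2)[OF A]]])
    also have "\<dots> = E.tor 0 B"
      using E.coset_eq_self_iff[OF E.submodule_tor[OF B'] E.M.zero_closed]
        submodule_zero[OF E.module_axioms E.submodule_tor[OF B'], of 0] by simp
    finally show ?thesis using False by (simp add: quotient_simps(1))
  qed
  have ac: "act B (u B) (l B) \<in> carrier (Q B)"
    using linear_mapD(1)[OF Psi(1)[OF B] TP.pure_closed[OF i[OF B] r(2)[OF B]]] val[OF B] by simp
  have "Psi p B X = (\<Oplus>\<^bsub>Q B\<^esub>A\<in>K p. Psi p B (TP.pure p (\<iota> p A (u A)) (l A)))"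
    using nf linear_map_finsum[OF TP.module_tensor module_Q[OF B'] Psi(1)[OF B] K_finite_set] i r
    unfolding normal_form_def by auto
  also have "\<dots> = (\<Oplus>\<^bsub>Q B\<^esub>A\<in>K p. if B = A then act B (u B) (l B) else \<zero>\<^bsub>Q B\<^esub>)"
    by (rule QB.M.finsum_cong') (use val ac in auto)
  also have "\<dots> = act B (u B) (l B)"
    using QB.M.add.finprod_singleton[OF B K_finite_set, of "\<lambda>A. act B (u B) (l B)"] ac by simp
  finally show ?thesis .
qed

lemma Rel_normal_form:
  assumes "Rel p x X" "normal_form p X u s l" "A \<in> K p"
  shows "x A \<in> act A (u A) (l A)"
  using Psi_normal_form[OF assms(2,3)] assms(1,3) E.coset_self[OF E.submodule_tor[OF K_subset[OF assms(3)]]] fam_mem[of x p 0 A]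
  unfolding Rel_def by auto

text \<open>
  From \<open>r x = t \<epsilon>(l)\<close> one obtains \<open>r (d x) = 0\<close>.
\<close>
lemma Rel_vertical:
  assumes "Rel p x X"
  shows "fam_dv p 0 x \<in> null_fam p (Suc 0)"
proof -
  have xc: "x \<in> carrier (fam p 0)" using Rel_carrier[OF assms] by blast
  obtain u s l where nf: "normal_form p X u s l" using normal_form_exists Rel_carrier[OF assms] by blast
  have "d 0 (x A) \<in> E.tor (Suc 0) A" if A: "A \<in> K p" for A
  proof -
    have l: "l A \<in> carrier L" using nf A unfolding normal_form_def by blast
    obtain r t where r: "r \<in> denominators A" "t \<in> carrier T" "r \<odot>\<^bsub>E 0\<^esub> x A = t \<odot>\<^bsub>E 0\<^esub> \<epsilon> (l A)" "x A \<in> carrier (E 0)"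
      using Rel_normal_form[OF assms nf A] unfolding act_def by auto
    have "r \<odot>\<^bsub>E (Suc 0)\<^esub> d 0 (x A) = t \<odot>\<^bsub>E (Suc 0)\<^esub> d 0 (\<epsilon> (l A))"
      using d_smult[OF den_carrier[OF K_subset[OF A] r(1)] r(4)] d_smult[OF r(2) \<epsilon>_closed[OF l]] r(3) by simp
    then have "r \<odot>\<^bsub>E (Suc 0)\<^esub> d 0 (x A) = \<zero>\<^bsub>E (Suc 0)\<^esub>" using d_\<epsilon>[OF l] r(2) by simp
    then show ?thesis unfolding E.torsion_def using r(1) d_closed[OF r(4)] by blast
  qed
  then show ?thesis
    unfolding null_fam_def using linear_mapD(1)[OF fam_dv_linear xc] by (auto simp: fam_dv_def)
qed

text \<open>
  Injectivity of the comparison map.  If \<open>x\<close> is torsion, then a denominator \<open>q\<close> annihilates \<open>\<epsilon>(l)\<close>,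
  hence \<open>l\<close>, and \<open>(1/s) \<otimes> l = (1/(q s)) \<otimes> q l = 0\<close>.  This is where \<open>\<epsilon>\<close> has to be injective.
\<close>
lemma Rel_null_iff:
  assumes "Rel p x X"
  shows "x \<in> null_fam p 0 \<longleftrightarrow> X = \<zero>\<^bsub>TP.MN p\<^esub>"
proof
  assume X: "X = \<zero>\<^bsub>TP.MN p\<^esub>"
  have "x A \<in> E.tor 0 A" if A: "A \<in> K p" for A
    using linear_map_zero[OF TP.module_tensor module_Q[OF K_subset[OF A]] Psi(1)[OF A]] X assms A
      E.coset_eq_self_iff[OF E.submodule_tor[OF K_subset[OF A]] fam_mem[OF Rel_carrier(1)[OF assms] A]]
    unfolding Rel_def by (simp add: quotient_simps(1))
  then show "x \<in> null_fam p 0" unfolding null_fam_def using Rel_carrier(1)[OF assms] by blast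
next
  assume x: "x \<in> null_fam p 0"
  obtain u s l where nf: "normal_form p X u s l" using normal_form_exists Rel_carrier[OF assms] by blast
  have "TP.pure p (\<iota> p A (u A)) (l A) = \<zero>\<^bsub>TP.MN p\<^esub>" if A: "A \<in> K p" for A
  proof -
    note A' = K_subset[OF A]
    interpret P: module T "loc A" by (rule module_loc[OF A'])
    have u: "reciprocal A (u A) (s A)" and l: "l A \<in> carrier L" using nf A unfolding normal_form_def by auto
    have u': "u A \<in> carrier (loc A)" "s A \<in> denominators A" "s A \<odot>\<^bsub>loc A\<^esub> u A = from_ring A \<one>"
      using u unfolding reciprocal_def by auto
    obtain r t where r: "r \<in> denominators A" "t \<in> carrier T" "x A \<in> carrier (E 0)"
        "r \<odot>\<^bsub>loc A\<^esub> u A = from_ring A t" "r \<odot>\<^bsub>E 0\<^esub> x A = t \<odot>\<^bsub>E 0\<^esub> \<epsilon> (l A)"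
      using actE[OF Rel_normal_form[OF assms nf A]] .
    obtain w where w: "w \<in> denominators A" "w \<odot>\<^bsub>E 0\<^esub> x A = \<zero>\<^bsub>E 0\<^esub>"
      using x A unfolding null_fam_def E.torsion_def by auto
    note c = den_carrier[OF A' r(1)] den_carrier[OF A' w(1)] den_carrier[OF A' u'(2)]
    note el = \<epsilon>_closed[OF l]
    have "from_ring A (s A \<otimes> t) = from_ring A (r \<otimes> \<one>)"
      using from_ring(3)[OF A' c(3) r(2)] from_ring(3)[OF A' c(1) one_closed] r(4) u'(3)
        P.smult_lcomm[OF c(3,1) u'(1)] by simp
    then obtain v where v: "v \<in> denominators A" "v \<otimes> (s A \<otimes> t) = v \<otimes> (r \<otimes> \<one>)"
      using from_ring_eq[OF A'] c r(2) by (metis m_closed one_closed)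
    have vc: "v \<in> carrier T" using den_carrier[OF A' v(1)] .
    \<comment> \<open>With \<open>v s t = v r\<close>, the element \<open>w v r\<close> annihilates \<open>\<epsilon> (l A)\<close>, since \<open>w\<close> annihilates \<open>x A\<close>.\<close>
    let ?q = "w \<otimes> (v \<otimes> r)"
    have q: "?q \<in> denominators A" using den_mult[OF A' w(1) den_mult[OF A' v(1) r(1)]] .
    have qc: "?q \<in> carrier T" using den_carrier[OF A' q] .
    have "?q \<odot>\<^bsub>E 0\<^esub> \<epsilon> (l A) = w \<odot>\<^bsub>E 0\<^esub> ((v \<otimes> (s A \<otimes> t)) \<odot>\<^bsub>E 0\<^esub> \<epsilon> (l A))"
      using c vc el v(2) by (simp add: E.smult_assoc1)
    also have "\<dots> = w \<odot>\<^bsub>E 0\<^esub> (v \<odot>\<^bsub>E 0\<^esub> (s A \<odot>\<^bsub>E 0\<^esub> (r \<odot>\<^bsub>E 0\<^esub> x A)))"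
      using r(5) c vc r(2) el by (simp add: E.smult_assoc1)
    also have "\<dots> = v \<odot>\<^bsub>E 0\<^esub> (s A \<odot>\<^bsub>E 0\<^esub> (r \<odot>\<^bsub>E 0\<^esub> (w \<odot>\<^bsub>E 0\<^esub> x A)))"
      using c vc r(3) by (simp add: E.smult_lcomm)
    also have "\<dots> = \<zero>\<^bsub>E 0\<^esub>" using w(2) c vc by simp
    finally have "\<epsilon> (?q \<odot>\<^bsub>L\<^esub> l A) = \<epsilon> \<zero>\<^bsub>L\<^esub>"
      using linear_mapD(3)[OF \<epsilon>_linear qc l] linear_map_zero[OF L.module_axioms E.module_axioms \<epsilon>_linear] by simp
    then have ql: "?q \<odot>\<^bsub>L\<^esub> l A = \<zero>\<^bsub>L\<^esub>" using inj_onD[OF \<epsilon>_inj] qc l by (metis L.M.zero_closed L.smult_closed)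
    obtain u2 where u2: "u2 \<in> carrier (loc A)" "?q \<odot>\<^bsub>loc A\<^esub> u2 = u A" using loc_divide[OF A' q u'(1)] .
    have i: "\<iota> p A u2 \<in> carrier (C p)" using \<iota>_closed[OF A u2(1)] .
    have "TP.pure p (\<iota> p A (u A)) (l A) = TP.pure p (\<iota> p A u2) (?q \<odot>\<^bsub>L\<^esub> l A)"
      using \<iota>_smult[OF A u2(1) qc] u2(2) TP.pure_smult[OF qc i l] by simp
    also have "\<dots> = \<zero>\<^bsub>TP.MN p\<^esub>" unfolding ql using TP.pure_smult(2)[OF zero_closed i L.M.zero_closed] i by simp
    finally show ?thesis .
  qed
  then have "(\<Oplus>\<^bsub>TP.MN p\<^esub>A\<in>K p. TP.pure p (\<iota> p A (u A)) (l A)) = (\<Oplus>\<^bsub>TP.MN p\<^esub>A\<in>K p. \<zero>\<^bsub>TP.MN p\<^esub>)"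
    by (intro TP.MN.M.finsum_cong') auto
  then have "X = (\<Oplus>\<^bsub>TP.MN p\<^esub>A\<in>K p. \<zero>\<^bsub>TP.MN p\<^esub>)"
    using nf unfolding normal_form_def by metis
  then show "X = \<zero>\<^bsub>TP.MN p\<^esub>" by simp
qed

lemma tensor_part_sum:
  assumes "finite F" "\<And>a. a \<in> F \<Longrightarrow> f a \<in> part (TP.MN p) D"
  shows "(\<Oplus>\<^bsub>TP.MN p\<^esub>a\<in>F. f a) \<in> part (TP.MN p) D"
proof (rule TP.MN.finsum_closed_subset[OF _ _ _ assms])
  let ?QF = "quotient_module T (TP.F p) (TP.rel p)"
  interpret QF: module T ?QF by (rule quotient_module_is_module[OF TP.F.module_axioms TP.submodule_rel])
  show "\<zero>\<^bsub>TP.MN p\<^esub> \<in> part (TP.MN p) D"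
    using generate.one[of "add_monoid ?QF"] by (cases D) (simp_all add: TP.tensor_simps)
  show "X \<oplus>\<^bsub>TP.MN p\<^esub> Y \<in> part (TP.MN p) D" if "X \<in> part (TP.MN p) D" "Y \<in> part (TP.MN p) D" for X Y
    using that generate.eng[of X "add_monoid ?QF" _ Y] TP.MN.M.a_closed by (cases D) (simp_all add: TP.tensor_simps)
  show "part (TP.MN p) D \<subseteq> carrier (TP.MN p)"
  proof
    fix X assume "X \<in> part (TP.MN p) D"
    then show "X \<in> carrier (TP.MN p)" using Rel_total Rel_carrier(2) by blast
  qed
qed

text \<open>
  If \<open>s (d x) = 0\<close>, then \<open>s x = \<epsilon>(l)\<close> for some \<open>l\<close> by exactness at \<open>E 0\<close>, and \<open>x\<close> represents
  \<open>(1/s) \<otimes> l\<close>.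
\<close>
lemma Rel_surjective:
  assumes x: "x \<in> part (fam p 0) D" "fam_dv p 0 x \<in> null_fam p (Suc 0)"
  shows "\<exists>X\<in>part (TP.MN p) D. Rel p x X"
proof -
  have xc: "x \<in> carrier (fam p 0)" using DC.part_in[OF x(1)] .
  have "\<forall>A\<in>K p. \<exists>y. reciprocal A (fst y) (fst (snd y)) \<and> snd (snd y) \<in> carrier L \<and>
      fst (snd y) \<odot>\<^bsub>E 0\<^esub> x A = \<epsilon> (snd (snd y)) \<and> TP.pure p (\<iota> p A (fst y)) (snd (snd y)) \<in> part (TP.MN p) D"
  proof
    fix A assume A: "A \<in> K p"
    note A' = K_subset[OF A]
    have xA: "x A \<in> part (E 0) D" "x A \<in> carrier (E 0)" using x(1) A fam_mem[OF xc A] unfolding fam_part by auto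
    obtain s where s: "s \<in> denominators A" "s \<odot>\<^bsub>E (Suc 0)\<^esub> d 0 (x A) = \<zero>\<^bsub>E (Suc 0)\<^esub>"
      using x(2) A unfolding null_fam_def E.torsion_def fam_dv_def by auto
    have sc: "s \<in> carrier T" using den_carrier[OF A' s(1)] .
    obtain k where k: "s \<in> rcomp T k" using multiplicative_setD(2)[OF denominators_multiplicative[OF A'] s(1)] by blast
    obtain l where l: "l \<in> part L (shift k D)" "\<epsilon> l = s \<odot>\<^bsub>E 0\<^esub> x A"
      using \<epsilon>_exact[OF E.part_smult[OF k xA(1)]] d_smult[OF sc xA(2)] s(2) by auto
    have "Elem \<one> \<in> part Rg (Some 0)" using one_rcomp by (auto simp: ring_as_gmodule_def)
    then have "from_ring A \<one> \<in> part (loc A) (shift k (Some (- int k)))"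
      using is_localizationD(2)[OF loc(2)[OF A'], of "Elem \<one>" "Some 0"] by simp
    then obtain u where u: "u \<in> part (loc A) (Some (- int k))" "s \<odot>\<^bsub>loc A\<^esub> u = from_ring A \<one>"
      using is_localizationD(4)[OF loc(2)[OF A'] s(1) k] by blast
    have uc: "u \<in> carrier (loc A)" using module_with_degrees.part_carrier[OF loc(1)[OF A'] u(1)] .
    have lc: "l \<in> carrier L" using L.part_carrier[OF l(1)] .
    have "TP.pure p (\<iota> p A u) l \<in> part (TP.MN p) D"
    proof (cases D)
      case None
      then show ?thesis using \<iota>_closed[OF A uc] lc by simp
    next
      case (Some v)
      have "\<iota> p A u \<in> mcomp (C p) (- int k)"
        using u(1) module_with_degrees.mcomp_zero[OF loc(1)[OF K_subset]] unfolding \<iota>_def C_simps by auto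
      moreover have "l \<in> mcomp L (int k + v)" using l(1) Some by simp
      moreover have "v = - int k + (int k + v)" by simp
      ultimately have "TP.pure p (\<iota> p A u) l \<in> mcomp (TP.MN p) v"
        unfolding TP.tensor_simps by (intro generate.incl) blast
      then show ?thesis using Some by simp
    qed
    then show "\<exists>y. reciprocal A (fst y) (fst (snd y)) \<and> snd (snd y) \<in> carrier L \<and>
        fst (snd y) \<odot>\<^bsub>E 0\<^esub> x A = \<epsilon> (snd (snd y)) \<and> TP.pure p (\<iota> p A (fst y)) (snd (snd y)) \<in> part (TP.MN p) D"
      using u(2) uc s(1) lc l(2) unfolding reciprocal_def by (intro exI[of _ "(u, s, l)"]) simp
  qed
  then obtain y where y: "\<forall>A\<in>K p. reciprocal A (fst (y A)) (fst (snd (y A))) \<and> snd (snd (y A)) \<in> carrier L \<and>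
      fst (snd (y A)) \<odot>\<^bsub>E 0\<^esub> x A = \<epsilon> (snd (snd (y A))) \<and>
      TP.pure p (\<iota> p A (fst (y A))) (snd (snd (y A))) \<in> part (TP.MN p) D"
    by (rule bchoice[THEN exE])
  define u s l where "u A = fst (y A)" and "s A = fst (snd (y A))" and "l A = snd (snd (y A))" for A
  have usl: "reciprocal A (u A) (s A)" "l A \<in> carrier L" "s A \<odot>\<^bsub>E 0\<^esub> x A = \<epsilon> (l A)"
      "TP.pure p (\<iota> p A (u A)) (l A) \<in> part (TP.MN p) D" if "A \<in> K p" for A
    using y that unfolding u_def s_def l_def by auto
  define X where "X = (\<Oplus>\<^bsub>TP.MN p\<^esub>A\<in>K p. TP.pure p (\<iota> p A (u A)) (l A))"
  have nf: "normal_form p X u s l" unfolding normal_form_def X_def using usl by blast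
  have XD: "X \<in> part (TP.MN p) D" unfolding X_def by (rule tensor_part_sum[OF K_finite_set usl(4)])
  have Xc: "X \<in> carrier (TP.MN p)" using Rel_total[OF XD] Rel_carrier(2) by blast
  have "x A \<in> act A (u A) (l A)" if A: "A \<in> K p" for A
    using actI[OF _ one_closed fam_mem[OF xc A], of "s A" A "u A" "l A"] usl[OF A] \<epsilon>_closed[OF usl(2)[OF A]]
    unfolding reciprocal_def by simp
  then have "Psi p A X = E.tor 0 A +>\<^bsub>E 0\<^esub> x A" if A: "A \<in> K p" for A
    using Psi_normal_form[OF nf A] act_coset[OF K_subset[OF A] reciprocal_closed[OF usl(1)[OF A]] usl(2)[OF A]] A by simp
  then show ?thesis using XD Xc xc unfolding Rel_def by blast
qed

end

section \<open>Differentials under the comparison map\<close>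

context cech_resolution
begin

abbreviation diff :: "nat \<Rightarrow> (nat set \<Rightarrow> 'a frac_expr) \<Rightarrow> nat set \<Rightarrow> 'a frac_expr" where
  "diff p \<equiv> cech_differential T J bs p"

abbreviation nat_map :: "nat \<Rightarrow> nat set \<Rightarrow> 'a frac_expr \<Rightarrow> 'a frac_expr" where
  "nat_map k B \<equiv> natural_map T J bs k (descending B)"

lemma nat_map:
  assumes B: "B \<subseteq> {..<length bs}" and k: "k \<in> B"
  shows "nat_map k B \<in> linear_map T (loc (B - {k})) (loc B)"
    and "t \<in> carrier T \<Longrightarrow> nat_map k B (from_ring (B - {k}) t) = from_ring B t"
proof -
  note fin = subset_finite[OF B]
  note n = natural_map[of "descending B" k, unfolded descending_simps(1)[OF fin] descending_simps(3)[OF fin, symmetric],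
      OF B descending_simps(2)[OF fin] k]
  show "nat_map k B \<in> linear_map T (loc (B - {k})) (loc B)" using n by blast
  show "t \<in> carrier T \<Longrightarrow> nat_map k B (from_ring (B - {k}) t) = from_ring B t"
    using n by (auto simp: Rg_simps)
qed

lemma diff_apply:
  "B \<in> K (Suc p) \<Longrightarrow> diff p x B =
     (\<Oplus>\<^bsub>loc B\<^esub>k\<in>B. sign (card {i \<in> B. i < k}) \<odot>\<^bsub>loc B\<^esub> nat_map k B (x (B - {k})))"
  unfolding cech_differential_def sign_def by (simp add: Let_def)

lemma nat_map_closed:
  assumes "c \<in> carrier (C p)" "B \<in> K (Suc p)" "k \<in> B"
  shows "nat_map k B (c (B - {k})) \<in> carrier (loc B)"
  by (rule linear_mapD(1)[OF nat_map(1)[OF K_subset[OF assms(2)] assms(3)] C_mem[OF assms(1) K_remove[OF assms(2,3)]]])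

lemma diff_linear: "diff p \<in> linear_map T (C p) (C (Suc p))"
  unfolding linear_map_def
proof (intro CollectI conjI ballI)
  have "diff p c B \<in> carrier (loc B)" if c: "c \<in> carrier (C p)" and B: "B \<in> K (Suc p)" for c B
  proof -
    interpret P: module T "loc B" by (rule module_loc[OF K_subset[OF B]])
    show ?thesis unfolding diff_apply[OF B] using nat_map_closed[OF c B] by (intro P.M.finsum_closed) auto
  qed
  then show "diff p \<in> carrier (C p) \<rightarrow> carrier (C (Suc p))"
    unfolding C_simps by (auto simp: cech_differential_def)
next
  fix c c' assume c: "c \<in> carrier (C p)" "c' \<in> carrier (C p)"
  have "diff p (c \<oplus>\<^bsub>C p\<^esub> c') B = diff p c B \<oplus>\<^bsub>loc B\<^esub> diff p c' B" if B: "B \<in> K (Suc p)" for B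
  proof -
    interpret P: module T "loc B" by (rule module_loc[OF K_subset[OF B]])
    note n = nat_map_closed[OF c(1) B] nat_map_closed[OF c(2) B]
    have "diff p (c \<oplus>\<^bsub>C p\<^esub> c') B = (\<Oplus>\<^bsub>loc B\<^esub>k\<in>B.
        sign (card {i \<in> B. i < k}) \<odot>\<^bsub>loc B\<^esub> nat_map k B (c (B - {k})) \<oplus>\<^bsub>loc B\<^esub>
        sign (card {i \<in> B. i < k}) \<odot>\<^bsub>loc B\<^esub> nat_map k B (c' (B - {k})))"
      unfolding diff_apply[OF B]
    proof (rule P.M.finsum_cong')
      fix k assume k: "k \<in> B"
      have "(c \<oplus>\<^bsub>C p\<^esub> c') (B - {k}) = c (B - {k}) \<oplus>\<^bsub>loc (B - {k})\<^esub> c' (B - {k})"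
        using K_remove[OF B k] by (simp add: C_simps(3))
      then have "nat_map k B ((c \<oplus>\<^bsub>C p\<^esub> c') (B - {k})) =
          nat_map k B (c (B - {k})) \<oplus>\<^bsub>loc B\<^esub> nat_map k B (c' (B - {k}))"
        using linear_mapD(2)[OF nat_map(1)[OF K_subset[OF B] k]] C_mem[OF _ K_remove[OF B k]] c by simp
      then show "sign (card {i \<in> B. i < k}) \<odot>\<^bsub>loc B\<^esub> nat_map k B ((c \<oplus>\<^bsub>C p\<^esub> c') (B - {k})) =
          sign (card {i \<in> B. i < k}) \<odot>\<^bsub>loc B\<^esub> nat_map k B (c (B - {k})) \<oplus>\<^bsub>loc B\<^esub>
          sign (card {i \<in> B. i < k}) \<odot>\<^bsub>loc B\<^esub> nat_map k B (c' (B - {k}))"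
        using n[OF k] by (simp add: P.smult_r_distr)
    qed (use n in auto)
    also have "\<dots> = diff p c B \<oplus>\<^bsub>loc B\<^esub> diff p c' B"
      unfolding diff_apply[OF B] by (rule P.M.finsum_addf) (use n in auto)
    finally show ?thesis .
  qed
  then show "diff p (c \<oplus>\<^bsub>C p\<^esub> c') = diff p c \<oplus>\<^bsub>C (Suc p)\<^esub> diff p c'"
    unfolding C_simps(3) by (auto simp: fun_eq_iff cech_differential_def)
next
  fix t c assume t: "t \<in> carrier T" and c: "c \<in> carrier (C p)"
  have "diff p (t \<odot>\<^bsub>C p\<^esub> c) B = t \<odot>\<^bsub>loc B\<^esub> diff p c B" if B: "B \<in> K (Suc p)" for B
  proof -
    interpret P: module T "loc B" by (rule module_loc[OF K_subset[OF B]])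
    note n = nat_map_closed[OF c B]
    have "t \<odot>\<^bsub>loc B\<^esub> diff p c B =
        (\<Oplus>\<^bsub>loc B\<^esub>k\<in>B. t \<odot>\<^bsub>loc B\<^esub> (sign (card {i \<in> B. i < k}) \<odot>\<^bsub>loc B\<^esub> nat_map k B (c (B - {k}))))"
      unfolding diff_apply[OF B] by (rule P.finsum_smult_ldistr) (use n t K_finite[OF B] in auto)
    also have "\<dots> = diff p (t \<odot>\<^bsub>C p\<^esub> c) B"
      unfolding diff_apply[OF B]
    proof (rule P.M.finsum_cong')
      fix k assume k: "k \<in> B"
      have "(t \<odot>\<^bsub>C p\<^esub> c) (B - {k}) = t \<odot>\<^bsub>loc (B - {k})\<^esub> c (B - {k})"
        using K_remove[OF B k] by (simp add: C_simps(4))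
      then have "nat_map k B ((t \<odot>\<^bsub>C p\<^esub> c) (B - {k})) = t \<odot>\<^bsub>loc B\<^esub> nat_map k B (c (B - {k}))"
        using linear_mapD(3)[OF nat_map(1)[OF K_subset[OF B] k] t] C_mem[OF c K_remove[OF B k]] by simp
      then show "t \<odot>\<^bsub>loc B\<^esub> (sign (card {i \<in> B. i < k}) \<odot>\<^bsub>loc B\<^esub> nat_map k B (c (B - {k}))) =
          sign (card {i \<in> B. i < k}) \<odot>\<^bsub>loc B\<^esub> nat_map k B ((t \<odot>\<^bsub>C p\<^esub> c) (B - {k}))"
        using P.smult_lcomm[OF t sign_closed n[OF k]] by simp
    qed (use n t nat_map_closed[OF TP.M.smult_closed[OF t c] B] in auto)
    finally show ?thesis ..
  qed
  then show "diff p (t \<odot>\<^bsub>C p\<^esub> c) = t \<odot>\<^bsub>C (Suc p)\<^esub> diff p c"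
    unfolding C_simps(4) by (auto simp: fun_eq_iff cech_differential_def)
qed

abbreviation tmap where "tmap p \<equiv> tensor_map T (C (Suc p)) L (diff p)"

lemmas tmap = tensor_map_linear[OF TP.tensor_product_axioms TP.tensor_product_axioms diff_linear]

lemma act_nat_map:
  assumes B: "B \<subseteq> {..<length bs}" and k: "k \<in> B" and c: "c \<in> carrier (loc (B - {k}))"
    and x: "x \<in> act (B - {k}) c l"
  shows "x \<in> act B (nat_map k B c) l"
proof -
  obtain s t where s: "s \<in> denominators (B - {k})" "t \<in> carrier T" "x \<in> carrier (E 0)"
    "s \<odot>\<^bsub>loc (B - {k})\<^esub> c = from_ring (B - {k}) t" "s \<odot>\<^bsub>E 0\<^esub> x = t \<odot>\<^bsub>E 0\<^esub> \<epsilon> l" using actE[OF x] .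
  have sB: "s \<in> denominators B" using denominators_mono[OF _ s(1)] by blast
  have "s \<odot>\<^bsub>loc B\<^esub> nat_map k B c = from_ring B t"
    using linear_mapD(3)[OF nat_map(1)[OF B k] den_carrier[OF B sB] c] s(4) nat_map(2)[OF B k s(2)] by simp
  then show ?thesis using actI[OF sB s(2,3)] s(5) by blast
qed

text \<open>
  The comparison map commutes with the differentials: a natural map sends \<open>t/s\<close> to \<open>t/s\<close>, so it does not
  change the product with \<open>\<epsilon> l\<close>, and the signs are the same on both sides.
\<close>
lemma Rel_horizontal_pure:
  assumes c: "c \<in> carrier (C p)" and l: "l \<in> carrier L" and x: "x \<in> carrier (fam p 0)"
    and act: "\<And>A. A \<in> K p \<Longrightarrow> x A \<in> act A (c A) l"
  shows "Rel (Suc p) (fam_dh p 0 x) (TP.pure (Suc p) (diff p c) l)"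
proof (rule Rel_pure[OF linear_mapD(1)[OF diff_linear c] l linear_mapD(1)[OF fam_dh_linear x]])
  fix B assume B: "B \<in> K (Suc p)"
  note B' = K_subset[OF B]
  interpret P: module T "loc B" by (rule module_loc[OF B'])
  let ?e = "\<lambda>k. sign (card {i \<in> B. i < k})"
  note n = nat_map_closed[OF c B]
  have xk: "x (B - {k}) \<in> carrier (E 0)" if "k \<in> B" for k using fam_mem[OF x K_remove[OF B that]] .
  have summand: "?e k \<odot>\<^bsub>E 0\<^esub> x (B - {k}) \<in> act B (?e k \<odot>\<^bsub>loc B\<^esub> nat_map k B (c (B - {k}))) l" if k: "k \<in> B" for k
    using act_smult(1)[OF B' n[OF k] l act_nat_map[OF B' k C_mem[OF c K_remove[OF B k]] act[OF K_remove[OF B k]]]]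
    by simp
  have "finite F \<Longrightarrow> F \<subseteq> B \<Longrightarrow> (\<Oplus>\<^bsub>E 0\<^esub>k\<in>F. ?e k \<odot>\<^bsub>E 0\<^esub> x (B - {k})) \<in>
      act B (\<Oplus>\<^bsub>loc B\<^esub>k\<in>F. ?e k \<odot>\<^bsub>loc B\<^esub> nat_map k B (c (B - {k}))) l" for F
  proof (induction F rule: finite_induct)
    case empty
    then show ?case using act_zero[OF B' l] by simp
  next
    case (insert k F)
    have F: "\<And>j. j \<in> F \<Longrightarrow> ?e j \<odot>\<^bsub>E 0\<^esub> x (B - {j}) \<in> carrier (E 0)"
      "\<And>j. j \<in> F \<Longrightarrow> ?e j \<odot>\<^bsub>loc B\<^esub> nat_map j B (c (B - {j})) \<in> carrier (loc B)"
      using insert.prems xk n by auto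
    have k: "k \<in> B" using insert.prems by blast
    have "(\<Oplus>\<^bsub>E 0\<^esub>k\<in>insert k F. ?e k \<odot>\<^bsub>E 0\<^esub> x (B - {k})) =
        ?e k \<odot>\<^bsub>E 0\<^esub> x (B - {k}) \<oplus>\<^bsub>E 0\<^esub> (\<Oplus>\<^bsub>E 0\<^esub>k\<in>F. ?e k \<odot>\<^bsub>E 0\<^esub> x (B - {k}))"
      by (rule E.M.finsum_insert) (use insert.hyps F xk[OF k] in auto)
    moreover have "(\<Oplus>\<^bsub>loc B\<^esub>k\<in>insert k F. ?e k \<odot>\<^bsub>loc B\<^esub> nat_map k B (c (B - {k}))) =
        ?e k \<odot>\<^bsub>loc B\<^esub> nat_map k B (c (B - {k})) \<oplus>\<^bsub>loc B\<^esub>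
        (\<Oplus>\<^bsub>loc B\<^esub>k\<in>F. ?e k \<odot>\<^bsub>loc B\<^esub> nat_map k B (c (B - {k})))"
      by (rule P.M.finsum_insert) (use insert.hyps F n[OF k] in auto)
    moreover have "(\<Oplus>\<^bsub>loc B\<^esub>k\<in>F. ?e k \<odot>\<^bsub>loc B\<^esub> nat_map k B (c (B - {k}))) \<in> carrier (loc B)"
      using F(2) by (intro P.M.finsum_closed) auto
    ultimately show ?case
      using act_add_left[OF B' _ _ l summand[OF k] insert.IH] n[OF k] insert.prems by simp
  qed
  from this[OF K_finite[OF B] order_refl] show "fam_dh p 0 x B \<in> act B (diff p c B) l"
    unfolding diff_apply[OF B] using B by (simp add: fam_dh_def E.boundary_def)
qed

lemma Rel_horizontal:
  assumes "Rel p x X"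
  shows "Rel (Suc p) (fam_dh p 0 x) (tmap p X)"
proof -
  have "\<exists>y. Rel p y X \<and> Rel (Suc p) (fam_dh p 0 y) (tmap p X)" if "X \<in> carrier (TP.MN p)" for X
    using that
  proof (induction rule: TP.tensor_induct)
    case zero
    interpret F: module T "fam p 0" by (rule module_fam)
    have "tmap p \<zero>\<^bsub>TP.MN p\<^esub> = \<zero>\<^bsub>TP.MN (Suc p)\<^esub>"
      by (rule linear_map_zero[OF TP.module_tensor TP.module_tensor tmap(1)])
    moreover have "fam_dh p 0 \<zero>\<^bsub>fam p 0\<^esub> = \<zero>\<^bsub>fam (Suc p) 0\<^esub>"
      by (rule linear_map_zero[OF module_fam module_fam fam_dh_linear])
    ultimately show ?case
      using Rel_zero_fam[OF TP.MN.M.zero_closed refl, of p] Rel_zero_fam[OF TP.MN.M.zero_closed refl, of "Suc p"]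
      by (intro exI[of _ "\<zero>\<^bsub>fam p 0\<^esub>"]) simp
  next
    case (pure c l)
    have "\<forall>A\<in>K p. \<exists>x. x \<in> act A (c A) l"
    proof
      fix A assume A: "A \<in> K p"
      obtain x where "x \<in> act A (c A) l" using act_nonempty[OF K_subset[OF A] C_mem[OF pure(1) A] pure(2)] .
      then show "\<exists>x. x \<in> act A (c A) l" ..
    qed
    then obtain y where y: "\<forall>A\<in>K p. y A \<in> act A (c A) l" by (rule bchoice[THEN exE])
    have yc: "restrict y (K p) \<in> carrier (fam p 0)" using y act_in_E unfolding fam_simps by auto
    have "Rel p (restrict y (K p)) (TP.pure p c l)" by (rule Rel_pure[OF pure yc]) (use y in auto)
    moreover have "Rel (Suc p) (fam_dh p 0 (restrict y (K p))) (TP.pure (Suc p) (diff p c) l)"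
      by (rule Rel_horizontal_pure[OF pure yc]) (use y in auto)
    ultimately show ?case using tmap(2)[OF pure] by auto
  next
    case (add X Y)
    then obtain x y where x: "Rel p x X" "Rel (Suc p) (fam_dh p 0 x) (tmap p X)"
      and y: "Rel p y Y" "Rel (Suc p) (fam_dh p 0 y) (tmap p Y)" by blast
    have "fam_dh p 0 (x \<oplus>\<^bsub>fam p 0\<^esub> y) = fam_dh p 0 x \<oplus>\<^bsub>fam (Suc p) 0\<^esub> fam_dh p 0 y"
      by (rule linear_mapD(2)[OF fam_dh_linear Rel_carrier(1)[OF x(1)] Rel_carrier(1)[OF y(1)]])
    moreover have "tmap p (X \<oplus>\<^bsub>TP.MN p\<^esub> Y) = tmap p X \<oplus>\<^bsub>TP.MN (Suc p)\<^esub> tmap p Y"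
      by (rule linear_mapD(2)[OF tmap(1) add(1,2)])
    ultimately show ?case using Rel_add[OF x(1) y(1)] Rel_add[OF x(2) y(2)] by auto
  qed
  then obtain y where y: "Rel p y X" "Rel (Suc p) (fam_dh p 0 y) (tmap p X)"
    using Rel_carrier(2)[OF assms] by blast
  have "Rel p (y \<ominus>\<^bsub>fam p 0\<^esub> x) (X \<ominus>\<^bsub>TP.MN p\<^esub> X)" using Rel_minus[OF y(1) assms] .
  moreover have "X \<ominus>\<^bsub>TP.MN p\<^esub> X = \<zero>\<^bsub>TP.MN p\<^esub>"
    using Rel_carrier(2)[OF assms] by (simp add: a_minus_def TP.MN.M.r_neg)
  ultimately have "y \<ominus>\<^bsub>fam p 0\<^esub> x \<in> null_fam p 0" using Rel_null_iff by metis
  then have "DC.cong p 0 y x" unfolding DC.cong_def using Rel_carrier(1) y(1) assms by blast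
  then show ?thesis using Rel_cong[OF y(2) DC.cong_dh] by blast
qed

definition cech_cocycles :: "nat \<Rightarrow> ((nat set \<Rightarrow> 'a frac_expr) \<times> 'l \<Rightarrow> 'a) set set" where
  "cech_cocycles i = cocycles TP.MN tmap i"

definition cech_coboundaries :: "nat \<Rightarrow> ((nat set \<Rightarrow> 'a frac_expr) \<times> 'l \<Rightarrow> 'a) set set" where
  "cech_coboundaries i = coboundaries TP.MN tmap i"

lemma cech_cocycles_iff:
  "X \<in> cech_cocycles i \<longleftrightarrow> X \<in> carrier (TP.MN i) \<and> tmap i X = \<zero>\<^bsub>TP.MN (Suc i)\<^esub>"
  unfolding cech_cocycles_def cocycles_def by blast

lemma submodule_cech_cocycles: "submodule (cech_cocycles i) T (TP.MN i)"
  by (rule TP.MN.submoduleI)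
    (auto simp: cech_cocycles_iff linear_mapD[OF tmap(1)] linear_map_zero[OF TP.module_tensor TP.module_tensor tmap(1)]
      linear_map_neg[OF TP.module_tensor TP.module_tensor tmap(1)] TP.MN.M.add.inv_one)

lemma submodule_cech_coboundaries: "submodule (cech_coboundaries i) T (TP.MN i)"
proof (cases i)
  case 0
  show ?thesis
    unfolding cech_coboundaries_def coboundaries_def 0
    by (rule TP.MN.submoduleI) (auto simp: TP.MN.M.add.inv_one)
next
  case (Suc k)
  have "submodule (tmap k ` carrier (TP.MN k)) T (TP.MN (Suc k))"
  proof (rule TP.MN.submoduleI)
    show "tmap k ` carrier (TP.MN k) \<subseteq> carrier (TP.MN (Suc k))" using linear_mapD(1)[OF tmap(1)] by blast
    show "\<zero>\<^bsub>TP.MN (Suc k)\<^esub> \<in> tmap k ` carrier (TP.MN k)"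
      using linear_map_zero[OF TP.module_tensor TP.module_tensor tmap(1), of k] TP.MN.M.zero_closed by (metis image_eqI)
    show "\<ominus>\<^bsub>TP.MN (Suc k)\<^esub> Y \<in> tmap k ` carrier (TP.MN k)" if Y: "Y \<in> tmap k ` carrier (TP.MN k)" for Y
    proof -
      obtain X where X: "X \<in> carrier (TP.MN k)" "Y = tmap k X" using Y by blast
      then show ?thesis
        using linear_map_neg[OF TP.module_tensor TP.module_tensor tmap(1) X(1)] TP.MN.M.a_inv_closed[OF X(1)]
        by (metis image_eqI)
    qed
    show "Y \<oplus>\<^bsub>TP.MN (Suc k)\<^esub> Y' \<in> tmap k ` carrier (TP.MN k)"
      if Y: "Y \<in> tmap k ` carrier (TP.MN k)" "Y' \<in> tmap k ` carrier (TP.MN k)" for Y Y'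
    proof -
      obtain X X' where X: "X \<in> carrier (TP.MN k)" "Y = tmap k X" "X' \<in> carrier (TP.MN k)" "Y' = tmap k X'"
        using Y by blast
      then show ?thesis
        using linear_mapD(2)[OF tmap(1) X(1,3)] TP.MN.M.a_closed[OF X(1,3)] by (metis image_eqI)
    qed
    show "t \<odot>\<^bsub>TP.MN (Suc k)\<^esub> Y \<in> tmap k ` carrier (TP.MN k)"
      if t: "t \<in> carrier T" and Y: "Y \<in> tmap k ` carrier (TP.MN k)" for t Y
    proof -
      obtain X where X: "X \<in> carrier (TP.MN k)" "Y = tmap k X" using Y by blast
      then show ?thesis
        using linear_mapD(3)[OF tmap(1) t X(1)] TP.MN.smult_closed[OF t X(1)] by (metis image_eqI)
    qed
  qed
  then show ?thesis unfolding cech_coboundaries_def coboundaries_def using Suc by simp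
qed

lemma cech_cohomology_eq:
  "cech_cohomology T J bs L i =
     graded_quotient T (graded_submodule (TP.MN i) (cech_cocycles i)) (cech_coboundaries i)"
  unfolding cech_cohomology_def cohomology_def cech_cocycles_def cech_coboundaries_def ..

lemma Rel_cocycle_iff:
  assumes "Rel i x X"
  shows "x \<in> DC.Z i 0 \<longleftrightarrow> X \<in> cech_cocycles i"
  unfolding DC.Z_def cech_cocycles_iff
  using Rel_null_iff[OF Rel_horizontal[OF assms]] Rel_vertical[OF assms] Rel_carrier[OF assms] by simp

lemma Rel_boundary_iff:
  assumes R: "Rel i x X"
  shows "x \<in> DC.B i 0 \<longleftrightarrow> X \<in> cech_coboundaries i"
proof (cases i)
  case 0
  then show ?thesis
    using Rel_null_iff[OF R] unfolding DC.B_def cech_coboundaries_def coboundaries_def by simp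
next
  case (Suc k)
  note R' = R[unfolded Suc]
  show ?thesis
  proof
    assume "x \<in> DC.B i 0"
    then obtain u where u: "u \<in> carrier (fam k 0)" "fam_dv k 0 u \<in> null_fam k (Suc 0)"
        "DC.cong (Suc k) 0 x (fam_dh k 0 u)"
      unfolding DC.B_def Suc by auto
    obtain Y where Y: "Rel k u Y" using Rel_surjective[of u k None] u by auto
    have "Rel (Suc k) (x \<ominus>\<^bsub>fam (Suc k) 0\<^esub> fam_dh k 0 u) (X \<ominus>\<^bsub>TP.MN (Suc k)\<^esub> tmap k Y)"
      by (rule Rel_minus[OF R' Rel_horizontal[OF Y]])
    then have "X \<ominus>\<^bsub>TP.MN (Suc k)\<^esub> tmap k Y = \<zero>\<^bsub>TP.MN (Suc k)\<^esub>"
      using Rel_null_iff DC.cong_minus_null[OF u(3)] by blast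
    then have "X = tmap k Y"
      using TP.MN.M.minus_eq_zero_iff Rel_carrier(2)[OF R'] Rel_carrier(2)[OF Rel_horizontal[OF Y]] by blast
    then show "X \<in> cech_coboundaries i"
      unfolding cech_coboundaries_def coboundaries_def Suc using Rel_carrier(2)[OF Y] by simp
  next
    assume "X \<in> cech_coboundaries i"
    then obtain Y where Y: "Y \<in> carrier (TP.MN k)" "X = tmap k Y"
      unfolding cech_coboundaries_def coboundaries_def Suc by auto
    obtain u where u: "Rel k u Y" using Rel_total[of Y k None] Y(1) by auto
    have "Rel (Suc k) (x \<ominus>\<^bsub>fam (Suc k) 0\<^esub> fam_dh k 0 u) (X \<ominus>\<^bsub>TP.MN (Suc k)\<^esub> tmap k Y)"
      by (rule Rel_minus[OF R' Rel_horizontal[OF u]])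
    moreover have "X \<ominus>\<^bsub>TP.MN (Suc k)\<^esub> tmap k Y = \<zero>\<^bsub>TP.MN (Suc k)\<^esub>"
      using Y(2) Rel_carrier(2)[OF R'] TP.MN.M.minus_eq_zero_iff by blast
    ultimately have "x \<ominus>\<^bsub>fam (Suc k) 0\<^esub> fam_dh k 0 u \<in> null_fam (Suc k) 0" using Rel_null_iff by blast
    then have "DC.cong (Suc k) 0 x (fam_dh k 0 u)"
      unfolding DC.cong_def using Rel_carrier(1)[OF R'] Rel_carrier(1)[OF Rel_horizontal[OF u]] by blast
    then show "x \<in> DC.B i 0" unfolding DC.B_def Suc using Rel_carrier(1)[OF u] Rel_vertical[OF u] by auto
  qed
qed

text \<open>
  The comparison map identifies the Cech complex of \<open>L\<close> with the kernels of the vertical differentials on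
  the cochains of \<open>E 0\<close>.
\<close>
theorem cech_edge:
  "correspondence T (fam i 0) (DC.Z i 0) (DC.B i 0) (TP.MN i) (cech_cocycles i) (cech_coboundaries i)
     (\<lambda>x X. Rel i x X \<and> x \<in> DC.Z i 0)"
  unfolding correspondence_def
proof (intro conjI allI ballI impI; (elim conjE)?)
  note Z = module.submoduleE[OF module_fam DC.submodule_Z[of i 0]]
  {
    fix x X assume x: "Rel i x X" "x \<in> DC.Z i 0"
    show "x \<in> DC.Z i 0" "X \<in> cech_cocycles i" "x \<in> DC.B i 0 \<longleftrightarrow> X \<in> cech_coboundaries i"
      using x Rel_cocycle_iff Rel_boundary_iff by auto
    {
      fix y Y assume y: "Rel i y Y" "y \<in> DC.Z i 0"
      show "Rel i (x \<oplus>\<^bsub>fam i 0\<^esub> y) (X \<oplus>\<^bsub>TP.MN i\<^esub> Y)" "x \<oplus>\<^bsub>fam i 0\<^esub> y \<in> DC.Z i 0"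
        using Rel_add[OF x(1) y(1)] Z(5)[OF x(2) y(2)] by auto
    }
    fix t assume t: "t \<in> carrier T"
    show "Rel i (t \<odot>\<^bsub>fam i 0\<^esub> x) (t \<odot>\<^bsub>TP.MN i\<^esub> X)" "t \<odot>\<^bsub>fam i 0\<^esub> x \<in> DC.Z i 0"
      using Rel_smult[OF t x(1)] Z(4)[OF t x(2)] by auto
  }
  fix D
  {
    fix x assume x: "x \<in> DC.Z i 0 \<inter> part (fam i 0) D"
    then obtain X where "X \<in> part (TP.MN i) D" "Rel i x X"
      using Rel_surjective[of x i D] unfolding DC.Z_def by auto
    then show "\<exists>X\<in>cech_cocycles i \<inter> part (TP.MN i) D. Rel i x X \<and> x \<in> DC.Z i 0"
      using x Rel_cocycle_iff by blast
  }
  {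
    fix X assume X: "X \<in> cech_cocycles i \<inter> part (TP.MN i) D"
    then obtain x where "x \<in> part (fam i 0) D" "Rel i x X" using Rel_total[of X i D] by blast
    then show "\<exists>x\<in>DC.Z i 0 \<inter> part (fam i 0) D. Rel i x X \<and> x \<in> DC.Z i 0"
      using X Rel_cocycle_iff by blast
  }
qed

theorem local_cohomology_isomorphic:
  "graded_isomorphic T (local_cohomology T I J E d i) (cech_cohomology T J bs L i)"
proof -
  obtain R where "correspondence T (fam 0 i) (DC.Z 0 i) (DC.B 0 i) (fam i 0) (DC.Z i 0) (DC.B i 0) R"
    using DC.staircase[of i 0] by auto
  note corr = correspondence_trans[OF correspondence_trans[OF torsion_edge this] cech_edge]
  show ?thesis
    unfolding local_cohomology_eq cech_cohomology_eq
    by (rule correspondence_isomorphic[OF E.module_axioms submodule_torsion_cocycles submodule_torsion_coboundaries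
        TP.module_tensor submodule_cech_cocycles submodule_cech_coboundaries corr])
qed

end

section \<open>Local cohomology as Cech cohomology\<close>

theorem theorem10p3:
  fixes T :: "'a gring" and I J :: "'a set" and bs :: "'a list"
    and L :: "('a, 'l) gmodule"
    and E :: "nat \<Rightarrow> ('a, 'e) gmodule" and d :: "nat \<Rightarrow> 'e \<Rightarrow> 'e" and \<epsilon> :: "'l \<Rightarrow> 'e"
    and i :: nat
  assumes "standard_graded_ring T" and "noetherian_ring T"
    and "homogeneous_ideal T I" and "homogeneous_ideal T J"
    and "graded_module T L"
    and "set bs \<subseteq> homogeneous_elements T" and "I = Idl\<^bsub>T\<^esub> (set bs)"
    and "graded_injective_resolution T L \<epsilon> E d"
  shows "graded_isomorphic T (local_cohomology T I J E d i) (cech_cohomology T J bs L i)"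
proof -
  interpret cech_resolution T J bs L E d \<epsilon>
    using assms unfolding homogeneous_ideal_def standard_graded_ring_def
    by (intro cech_resolution.intro cech_setting.intro cech_setting_axioms.intro
        cech_resolution_axioms.intro) (auto simp: homogeneous_ideal_def)
  show ?thesis using local_cohomology_isomorphic unfolding assms(7) .
qed

end
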